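(* Let $p$ be a prime, $q$ a power of $p$, and $k=\mathbb{F}_q(t)$. Let $D\in k$ be written in the normalized form $$D=\sum_{i=1}^{m}\frac{Q_i}{P_i^{e_i}}+f(t),$$ where $P_1,\dots,P_m\in\mathbb{F}_q[t]$ are distinct monic irreducible polynomials, $Q_i\in\mathbb{F}_q[t]$ with $\gcd(P_i,Q_i)=1$ and $\deg Q_i<\deg P_i^{e_i}$, $p\nmid e_i$, and $f\in\mathbb{F}_q[t]$ is either $0$, or a constant $c\in\mathbb{F}_q$ such that $x^p-x=c$ has no solution in $\mathbb{F}_q$, or a nonconstant polynomial with $p\nmid\deg f$. Assume $D$ is not of the form $x^p-x$ with $x\in k$. Let $K=k(\alpha)$ with $\alpha^p-\alpha=D$, and assume $\mathbb{F}_q$ is algebraically closed in $K$. Let $G=\mathrm{Gal}(K/k)$, let $O_K$ be the integral closure of $\mathbb{F}_q[t]$ in $K$, let $Cl(K)$ be the ideal class group of $O_K$, and let $\mathfrak{P}_i$ be the unique prime of $O_K$ above $P_i$ ($1\le i\le m$). Then the group $Cl(K)^G$ of $G$-invariant ideal classes is a vector space over $\mathbb{F}_p$ generated by $[\mathfrak{P}_1],\dots,[\mathfrak{P}_m]$, and $$\dim_{\mathbb{F}_p}Cl(K)^G=\begin{cases} m-1 & \text{if } K \text{ is real},\\ m & \text{if } K \text{ is imaginary}.\end{cases}$$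
   Context: $K/k$ is a cyclic (Artin–Schreier) extension of degree $p$; the finite places of $k$ ramified in $K$ are exactly $P_1,\dots,P_m$. $K$ is called real if $f=0$ (the infinite place $1/t$ of $k$ splits completely in $K$), and imaginary otherwise (if $f$ is a nonzero constant, $1/t$ is inert in $K$; if $f$ is nonconstant, $1/t$ is ramified in $K$). $G$ acts on $Cl(K)$ via its action on ideals. *)

theory Defs
  imports
    "HOL-Computational_Algebra.Polynomial_Factorial"
    "HOL-Number_Theory.Residues"
    "HOL-Algebra.Algebraic_Closure_Type"
    "HOL-Algebra.Generated_Fields"
    "HOL-Algebra.Ideal_Product"
    "Jordan_Normal_Form.Missing_VectorSpace"
    "Jordan_Normal_Form.Matrix"
begin

hide_const (open) Multiset.mult Polynomial.smult Divisibility.prime Divisibility.irreducible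

text \<open>
  A field extension is given by two types together with a homomorphism \<open>\<iota>\<close> of the base field
  into the extension field.  The rational function field over \<^typ>\<open>'a\<close> is \<^typ>\<open>'a poly fract\<close>.
  Where a notion of HOL-Algebra is used, the extension field is viewed as the record
  \<^const>\<open>ring_of_type_algebra\<close>.
\<close>

definition simple_extension :: "('f :: field \<Rightarrow> 'k :: field) \<Rightarrow> 'k \<Rightarrow> bool" where
  "simple_extension \<iota> \<alpha> \<longleftrightarrow>
     generate_field ring_of_type_algebra (insert \<alpha> (range \<iota>)) = UNIV"

definition galois_group :: "('f :: field \<Rightarrow> 'k :: field) \<Rightarrow> ('k \<Rightarrow> 'k) set" where
  "galois_group \<iota> = {\<sigma>. field_hom \<sigma> \<and> bij \<sigma> \<and> (\<forall>x. \<sigma> (\<iota> x) = \<iota> x)}"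

definition algebraically_closed_in :: "('f :: field \<Rightarrow> 'k :: field) \<Rightarrow> bool" where
  "algebraically_closed_in \<kappa> \<longleftrightarrow>
     (\<forall>x. (\<exists>g. g \<noteq> 0 \<and> poly (map_poly \<kappa> g) x = 0) \<longrightarrow> x \<in> range \<kappa>)"

definition integral_closure :: "('r :: comm_ring_1 \<Rightarrow> 'k :: field) \<Rightarrow> 'k set" where
  "integral_closure h = {x. \<exists>g. lead_coeff g = 1 \<and> poly (map_poly h g) x = 0}"

definition ring_of_integers :: "('a :: field poly fract \<Rightarrow> 'k :: field) \<Rightarrow> 'k set" where
  "ring_of_integers \<iota> = integral_closure (\<lambda>g. \<iota> (to_fract g))"

definition prime_above :: "('a :: field poly fract \<Rightarrow> 'k :: field) \<Rightarrow> 'a poly \<Rightarrow> 'k set \<Rightarrow> bool" where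
  "prime_above \<iota> \<pi> \<PP> \<longleftrightarrow>
     primeideal \<PP> (ring_of_type_algebra\<lparr>carrier := ring_of_integers \<iota>\<rparr>) \<and>
     {g. \<iota> (to_fract g) \<in> \<PP>} = {g. \<pi> dvd g}"


text \<open>
  In the following, \<open>R\<close> is a subring of a field with that field as its field of fractions.
  Fractional ideals are nonzero by definition.  All of them are taken (not only the invertible
  ones), so \<open>fractional_ideal_group R\<close> is a group if \<open>R\<close> is a Dedekind domain, but not in general.
\<close>

definition fractional_ideals :: "'k :: field set \<Rightarrow> 'k set set" where
  "fractional_ideals R = {I. 0 \<in> I \<and> I \<noteq> {0} \<and>
     (\<forall>x\<in>I. \<forall>y\<in>I. x + y \<in> I) \<and> (\<forall>r\<in>R. \<forall>x\<in>I. r * x \<in> I) \<and>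
     (\<exists>d\<in>R. d \<noteq> 0 \<and> (\<forall>x\<in>I. d * x \<in> R))}"

definition principal_fractional_ideals :: "'k :: field set \<Rightarrow> 'k set set" where
  "principal_fractional_ideals R = {(\<lambda>x. a * x) ` R | a. a \<noteq> 0}"

definition fractional_ideal_group :: "'k :: field set \<Rightarrow> 'k set monoid" where
  "fractional_ideal_group R =
     \<lparr>carrier = fractional_ideals R, mult = ideal_prod ring_of_type_algebra, one = R\<rparr>"

definition class_group :: "'k :: field set \<Rightarrow> 'k set set monoid" where
  "class_group R = fractional_ideal_group R Mod principal_fractional_ideals R"

definition ideal_class :: "'k :: field set \<Rightarrow> 'k set \<Rightarrow> 'k set set" where
  "ideal_class R I = principal_fractional_ideals R #>\<^bsub>fractional_ideal_group R\<^esub> I"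

text \<open>
  An ideal class is a set of fractional ideals, hence the two nested images for the action
  \<open>[I] \<mapsto> [\<sigma>(I)]\<close>.
\<close>

definition invariant_classes :: "('k :: field \<Rightarrow> 'k) set \<Rightarrow> 'k set \<Rightarrow> 'k set set set" where
  "invariant_classes G R = {C \<in> carrier (class_group R). \<forall>\<sigma>\<in>G. (\<lambda>I. \<sigma> ` I) ` C = C}"

text \<open>
  A subset \<open>H\<close> of a multiplicatively written group, with the residue class of \<open>n\<close> acting by
  \<open>x \<mapsto> x\<^sup>n\<close>, where \<open>n\<close> is its representative in \<^const>\<open>residue_ring\<close>.  The record type of modules
  extends that of rings; its fields \<open>mult\<close> and \<open>one\<close> are irrelevant for the module structure.
\<close>

definition power_module :: "('c, 'd) monoid_scheme \<Rightarrow> 'c set \<Rightarrow> (int, 'c) module" where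
  "power_module M H =
     \<lparr>carrier = H, mult = mult M, one = one M, zero = one M, add = mult M,
      smult = (\<lambda>n x. x [^]\<^bsub>M\<^esub> n)\<rparr>"

end

theory Submission
  imports Defs "Jordan_Normal_Form.Char_Poly"
begin

text \<open>
  Let \<open>\<sigma>\<close> be the generator of the Galois group with \<open>\<sigma> \<alpha> = \<alpha> + 1\<close>.  If \<open>\<sigma> I = a I\<close>, then the norm
  of \<open>a\<close> is a constant and hence the norm of a constant, so by Hilbert's Theorem 90 the class of \<open>I\<close>
  contains an invariant ideal.  Up to ideals of \<open>k\<close>, such an ideal is a product of powers
  \<open>\<PP>\<^sub>i\<^sup>n\<^sup>i\<close> of the ramified primes, and \<open>\<PP>\<^sub>i\<^sup>p = (P\<^sub>i)\<close>.  If a product of this form is principal, say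
  generated by \<open>a\<close>, then \<open>\<sigma> a / a\<close> is a unit of norm one; so the relations between the classes of the
  ramified primes correspond to the units of norm one modulo the \<open>\<sigma> z / z\<close> with \<open>z\<close> a unit.

  If \<open>K\<close> is imaginary, there is only one place above infinity, so a unit of norm one is a constant,
  and then it is \<open>1\<close> because \<open>c\<^sup>p = 1\<close> implies \<open>c = 1\<close>: there are no relations.  If \<open>K\<close> is real, the
  valuations of the units of norm one at the \<open>p\<close> places above infinity form a lattice of integer
  vectors of sum zero, invariant under cyclic shifts.  It is nonzero by Dirichlet's pigeonhole
  argument, and its quotient by the image of \<open>\<sigma> - 1\<close> is cyclic of order \<open>p\<close>: there is one relation.

  Ideals are handled through explicit filtrations of \<open>K\<close>, defined by the valuations of the coordinates
  with respect to \<open>1, \<alpha>, \<dots>, \<alpha>\<^sup>p\<^sup>-\<^sup>1\<close>, so that the Dedekind property of the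
  ring of integers is not presupposed.
\<close>

section \<open>Polynomials over a field\<close>

text \<open>No valuation of K is available at the start. The filtration by coordinates is
  submultiplicative at every place, but it is a valuation only where a single place of K lies above.
  At an unramified prime, which may split, it only describes the local ring; this suffices because a
  \<sigma>-stable ideal is determined there by its intersection with k. At a ramified place the pole
  order of D is prime to p, which keeps the terms of an expansion in \<alpha> apart, so that the
  norm computes the valuation. Hence the normalized form of D: it makes the finite places ramified
  or integral for D, and at infinity the three shapes of f give a place that splits completely, is
  inert, or is ramified.

  That the constants are algebraically closed in K is what makes an integral element without poles
  at infinity a constant. Finiteness of the constant field serves two purposes: every constant is a
  p-th power, hence the norm of a constant, and the pigeonhole argument has finitely many
  coefficients to choose from.\<close>

lemma poly_ideal_principal:
  fixes I :: "'a::field poly set"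
  assumes "0 \<in> I" "\<And>a b. a \<in> I \<Longrightarrow> b \<in> I \<Longrightarrow> a + b \<in> I" "\<And>a b. b \<in> I \<Longrightarrow> a * b \<in> I"
  shows "\<exists>d\<in>I. \<forall>a\<in>I. d dvd a"
proof (cases "I = {0}")
  case False
  then obtain b where b: "b \<in> I" "b \<noteq> 0" using assms(1) by auto
  define d where "d = (ARG_MIN degree x. x \<in> I \<and> x \<noteq> 0)"
  have d: "d \<in> I \<and> d \<noteq> 0"
    unfolding d_def by (rule arg_min_natI[of _ b]) (use b in auto)
  have le: "degree d \<le> degree x" if "x \<in> I" "x \<noteq> 0" for x
    unfolding d_def using arg_min_nat_le[of "\<lambda>x. x \<in> I \<and> x \<noteq> 0" x degree] that by auto
  have "d dvd a" if a: "a \<in> I" for a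
  proof (rule ccontr)
    assume nd: "\<not> d dvd a"
    have "a mod d = a + (- (a div d)) * d" by (simp add: minus_div_mult_eq_mod[symmetric])
    hence "a mod d \<in> I" using assms(2)[OF a assms(3)[of d "- (a div d)"]] d by simp
    moreover have "a mod d \<noteq> 0" using nd by auto
    ultimately show False using le[of "a mod d"] degree_mod_less[of d a] d by auto
  qed
  thus ?thesis using d by blast
qed auto

lemma poly_bezout:
  fixes g h :: "'a::field poly"
  obtains d u v where "d dvd g" "d dvd h" "d = u * g + v * h"
proof -
  define I where "I = {u * g + v * h |u v. True}"
  have "\<exists>d\<in>I. \<forall>a\<in>I. d dvd a"
  proof (rule poly_ideal_principal)
    show "0 \<in> I" unfolding I_def by (rule CollectI, rule exI[of _ 0], rule exI[of _ 0]) simp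
    fix a b assume "a \<in> I" "b \<in> I"
    then obtain u v u' v' where "a = u * g + v * h" "b = u' * g + v' * h" unfolding I_def by blast
    hence "a + b = (u + u') * g + (v + v') * h" by (simp add: algebra_simps)
    thus "a + b \<in> I" unfolding I_def by blast
  next
    fix a b assume "b \<in> I"
    then obtain u v where "b = u * g + v * h" unfolding I_def by blast
    hence "a * b = (a * u) * g + (a * v) * h" by (simp add: algebra_simps)
    thus "a * b \<in> I" unfolding I_def by blast
  qed
  then obtain d where d: "d \<in> I" "\<forall>a\<in>I. d dvd a" by blast
  have "1 * g + 0 * h \<in> I" "0 * g + 1 * h \<in> I" unfolding I_def by blast+
  hence "d dvd g" "d dvd h" using d(2) by fastforce+
  with d(1) show ?thesis using that unfolding I_def by blast
qed

lemma lead_coeff_translate: "lead_coeff (pcompose g [:c, 1:]) = lead_coeff (g :: 'a::idom poly)"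
  by (subst lead_coeff_comp) auto

text \<open>The leading terms cancel, and the next coefficient is that of c times the derivative, as
  in Taylor's formula. For constant \<open>g\<close> the difference vanishes, so the truncated
  \<open>degree g - 1\<close> is harmless.\<close>

lemma coeff_translate_diff:
  fixes g :: "'a::idom poly"
  shows "degree (pcompose g [:c, 1:] - g) \<le> degree g - 1 \<and>
    (degree g > 0 \<longrightarrow> coeff (pcompose g [:c, 1:] - g) (degree g - 1) = of_nat (degree g) * c * lead_coeff g)"
proof (induction g)
  case (pCons a g)
  show ?case
  proof (cases "g = 0")
    case False
    have eq: "pcompose (pCons a g) [:c, 1:] - pCons a g =
      pCons 0 (pcompose g [:c, 1:] - g) + Polynomial.smult c (pcompose g [:c, 1:])"
      by (simp add: pcompose_pCons algebra_simps)
    have deg: "degree (pCons a g) = Suc (degree g)" using False by simp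
    have "degree (pCons 0 (pcompose g [:c, 1:] - g)) \<le> degree g"
    proof (cases "degree g = 0")
      case True
      then obtain x where "g = [:x:]" using degree_eq_zeroE by blast
      thus ?thesis by simp
    next
      case False
      thus ?thesis using pCons.IH degree_pCons_le[of 0 "pcompose g [:c, 1:] - g"] by linarith
    qed
    hence 1: "degree (pcompose (pCons a g) [:c, 1:] - pCons a g) \<le> degree g"
      unfolding eq by (intro degree_add_le) (auto simp: degree_pcompose intro: order.trans[OF degree_smult_le])
    have "coeff (pcompose (pCons a g) [:c, 1:] - pCons a g) (degree g) = of_nat (Suc (degree g)) * c * lead_coeff g"
    proof (cases "degree g")
      case 0
      then obtain x where "g = [:x:]" using degree_eq_zeroE by blast
      thus ?thesis unfolding eq by simp
    next
      case (Suc n)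
      have "coeff (pcompose g [:c, 1:]) (degree g) = lead_coeff g"
        using lead_coeff_translate[of g c] by (simp add: degree_pcompose)
      thus ?thesis unfolding eq using pCons.IH Suc by (simp add: algebra_simps)
    qed
    with 1 deg False show ?thesis by simp
  qed simp
qed simp

lemma degree_translate_diff:
  fixes g :: "'a::idom poly"
  assumes "degree g > 0" "of_nat (degree g) * c \<noteq> (0::'a)"
  shows "degree (pcompose g [:c, 1:] - g) = degree g - 1"
    and "lead_coeff (pcompose g [:c, 1:] - g) = of_nat (degree g) * c * lead_coeff g"
proof -
  have "coeff (pcompose g [:c, 1:] - g) (degree g - 1) \<noteq> 0"
    using coeff_translate_diff[of g c] assms by auto
  thus *: "degree (pcompose g [:c, 1:] - g) = degree g - 1"
    using coeff_translate_diff[of g c] le_degree by (metis le_antisym)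
  show "lead_coeff (pcompose g [:c, 1:] - g) = of_nat (degree g) * c * lead_coeff g"
    unfolding * using coeff_translate_diff[of g c] assms by simp
qed

section \<open>Artin--Schreier polynomials\<close>

lemma prime_elem_dvd_prodE:
  assumes "prime_elem (t :: 'a::comm_ring_1)" "t dvd prod f A" "finite A"
  shows "\<exists>i\<in>A. t dvd f i"
  using assms(3,2)
proof (induction A rule: finite_induct)
  case empty
  thus ?case using assms(1) by (simp add: prime_elem_def)
next
  case (insert x A)
  thus ?case using prime_elem_dvd_multD[OF assms(1), of "f x" "prod f A"] by auto
qed

lemma of_nat_frobenius:
  assumes "prime CHAR('a::comm_ring_1)" "p = CHAR('a)"
  shows "of_nat n ^ p = (of_nat n :: 'a)"
proof (induction n)
  case 0
  thus ?case using assms prime_gt_0_nat[of p] by (simp add: power_0_left)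
next
  case (Suc n)
  have "(of_nat (Suc n) :: 'a) ^ p = (1 + of_nat n) ^ p" by simp
  also have "\<dots> = 1 ^ p + of_nat n ^ p" using assms by (intro freshmans_dream)
  finally show ?case using Suc by simp
qed

lemma freshmans_dream_minus:
  fixes x y :: "'a::comm_ring_1"
  assumes "prime CHAR('a)" "p = CHAR('a)"
  shows "(x - y) ^ p = x ^ p - y ^ p"
  using freshmans_dream[OF assms, of "x - y" y] by (simp add: algebra_simps)

definition artin_schreier_poly :: "nat \<Rightarrow> 'a::field \<Rightarrow> 'a poly" where
  "artin_schreier_poly p D = [:0, 1:] ^ p - [:D, 1:]"

lemma poly_artin_schreier_poly: "poly (artin_schreier_poly p D) x = x ^ p - x - D"
  by (simp add: artin_schreier_poly_def)

lemma degree_artin_schreier_poly: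
  assumes "p > 1"
  shows "degree (artin_schreier_poly p D) = p"
proof -
  have "degree ([:0, 1:] ^ p - [:D, 1:]) = degree ([:0, 1::'a:] ^ p)"
    unfolding diff_conv_add_uminus using assms by (intro degree_add_eq_left) (simp add: degree_power_eq)
  thus ?thesis by (simp add: artin_schreier_poly_def degree_power_eq)
qed

lemma pcompose_power: "pcompose (g ^ n) (h :: 'a::comm_ring_1 poly) = pcompose g h ^ n"
  by (induction n) (simp_all add: pcompose_mult)

text \<open>In characteristic p the map sending x to \<open>x ^ p - x\<close> is additive and
  vanishes on the prime field.\<close>

lemma translate_artin_schreier_poly:
  assumes "prime CHAR('a::field)" "p = CHAR('a)"
  shows "pcompose (artin_schreier_poly p D) [:of_nat n, 1:] = artin_schreier_poly p (D :: 'a)"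
proof -
  have c: "CHAR('a poly) = p" "prime CHAR('a poly)" using assms by simp_all
  have "[:of_nat n, 1:] ^ p = ([:0, 1:] + of_nat n) ^ p" by (simp add: of_nat_poly)
  also have "\<dots> = [:0, 1:] ^ p + (of_nat n :: 'a poly) ^ p"
    using c by (intro freshmans_dream) auto
  also have "(of_nat n :: 'a poly) ^ p = of_nat n" using c by (intro of_nat_frobenius) auto
  finally have *: "[:of_nat n, 1:] ^ p = [:0, 1:] ^ p + (of_nat n :: 'a poly)" .
  have "pcompose (artin_schreier_poly p D) [:of_nat n, 1:] = [:of_nat n, 1:] ^ p - [:D + of_nat n, 1:]"
    by (simp add: artin_schreier_poly_def pcompose_diff pcompose_power pcompose_pCons)
  also have "\<dots> = artin_schreier_poly p D"
    unfolding * by (simp add: artin_schreier_poly_def of_nat_poly)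
  finally show ?thesis .
qed

lemma dvd_monic_eq:
  fixes a b :: "'a::field poly"
  assumes "a dvd b" "degree a = degree b" "lead_coeff a = lead_coeff b" "b \<noteq> 0"
  shows "a = b"
proof -
  from assms(1) obtain k where k: "b = a * k" by (elim dvdE)
  hence "degree k = 0" using assms(2,4) by (metis add_cancel_right_right degree_mult_eq mult_zero_left mult_zero_right)
  then obtain c where "k = [:c:]" using degree_eq_zeroE by blast
  thus ?thesis using k assms(3,4) by (auto simp: lead_coeff_mult)
qed

text \<open>The translates by elements of the prime field permute the irreducible factors.  If a proper
  factor of minimal degree were fixed by a nontrivial translation, its second coefficient would
  change; so it has \<open>p\<close> different translates, hence is linear.\<close>

lemma artin_schreier_poly_no_factor:
  fixes D :: "'a::field"
  assumes "prime p" "CHAR('a) = p" "\<nexists>x. D = x ^ p - x"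
    and "d dvd artin_schreier_poly p D" "0 < degree d" "degree d < p"
  shows False
proof -
  let ?h = "artin_schreier_poly p D"
  let ?P = "\<lambda>d. d dvd ?h \<and> 0 < degree d"
  have p1: "p > 1" using assms(1) prime_gt_1_nat by blast
  have h0: "?h \<noteq> 0" using degree_artin_schreier_poly[OF p1, of D] p1 by auto
  define e0 where "e0 = (ARG_MIN degree x. ?P x)"
  have e0: "?P e0" unfolding e0_def by (rule arg_min_natI[of _ d]) (use assms in auto)
  have min: "degree e0 \<le> degree x" if "?P x" for x
    unfolding e0_def using arg_min_nat_le[of ?P x degree] that by auto
  define e where "e = Polynomial.smult (inverse (lead_coeff e0)) e0"
  have e00: "e0 \<noteq> 0" using e0 by auto
  have dege: "degree e = degree e0" and lce: "lead_coeff e = 1" using e00 by (auto simp: e_def)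
  have edvd: "e dvd ?h" using e0 e00 by (simp add: e_def smult_dvd_iff)
  have deg_pos: "0 < degree e" and deg_less: "degree e < p"
    using e0 dege min[of d] assms by auto
  \<comment> \<open>Minimality of the degree makes every divisor of this degree irreducible, which
    covers all translates of \<open>e\<close> at once.\<close>
  have prime_el: "prime_elem x" if "x dvd ?h" "degree x = degree e" for x
  proof (rule field_poly_irreducible_imp_prime, rule Factorial_Ring.irreducibleI)
    show "x \<noteq> 0" using that h0 by auto
    show "\<not> is_unit x" using that deg_pos by (auto simp: is_unit_iff_degree)
    fix a b assume ab: "x = a * b"
    with that h0 have nz: "a \<noteq> 0" "b \<noteq> 0" by auto
    hence sum: "degree a + degree b = degree e" using ab that by (simp add: degree_mult_eq)
    have "a dvd ?h" "b dvd ?h" using ab that(1) by (auto dest: dvd_mult_left dvd_mult_right)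
    hence "degree a = 0 \<or> degree a \<ge> degree e" "degree b = 0 \<or> degree b \<ge> degree e"
      using min[of a] min[of b] dege by auto
    hence "degree a = 0 \<or> degree b = 0" using sum by linarith
    thus "is_unit a \<or> is_unit b" using nz by (auto simp: is_unit_iff_degree)
  qed
  define t where "t i = pcompose e [:of_nat i, 1:]" for i :: nat
  have tdvd: "t i dvd ?h" for i
  proof -
    from edvd obtain k where "?h = e * k" by (elim dvdE)
    hence "pcompose ?h [:of_nat i, 1:] = t i * pcompose k [:of_nat i, 1:]" by (simp only: t_def pcompose_mult)
    moreover have "pcompose ?h [:of_nat i, 1:] = ?h"
      using assms(1,2) by (intro translate_artin_schreier_poly) simp_all
    ultimately show ?thesis by (metis dvd_triv_left)
  qed
  have tdeg: "degree (t i) = degree e" "lead_coeff (t i) = 1" for i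
    using lce lead_coeff_translate[of e "of_nat i"] by (simp_all add: t_def degree_pcompose)
  have tneq: "\<not> t i dvd t j" if "i < j" "j < p" for i j
  proof
    assume "t i dvd t j"
    moreover have "t j \<noteq> 0" using tdeg(1)[of j] deg_pos by auto
    ultimately have eq: "t i = t j" using tdeg by (intro dvd_monic_eq) simp_all
    have "t j = pcompose (t i) [:of_nat (j - i), 1:]"
    proof -
      have "pcompose (t i) [:of_nat (j - i), 1:] = pcompose e (pcompose [:of_nat i, 1:] [:of_nat (j - i), 1:])"
        unfolding t_def by (rule pcompose_assoc[symmetric])
      also have "pcompose [:of_nat i, 1:] [:of_nat (j - i), 1:] = [:of_nat j, 1 :: 'a:]"
        using that by (simp add: pcompose_pCons of_nat_diff)
      finally show ?thesis by (simp add: t_def)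
    qed
    hence "pcompose (t i) [:of_nat (j - i), 1:] - t i = 0" using eq by simp
    moreover have "(of_nat (degree (t i)) * of_nat (j - i) :: 'a) \<noteq> 0"
    proof -
      have "\<not> p dvd degree e" "\<not> p dvd j - i"
        using that deg_pos deg_less nat_dvd_not_less[of "j - i" p] by (auto intro!: nat_dvd_not_less)
      thus ?thesis using tdeg(1)[of i] assms(2) by (simp add: of_nat_eq_0_iff_char_dvd)
    qed
    ultimately show False
      using degree_translate_diff(2)[of "t i" "of_nat (j - i)"] tdeg deg_pos by simp
  qed
  \<comment> \<open>The translates are pairwise non-associated primes, so their product divides. Its
    degree is \<open>p * degree e\<close>, which leaves only degree 1, that is, a root in the
    field.\<close>
  have "(\<Prod>i<n. t i) dvd ?h" if "n \<le> p" for n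
    using that
  proof (induction n)
    case (Suc n)
    hence "(\<Prod>i<n. t i) dvd ?h" by simp
    then obtain r where r: "?h = (\<Prod>i<n. t i) * r" by (elim dvdE)
    have pr: "prime_elem (t n)" using prime_el tdvd tdeg by auto
    have "t n dvd (\<Prod>i<n. t i) * r" using tdvd r by metis
    moreover have "\<not> t n dvd (\<Prod>i<n. t i)"
    proof
      assume "t n dvd (\<Prod>i<n. t i)"
      then obtain i where i: "i < n" "t n dvd t i"
        using prime_elem_dvd_prodE[OF pr] by blast
      moreover have "t i \<noteq> 0" using tdeg(1)[of i] deg_pos by auto
      ultimately have "t n = t i" using tdeg i by (intro dvd_monic_eq) simp_all
      thus False using tneq[of i n] i Suc.prems by simp
    qed
    ultimately have "t n dvd r" using pr prime_elem_dvd_multD by blast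
    then obtain k where "r = t n * k" by (elim dvdE)
    with r have "?h = (\<Prod>i<Suc n. t i) * k" by (simp add: mult_ac)
    thus ?case by (rule dvdI)
  qed simp
  hence "(\<Prod>i<p. t i) dvd ?h" by simp
  hence "degree (\<Prod>i<p. t i) \<le> p" using h0 degree_artin_schreier_poly[OF p1, of D] by (metis dvd_imp_degree_le)
  moreover have "degree (\<Prod>i<p. t i) = p * degree e"
  proof -
    have "t i \<noteq> 0" for i using tdeg[of i] deg_pos by auto
    thus ?thesis by (subst degree_prod_eq_sum_degree) (auto simp: tdeg)
  qed
  ultimately have "degree e = 1" using deg_pos p1 by simp
  then obtain a b where "e = [:a, b:]" by (metis degree1_coeffs)
  with \<open>degree e = 1\<close> lce have e: "e = [:a, 1:]" by auto
  hence "poly ?h (- a) = 0" using edvd poly_eq_0_iff_dvd[of ?h "- a"] by simp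
  hence "D = (- a) ^ p - (- a)" by (simp add: poly_artin_schreier_poly algebra_simps)
  thus False using assms(3) by blast
qed

text \<open>A common divisor of positive degree would be a proper factor. This is used twice: over k
  for inverses and uniqueness of coordinates in K, and over the residue field of an inert
  place.\<close>

lemma artin_schreier_poly_bezout:
  fixes D :: "'a::field"
  assumes "prime p" "CHAR('a) = p" "\<nexists>x. D = x ^ p - x" "g \<noteq> 0" "degree g < p"
  obtains u v where "u * g + v * artin_schreier_poly p D = 1"
proof -
  obtain d u v where d: "d dvd g" "d dvd artin_schreier_poly p D" "d = u * g + v * artin_schreier_poly p D"
    using poly_bezout .
  have "degree d < p" using d(1) assms(4,5) dvd_imp_degree_le by (metis le_less_trans)
  hence "degree d = 0" using artin_schreier_poly_no_factor[OF assms(1-3) d(2)] by auto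
  then obtain c where c: "d = [:c:]" using degree_eq_zeroE by blast
  with d(1) assms(4) have "c \<noteq> 0" by auto
  hence "[:inverse c:] * d = 1" using c by simp
  hence "([:inverse c:] * u) * g + ([:inverse c:] * v) * artin_schreier_poly p D = 1"
    unfolding d(3) by (simp only: distrib_left mult.assoc)
  thus ?thesis using that by blast
qed

section \<open>Artin--Schreier extensions\<close>

definition poly_ev :: "('f::field \<Rightarrow> 'k::field) \<Rightarrow> 'k \<Rightarrow> 'f poly \<Rightarrow> 'k" where
  "poly_ev \<phi> a g = poly (map_poly \<phi> g) a"

context field_hom
begin

lemma poly_ev_simps:
  "poly_ev hom a (g + h) = poly_ev hom a g + poly_ev hom a h"
  "poly_ev hom a (g - h) = poly_ev hom a g - poly_ev hom a h"
  "poly_ev hom a (- g) = - poly_ev hom a g"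
  "poly_ev hom a (g * h) = poly_ev hom a g * poly_ev hom a h"
  "poly_ev hom a (pCons c g) = hom c + a * poly_ev hom a g"
  "poly_ev hom a (Polynomial.smult c g) = hom c * poly_ev hom a g"
  "poly_ev hom a 0 = 0"
  "poly_ev hom a 1 = 1"
proof -
  interpret m: map_poly_inj_idom_hom hom ..
  show "poly_ev hom a (g + h) = poly_ev hom a g + poly_ev hom a h"
    "poly_ev hom a (g - h) = poly_ev hom a g - poly_ev hom a h"
    "poly_ev hom a (- g) = - poly_ev hom a g"
    "poly_ev hom a (g * h) = poly_ev hom a g * poly_ev hom a h"
    "poly_ev hom a (pCons c g) = hom c + a * poly_ev hom a g"
    "poly_ev hom a (Polynomial.smult c g) = hom c * poly_ev hom a g"
    "poly_ev hom a 0 = 0" "poly_ev hom a 1 = 1"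
    by (simp_all add: poly_ev_def hom_distribs)
qed

lemma poly_ev_power: "poly_ev hom a (g ^ n) = poly_ev hom a g ^ n"
  by (induction n) (simp_all add: poly_ev_simps)

lemma poly_ev_pcompose: "poly_ev hom a (pcompose g h) = poly_ev hom (poly_ev hom a h) g"
  by (induction g) (simp_all add: poly_ev_simps pcompose_pCons algebra_simps)

lemma poly_ev_artin_schreier_poly: "poly_ev hom a (artin_schreier_poly p D) = a ^ p - a - hom D"
  by (simp add: artin_schreier_poly_def poly_ev_simps poly_ev_power algebra_simps)

lemma poly_ev_altdef: "poly_ev hom a g = (\<Sum>i\<le>degree g. hom (coeff g i) * a ^ i)"
  by (simp add: poly_ev_def poly_altdef)

lemma poly_ev_altdef':
  assumes "degree g < n"
  shows "poly_ev hom a g = (\<Sum>i<n. hom (coeff g i) * a ^ i)"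
  unfolding poly_ev_altdef using assms
  by (intro sum.mono_neutral_left) (auto simp: coeff_eq_0 not_le)

end

lemma field_homI:
  assumes "\<And>x y. f (x + y) = f x + f y" "\<And>x y. f (x * y) = f x * f y" "f 1 = (1 :: 'b::field)"
  shows "field_hom (f :: 'a::field \<Rightarrow> 'b)"
proof -
  have "f 0 + f 0 = f 0 + 0" using assms(1)[of 0 0] by simp
  hence "f 0 = 0" by (rule add_left_imp_eq)
  thus ?thesis using assms by unfold_locales simp_all
qed

lemma char_field_hom:
  assumes "field_hom (\<phi> :: 'f::field \<Rightarrow> 'k::field)"
  shows "CHAR('k) = CHAR('f)"
proof (rule CHAR_eqI)
  interpret field_hom \<phi> by fact
  show "of_nat CHAR('f) = (0 :: 'k)" using hom_of_nat[of "CHAR('f)"] by simp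
  fix n assume "of_nat n = (0 :: 'k)"
  hence "\<phi> (of_nat n) = 0" by (simp add: hom_of_nat)
  thus "CHAR('f) dvd n" by (simp add: of_nat_eq_0_iff_char_dvd)
qed

text \<open>The p elements of the prime field already exhaust the roots of X^p - X.\<close>

lemma frobenius_fixed:
  fixes z :: "'k::field"
  assumes "prime p" "CHAR('k) = p" "z ^ p = z"
  shows "\<exists>j<p. z = of_nat j"
proof -
  have p1: "p > 1" using assms(1) prime_gt_1_nat by blast
  let ?h = "artin_schreier_poly p (0 :: 'k)"
  have deg: "degree ?h = p" using degree_artin_schreier_poly[OF p1] .
  hence nz: "?h \<noteq> 0" using p1 by auto
  have fin: "finite {x. poly ?h x = 0}" using poly_roots_finite[OF nz] .
  have inj: "inj_on (of_nat :: nat \<Rightarrow> 'k) {..<p}"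
    using assms(2) by (auto intro!: inj_onI simp: of_nat_eq_iff_cong_CHAR cong_def)
  have sub: "of_nat ` {..<p} \<subseteq> {x. poly ?h x = 0}"
    using of_nat_frobenius[where ?'a = 'k, OF _ assms(2)[symmetric]] assms(1,2)
    by (auto simp: poly_artin_schreier_poly)
  have "card {x. poly ?h x = 0} \<le> card (of_nat ` {..<p} :: 'k set)"
    using poly_roots_degree[OF nz] deg inj by (simp add: card_image)
  hence "of_nat ` {..<p} = {x. poly ?h x = 0}" using sub fin by (metis card_seteq)
  moreover have "z \<in> {x. poly ?h x = 0}" using assms(3) by (simp add: poly_artin_schreier_poly)
  ultimately show ?thesis by auto
qed

locale artin_schreier = field_hom \<iota> for \<iota> :: "'f::field \<Rightarrow> 'k::field" +
  fixes p :: nat and D :: 'f and \<alpha> :: 'k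
  assumes prime_p: "prime p"
    and char_f: "CHAR('f) = p"
    and not_trivial: "\<nexists>x. D = x ^ p - x"
    and root: "\<alpha> ^ p - \<alpha> = \<iota> D"
    and gen: "simple_extension \<iota> \<alpha>"
begin

lemma p_gt_1: "p > 1" using prime_p prime_gt_1_nat by blast
lemma p_pos: "p > 0" using p_gt_1 by simp

lemma char_k: "CHAR('k) = p"
  using char_field_hom[OF field_hom_axioms] char_f by simp

lemma of_nat_p: "of_nat p = (0 :: 'k)" "of_nat p = (0 :: 'f)"
  using of_nat_CHAR[where ?'a = 'k] of_nat_CHAR[where ?'a = 'f] char_k char_f by auto

lemma \<iota>_eq_iff [simp]: "\<iota> x = \<iota> y \<longleftrightarrow> x = y" by (rule eq_iff)

abbreviation ev :: "'f poly \<Rightarrow> 'k" where "ev \<equiv> poly_ev \<iota> \<alpha>"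
abbreviation minpoly :: "'f poly" where "minpoly \<equiv> artin_schreier_poly p D"

lemma ev_minpoly: "ev minpoly = 0"
  using root by (simp add: poly_ev_artin_schreier_poly)

lemma degree_minpoly: "degree minpoly = p"
  by (rule degree_artin_schreier_poly[OF p_gt_1])

lemma minpoly_nz: "minpoly \<noteq> 0"
  using degree_minpoly p_pos by auto

lemma ev_eq_0:
  assumes "ev g = 0" "degree g < p"
  shows "g = 0"
proof (rule ccontr)
  assume "g \<noteq> 0"
  then obtain u v where "u * g + v * minpoly = 1"
    using artin_schreier_poly_bezout[OF prime_p char_f not_trivial _ assms(2)] by blast
  hence "ev (u * g + v * minpoly) = 1" by (simp add: poly_ev_simps)
  thus False using assms ev_minpoly by (simp add: poly_ev_simps)
qed

lemma ev_mod: "ev (g mod minpoly) = ev g"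
proof -
  have "ev g = ev (g div minpoly * minpoly + g mod minpoly)" by (simp only: div_mult_mod_eq)
  also have "\<dots> = ev (g mod minpoly)" by (simp only: poly_ev_simps ev_minpoly) simp
  finally show ?thesis by simp
qed

lemma degree_mod_minpoly: "degree (g mod minpoly) < p"
  using degree_mod_less[OF minpoly_nz, of g] degree_minpoly p_pos by auto

lemma ev_inverse:
  assumes "ev g \<noteq> 0"
  shows "\<exists>u. ev u * ev g = 1"
proof -
  have "g mod minpoly \<noteq> 0" using assms ev_mod[of g] by (auto simp: poly_ev_simps)
  then obtain u v where "u * (g mod minpoly) + v * minpoly = 1"
    using artin_schreier_poly_bezout[OF prime_p char_f not_trivial _ degree_mod_minpoly] by blast
  hence "ev (u * (g mod minpoly) + v * minpoly) = 1" by (simp add: poly_ev_simps)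
  thus ?thesis using ev_minpoly ev_mod by (auto simp: poly_ev_simps)
qed

text \<open>The image of \<open>ev\<close> contains the generators and is closed under the field
  operations. Only inverses need an argument, and \<open>ev_inverse\<close> gives them as
  polynomials in \<alpha>.\<close>

lemma surj_ev: "\<exists>g. ev g = x"
proof -
  let ?R = "ring_of_type_algebra :: 'k ring"
  interpret R: Ring.field ?R by (rule field_from_type_algebra)
  have neg: "\<ominus>\<^bsub>?R\<^esub> h = - h" for h
  proof -
    have "h \<oplus>\<^bsub>?R\<^esub> (- h) = \<zero>\<^bsub>?R\<^esub>" by (simp add: ring_of_type_algebra_def)
    thus ?thesis using R.minus_equality[of "- h" h] by (simp add: ring_of_type_algebra_def add.commute)
  qed
  have inv: "inv\<^bsub>?R\<^esub> h = inverse h" if "h \<noteq> 0" for h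
    by (rule R.inv_char) (use that in \<open>auto simp: ring_of_type_algebra_def\<close>)
  have "x \<in> generate_field ?R (insert \<alpha> (range \<iota>))" using gen by (simp add: simple_extension_def)
  thus ?thesis
  proof (induction rule: generate_field.induct)
    case one
    have "ev 1 = 1" by (simp add: poly_ev_simps)
    thus ?case by (auto simp: ring_of_type_algebra_def)
  next
    case (incl h)
    have "ev [:c:] = \<iota> c" "ev [:0, 1:] = \<alpha>" for c by (simp_all add: poly_ev_simps)
    thus ?case using incl by blast
  next
    case (a_inv h)
    then obtain g where "ev g = h" by auto
    hence "ev (- g) = - h" by (simp add: poly_ev_simps)
    thus ?case using neg by auto
  next
    case (m_inv h)
    then obtain g where g: "ev g = h" by auto
    have h: "h \<noteq> 0" using m_inv by (simp add: ring_of_type_algebra_def)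
    obtain u where "ev u * h = 1" using ev_inverse g h by blast
    hence "ev u = inverse h" using h by (simp add: field_simps)
    thus ?case using inv[OF h] by auto
  next
    case (eng_add h1 h2)
    then obtain g1 g2 where "ev g1 = h1" "ev g2 = h2" by auto
    hence "ev (g1 + g2) = h1 + h2" by (simp add: poly_ev_simps)
    thus ?case by (auto simp: ring_of_type_algebra_def)
  next
    case (eng_mult h1 h2)
    then obtain g1 g2 where "ev g1 = h1" "ev g2 = h2" by auto
    hence "ev (g1 * g2) = h1 * h2" by (simp add: poly_ev_simps)
    thus ?case by (auto simp: ring_of_type_algebra_def)
  qed
qed

section \<open>Coordinates with respect to the powers of \<alpha>\<close>

definition rep :: "'k \<Rightarrow> 'f poly" where
  "rep x = (SOME g. degree g < p \<and> ev g = x)"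

lemma rep: "degree (rep x) < p" "ev (rep x) = x"
proof -
  obtain g where "ev g = x" using surj_ev by blast
  hence "degree (g mod minpoly) < p \<and> ev (g mod minpoly) = x"
    using degree_mod_minpoly ev_mod by simp
  hence "degree (rep x) < p \<and> ev (rep x) = x" unfolding rep_def by (rule someI)
  thus "degree (rep x) < p" "ev (rep x) = x" by auto
qed

lemma rep_unique:
  assumes "degree g < p" "ev g = x"
  shows "rep x = g"
proof -
  have "ev (rep x - g) = 0" using rep assms by (simp add: poly_ev_simps)
  moreover have "degree (rep x - g) < p" using rep(1)[of x] assms by (intro degree_diff_less)
  ultimately show ?thesis using ev_eq_0 by fastforce
qed

definition coef :: "'k \<Rightarrow> nat \<Rightarrow> 'f" where "coef x i = coeff (rep x) i"

lemma rep_add: "rep (x + y) = rep x + rep y"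
  by (rule rep_unique) (use rep in \<open>auto simp: poly_ev_simps intro: degree_add_less\<close>)
lemma rep_uminus: "rep (- x) = - rep x"
  by (rule rep_unique) (use rep in \<open>auto simp: poly_ev_simps\<close>)
lemma rep_diff: "rep (x - y) = rep x - rep y"
  by (rule rep_unique) (use rep in \<open>auto simp: poly_ev_simps intro: degree_diff_less\<close>)
lemma rep_scale: "rep (\<iota> c * x) = Polynomial.smult c (rep x)"
  by (rule rep_unique) (simp_all add: poly_ev_simps rep p_pos)
lemma rep_0: "rep 0 = 0"
  by (rule rep_unique) (use p_pos in \<open>auto simp: poly_ev_simps\<close>)
lemma rep_\<iota>: "rep (\<iota> c) = [:c:]"
proof (rule rep_unique)
  have "degree [:c:] = 0" by simp
  thus "degree [:c:] < p" using p_pos by (metis)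
qed (simp add: poly_ev_simps)
lemma rep_power: "n < p \<Longrightarrow> rep (\<alpha> ^ n) = [:0, 1:] ^ n"
  by (rule rep_unique) (auto simp: poly_ev_simps poly_ev_power degree_power_eq)
lemma rep_eq_0_iff: "rep x = 0 \<longleftrightarrow> x = 0"
  using rep(2)[of x] rep_0 by (metis poly_ev_simps(7))

lemma coef_simps:
  "coef (x + y) i = coef x i + coef y i" "coef (x - y) i = coef x i - coef y i"
  "coef (- x) i = - coef x i" "coef (\<iota> c * x) i = c * coef x i" "coef 0 i = 0"
  by (simp_all add: coef_def rep_add rep_diff rep_uminus rep_scale rep_0)

lemma coef_\<iota>: "coef (\<iota> c) i = (if i = 0 then c else 0)"
  by (simp add: coef_def rep_\<iota> coeff_pCons split: nat.splits)

lemma coef_power: "n < p \<Longrightarrow> coef (\<alpha> ^ n) i = (if i = n then 1 else 0)"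
  by (simp add: coef_def rep_power x_as_monom x_pow_n del: One_nat_def)

lemma coef_expand: "x = (\<Sum>i<p. \<iota> (coef x i) * \<alpha> ^ i)"
  using poly_ev_altdef'[OF rep(1), of \<alpha> x] rep(2)[of x] by (simp add: coef_def)

lemma coef_ge: "i \<ge> p \<Longrightarrow> coef x i = 0"
  using rep(1)[of x] by (simp add: coef_def coeff_eq_0)

lemma coef_sum: "coef (\<Sum>i\<in>A. f i) j = (\<Sum>i\<in>A. coef (f i) j)"
  by (induction A rule: infinite_finite_induct) (auto simp: coef_simps)

lemma coef_eqI: "(\<And>i. i < p \<Longrightarrow> coef x i = coef y i) \<Longrightarrow> x = y"
  using coef_expand[of x] coef_expand[of y] by simp

text \<open>The universal property of k[X] / (X^p - X - D). It yields \<sigma>, with target K, and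
  later the embedding of K into Laurent series at infinity.\<close>

lemma extend_hom:
  fixes \<phi> :: "'f \<Rightarrow> 'l::field"
  assumes "field_hom \<phi>" "a ^ p - a = \<phi> D"
  defines "\<psi> \<equiv> (\<lambda>x. poly_ev \<phi> a (rep x))"
  shows "field_hom \<psi>" "\<psi> (ev g) = poly_ev \<phi> a g" "\<psi> (\<iota> c) = \<phi> c" "\<psi> \<alpha> = a"
proof -
  interpret f: field_hom \<phi> by fact
  have 0: "poly_ev \<phi> a minpoly = 0" using assms(2) by (simp add: f.poly_ev_artin_schreier_poly)
  have *: "\<psi> (ev g) = poly_ev \<phi> a g" for g
  proof -
    have "rep (ev g) = g mod minpoly" by (rule rep_unique) (use degree_mod_minpoly ev_mod in auto)
    moreover have "poly_ev \<phi> a g = poly_ev \<phi> a (g div minpoly * minpoly + g mod minpoly)"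
      by (simp only: div_mult_mod_eq)
    hence "poly_ev \<phi> a g = poly_ev \<phi> a (g mod minpoly)"
      by (simp only: f.poly_ev_simps 0) simp
    ultimately show ?thesis by (simp add: \<psi>_def)
  qed
  thus "\<psi> (ev g) = poly_ev \<phi> a g" .
  have c: "ev [:c:] = \<iota> c" "ev [:0, 1:] = \<alpha>" for c by (simp_all add: poly_ev_simps)
  show 1: "\<psi> (\<iota> c) = \<phi> c" for c using *[of "[:c:]"] c by (simp add: f.poly_ev_simps)
  show "\<psi> \<alpha> = a" using *[of "[:0, 1:]"] c by (simp add: f.poly_ev_simps)
  show "field_hom \<psi>"
  proof (rule field_homI)
    fix x y
    show "\<psi> (x + y) = \<psi> x + \<psi> y" by (simp add: \<psi>_def rep_add f.poly_ev_simps)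
    have "\<psi> (ev (rep x * rep y)) = \<psi> x * \<psi> y" unfolding * by (simp add: f.poly_ev_simps \<psi>_def)
    thus "\<psi> (x * y) = \<psi> x * \<psi> y" by (simp add: poly_ev_simps rep)
  next
    show "\<psi> 1 = 1" using 1[of 1] by simp
  qed
qed

lemma field_hom_ev:
  assumes "field_hom \<psi>" "\<And>c. \<psi> (\<iota> c) = \<phi> c"
  shows "\<psi> (ev g) = poly_ev \<phi> (\<psi> \<alpha>) g"
proof -
  interpret s: field_hom \<psi> by fact
  interpret f: field_hom \<phi>
  proof (rule field_homI)
    fix x y show "\<phi> (x + y) = \<phi> x + \<phi> y" "\<phi> (x * y) = \<phi> x * \<phi> y"
      unfolding assms(2)[symmetric] by (simp_all add: hom_add hom_mult s.hom_add s.hom_mult)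
  next
    show "\<phi> 1 = 1" unfolding assms(2)[symmetric] by simp
  qed
  show ?thesis
    by (induction g) (simp_all add: poly_ev_simps f.poly_ev_simps assms(2) s.hom_add s.hom_mult)
qed

section \<open>The Galois group\<close>

definition \<sigma> :: "'k \<Rightarrow> 'k" where "\<sigma> x = poly_ev \<iota> (\<alpha> + 1) (rep x)"

lemma translated_root: "(\<alpha> + of_nat j) ^ p - (\<alpha> + of_nat j) = \<iota> D"
proof -
  have "(\<alpha> + of_nat j) ^ p = \<alpha> ^ p + of_nat j ^ p" using prime_p char_k by (intro freshmans_dream) auto
  also have "(of_nat j :: 'k) ^ p = of_nat j" using prime_p char_k by (intro of_nat_frobenius) auto
  finally show ?thesis using root by simp
qed

lemma \<sigma>_facts: "field_hom \<sigma>" "\<sigma> (ev g) = ev (pcompose g [:1, 1:])" "\<sigma> (\<iota> c) = \<iota> c" "\<sigma> \<alpha> = \<alpha> + 1"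
proof -
  note e = extend_hom[OF field_hom_axioms, of "\<alpha> + 1", folded \<sigma>_def]
  have r: "(\<alpha> + 1) ^ p - (\<alpha> + 1) = \<iota> D" using translated_root[of 1] by simp
  show "field_hom \<sigma>" "\<sigma> (\<iota> c) = \<iota> c" "\<sigma> \<alpha> = \<alpha> + 1" using e[OF r] by (simp_all add: \<sigma>_def[abs_def])
  have "\<sigma> (ev g) = poly_ev \<iota> (\<alpha> + 1) g" using e(2)[OF r] by simp
  thus "\<sigma> (ev g) = ev (pcompose g [:1, 1:])"
    by (simp add: poly_ev_pcompose poly_ev_simps add.commute)
qed

sublocale \<sigma>: field_hom \<sigma> by (rule \<sigma>_facts)

lemma \<sigma>_\<iota> [simp]: "\<sigma> (\<iota> c) = \<iota> c" by (rule \<sigma>_facts)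

lemma rep_\<sigma>: "rep (\<sigma> x) = pcompose (rep x) [:1, 1:]"
proof (rule rep_unique)
  show "degree (pcompose (rep x) [:1, 1:]) < p" using rep(1) by (simp add: degree_pcompose)
  show "ev (pcompose (rep x) [:1, 1:]) = \<sigma> x" using \<sigma>_facts(2)[of "rep x"] rep(2) by simp
qed

lemma \<sigma>_pow_hom: "field_hom (\<sigma> ^^ j)"
proof (induction j)
  case (Suc j)
  then interpret s: field_hom "\<sigma> ^^ j" .
  show ?case
    by (rule field_homI) (simp_all add: \<sigma>.hom_add \<sigma>.hom_mult s.hom_add s.hom_mult)
qed (auto intro!: field_homI)

lemma \<sigma>_pow_\<iota> [simp]: "(\<sigma> ^^ j) (\<iota> c) = \<iota> c"
  by (induction j) auto

lemma \<sigma>_pow_\<alpha>: "(\<sigma> ^^ j) \<alpha> = \<alpha> + of_nat j"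
  by (induction j) (auto simp: \<sigma>_facts(4) \<sigma>.hom_add \<sigma>.hom_of_nat)

lemma hom_ext:
  assumes "field_hom \<psi>" "field_hom \<psi>'" "\<And>c. \<psi> (\<iota> c) = \<psi>' (\<iota> c)" "\<psi> \<alpha> = \<psi>' \<alpha>"
  shows "\<psi> = \<psi>'"
proof
  fix x
  have "\<psi> (ev (rep x)) = \<psi>' (ev (rep x))"
    using field_hom_ev[OF assms(1), of "\<lambda>c. \<psi> (\<iota> c)" "rep x"]
      field_hom_ev[OF assms(2), of "\<lambda>c. \<psi> (\<iota> c)" "rep x"] assms(3,4) by simp
  thus "\<psi> x = \<psi>' x" by (simp add: rep)
qed

lemma field_hom_id: "field_hom (\<lambda>x :: 'k. x)"
  by (rule field_homI) auto

lemma \<sigma>_pow_p: "\<sigma> ^^ p = (\<lambda>x. x)"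
  by (rule hom_ext[OF \<sigma>_pow_hom field_hom_id]) (auto simp: \<sigma>_pow_\<alpha> of_nat_p)

lemma \<sigma>_pow_mod: "(\<sigma> ^^ n) x = (\<sigma> ^^ (n mod p)) x"
proof -
  have "\<sigma> ^^ (p * k) = (\<lambda>x. x)" for k
    by (induction k) (simp_all add: funpow_add \<sigma>_pow_p comp_def)
  from this[of "n div p"] have "(\<sigma> ^^ (n mod p + p * (n div p))) x = (\<sigma> ^^ (n mod p)) x"
    by (simp only: funpow_add comp_def)
  thus ?thesis by simp
qed

lemma \<sigma>_pow_add: "(\<sigma> ^^ i) ((\<sigma> ^^ j) x) = (\<sigma> ^^ (i + j)) x"
  by (simp add: funpow_add)

lemma bij_\<sigma>_pow: "bij (\<sigma> ^^ j)"
proof (rule o_bij)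
  define i where "i = p - j mod p"
  have "(i + j) mod p = 0"
  proof -
    have "(i + j) mod p = (i + j mod p) mod p" by (simp add: mod_simps)
    moreover have "i + j mod p = p" using p_pos by (simp add: i_def less_imp_le)
    ultimately show ?thesis by simp
  qed
  hence "(\<sigma> ^^ (i + j)) x = x" for x using \<sigma>_pow_mod[of "i + j" x] by simp
  thus "(\<sigma> ^^ i) \<circ> (\<sigma> ^^ j) = id" "(\<sigma> ^^ j) \<circ> (\<sigma> ^^ i) = id"
    by (auto simp: \<sigma>_pow_add add.commute)
qed

text \<open>For an automorphism \<tau> over k, the difference of \<tau> \<alpha> and \<alpha> is
  fixed by Frobenius, hence lies in the prime field.\<close>

lemma galois_group: "galois_group \<iota> = {\<sigma> ^^ j | j. j < p}"
proof (intro equalityI subsetI)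
  fix \<tau> assume "\<tau> \<in> {\<sigma> ^^ j | j. j < p}"
  thus "\<tau> \<in> galois_group \<iota>" using \<sigma>_pow_hom bij_\<sigma>_pow by (auto simp: galois_group_def)
next
  fix \<tau> assume "\<tau> \<in> galois_group \<iota>"
  hence t: "field_hom \<tau>" "\<And>c. \<tau> (\<iota> c) = \<iota> c" by (auto simp: galois_group_def)
  then interpret t: field_hom \<tau> by simp
  have "\<tau> \<alpha> ^ p - \<tau> \<alpha> = \<tau> (\<alpha> ^ p - \<alpha>)" by (simp only: t.hom_minus t.hom_power)
  also have "\<dots> = \<alpha> ^ p - \<alpha>" using root t by simp
  finally have e: "\<tau> \<alpha> ^ p - \<tau> \<alpha> = \<alpha> ^ p - \<alpha>" .
  have "(\<tau> \<alpha> - \<alpha>) ^ p = \<tau> \<alpha> ^ p - \<alpha> ^ p"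
    using prime_p char_k by (intro freshmans_dream_minus) auto
  also have "\<dots> = \<tau> \<alpha> - \<alpha>" using e by (metis add_diff_cancel_left' diff_add_cancel diff_diff_eq2)
  finally have "(\<tau> \<alpha> - \<alpha>) ^ p = \<tau> \<alpha> - \<alpha>" .
  then obtain j where j: "j < p" "\<tau> \<alpha> - \<alpha> = of_nat j"
    using frobenius_fixed[OF prime_p char_k] by blast
  hence "\<tau> \<alpha> = (\<sigma> ^^ j) \<alpha>" by (simp add: \<sigma>_pow_\<alpha> algebra_simps)
  hence "\<tau> = \<sigma> ^^ j" by (intro hom_ext[OF t(1) \<sigma>_pow_hom]) (auto simp: t)
  thus "\<tau> \<in> {\<sigma> ^^ j | j. j < p}" using j by auto
qed

lemma of_nat_unit:
  assumes "0 < n" "n < p"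
  shows "(of_nat n :: 'f) \<noteq> 0" "\<exists>k. of_nat (k * n) = (1 :: 'k)"
proof -
  have nd: "\<not> p dvd n" using assms by (auto dest: dvd_imp_le)
  thus "(of_nat n :: 'f) \<noteq> 0" using char_f by (simp add: of_nat_eq_0_iff_char_dvd)
  have "coprime n p" using prime_imp_coprime[OF prime_p nd] by (simp add: coprime_commute)
  then obtain k where "[n * k = 1] (mod p)" using cong_solve_coprime_nat[of n p] by auto
  hence "(of_nat (n * k) :: 'k) = of_nat 1" unfolding of_nat_eq_iff_cong_CHAR char_k .
  thus "\<exists>k. of_nat (k * n) = (1 :: 'k)" by (auto simp: mult.commute)
qed

text \<open>Coordinates have degree below p, so the factor \<open>degree (rep x)\<close> from
  \<open>degree_translate_diff\<close> is invertible in k.\<close>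

lemma rep_\<sigma>_diff:
  assumes "degree (rep x) > 0"
  shows "degree (rep (\<sigma> x - x)) = degree (rep x) - 1"
    "lead_coeff (rep (\<sigma> x - x)) = of_nat (degree (rep x)) * lead_coeff (rep x)"
proof -
  have "of_nat (degree (rep x)) * 1 \<noteq> (0 :: 'f)" using of_nat_unit assms rep(1) by auto
  thus "degree (rep (\<sigma> x - x)) = degree (rep x) - 1"
    "lead_coeff (rep (\<sigma> x - x)) = of_nat (degree (rep x)) * lead_coeff (rep x)"
    using degree_translate_diff[of "rep x" 1] assms by (auto simp: rep_diff rep_\<sigma>)
qed

text \<open>In positive degree the leading coefficient of \<open>\<sigma> x - x\<close> is a nonzero
  multiple of that of \<open>x\<close>, so it cannot vanish.\<close>

lemma fixed_field:
  assumes "\<sigma> x = x"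
  shows "x \<in> range \<iota>"
proof -
  have "degree (rep x) = 0"
  proof (rule ccontr)
    assume "degree (rep x) \<noteq> 0"
    hence d: "degree (rep x) > 0" by simp
    have "of_nat (degree (rep x)) * lead_coeff (rep x) = 0"
      using rep_\<sigma>_diff(2)[OF d] assms by (simp add: rep_0)
    thus False using of_nat_unit(1)[OF d rep(1)] d by auto
  qed
  then obtain c where "rep x = [:c:]" using degree_eq_zeroE by blast
  hence "x = \<iota> c" using rep(2)[of x] by (simp add: poly_ev_simps)
  thus ?thesis by blast
qed

text \<open>Applying \<open>\<sigma> - 1\<close> as often as the degree in \<open>\<alpha>\<close> isolates the leading coefficient, up to a
  factor that is a unit modulo \<open>p\<close>.\<close>

lemma lead_coeff_mem:
  assumes add: "\<And>x y. x \<in> I \<Longrightarrow> y \<in> I \<Longrightarrow> x + y \<in> I" and diff: "\<And>x y. x \<in> I \<Longrightarrow> y \<in> I \<Longrightarrow> x - y \<in> I"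
    and \<sigma>: "\<And>x. x \<in> I \<Longrightarrow> \<sigma> x \<in> I" and "x \<in> I"
  shows "\<iota> (lead_coeff (rep x)) \<in> I"
  using \<open>x \<in> I\<close>
proof (induction "degree (rep x)" arbitrary: x)
  case 0
  then obtain c where c: "rep x = [:c:]" using degree_eq_zeroE by metis
  hence "x = \<iota> c" using rep(2)[of x] by (simp add: poly_ev_simps)
  thus ?case using 0 c by simp
next
  case (Suc d)
  have d: "degree (rep x) > 0" using Suc by simp
  have "\<sigma> x - x \<in> I" using diff \<sigma> Suc.prems by blast
  hence *: "\<iota> (of_nat (Suc d) * lead_coeff (rep x)) \<in> I"
    using Suc.hyps(1)[of "\<sigma> x - x"] rep_\<sigma>_diff[OF d] Suc.hyps(2) by simp
  obtain k where k: "of_nat (k * Suc d) = (1 :: 'k)" using of_nat_unit(2)[of "Suc d"] rep(1)[of x] Suc.hyps(2) by auto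
  have mult: "of_nat n * y \<in> I" if "y \<in> I" for n y
  proof (induction n)
    case 0
    show ?case using diff[OF that that] by simp
  next
    case (Suc n)
    show ?case using add[OF that Suc] by (simp add: algebra_simps)
  qed
  have "of_nat k * \<iota> (of_nat (Suc d) * lead_coeff (rep x)) = of_nat (k * Suc d) * \<iota> (lead_coeff (rep x))"
    by (simp only: hom_mult hom_of_nat of_nat_mult mult.assoc)
  thus ?case using mult[OF *, of k] k by simp
qed

definition nrm :: "'k \<Rightarrow> 'f" where
  "nrm x = inv_into UNIV \<iota> (\<Prod>j<p. (\<sigma> ^^ j) x)"

lemma \<sigma>_cyclic_prod:
  fixes F :: "nat \<Rightarrow> 'b::comm_monoid_mult"
  assumes "F p = F 0"
  shows "(\<Prod>j<p. F (Suc j)) = (\<Prod>j<p. F j)"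
proof -
  obtain n where n: "p = Suc n" using p_pos gr0_implies_Suc by blast
  have "(\<Prod>j<p. F (Suc j)) = (\<Prod>j<n. F (Suc j)) * F 0" using assms by (simp add: n)
  also have "\<dots> = (\<Prod>j<p. F j)" unfolding n by (subst prod.lessThan_Suc_shift) (simp add: mult.commute)
  finally show ?thesis .
qed

lemma \<iota>_nrm: "\<iota> (nrm x) = (\<Prod>j<p. (\<sigma> ^^ j) x)"
proof -
  have "\<sigma> (\<Prod>j<p. (\<sigma> ^^ j) x) = (\<Prod>j<p. (\<sigma> ^^ Suc j) x)" by (simp add: \<sigma>.hom_prod)
  also have "\<dots> = (\<Prod>j<p. (\<sigma> ^^ j) x)" by (rule \<sigma>_cyclic_prod) (simp add: \<sigma>_pow_p)
  finally show ?thesis using fixed_field unfolding nrm_def by (simp add: f_inv_into_f)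
qed

lemma nrm_mult: "nrm (x * y) = nrm x * nrm y"
proof -
  have "(\<sigma> ^^ j) (x * y) = (\<sigma> ^^ j) x * (\<sigma> ^^ j) y" for j
  proof -
    interpret s: field_hom "\<sigma> ^^ j" by (rule \<sigma>_pow_hom)
    show ?thesis by (rule s.hom_mult)
  qed
  hence "\<iota> (nrm (x * y)) = \<iota> (nrm x * nrm y)" by (simp add: \<iota>_nrm hom_mult prod.distrib)
  thus ?thesis by simp
qed

lemma nrm_\<iota>: "nrm (\<iota> c) = c ^ p"
proof -
  have "\<iota> (nrm (\<iota> c)) = \<iota> (c ^ p)" by (simp add: \<iota>_nrm hom_power)
  thus ?thesis by simp
qed

lemma nrm_1: "nrm 1 = 1" using nrm_\<iota>[of 1] by simp

lemma nrm_\<sigma>: "nrm (\<sigma> x) = nrm x"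
proof -
  have "(\<sigma> ^^ j) (\<sigma> x) = (\<sigma> ^^ Suc j) x" for j by (simp add: funpow_swap1)
  hence "\<iota> (nrm (\<sigma> x)) = (\<Prod>j<p. (\<sigma> ^^ Suc j) x)" by (simp add: \<iota>_nrm)
  also have "\<dots> = \<iota> (nrm x)" unfolding \<iota>_nrm by (rule \<sigma>_cyclic_prod) (simp add: \<sigma>_pow_p)
  finally show ?thesis by simp
qed

lemma nrm_eq_0_iff: "nrm x = 0 \<longleftrightarrow> x = 0"
proof
  assume "nrm x = 0"
  hence "nrm x * nrm (inverse x) = 0" by simp
  hence "nrm (x * inverse x) = 0" by (simp only: nrm_mult)
  thus "x = 0" using nrm_1 by (cases "x = 0") auto
next
  assume "x = 0"
  thus "nrm x = 0" using nrm_\<iota>[of 0] p_pos by (simp add: power_0_left)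
qed

text \<open>The characteristic polynomial of \<open>x\<close> over k. Its coefficients lie in every
  subring that contains all conjugates of \<open>x\<close>; this is applied both to the integers and
  to the elements without poles at infinity.\<close>

definition conj_poly :: "'k \<Rightarrow> 'k poly" where
  "conj_poly x = (\<Prod>j<p. [:- (\<sigma> ^^ j) x, 1:])"

lemma lead_coeff_conj_poly: "lead_coeff (conj_poly x) = 1"
  by (simp add: conj_poly_def lead_coeff_prod)

lemma poly_conj_poly: "poly (conj_poly x) x = 0"
proof -
  have "0 \<in> {..<p}" "poly [:- (\<sigma> ^^ 0) x, 1:] x = 0" using p_pos by simp_all
  thus ?thesis unfolding conj_poly_def poly_prod by (intro prod_zero) blast+
qed

lemma coeff_prod_linear_mem:
  assumes "\<And>x y. x \<in> S \<Longrightarrow> y \<in> S \<Longrightarrow> x - y \<in> S" "\<And>x y. x \<in> S \<Longrightarrow> y \<in> S \<Longrightarrow> x * y \<in> S"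
    "1 \<in> S" "finite A" "\<And>i. i \<in> A \<Longrightarrow> f i \<in> S"
  shows "coeff (\<Prod>i\<in>A. [:- f i, 1 :: 'b::comm_ring_1:]) n \<in> S"
  using assms(4,5)
proof (induction A arbitrary: n rule: finite_induct)
  case empty
  have "0 \<in> S" using assms(1)[OF assms(3) assms(3)] by simp
  thus ?case using assms(3) by (simp add: coeff_1)
next
  case (insert i A)
  let ?q = "\<Prod>i\<in>A. [:- f i, 1:]"
  have 0: "0 \<in> S" using assms(1)[OF assms(3) assms(3)] by simp
  have "coeff ([:- f i, 1:] * ?q) n = (case n of 0 \<Rightarrow> 0 | Suc m \<Rightarrow> coeff ?q m) - f i * coeff ?q n"
    by (auto simp: coeff_pCons split: nat.splits)
  moreover have "f i * coeff ?q n \<in> S" using insert assms(2) by auto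
  moreover have "(case n of 0 \<Rightarrow> 0 | Suc m \<Rightarrow> coeff ?q m) \<in> S"
    using insert 0 by (auto split: nat.splits)
  ultimately show ?case using insert.hyps assms(1) by auto
qed

lemma coeff_conj_poly_mem:
  assumes "\<And>x y. x \<in> S \<Longrightarrow> y \<in> S \<Longrightarrow> x - y \<in> S" "\<And>x y. x \<in> S \<Longrightarrow> y \<in> S \<Longrightarrow> x * y \<in> S"
    "1 \<in> S" "\<And>j. j < p \<Longrightarrow> (\<sigma> ^^ j) x \<in> S"
  shows "coeff (conj_poly x) n \<in> S"
  unfolding conj_poly_def using assms by (intro coeff_prod_linear_mem) auto

lemma conj_poly_in_base: "\<exists>g. conj_poly x = map_poly \<iota> g \<and> lead_coeff g = 1"
proof -
  have s: "map_poly \<sigma> (conj_poly x) = conj_poly x"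
  proof -
    interpret m: map_poly_inj_idom_hom \<sigma> ..
    have "map_poly \<sigma> (conj_poly x) = (\<Prod>j<p. [:- (\<sigma> ^^ Suc j) x, 1:])"
      unfolding conj_poly_def m.hom_prod by (simp add: map_poly_pCons \<sigma>.hom_uminus)
    also have "\<dots> = conj_poly x" unfolding conj_poly_def by (rule \<sigma>_cyclic_prod) (simp add: \<sigma>_pow_p)
    finally show ?thesis .
  qed
  have "coeff (conj_poly x) n \<in> range \<iota>" for n
  proof (rule fixed_field)
    have "coeff (map_poly \<sigma> (conj_poly x)) n = \<sigma> (coeff (conj_poly x) n)" by (simp add: coeff_map_poly)
    thus "\<sigma> (coeff (conj_poly x) n) = coeff (conj_poly x) n" using s by simp
  qed
  hence i: "\<iota> (inv_into UNIV \<iota> (coeff (conj_poly x) n)) = coeff (conj_poly x) n" for n by (simp add: f_inv_into_f)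
  define g where "g = map_poly (inv_into UNIV \<iota>) (conj_poly x)"
  have "inv_into UNIV \<iota> 0 = 0" using i[of "Suc (degree (conj_poly x))"] by (metis \<iota>_eq_iff coeff_eq_0 hom_zero lessI)
  hence "conj_poly x = map_poly \<iota> g"
    unfolding g_def by (intro poly_eqI) (simp add: coeff_map_poly i)
  moreover from this have "\<iota> (lead_coeff g) = \<iota> 1" using lead_coeff_conj_poly[of x] by simp
  hence "lead_coeff g = 1" by simp
  ultimately show ?thesis by blast
qed

text \<open>Hilbert's Theorem 90.  The resolvents of \<open>1, \<alpha>, \<dots>, \<alpha>\<^sup>p\<^sup>-\<^sup>1\<close> cannot all vanish: combine
  them with the coefficients of the polynomial that vanishes at all conjugates of \<open>\<alpha>\<close> but \<open>\<alpha>\<close>.\<close>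

lemma hilbert_90:
  assumes "nrm u = 1"
  shows "\<exists>b. b \<noteq> 0 \<and> u = \<sigma> b / b"
proof -
  have u0: "u \<noteq> 0" using assms nrm_eq_0_iff[of u] by auto
  \<comment> \<open>The partial norms of \<open>u\<close> form the cocycle that takes the value
    \<open>u\<close> at \<sigma>. \<open>B\<close> is the resolvent for it: applying \<sigma> and
    multiplying by \<open>u\<close> permutes its summands cyclically, because
    \<open>w p = 1\<close>.\<close>
  define w where "w j = (\<Prod>i<j. (\<sigma> ^^ i) u)" for j
  have wS: "w (Suc j) = u * \<sigma> (w j)" for j
    unfolding w_def by (subst prod.lessThan_Suc_shift) (simp add: \<sigma>.hom_prod)
  have w0: "w 0 = 1" "w p = 1" using assms \<iota>_nrm[of u] by (simp_all add: w_def)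
  define B where "B t = (\<Sum>j<p. w j * (\<sigma> ^^ j) t)" for t
  have B: "u * \<sigma> (B t) = B t" for t
  proof -
    have "u * \<sigma> (B t) = (\<Sum>j<p. w (Suc j) * (\<sigma> ^^ Suc j) t)"
      by (simp add: B_def \<sigma>.hom_sum \<sigma>.hom_mult sum_distrib_left wS mult_ac)
    also have "\<dots> = B t"
    proof -
      obtain n where n: "p = Suc n" using p_pos gr0_implies_Suc by blast
      have "(\<Sum>j<p. w (Suc j) * (\<sigma> ^^ Suc j) t) =
          (\<Sum>j<n. w (Suc j) * (\<sigma> ^^ Suc j) t) + w p * (\<sigma> ^^ p) t" by (simp add: n)
      also have "w p * (\<sigma> ^^ p) t = w 0 * (\<sigma> ^^ 0) t" using w0 by (simp add: \<sigma>_pow_p)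
      also have "(\<Sum>j<n. w (Suc j) * (\<sigma> ^^ Suc j) t) + w 0 * (\<sigma> ^^ 0) t = B t"
        unfolding B_def n by (subst sum.lessThan_Suc_shift) (simp add: add.commute)
      finally show ?thesis .
    qed
    finally show ?thesis .
  qed
  have "\<exists>i. B (\<alpha> ^ i) \<noteq> 0"
  proof (rule ccontr)
    assume "\<not> ?thesis"
    hence z: "B (\<alpha> ^ i) = 0" for i by blast
    define g where "g = (\<Prod>j\<in>{1..<p}. [:- (\<alpha> + of_nat j), 1:])"
    have g: "poly g (\<alpha> + of_nat j) = (if j = 0 then poly g \<alpha> else 0)" if "j < p" for j
      using that by (auto simp: g_def poly_prod intro!: prod_zero bexI[of _ j])
    have "poly g \<alpha> \<noteq> 0"
    proof -
      have "(of_nat j :: 'k) \<noteq> 0" if "j \<in> {1..<p}" for j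
        using that char_k nat_dvd_not_less[of j p] by (auto simp: of_nat_eq_0_iff_char_dvd)
      thus ?thesis by (auto simp: g_def poly_prod)
    qed
    have "(\<Sum>i\<le>degree g. coeff g i * B (\<alpha> ^ i)) = (\<Sum>j<p. w j * poly g (\<alpha> + of_nat j))"
    proof -
      have pw: "(\<sigma> ^^ j) (\<alpha> ^ i) = (\<alpha> + of_nat j) ^ i" for i j
      proof -
        interpret s: field_hom "\<sigma> ^^ j" by (rule \<sigma>_pow_hom)
        show ?thesis by (simp add: s.hom_power \<sigma>_pow_\<alpha>)
      qed
      have "(\<Sum>i\<le>degree g. coeff g i * B (\<alpha> ^ i)) =
          (\<Sum>i\<le>degree g. \<Sum>j<p. w j * (coeff g i * (\<alpha> + of_nat j) ^ i))"
        by (simp add: B_def pw sum_distrib_left mult_ac)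
      also have "\<dots> = (\<Sum>j<p. w j * poly g (\<alpha> + of_nat j))"
        by (subst sum.swap) (simp add: poly_altdef sum_distrib_left)
      finally show ?thesis .
    qed
    also have "\<dots> = (\<Sum>j<p. if j = 0 then w 0 * poly g \<alpha> else 0)"
      by (rule sum.cong) (auto simp: g)
    also have "\<dots> = poly g \<alpha>" using p_pos w0 by simp
    finally show False using z \<open>poly g \<alpha> \<noteq> 0\<close> by simp
  qed
  then obtain t where t: "B t \<noteq> 0" by blast
  have "\<sigma> (B t) \<noteq> 0" using t by simp
  \<comment> \<open>The resolvent satisfies \<open>u * \<sigma> (B t) = B t\<close>, so the witness
    is its inverse and not the resolvent itself.\<close>
  hence "u = inverse (\<sigma> (B t)) / inverse (B t)" using B[of t] t by (simp add: divide_simps)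
  hence "u = \<sigma> (inverse (B t)) / inverse (B t)" by (simp only: \<sigma>.hom_inverse)
  thus ?thesis using t by (intro exI[of _ "inverse (B t)"]) auto
qed

end

section \<open>Valuations and the filtration by powers of a prime\<close>

definition valuation :: "('f::field \<Rightarrow> int) \<Rightarrow> bool" where
  "valuation v \<longleftrightarrow> (\<forall>x y. x \<noteq> 0 \<longrightarrow> y \<noteq> 0 \<longrightarrow> v (x * y) = v x + v y) \<and>
     (\<forall>x y. x \<noteq> 0 \<longrightarrow> y \<noteq> 0 \<longrightarrow> x + y \<noteq> 0 \<longrightarrow> min (v x) (v y) \<le> v (x + y))"

definition val_ge :: "('f::field \<Rightarrow> int) \<Rightarrow> int \<Rightarrow> 'f \<Rightarrow> bool" where
  "val_ge v n x \<longleftrightarrow> x = 0 \<or> n \<le> v x"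

lemma val_geI: "(x \<noteq> 0 \<Longrightarrow> n \<le> v x) \<Longrightarrow> val_ge v n x" by (auto simp: val_ge_def)
lemma val_ge_0 [simp]: "val_ge v n 0" by (simp add: val_ge_def)
lemma val_ge_mono: "val_ge v n x \<Longrightarrow> m \<le> n \<Longrightarrow> val_ge v m x" by (auto simp: val_ge_def)

context
  fixes v :: "'f::field \<Rightarrow> int"
  assumes v: "valuation v"
begin

lemma val_mult: "x \<noteq> 0 \<Longrightarrow> y \<noteq> 0 \<Longrightarrow> v (x * y) = v x + v y"
  using v by (simp add: valuation_def)

lemma val_1 [simp]: "v 1 = 0" using val_mult[of 1 1] by simp

lemma val_uminus [simp]: "v (- x) = v x"
proof (cases "x = 0")
  case False
  have "v (- 1) + v (- 1) = 0" using val_mult[of "- 1" "- 1"] by simp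
  thus ?thesis using val_mult[of "- 1" x] False by simp
qed simp

lemma val_ge_add: "val_ge v n x \<Longrightarrow> val_ge v n y \<Longrightarrow> val_ge v n (x + y)"
proof (cases "x = 0 \<or> y = 0 \<or> x + y = 0")
  case False
  assume "val_ge v n x" "val_ge v n y"
  moreover have "min (v x) (v y) \<le> v (x + y)" using v False by (simp add: valuation_def)
  ultimately show ?thesis using False by (auto simp: val_ge_def)
qed auto

lemma val_ge_uminus: "val_ge v n x \<Longrightarrow> val_ge v n (- x)"
  by (simp add: val_ge_def)

lemma val_ge_diff: "val_ge v n x \<Longrightarrow> val_ge v n y \<Longrightarrow> val_ge v n (x - y)"
  using val_ge_add[of n x "- y"] val_ge_uminus by simp

lemma val_ge_mult: "val_ge v n x \<Longrightarrow> val_ge v m y \<Longrightarrow> val_ge v (n + m) (x * y)"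
  by (cases "x = 0 \<or> y = 0") (auto simp: val_ge_def val_mult)

lemma val_inverse: "x \<noteq> 0 \<Longrightarrow> v (inverse x) = - v x"
  using val_mult[of x "inverse x"] by simp

lemma val_divide: "x \<noteq> 0 \<Longrightarrow> y \<noteq> 0 \<Longrightarrow> v (x / y) = v x - v y"
  using val_mult[of x "inverse y"] val_inverse[of y] by (simp add: field_simps)

lemma val_power: "x \<noteq> 0 \<Longrightarrow> v (x ^ n) = int n * v x"
  by (induction n) (auto simp: val_mult algebra_simps)

lemma val_powi: "x \<noteq> 0 \<Longrightarrow> v (x powi n) = n * v x"
  by (cases "n \<ge> 0") (auto simp: power_int_def val_power val_inverse)

lemma val_prod: "(\<And>i. i \<in> A \<Longrightarrow> f i \<noteq> 0) \<Longrightarrow> v (\<Prod>i\<in>A. f i) = (\<Sum>i\<in>A. v (f i))"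
  by (induction A rule: infinite_finite_induct) (auto simp: val_mult)

lemma val_ge_sum: "(\<And>i. i \<in> A \<Longrightarrow> val_ge v n (f i)) \<Longrightarrow> val_ge v n (\<Sum>i\<in>A. f i)"
  by (induction A rule: infinite_finite_induct) (auto intro: val_ge_add)

lemma val_add_eq:
  assumes "x \<noteq> 0" "val_ge v (v x + 1) y"
  shows "x + y \<noteq> 0" "v (x + y) = v x"
proof -
  show nz: "x + y \<noteq> 0"
  proof
    assume "x + y = 0"
    hence "y = - x" by (simp add: eq_neg_iff_add_eq_0 add.commute)
    thus False using assms by (simp add: val_ge_def)
  qed
  have "val_ge v (v x) (x + y)"
    using assms val_ge_mono by (intro val_ge_add) (auto simp: val_ge_def)
  hence 1: "v x \<le> v (x + y)" using nz by (simp add: val_ge_def)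
  show "v (x + y) = v x"
  proof (rule ccontr)
    assume "v (x + y) \<noteq> v x"
    hence "val_ge v (v x + 1) (x + y)" using 1 by (simp add: val_ge_def)
    hence "val_ge v (v x + 1) (x + y - y)" using assms by (intro val_ge_diff)
    thus False using assms by (simp add: val_ge_def)
  qed
qed

end

section \<open>The filtration of K attached to a place of k\<close>

context artin_schreier
begin

text \<open>If w extends \<open>p * v\<close>, then D has w-value at least \<open>- p * e\<close>,
  and the equation of \<alpha> forces w(\<alpha>) to be at least \<open>- e\<close>. So
  \<open>e\<close> bounds the pole order of \<alpha>, and \<open>0 \<le> e\<close> allows \<alpha>
  to be replaced by its conjugates.\<close>

definition admissible :: "('f \<Rightarrow> int) \<Rightarrow> int \<Rightarrow> bool" where
  "admissible v e \<longleftrightarrow> valuation v \<and> val_ge v (- e) D \<and> 0 \<le> e"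

text \<open>In the cases of interest \<open>fil v e n\<close> is the set of \<open>x\<close> with \<open>w(x) \<ge> n\<close>, where \<open>w\<close> extends
  \<open>p v\<close> to \<open>K\<close>.\<close>

definition fil :: "('f \<Rightarrow> int) \<Rightarrow> int \<Rightarrow> int \<Rightarrow> 'k set" where
  "fil v e n = {x. \<forall>i<p. coef x i = 0 \<or> n + int i * e \<le> int p * v (coef x i)}"

lemma fil_mono: "x \<in> fil v e n \<Longrightarrow> m \<le> n \<Longrightarrow> x \<in> fil v e m"
  by (force simp: fil_def)

lemma fil_0 [simp]: "0 \<in> fil v e n" by (simp add: fil_def coef_simps)

lemma fil_\<iota>: "\<iota> c \<in> fil v e n \<longleftrightarrow> c = 0 \<or> n \<le> int p * v c"
  using p_pos by (auto simp: fil_def coef_\<iota>)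

lemma coef_monomial: "i < p \<Longrightarrow> coef (\<iota> c * \<alpha> ^ i) j = (if j = i then c else 0)"
  by (simp add: coef_simps coef_power)

lemma fil_monomial: "i < p \<Longrightarrow> \<iota> c * \<alpha> ^ i \<in> fil v e n \<longleftrightarrow> c = 0 \<or> n + int i * e \<le> int p * v c"
  by (auto simp: fil_def coef_monomial)

lemma fil_exhaust:
  assumes "x \<noteq> 0"
  obtains n where "x \<in> fil v e n" "x \<notin> fil v e (n + 1)"
proof -
  define A where "A = {i. i < p \<and> coef x i \<noteq> 0}"
  \<comment> \<open>The value of the i-th term of the expansion when \<alpha> is given the value
    \<open>- e\<close>; the minimum over the nonzero terms is the level sought.\<close>
  define g where "g i = int p * v (coef x i) - int i * e" for i
  have A: "finite A" "A \<noteq> {}" using assms coef_eqI[of x 0] by (auto simp: A_def coef_simps)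
  have in_iff: "x \<in> fil v e n \<longleftrightarrow> (\<forall>i\<in>A. n \<le> g i)" for n
    by (auto simp: fil_def A_def g_def algebra_simps)
  have "x \<in> fil v e (Min (g ` A))" unfolding in_iff using A by simp
  moreover have "Min (g ` A) \<in> g ` A" using A by (intro Min_in) auto
  hence "x \<notin> fil v e (Min (g ` A) + 1)" unfolding in_iff by force
  ultimately show ?thesis using that by blast
qed

context
  fixes v e
  assumes adm: "admissible v e"
begin

lemma adm_val: "valuation v" and adm_D: "val_ge v (- e) D" and adm_e: "0 \<le> e"
  using adm by (auto simp: admissible_def)

lemma fil_add: "x \<in> fil v e n \<Longrightarrow> y \<in> fil v e n \<Longrightarrow> x + y \<in> fil v e n"
proof -
  assume x: "x \<in> fil v e n" and y: "y \<in> fil v e n"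
  show ?thesis unfolding fil_def
  proof (intro CollectI allI impI)
    fix i assume i: "i < p"
    show "coef (x + y) i = 0 \<or> n + int i * e \<le> int p * v (coef (x + y) i)"
    proof (rule ccontr)
      assume "\<not> ?thesis"
      hence 0: "coef x i + coef y i \<noteq> 0" and nz: "\<not> n + int i * e \<le> int p * v (coef x i + coef y i)"
        by (auto simp: coef_simps)
      show False
      proof (cases "coef x i = 0 \<or> coef y i = 0")
        case True
        thus False using x y i nz 0 by (auto simp: fil_def)
      next
        case False
        hence "min (v (coef x i)) (v (coef y i)) \<le> v (coef x i + coef y i)"
          using adm_val 0 by (simp add: valuation_def)
        hence "int p * min (v (coef x i)) (v (coef y i)) \<le> int p * v (coef x i + coef y i)"
          by (intro mult_left_mono) auto
        moreover have "n + int i * e \<le> int p * v (coef x i)" "n + int i * e \<le> int p * v (coef y i)"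
          using x y i False by (auto simp: fil_def)
        ultimately show False using nz by (auto simp: min_def split: if_splits)
      qed
    qed
  qed
qed

lemma fil_uminus: "x \<in> fil v e n \<Longrightarrow> - x \<in> fil v e n"
  by (simp add: fil_def coef_simps val_uminus[OF adm_val])

lemma fil_diff: "x \<in> fil v e n \<Longrightarrow> y \<in> fil v e n \<Longrightarrow> x - y \<in> fil v e n"
  using fil_add[of x n "- y"] fil_uminus by simp

lemma fil_sum: "(\<And>i. i \<in> A \<Longrightarrow> f i \<in> fil v e n) \<Longrightarrow> (\<Sum>i\<in>A. f i) \<in> fil v e n"
  by (induction A rule: infinite_finite_induct) (auto intro: fil_add)

lemma fil_scale_iff:
  assumes "c \<noteq> 0"
  shows "\<iota> c * x \<in> fil v e (n + int p * v c) \<longleftrightarrow> x \<in> fil v e n"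
proof -
  have "c * a = 0 \<or> n + int p * v c + k \<le> int p * v (c * a) \<longleftrightarrow> a = 0 \<or> n + k \<le> int p * v a" for a k
    using assms by (cases "a = 0") (auto simp: val_mult[OF adm_val] distrib_left)
  thus ?thesis by (simp add: fil_def coef_simps(4))
qed

lemma fil_scale: "c \<noteq> 0 \<Longrightarrow> x \<in> fil v e n \<Longrightarrow> \<iota> c * x \<in> fil v e (n + int p * v c)"
  by (simp add: fil_scale_iff)

text \<open>Only the top term leaves the basis, and there
  \<open>\<alpha> ^ p = \<alpha> + \<iota> D\<close>. The bound for D allows a loss of exactly
  \<open>p * e\<close>, and for \<alpha> the inequality \<open>e \<le> p * e\<close>
  suffices.\<close>

lemma fil_\<alpha>_mult:
  assumes "x \<in> fil v e n"
  shows "\<alpha> * x \<in> fil v e (n - e)"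
proof -
  have "\<alpha> * x = (\<Sum>i<p. \<iota> (coef x i) * \<alpha> ^ Suc i)"
    by (subst coef_expand[of x]) (simp add: sum_distrib_left mult_ac)
  also have "\<dots> \<in> fil v e (n - e)"
  proof (rule fil_sum)
    fix i assume "i \<in> {..<p}"
    hence i: "i < p" by simp
    let ?c = "coef x i"
    show "\<iota> ?c * \<alpha> ^ Suc i \<in> fil v e (n - e)"
    proof (cases "?c = 0")
      case c: False
      hence le: "n + int i * e \<le> int p * v ?c" using assms i by (auto simp: fil_def)
      show ?thesis
      proof (cases "Suc i < p")
        case True
        have "n - e + int (Suc i) * e \<le> int p * v ?c" using le by (simp add: algebra_simps)
        thus ?thesis using fil_monomial[OF True] by blast
      next
        case False
        hence ip: "Suc i = p" using i by simp
        hence "int i = int p - 1" by linarith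
        hence "int i * e = int p * e - e" by (simp add: left_diff_distrib)
        hence le': "n + int p * e - e \<le> int p * v ?c" using le by linarith
        have "\<alpha> ^ p = \<alpha> + \<iota> D" using root by (simp add: algebra_simps)
        hence "\<iota> ?c * \<alpha> ^ Suc i = \<iota> ?c * \<alpha> ^ 1 + \<iota> (?c * D)"
          unfolding ip by (simp add: algebra_simps hom_mult)
        moreover have "\<iota> ?c * \<alpha> ^ 1 \<in> fil v e (n - e)"
        proof -
          have "e * 1 \<le> e * int p" using adm_e p_pos by (intro mult_left_mono) auto
          thus ?thesis using le' fil_monomial[OF p_gt_1, of ?c v e "n - e"] by (simp add: algebra_simps)
        qed
        moreover have "\<iota> (?c * D) \<in> fil v e (n - e)"
        proof (cases "D = 0")
          case False
          have "int p * (- e) \<le> int p * v D" using adm_D False by (intro mult_left_mono) (auto simp: val_ge_def)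
          thus ?thesis using le' c False by (simp add: fil_\<iota> val_mult[OF adm_val] algebra_simps)
        qed simp
        ultimately show ?thesis using fil_add by simp
      qed
    qed simp
  qed
  finally show ?thesis .
qed

lemma fil_\<alpha>_power_mult: "x \<in> fil v e n \<Longrightarrow> \<alpha> ^ i * x \<in> fil v e (n - int i * e)"
proof (induction i)
  case (Suc i)
  from fil_\<alpha>_mult[OF Suc.IH[OF Suc.prems]] show ?case by (simp add: algebra_simps)
qed simp

lemma fil_mult:
  assumes "x \<in> fil v e n" "y \<in> fil v e m"
  shows "x * y \<in> fil v e (n + m)"
proof -
  have "x * y = (\<Sum>i<p. \<iota> (coef x i) * (\<alpha> ^ i * y))"
    by (subst coef_expand[of x]) (simp only: sum_distrib_right mult.assoc)
  also have "\<dots> \<in> fil v e (n + m)"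
  proof (rule fil_sum)
    fix i assume i: "i \<in> {..<p}"
    show "\<iota> (coef x i) * (\<alpha> ^ i * y) \<in> fil v e (n + m)"
    proof (cases "coef x i = 0")
      case False
      hence "n + int i * e \<le> int p * v (coef x i)" using assms(1) i by (auto simp: fil_def)
      moreover have "\<iota> (coef x i) * (\<alpha> ^ i * y) \<in> fil v e (m - int i * e + int p * v (coef x i))"
        by (rule fil_scale[OF False fil_\<alpha>_power_mult[OF assms(2)]])
      ultimately show ?thesis by (auto elim: fil_mono)
    qed simp
  qed
  finally show ?thesis .
qed

lemma fil_1: "1 \<in> fil v e 0"
  using fil_\<iota>[of 1 v e 0] val_1[OF adm_val] by simp

lemma fil_power: "x \<in> fil v e n \<Longrightarrow> x ^ i \<in> fil v e (int i * n)"
proof (induction i)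
  case 0
  show ?case using fil_1 by simp
next
  case (Suc i)
  from fil_mult[OF Suc.prems Suc.IH[OF Suc.prems]] show ?case by (simp add: algebra_simps)
qed

lemma fil_\<alpha>: "\<alpha> \<in> fil v e (- e)"
  using fil_\<alpha>_mult[OF fil_1] by simp

text \<open>Since \<open>e\<close> is nonnegative, the conjugate \<open>\<alpha> + 1\<close> obeys
  the same bound as \<alpha>.\<close>

lemma fil_\<sigma>:
  assumes "x \<in> fil v e n"
  shows "\<sigma> x \<in> fil v e n"
proof -
  have "1 \<in> fil v e (- e)" using fil_1 adm_e by (auto elim: fil_mono)
  hence a: "\<alpha> + 1 \<in> fil v e (- e)" using fil_\<alpha> fil_add by blast
  have "\<sigma> x = (\<Sum>i<p. \<iota> (coef x i) * (\<alpha> + 1) ^ i)"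
    by (subst coef_expand[of x]) (simp add: \<sigma>.hom_sum \<sigma>.hom_mult \<sigma>.hom_power \<sigma>_facts(4))
  also have "\<dots> \<in> fil v e n"
  proof (rule fil_sum)
    fix i assume i: "i \<in> {..<p}"
    show "\<iota> (coef x i) * (\<alpha> + 1) ^ i \<in> fil v e n"
    proof (cases "coef x i = 0")
      case False
      hence "n + int i * e \<le> int p * v (coef x i)" using assms i by (auto simp: fil_def)
      thus ?thesis using fil_scale[OF False fil_power[OF a, of i]] by (auto elim: fil_mono)
    qed simp
  qed
  finally show ?thesis .
qed

lemma fil_\<sigma>_pow: "x \<in> fil v e n \<Longrightarrow> (\<sigma> ^^ j) x \<in> fil v e n"
  by (induction j) (auto intro: fil_\<sigma>)

text \<open>The p conjugates together reach level \<open>p * n\<close>, and on the base field the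
  level is p times the value.\<close>

lemma fil_nrm:
  assumes "x \<in> fil v e n" "x \<noteq> 0"
  shows "n \<le> v (nrm x)"
proof -
  have "(\<Prod>j<k. (\<sigma> ^^ j) x) \<in> fil v e (int k * n)" for k
  proof (induction k)
    case 0
    show ?case using fil_1 by simp
  next
    case (Suc k)
    from fil_mult[OF Suc fil_\<sigma>_pow[OF assms(1)]] show ?case by (simp add: algebra_simps)
  qed
  hence "\<iota> (nrm x) \<in> fil v e (int p * n)" by (simp add: \<iota>_nrm)
  thus ?thesis using assms(2) p_pos by (simp add: fil_\<iota> nrm_eq_0_iff)
qed

lemma fil_prod_1:
  assumes "finite A" "\<And>j. j \<in> A \<Longrightarrow> z j - 1 \<in> fil v e 1"
  shows "(\<Prod>j\<in>A. z j) - 1 \<in> fil v e 1"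
  using assms
proof (induction A rule: finite_induct)
  case (insert a A)
  have 1: "z a - 1 \<in> fil v e 1" "prod z A - 1 \<in> fil v e 1" using insert by auto
  have "(z a - 1) * (prod z A - 1) \<in> fil v e 1" by (rule fil_mono[OF fil_mult[OF 1]]) simp
  hence "(z a - 1) * (prod z A - 1) + ((z a - 1) + (prod z A - 1)) \<in> fil v e 1"
    using 1 fil_add by blast
  also have "(z a - 1) * (prod z A - 1) + ((z a - 1) + (prod z A - 1)) = prod z (insert a A) - 1"
    using insert.hyps by (simp add: algebra_simps)
  finally show ?case .
qed simp

end

text \<open>Every nonzero element has an inverse up to terms of positive level, which makes the
  filtration the valuation of the only place above \<open>v\<close>. Asking for an approximate
  inverse treats ramified and inert places alike.\<close>

definition single_place :: "('f \<Rightarrow> int) \<Rightarrow> int \<Rightarrow> bool" where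
  "single_place v e \<longleftrightarrow> admissible v e \<and>
     (\<forall>x. x \<noteq> 0 \<longrightarrow> (\<exists>n y. x \<in> fil v e n \<and> y \<in> fil v e (- n) \<and> x * y - 1 \<in> fil v e 1))"

text \<open>The product of \<open>x\<close> and its approximate inverse has a norm congruent to 1,
  hence of value 0. The two lower bounds from \<open>fil_nrm\<close> therefore add up to an
  equality, so both are sharp.\<close>

lemma single_place_fil_iff:
  assumes "single_place v e" "x \<noteq> 0"
  shows "x \<in> fil v e m \<longleftrightarrow> m \<le> v (nrm x)"
proof -
  have adm: "admissible v e" using assms by (simp add: single_place_def)
  obtain n y where ny: "x \<in> fil v e n" "y \<in> fil v e (- n)" "x * y - 1 \<in> fil v e 1"
    using assms by (auto simp: single_place_def)
  have "(\<Prod>j<p. (\<sigma> ^^ j) (x * y)) - 1 \<in> fil v e 1"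
  proof (rule fil_prod_1[OF adm])
    fix j
    interpret s: field_hom "\<sigma> ^^ j" by (rule \<sigma>_pow_hom)
    have "(\<sigma> ^^ j) (x * y - 1) = (\<sigma> ^^ j) (x * y) - 1" by (simp only: s.hom_minus s.hom_one)
    thus "(\<sigma> ^^ j) (x * y) - 1 \<in> fil v e 1" using fil_\<sigma>_pow[OF adm ny(3), of j] by simp
  qed simp
  hence "\<iota> (nrm (x * y) - 1) \<in> fil v e 1" by (simp add: \<iota>_nrm hom_minus)
  \<comment> \<open>Levels of base elements are multiples of p, so level at least 1 means value at
    least 1. The summand 0 stands for the value of 1 in \<open>val_add_eq\<close>.\<close>
  hence "val_ge v (0 + 1) (nrm (x * y) - 1)"
    using p_pos by (auto simp: fil_\<iota> val_ge_def) (metis less_1_mult' int_one_le_iff_zero_less zero_less_mult_pos of_nat_0_less_iff)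
  hence *: "nrm (x * y) \<noteq> 0" "v (nrm (x * y)) = 0"
    using val_add_eq[OF adm_val[OF adm], of 1 "nrm (x * y) - 1"] val_1[OF adm_val[OF adm]] by simp_all
  hence y: "y \<noteq> 0" by (auto simp: nrm_eq_0_iff)
  have "v (nrm x) + v (nrm y) = 0"
    using * val_mult[OF adm_val[OF adm], of "nrm x" "nrm y"] assms y by (simp add: nrm_mult nrm_eq_0_iff)
  moreover have "n \<le> v (nrm x)" "- n \<le> v (nrm y)"
    using fil_nrm[OF adm ny(1) assms(2)] fil_nrm[OF adm ny(2) y] by auto
  ultimately have n: "v (nrm x) = n" by simp
  show ?thesis using n ny(1) fil_nrm[OF adm _ assms(2)] by (auto elim: fil_mono)
qed

text \<open>For a ramified place the terms of \<open>\<Sum> c\<^sub>i \<alpha>\<^sup>i\<close> have values that are distinct modulo \<open>p\<close>, so one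
  term dominates.\<close>

lemma single_place_ramified:
  assumes "valuation v" "D \<noteq> 0" "v D = - e" "e > 0" "\<not> int p dvd e"
  shows "single_place v e"
  unfolding single_place_def
proof (intro conjI allI impI)
  show adm: "admissible v e" using assms by (simp add: admissible_def val_ge_def)
  fix x :: 'k assume "x \<noteq> 0"
  then obtain n where n: "x \<in> fil v e n" "x \<notin> fil v e (n + 1)" using fil_exhaust by blast
  \<comment> \<open>Failure at level \<open>n + 1\<close> singles out an index whose term has value
    exactly \<open>n\<close>.\<close>
  then obtain i where i: "i < p" "coef x i \<noteq> 0" "int p * v (coef x i) < n + 1 + int i * e"
    unfolding fil_def by (auto simp: not_le)
  let ?c = "coef x i"
  have ieq: "int p * v ?c = n + int i * e" using n(1) i by (force simp: fil_def)
  let ?m = "\<iota> ?c * \<alpha> ^ i"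
  have rest: "x - ?m \<in> fil v e (n + 1)"
    unfolding fil_def
  proof (intro CollectI allI impI)
    fix j assume j: "j < p"
    show "coef (x - ?m) j = 0 \<or> n + 1 + int j * e \<le> int p * v (coef (x - ?m) j)"
    proof (cases "j = i \<or> coef x j = 0")
      case True
      thus ?thesis using i by (auto simp: coef_simps(2) coef_monomial)
    next
      case False
      hence le: "n + int j * e \<le> int p * v (coef x j)" using n(1) j by (auto simp: fil_def)
      have "n + int j * e \<noteq> int p * v (coef x j)"
      proof
        assume "n + int j * e = int p * v (coef x j)"
        hence "(int j - int i) * e = int p * (v (coef x j) - v ?c)" using ieq by (simp add: algebra_simps)
        hence "int p dvd (int j - int i) * e" by simp
        hence "int p dvd int j - int i"
          using assms(5) prime_p by (metis prime_dvd_mult_eq_int prime_nat_int_transfer)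
        hence "\<bar>int j - int i\<bar> \<ge> int p" using False by (intro zdvd_imp_le) auto
        thus False using i j by linarith
      qed
      thus ?thesis using le False i by (simp add: coef_simps(2) coef_monomial)
    qed
  qed
  \<comment> \<open>The inverse of \<alpha>, read off from
    \<open>\<alpha> * (\<alpha> ^ (p - 1) - 1) = \<iota> D\<close>. Its level is \<open>e\<close>
    because D has value \<open>- e\<close>.\<close>
  define b where "b = \<iota> (inverse D) * (\<alpha> ^ (p - 1) - 1)"
  have ab: "\<alpha> * b = 1"
  proof -
    have "\<alpha> * \<alpha> ^ (p - 1) = \<alpha> ^ p" using p_pos by (metis power_eq_if not_gr_zero)
    hence "\<alpha> * b = \<iota> (inverse D) * (\<alpha> ^ p - \<alpha>)" unfolding b_def by (simp add: algebra_simps)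
    also have "\<dots> = \<iota> (inverse D * D)" unfolding root hom_mult ..
    finally show ?thesis using assms(2) by simp
  qed
  have bfil: "b \<in> fil v e e"
  proof -
    have p1: "int (p - 1) = int p - 1" using p_pos by simp
    have 1: "\<alpha> ^ (p - 1) \<in> fil v e (- (int p * e) + e)"
      using fil_power[OF adm fil_\<alpha>[OF adm], of "p - 1"] p1 by (simp add: algebra_simps)
    have "e * 1 \<le> e * int p" using assms(4) p_pos by (intro mult_left_mono) auto
    hence "1 \<in> fil v e (- (int p * e) + e)" using fil_1[OF adm] by (auto elim!: fil_mono simp: algebra_simps)
    hence "\<alpha> ^ (p - 1) - 1 \<in> fil v e (- (int p * e) + e)" using 1 fil_diff[OF adm] by blast
    from fil_scale[OF adm _ this, of "inverse D"] show ?thesis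
      using assms(2,3) by (simp add: b_def val_inverse[OF assms(1)] algebra_simps)
  qed
  \<comment> \<open>The exact inverse of the dominant term, hence an inverse of \<open>x\<close> up
    to positive level.\<close>
  define y where "y = \<iota> (inverse ?c) * b ^ i"
  have y: "y \<in> fil v e (- n)"
  proof -
    have "- n = int i * e + int p * v (inverse ?c)"
      using i(2) ieq by (simp add: val_inverse[OF assms(1)] algebra_simps)
    thus ?thesis unfolding y_def using fil_scale[OF adm _ fil_power[OF adm bfil, of i], of "inverse ?c"] i(2)
      by simp
  qed
  have "?m * y = \<iota> (?c * inverse ?c) * (\<alpha> * b) ^ i"
    unfolding y_def hom_mult power_mult_distrib by (simp only: mult_ac)
  hence my: "?m * y = 1" using ab i(2) by simp
  have "x * y - 1 = (x - ?m) * y" using my by (simp add: algebra_simps)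
  moreover have "(x - ?m) * y \<in> fil v e 1" using fil_mult[OF adm rest y] by simp
  ultimately show "\<exists>n y. x \<in> fil v e n \<and> y \<in> fil v e (- n) \<and> x * y - 1 \<in> fil v e 1"
    using n(1) y by metis
qed

text \<open>For an inert place the residue extension is the Artin--Schreier extension defined by the residue
  of \<open>D\<close>, and an inverse modulo the prime comes from B\'ezout's identity over the residue field.\<close>

lemma single_place_inert:
  fixes \<kappa> :: "'c::field \<Rightarrow> 'f"
  assumes v: "valuation v" and \<kappa>: "field_hom \<kappa>" "\<And>c. c \<noteq> 0 \<Longrightarrow> v (\<kappa> c) = 0"
    and residue: "\<And>x. val_ge v 0 x \<Longrightarrow> \<exists>c. val_ge v 1 (x - \<kappa> c)"
    and T: "T \<noteq> 0" "v T = 1"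
    and c0: "val_ge v 1 (D - \<kappa> c0)" "\<nexists>x. c0 = x ^ p - x"
  shows "single_place v 0"
  unfolding single_place_def
proof (intro conjI allI impI)
  interpret \<kappa>: field_hom \<kappa> by fact
  have char_c: "CHAR('c) = p" using char_field_hom[OF \<kappa>(1)] char_f by simp
  have "val_ge v 0 (\<kappa> c0)" using \<kappa>(2)[of c0] by (cases "c0 = 0") (auto simp: val_ge_def)
  hence "val_ge v 0 (D - \<kappa> c0 + \<kappa> c0)"
    using c0(1) by (intro val_ge_add[OF v]) (auto elim: val_ge_mono)
  thus adm: "admissible v 0" using v by (simp add: admissible_def)
  have fil0: "x \<in> fil v 0 (int p * s) \<longleftrightarrow> (\<forall>i<p. val_ge v s (coef x i))" for x s
    using p_pos by (simp add: fil_def val_ge_def)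
  have up: "fil v 0 (int p * s + 1) = fil v 0 (int p * (s + 1))" for s
  proof -
    have "int p * s + 1 \<le> int p * t \<longleftrightarrow> int p * (s + 1) \<le> int p * t" for t
    proof -
      have "int p * s + 1 \<le> int p * t \<longleftrightarrow> s < t"
      proof
        assume "int p * s + 1 \<le> int p * t"
        hence "int p * s < int p * t" by linarith
        thus "s < t" using p_pos by simp
      next
        assume "s < t"
        hence "int p * s < int p * t" using p_pos by simp
        thus "int p * s + 1 \<le> int p * t" by linarith
      qed
      moreover have "int p * (s + 1) \<le> int p * t \<longleftrightarrow> s < t" using p_pos by auto
      ultimately show ?thesis by simp
    qed
    thus ?thesis by (simp add: fil_def)
  qed
  fix x :: 'k assume x0: "x \<noteq> 0"
  obtain n where n: "x \<in> fil v 0 n" "x \<notin> fil v 0 (n + 1)" using fil_exhaust[OF x0] by blast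
  then obtain i where i: "i < p" "coef x i \<noteq> 0" "int p * v (coef x i) < n + 1"
    by (auto simp: fil_def not_le)
  moreover have "n \<le> int p * v (coef x i)" using n(1) i(1,2) by (auto simp: fil_def)
  ultimately have ns: "n = int p * v (coef x i)" by simp
  define s where "s = v (coef x i)"
  \<comment> \<open>Dividing by a power of the uniformizer moves \<open>x\<close> to level 0, with
    its i-th coordinate a unit.\<close>
  define x' where "x' = \<iota> (T powi (- s)) * x"
  have Ts: "T powi k \<noteq> 0" "v (T powi k) = k" for k using T by (simp_all add: val_powi[OF v])
  have x': "x' \<in> fil v 0 0"
    using fil_scale[OF adm Ts(1)[of "- s"] n(1)] Ts(2) by (simp add: x'_def ns s_def)
  have xx': "x = \<iota> (T powi s) * x'"
  proof -
    have "\<iota> (T powi s) * x' = \<iota> (T powi s * T powi (- s)) * x" by (simp add: x'_def hom_mult)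
    thus ?thesis using T by (simp add: power_int_minus)
  qed
  have "\<forall>j. \<exists>c. j < p \<longrightarrow> val_ge v 1 (coef x' j - \<kappa> c)"
    using residue x' fil0[of x' 0] by auto
  then obtain r where r: "\<And>j. j < p \<Longrightarrow> val_ge v 1 (coef x' j - \<kappa> (r j))" by metis
  \<comment> \<open>The reduction of \<open>x'\<close> as a polynomial over the residue field; it is
    nonzero because the i-th coordinate survives.\<close>
  define g where "g = (\<Sum>j<p. Polynomial.monom (r j) j)"
  have cg: "coeff g j = (if j < p then r j else 0)" for j
    unfolding g_def coeff_sum by (simp add: if_distrib[where f = "\<lambda>x. coeff x j"] )
  have degg: "degree g < p"
  proof -
    have "degree g \<le> p - 1" by (rule degree_le) (auto simp: cg)
    thus ?thesis using p_pos by linarith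
  qed
  have "g \<noteq> 0"
  proof
    assume "g = 0"
    hence "r i = 0" using cg[of i] i(1) by simp
    hence "val_ge v 1 (coef x' i)" using r[OF i(1)] by simp
    moreover have "coef x' i = T powi (- s) * coef x i" by (simp add: x'_def coef_simps)
    ultimately show False using i(2) Ts val_mult[OF v Ts(1)[of "- s"] i(2)] T(1)
      by (auto simp: val_ge_def s_def)
  qed
  then obtain u w where uw: "u * g + w * artin_schreier_poly p c0 = 1"
    using artin_schreier_poly_bezout[OF prime_p char_c c0(2) _ degg] by blast
  define \<phi> where "\<phi> = (\<lambda>c. \<iota> (\<kappa> c))"
  interpret \<phi>: field_hom \<phi> by (rule field_homI) (simp_all add: \<phi>_def \<kappa>.hom_add \<kappa>.hom_mult hom_add hom_mult)
  let ?E = "poly_ev \<phi> \<alpha>"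
  have E: "?E h \<in> fil v 0 0" for h
    unfolding \<phi>.poly_ev_altdef
  proof (rule fil_sum[OF adm])
    fix j
    have 1: "\<phi> (coeff h j) \<in> fil v 0 0" using \<kappa>(2)[of "coeff h j"]
      by (cases "coeff h j = 0") (auto simp: \<phi>_def fil_\<iota>)
    have 2: "\<alpha> ^ j \<in> fil v 0 0" using fil_power[OF adm fil_\<alpha>[OF adm], of j] by simp
    show "\<phi> (coeff h j) * \<alpha> ^ j \<in> fil v 0 0" using fil_mult[OF adm 1 2] by simp
  qed
  have xg: "x' - ?E g \<in> fil v 0 1"
  proof -
    have "?E g = (\<Sum>j<p. \<iota> (\<kappa> (r j)) * \<alpha> ^ j)"
      unfolding \<phi>.poly_ev_altdef'[OF degg] by (rule sum.cong) (auto simp: cg \<phi>_def)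
    hence "coef (?E g) j = \<kappa> (r j)" if "j < p" for j
      using that by (simp add: coef_sum coef_monomial)
    hence "x' - ?E g \<in> fil v 0 (int p * 1)" unfolding fil0 using r by (simp add: coef_simps)
    thus ?thesis using p_pos by (auto elim: fil_mono)
  qed
  \<comment> \<open>Lifting the identity \<open>uw\<close> to the constants of k and evaluating at
    \<alpha> turns the residual Artin-Schreier polynomial into
    \<open>\<iota> (D - \<kappa> c0)\<close>, which has positive level. So \<open>?E u\<close>
    inverts \<open>?E g\<close> up to such terms.\<close>
  have "?E u * ?E g + ?E w * (\<alpha> ^ p - \<alpha> - \<phi> c0) = ?E (u * g + w * artin_schreier_poly p c0)"
    by (simp only: \<phi>.poly_ev_simps \<phi>.poly_ev_artin_schreier_poly)
  hence "?E u * ?E g + ?E w * (\<iota> D - \<phi> c0) = 1"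
    unfolding uw root by (simp only: \<phi>.poly_ev_simps)
  moreover have "\<iota> D - \<phi> c0 = \<iota> (D - \<kappa> c0)" by (simp add: hom_minus \<phi>_def)
  ultimately have "?E u * ?E g + ?E w * \<iota> (D - \<kappa> c0) = 1" by simp
  moreover have "a - 1 = - b" if "a + b = 1" for a b :: 'k unfolding that[symmetric] by simp
  ultimately have bez: "?E u * ?E g - 1 = - (?E w * \<iota> (D - \<kappa> c0))" by blast
  have Dc: "\<iota> (D - \<kappa> c0) \<in> fil v 0 1"
  proof -
    have "1 \<le> int p * t" if "1 \<le> t" for t using that p_pos by (simp add: int_one_le_iff_zero_less)
    thus ?thesis using c0(1) by (auto simp: fil_\<iota> val_ge_def)
  qed
  have "?E u * ?E g - 1 \<in> fil v 0 1"
    unfolding bez using fil_mult[OF adm E[of w] Dc] fil_uminus[OF adm] by simp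
  moreover have "(x' - ?E g) * ?E u \<in> fil v 0 1" using fil_mult[OF adm xg E[of u]] by simp
  ultimately have "(x' - ?E g) * ?E u + (?E u * ?E g - 1) \<in> fil v 0 1" using fil_add[OF adm] by blast
  hence xu: "x' * ?E u - 1 \<in> fil v 0 1" by (simp add: algebra_simps)
  define y where "y = \<iota> (T powi (- s)) * ?E u"
  have "y \<in> fil v 0 (- n)"
    using fil_scale[OF adm Ts(1)[of "- s"] E[of u]] Ts(2) by (simp add: y_def ns s_def)
  moreover have "x * y = x' * ?E u"
  proof -
    have "x * y = \<iota> (T powi s * T powi (- s)) * (x' * ?E u)" by (simp add: y_def xx' hom_mult)
    thus ?thesis using T by (simp add: power_int_minus)
  qed
  ultimately show "\<exists>n y. x \<in> fil v 0 n \<and> y \<in> fil v 0 (- n) \<and> x * y - 1 \<in> fil v 0 1"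
    using n(1) xu by metis
qed

end

section \<open>Valuations of the rational function field\<close>

definition monic_irreducible :: "'a::field poly \<Rightarrow> bool" where
  "monic_irreducible \<pi> \<longleftrightarrow> irreducible \<pi> \<and> lead_coeff \<pi> = 1"

lemma monic_irreducible_prime_elem: "monic_irreducible \<pi> \<Longrightarrow> prime_elem \<pi>"
  unfolding monic_irreducible_def using field_poly_irreducible_imp_prime by blast

lemma degree_monic_irreducible:
  assumes "monic_irreducible \<pi>"
  shows "degree \<pi> > 0"
proof (rule ccontr)
  assume "\<not> ?thesis"
  moreover have "\<pi> \<noteq> 0" using assms by (auto simp: monic_irreducible_def)
  ultimately have "is_unit \<pi>" by (simp add: is_unit_iff_degree)
  thus False using assms by (auto simp: monic_irreducible_def Factorial_Ring.irreducible_def)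
qed

lemma monic_irreducible_dvd:
  assumes "monic_irreducible \<pi>" "monic_irreducible \<rho>" "\<pi> dvd \<rho>"
  shows "\<pi> = \<rho>"
proof -
  from assms(3) obtain k where k: "\<rho> = \<pi> * k" by (elim dvdE)
  have "\<not> is_unit \<pi>" using degree_monic_irreducible[OF assms(1)] by (auto simp: poly_dvd_1)
  hence "is_unit k" using assms(2) Factorial_Ring.irreducibleD[of \<rho>, OF _ k] by (auto simp: monic_irreducible_def)
  hence dk: "degree k = 0" by (simp add: poly_dvd_1)
  have nz: "\<rho> \<noteq> 0" using assms(2) by (auto simp: monic_irreducible_def)
  hence "degree \<rho> = degree \<pi>" using k dk by (auto simp: degree_mult_eq)
  thus ?thesis using assms nz by (intro dvd_monic_eq) (auto simp: monic_irreducible_def)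
qed

lemma monic_irreducible_factor:
  fixes a :: "'a::field poly"
  assumes "degree a > 0"
  obtains \<pi> where "monic_irreducible \<pi>" "\<pi> dvd a"
proof -
  let ?P = "\<lambda>d. d dvd a \<and> 0 < degree d"
  define d where "d = (ARG_MIN degree x. ?P x)"
  have d: "?P d" unfolding d_def by (rule arg_min_natI[of _ a]) (use assms in auto)
  have min: "degree d \<le> degree x" if "?P x" for x
    unfolding d_def using arg_min_nat_le[of ?P x degree] that by auto
  have d0: "d \<noteq> 0" using d by auto
  define \<pi> where "\<pi> = Polynomial.smult (inverse (lead_coeff d)) d"
  have deg: "degree \<pi> = degree d" and lc: "lead_coeff \<pi> = 1" using d0 by (auto simp: \<pi>_def)
  have dv: "\<pi> dvd a" using d d0 by (simp add: \<pi>_def smult_dvd_iff)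
  have "irreducible \<pi>"
  proof (rule Factorial_Ring.irreducibleI)
    show "\<pi> \<noteq> 0" using lc by auto
    show "\<not> is_unit \<pi>" using deg d by (auto simp: poly_dvd_1)
    fix x y assume xy: "\<pi> = x * y"
    hence nz: "x \<noteq> 0" "y \<noteq> 0" using lc by auto
    hence sum: "degree x + degree y = degree d" using xy deg by (simp add: degree_mult_eq)
    have "x dvd a" "y dvd a" using xy dv by (auto dest: dvd_mult_left dvd_mult_right)
    hence "degree x = 0 \<or> degree x \<ge> degree d" "degree y = 0 \<or> degree y \<ge> degree d"
      using min[of x] min[of y] by auto
    hence "degree x = 0 \<or> degree y = 0" using sum by linarith
    thus "is_unit x \<or> is_unit y" using nz by (auto simp: is_unit_iff_degree)
  qed
  thus ?thesis using that[of \<pi>] lc dv by (simp add: monic_irreducible_def)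
qed

section \<open>Multiplicities and the valuations of k\<close>

definition pmult :: "'a::field poly \<Rightarrow> 'a poly \<Rightarrow> nat" where
  "pmult \<pi> a = (THE n. \<exists>b. a = \<pi> ^ n * b \<and> \<not> \<pi> dvd b)"

lemma pmult_exists:
  assumes "degree \<pi> > 0" "(a :: 'a::field poly) \<noteq> 0"
  shows "\<exists>n b. a = \<pi> ^ n * b \<and> \<not> \<pi> dvd b"
  using assms(2)
proof (induction "degree a" arbitrary: a rule: less_induct)
  case less
  show ?case
  proof (cases "\<pi> dvd a")
    case True
    then obtain c where c: "a = \<pi> * c" by (elim dvdE)
    hence "c \<noteq> 0" "\<pi> \<noteq> 0" using less.prems by auto
    hence "degree c < degree a" using c assms(1) by (simp add: degree_mult_eq)
    then obtain n b where "c = \<pi> ^ n * b" "\<not> \<pi> dvd b" using less.hyps \<open>c \<noteq> 0\<close> by blast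
    hence "a = \<pi> ^ Suc n * b \<and> \<not> \<pi> dvd b" using c by (simp add: mult_ac)
    thus ?thesis by blast
  next
    case False
    hence "a = \<pi> ^ 0 * a \<and> \<not> \<pi> dvd a" by simp
    thus ?thesis by blast
  qed
qed

lemma pmult_eqI:
  assumes "degree \<pi> > 0" "\<not> \<pi> dvd b"
  shows "pmult \<pi> (\<pi> ^ n * b) = n"
  unfolding pmult_def
proof (rule the_equality)
  fix k assume "\<exists>c. \<pi> ^ n * b = \<pi> ^ k * c \<and> \<not> \<pi> dvd c"
  then obtain c where c: "\<pi> ^ n * b = \<pi> ^ k * c" "\<not> \<pi> dvd c" by blast
  have p0: "\<pi> \<noteq> 0" using assms by auto
  have *: "i \<le> j" if "\<pi> ^ i * x = \<pi> ^ j * y" "\<not> \<pi> dvd y" for i j x y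
  proof (rule ccontr)
    assume "\<not> i \<le> j"
    then obtain d where d: "i = j + Suc d" by (metis add_Suc_right less_imp_Suc_add not_le)
    hence "\<pi> ^ j * (\<pi> ^ Suc d * x) = \<pi> ^ j * y" using that(1) by (simp only: power_add mult.assoc)
    hence "\<pi> ^ Suc d * x = y" using p0 by simp
    hence "y = \<pi> * (\<pi> ^ d * x)" by (simp add: mult_ac)
    thus False using that(2) by simp
  qed
  show "k = n" using *[OF c] *[OF c(1)[symmetric] assms(2)] by simp
qed (use assms in auto)

lemma pmult_decompose:
  assumes "degree \<pi> > 0" "a \<noteq> 0"
  obtains b where "a = \<pi> ^ pmult \<pi> a * b" "\<not> \<pi> dvd b"
  using pmult_exists[OF assms] pmult_eqI[OF assms(1)] by metis

lemma pmult_mult: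
  assumes "monic_irreducible \<pi>" "a \<noteq> 0" "b \<noteq> 0"
  shows "pmult \<pi> (a * b) = pmult \<pi> a + pmult \<pi> b"
proof -
  have d: "degree \<pi> > 0" using degree_monic_irreducible[OF assms(1)] .
  obtain a' where a: "a = \<pi> ^ pmult \<pi> a * a'" "\<not> \<pi> dvd a'" using pmult_decompose[OF d assms(2)] .
  obtain b' where b: "b = \<pi> ^ pmult \<pi> b * b'" "\<not> \<pi> dvd b'" using pmult_decompose[OF d assms(3)] .
  have "a * b = (\<pi> ^ pmult \<pi> a * a') * (\<pi> ^ pmult \<pi> b * b')" using a b by metis
  also have "\<dots> = \<pi> ^ (pmult \<pi> a + pmult \<pi> b) * (a' * b')" by (simp add: power_add mult_ac)
  finally have ab: "a * b = \<pi> ^ (pmult \<pi> a + pmult \<pi> b) * (a' * b')" .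
  have "\<not> \<pi> dvd a' * b'"
    using a b monic_irreducible_prime_elem[OF assms(1)] prime_elem_dvd_multD by blast
  from pmult_eqI[OF d this] show ?thesis unfolding ab .
qed

lemma pmult_add:
  assumes "monic_irreducible \<pi>" "a \<noteq> 0" "b \<noteq> 0" "a + b \<noteq> 0"
  shows "min (pmult \<pi> a) (pmult \<pi> b) \<le> pmult \<pi> (a + b)"
proof -
  have d: "degree \<pi> > 0" using degree_monic_irreducible[OF assms(1)] .
  obtain a' where a: "a = \<pi> ^ pmult \<pi> a * a'" using pmult_decompose[OF d assms(2)] .
  obtain b' where b: "b = \<pi> ^ pmult \<pi> b * b'" using pmult_decompose[OF d assms(3)] .
  let ?m = "min (pmult \<pi> a) (pmult \<pi> b)"
  have "\<pi> ^ ?m dvd \<pi> ^ pmult \<pi> a * a'" "\<pi> ^ ?m dvd \<pi> ^ pmult \<pi> b * b'"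
    by (intro dvd_mult2 le_imp_power_dvd; simp)+
  hence "\<pi> ^ ?m dvd a + b" using a b by (metis dvd_add)
  then obtain c where c: "a + b = \<pi> ^ ?m * c" by (elim dvdE)
  have "c \<noteq> 0" using assms(4) c by auto
  then obtain c' where c': "c = \<pi> ^ pmult \<pi> c * c'" "\<not> \<pi> dvd c'" using pmult_decompose[OF d] by blast
  have "a + b = \<pi> ^ ?m * (\<pi> ^ pmult \<pi> c * c')" using c c' by metis
  also have "\<dots> = \<pi> ^ (?m + pmult \<pi> c) * c'" by (simp add: power_add mult_ac)
  finally show ?thesis using pmult_eqI[OF d c'(2)] by (metis le_add1)
qed

lemma pmult_pos_iff:
  assumes "degree \<pi> > 0" "a \<noteq> 0"
  shows "pmult \<pi> a > 0 \<longleftrightarrow> \<pi> dvd a"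
proof -
  obtain b where b: "a = \<pi> ^ pmult \<pi> a * b" "\<not> \<pi> dvd b" using pmult_decompose[OF assms] .
  show ?thesis
  proof
    assume "pmult \<pi> a > 0"
    hence "\<pi> dvd \<pi> ^ pmult \<pi> a * b" by (intro dvd_mult2) (simp add: dvd_power)
    thus "\<pi> dvd a" using b by simp
  next
    assume "\<pi> dvd a"
    thus "pmult \<pi> a > 0" using b by (cases "pmult \<pi> a = 0") auto
  qed
qed

lemma fract_cases:
  fixes x :: "'a::idom fract"
  obtains a b where "b \<noteq> 0" "x = to_fract a / to_fract b"
  by (cases x) (auto simp: Fract_conv_to_fract)

definition fract_val :: "('r::idom \<Rightarrow> int) \<Rightarrow> 'r fract \<Rightarrow> int" where
  "fract_val w x = (let (a, b) = (SOME (a, b). b \<noteq> 0 \<and> x = to_fract a / to_fract b) in w a - w b)"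

text \<open>Any two representations of a fraction agree after cross-multiplication, so the choice
  made by \<open>SOME\<close> does not matter for a multiplicative \<open>w\<close>.\<close>

lemma fract_val_eq:
  assumes "\<And>a b. a \<noteq> 0 \<Longrightarrow> b \<noteq> 0 \<Longrightarrow> w (a * b) = w a + w b" "a \<noteq> 0" "b \<noteq> 0"
  shows "fract_val w (to_fract a / to_fract b) = w a - w b"
proof -
  define ab where "ab = (SOME (c, d). d \<noteq> 0 \<and> to_fract a / to_fract b = to_fract c / to_fract d)"
  have "case ab of (c, d) \<Rightarrow> d \<noteq> 0 \<and> to_fract a / to_fract b = to_fract c / to_fract d"
    unfolding ab_def by (rule someI[of _ "(a, b)"]) (use assms in auto)
  then obtain c d where cd: "ab = (c, d)" "d \<noteq> 0" "to_fract a / to_fract b = to_fract c / to_fract d"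
    by (cases ab) auto
  hence "to_fract (a * d) = to_fract (c * b)" using assms by (simp add: field_simps)
  hence eq: "a * d = c * b" by (simp only: to_fract_eq_iff)
  moreover from this have "c \<noteq> 0" using assms cd by auto
  ultimately have "w a + w d = w c + w b" using assms cd by metis
  moreover have "fract_val w (to_fract a / to_fract b) = (case ab of (c, d) \<Rightarrow> w c - w d)"
    by (simp only: fract_val_def ab_def Let_def)
  ultimately show ?thesis by (simp add: cd(1))
qed

lemma valuation_fract_val:
  assumes w: "\<And>a b. a \<noteq> 0 \<Longrightarrow> b \<noteq> 0 \<Longrightarrow> w (a * b) = w a + w b"
    and min: "\<And>a b. a \<noteq> 0 \<Longrightarrow> b \<noteq> 0 \<Longrightarrow> a + b \<noteq> 0 \<Longrightarrow> min (w a) (w b) \<le> w (a + b)"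
  shows "valuation (fract_val w)"
  unfolding valuation_def
proof (intro conjI allI impI)
  fix x y :: "'a fract" assume nz: "x \<noteq> 0" "y \<noteq> 0"
  obtain a b where ab: "b \<noteq> 0" "x = to_fract a / to_fract b" by (rule fract_cases)
  obtain c d where cd: "d \<noteq> 0" "y = to_fract c / to_fract d" by (rule fract_cases)
  have ac: "a \<noteq> 0" "c \<noteq> 0" using nz ab cd by auto
  have vx: "fract_val w x = w a - w b" "fract_val w y = w c - w d"
    using fract_val_eq[of w, OF w] ab cd ac by auto
  have "x * y = to_fract (a * c) / to_fract (b * d)" using ab cd by simp
  thus "fract_val w (x * y) = fract_val w x + fract_val w y"
    using fract_val_eq[of w, OF w, of "a * c" "b * d"] vx ab cd ac w by simp
  assume s: "x + y \<noteq> 0"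
  have xy: "x + y = to_fract (a * d + c * b) / to_fract (b * d)" using ab cd by (simp add: field_simps)
  hence nz': "a * d + c * b \<noteq> 0" using s by (metis div_0 to_fract_0)
  have "min (w (a * d)) (w (c * b)) \<le> w (a * d + c * b)" using min nz' ab cd ac by auto
  thus "min (fract_val w x) (fract_val w y) \<le> fract_val w (x + y)"
    unfolding xy vx using fract_val_eq[of w, OF w, of "a * d + c * b" "b * d"] nz' ab cd ac w by simp
qed

definition pval :: "'a::field poly \<Rightarrow> 'a poly fract \<Rightarrow> int" where
  "pval \<pi> = fract_val (\<lambda>a. int (pmult \<pi> a))"

text \<open>The valuation at the place 1/t.\<close>

definition infval :: "'a::field poly fract \<Rightarrow> int" where
  "infval = fract_val (\<lambda>a. - int (degree a))"

lemma pval_fract: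
  assumes "monic_irreducible \<pi>" "a \<noteq> 0" "b \<noteq> 0"
  shows "pval \<pi> (to_fract a / to_fract b) = int (pmult \<pi> a) - int (pmult \<pi> b)"
  unfolding pval_def using assms by (intro fract_val_eq) (auto simp: pmult_mult)

lemma pmult_1: "monic_irreducible \<pi> \<Longrightarrow> pmult \<pi> 1 = 0"
  using pmult_mult[of \<pi> 1 1] by simp

lemma pval_to_fract: "monic_irreducible \<pi> \<Longrightarrow> a \<noteq> 0 \<Longrightarrow> pval \<pi> (to_fract a) = int (pmult \<pi> a)"
  using pval_fract[of \<pi> a 1] by (simp add: pmult_1)

lemma valuation_pval:
  assumes "monic_irreducible \<pi>"
  shows "valuation (pval \<pi>)"
  unfolding pval_def
proof (rule valuation_fract_val)
  fix a b :: "'a poly" assume nz: "a \<noteq> 0" "b \<noteq> 0"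
  show "int (pmult \<pi> (a * b)) = int (pmult \<pi> a) + int (pmult \<pi> b)"
    using pmult_mult[OF assms nz] by simp
  assume "a + b \<noteq> 0"
  from pmult_add[OF assms nz this] show "min (int (pmult \<pi> a)) (int (pmult \<pi> b)) \<le> int (pmult \<pi> (a + b))"
    by linarith
qed

lemma infval_fract: "a \<noteq> 0 \<Longrightarrow> b \<noteq> 0 \<Longrightarrow> infval (to_fract a / to_fract b) = int (degree b) - int (degree a)"
  unfolding infval_def by (subst fract_val_eq) (auto simp: degree_mult_eq)

lemma infval_to_fract: "a \<noteq> 0 \<Longrightarrow> infval (to_fract a) = - int (degree a)"
  using infval_fract[of a 1] by simp

lemma valuation_infval: "valuation infval"
  unfolding infval_def
proof (rule valuation_fract_val)
  fix a b :: "'a poly" assume "a \<noteq> 0" "b \<noteq> 0" "a + b \<noteq> 0"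
  have "degree (a + b) \<le> max (degree a) (degree b)" by (rule degree_add_le_max)
  thus "min (- int (degree a)) (- int (degree b)) \<le> - int (degree (a + b))" by (auto simp: max_def min_def split: if_splits)
qed (auto simp: degree_mult_eq)

lemma pmult_self: "monic_irreducible \<pi> \<Longrightarrow> pmult \<pi> \<pi> = 1"
proof -
  assume a: "monic_irreducible \<pi>"
  have d: "degree \<pi> > 0" using degree_monic_irreducible[OF a] .
  hence "\<not> \<pi> dvd 1" by (auto simp: poly_dvd_1)
  from pmult_eqI[OF d this, of 1] show ?thesis by simp
qed

lemma monic_irreducible_nz: "monic_irreducible \<pi> \<Longrightarrow> \<pi> \<noteq> 0"
  by (auto simp: monic_irreducible_def)

lemma pval_self: "monic_irreducible \<pi> \<Longrightarrow> pval \<pi> (to_fract \<pi>) = 1"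
  by (simp add: pval_to_fract pmult_self monic_irreducible_nz)

lemma pmult_not_dvd: "monic_irreducible \<pi> \<Longrightarrow> \<not> \<pi> dvd a \<Longrightarrow> pmult \<pi> a = 0"
  using pmult_eqI[of \<pi> a 0] degree_monic_irreducible[of \<pi>] by simp

lemma pval_not_dvd: "monic_irreducible \<pi> \<Longrightarrow> \<not> \<pi> dvd a \<Longrightarrow> pval \<pi> (to_fract a) = 0"
  by (cases "a = 0") (auto simp: pval_to_fract pmult_not_dvd)

lemma pval_other: "monic_irreducible \<pi> \<Longrightarrow> monic_irreducible \<rho> \<Longrightarrow> \<pi> \<noteq> \<rho> \<Longrightarrow> pval \<pi> (to_fract \<rho>) = 0"
  using monic_irreducible_dvd pval_not_dvd by blast

text \<open>In a representation with denominator of least degree, a prime factor of the denominator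
  would also divide the numerator and could be cancelled.\<close>

lemma pval_ge_0_imp_poly:
  fixes c :: "'a::field poly fract"
  assumes "\<And>\<pi>. monic_irreducible \<pi> \<Longrightarrow> val_ge (pval \<pi>) 0 c"
  shows "c \<in> range to_fract"
proof (cases "c = 0")
  case False
  let ?P = "\<lambda>b. b \<noteq> 0 \<and> (\<exists>a. c = to_fract a / to_fract b)"
  obtain a0 b0 where "b0 \<noteq> 0" "c = to_fract a0 / to_fract b0" by (rule fract_cases)
  hence ex: "?P b0" by blast
  define b where "b = (ARG_MIN degree x. ?P x)"
  have b: "?P b" unfolding b_def by (rule arg_min_natI[of _ b0]) (use ex in auto)
  have min: "degree b \<le> degree x" if "?P x" for x
    unfolding b_def using arg_min_nat_le[of ?P x degree] that by auto
  from b obtain a where a: "c = to_fract a / to_fract b" and b0: "b \<noteq> 0" by blast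
  have a0: "a \<noteq> 0" using a False by auto
  have "degree b = 0"
  proof (rule ccontr)
    assume "degree b \<noteq> 0"
    then obtain \<pi> where \<pi>: "monic_irreducible \<pi>" "\<pi> dvd b" using monic_irreducible_factor[of b] by auto
    have d: "degree \<pi> > 0" using degree_monic_irreducible[OF \<pi>(1)] .
    have "0 \<le> pval \<pi> c" using assms[OF \<pi>(1)] False by (simp add: val_ge_def)
    hence "pmult \<pi> b \<le> pmult \<pi> a" unfolding a using pval_fract[OF \<pi>(1) a0 b0] by simp
    hence "\<pi> dvd a" using \<pi>(2) pmult_pos_iff[OF d a0] pmult_pos_iff[OF d b0] by linarith
    then obtain a' where a': "a = \<pi> * a'" by (elim dvdE)
    from \<pi>(2) obtain b' where b': "b = \<pi> * b'" by (elim dvdE)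
    have nz: "\<pi> \<noteq> 0" "b' \<noteq> 0" using b' b0 by auto
    hence "c = to_fract a' / to_fract b'" unfolding a a' b' by simp
    hence "degree b \<le> degree b'" using min nz by blast
    thus False using b' nz d by (simp add: degree_mult_eq)
  qed
  then obtain u where u: "b = [:u:]" using degree_eq_zeroE by blast
  hence "u \<noteq> 0" using b0 by auto
  hence "[:inverse u:] * b = 1" using u by simp
  hence inv: "to_fract ([:inverse u:]) * to_fract b = 1" by (metis to_fract_1 to_fract_mult)
  have "c = (to_fract [:inverse u:] * to_fract b) * (to_fract a / to_fract b)" unfolding inv a by simp
  also have "\<dots> = to_fract [:inverse u:] * to_fract a" using b0 by simp
  finally have "c = to_fract ([:inverse u:] * a)" by (simp only: to_fract_mult)
  thus ?thesis by blast
qed (metis rangeI to_fract_0)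

lemma val_ge_pval_to_fract: "monic_irreducible \<pi> \<Longrightarrow> val_ge (pval \<pi>) 0 (to_fract a)"
  by (cases "a = 0") (auto simp: val_ge_def pval_to_fract)

lemma field_hom_const: "field_hom (\<lambda>c :: 'a::field. to_fract [:c:])"
proof (rule field_homI)
  fix x y :: 'a
  have "[:x + y:] = [:x:] + [:y:]" "[:x * y:] = [:x:] * [:y:]" by simp_all
  thus "to_fract [:x + y:] = to_fract [:x:] + to_fract [:y:]"
    "to_fract [:x * y:] = to_fract [:x:] * to_fract [:y:]" by (simp_all only: to_fract_add to_fract_mult)
qed (simp add: one_pCons[symmetric])

section \<open>The ring of integers and the ideals of ramified primes\<close>

text \<open>The exponent \<open>ee\<close> is the pole order of D at the primes in
  \<open>ram\<close> and 0 elsewhere, so one formula for the filtration covers all finite primes.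
  Nothing is fixed about infinity: the real and imaginary cases enter later through
  \<open>infval\<close>.\<close>

locale artin_schreier_function_field = artin_schreier \<iota> p D \<alpha>
  for \<iota> :: "'a::finite_field poly fract \<Rightarrow> 'k::field" and p D \<alpha> +
  fixes ram :: "'a poly set" and ee :: "'a poly \<Rightarrow> int"
  assumes finite_ram: "finite ram"
    and ram_irr: "\<And>\<pi>. \<pi> \<in> ram \<Longrightarrow> monic_irreducible \<pi>"
    and unram: "\<And>\<pi>. monic_irreducible \<pi> \<Longrightarrow> \<pi> \<notin> ram \<Longrightarrow> ee \<pi> = 0 \<and> val_ge (pval \<pi>) 0 D"
    and ram_ee: "\<And>\<pi>. \<pi> \<in> ram \<Longrightarrow> pval \<pi> D = - ee \<pi> \<and> 0 < ee \<pi> \<and> \<not> int p dvd ee \<pi>"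
    and const_closed: "algebraically_closed_in (\<lambda>c. \<iota> (to_fract [:c:]))"
begin

abbreviation F :: "'a poly \<Rightarrow> int \<Rightarrow> 'k set" where "F \<pi> \<equiv> fil (pval \<pi>) (ee \<pi>)"
abbreviation \<kappa> :: "'a poly \<Rightarrow> 'k" where "\<kappa> a \<equiv> \<iota> (to_fract a)"

lemma D_nz: "D \<noteq> 0"
  using not_trivial p_pos by (metis diff_self power_0_left less_numeral_extra(3) zero_less_iff_neq_zero)

lemma single_ram: "\<pi> \<in> ram \<Longrightarrow> single_place (pval \<pi>) (ee \<pi>)"
  using single_place_ramified[OF valuation_pval[OF ram_irr] D_nz] ram_ee by blast

lemma adm: "monic_irreducible \<pi> \<Longrightarrow> admissible (pval \<pi>) (ee \<pi>)"
  using single_ram[of \<pi>] unram[of \<pi>] valuation_pval[of \<pi>]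
  by (cases "\<pi> \<in> ram") (auto simp: admissible_def single_place_def)

text \<open>For \<open>n\<close> supported on \<open>ram\<close> this is the product of the powers
  with exponents \<open>n \<pi>\<close> of the primes above the ramified \<pi>, given by local
  conditions. The abbreviation \<open>O\<^sub>K\<close> is justified by
  \<open>ring_of_integers_eq\<close>.\<close>

definition J :: "('a poly \<Rightarrow> int) \<Rightarrow> 'k set" where
  "J n = {x. \<forall>\<pi>. monic_irreducible \<pi> \<longrightarrow> x \<in> F \<pi> (n \<pi>)}"

abbreviation O\<^sub>K :: "'k set" where "O\<^sub>K \<equiv> J (\<lambda>_. 0)"

lemma J_0 [simp]: "0 \<in> J n" by (simp add: J_def)
lemma J_add: "x \<in> J n \<Longrightarrow> y \<in> J n \<Longrightarrow> x + y \<in> J n" using fil_add[OF adm] by (auto simp: J_def)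
lemma J_diff: "x \<in> J n \<Longrightarrow> y \<in> J n \<Longrightarrow> x - y \<in> J n" using fil_diff[OF adm] by (auto simp: J_def)
lemma J_\<sigma>: "x \<in> J n \<Longrightarrow> \<sigma> x \<in> J n" using fil_\<sigma>[OF adm] by (auto simp: J_def)
lemma J_\<sigma>_pow: "x \<in> J n \<Longrightarrow> (\<sigma> ^^ j) x \<in> J n" by (induction j) (auto intro: J_\<sigma>)
lemma J_mult: "x \<in> J n \<Longrightarrow> y \<in> J n' \<Longrightarrow> x * y \<in> J (\<lambda>\<pi>. n \<pi> + n' \<pi>)"
  using fil_mult[OF adm] by (auto simp: J_def)
lemma J_O_mult: "x \<in> O\<^sub>K \<Longrightarrow> y \<in> J n \<Longrightarrow> x * y \<in> J n" using J_mult[of x "\<lambda>_. 0" y n] by simp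
lemma O_1: "1 \<in> O\<^sub>K" using fil_1[OF adm] by (auto simp: J_def)
lemma O_power: "x \<in> O\<^sub>K \<Longrightarrow> x ^ n \<in> O\<^sub>K" by (induction n) (auto simp: O_1 J_O_mult)
lemma O_prod: "(\<And>i. i \<in> A \<Longrightarrow> f i \<in> O\<^sub>K) \<Longrightarrow> prod f A \<in> O\<^sub>K"
  by (induction A rule: infinite_finite_induct) (auto simp: O_1 J_O_mult)

lemma F_\<kappa>: "monic_irreducible \<pi> \<Longrightarrow> \<kappa> a \<in> F \<pi> 0"
  by (cases "a = 0") (auto simp: fil_\<iota> pval_to_fract)

lemma O_\<kappa>: "\<kappa> a \<in> O\<^sub>K" using F_\<kappa> by (auto simp: J_def)

lemma O_\<iota>:
  assumes "\<iota> c \<in> O\<^sub>K"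
  shows "c \<in> range to_fract"
proof (rule pval_ge_0_imp_poly)
  fix \<pi> :: "'a poly" assume "monic_irreducible \<pi>"
  hence "\<iota> c \<in> F \<pi> 0" using assms by (auto simp: J_def)
  thus "val_ge (pval \<pi>) 0 c" using p_pos by (auto simp: fil_\<iota> val_ge_def zero_le_mult_iff)
qed

lemma J_scale:
  assumes "g \<noteq> 0"
  shows "\<iota> g * x \<in> J (\<lambda>\<pi>. n \<pi> + int p * pval \<pi> g) \<longleftrightarrow> x \<in> J n"
  using fil_scale_iff[OF adm assms] by (auto simp: J_def)

text \<open>A common denominator for \<alpha>: the level of \<alpha> at a ramified \<pi> is
  \<open>- ee \<pi>\<close>, while the chosen power of \<pi> has level
  \<open>p * ee \<pi>\<close>.\<close>

definition B :: "'a poly" where "B = (\<Prod>\<pi>\<in>ram. \<pi> ^ nat (ee \<pi>))"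

lemma ram_prod:
  fixes N :: "'a poly \<Rightarrow> nat"
  defines "b \<equiv> \<Prod>\<pi>\<in>ram. \<pi> ^ N \<pi>"
  shows "b \<noteq> 0" and "\<pi> \<in> ram \<Longrightarrow> pval \<pi> (to_fract b) = int (N \<pi>)"
    and "monic_irreducible \<pi> \<Longrightarrow> \<pi> \<notin> ram \<Longrightarrow> pval \<pi> (to_fract b) = 0"
proof -
  have nz: "\<rho> \<noteq> 0" if "\<rho> \<in> ram" for \<rho> using ram_irr[OF that] monic_irreducible_nz by blast
  show b0: "b \<noteq> 0" using nz finite_ram by (auto simp: b_def)
  have v: "pval \<pi> (to_fract b) = (\<Sum>\<rho>\<in>ram. int (N \<rho>) * pval \<pi> (to_fract \<rho>))" if "monic_irreducible \<pi>" for \<pi>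
  proof -
    have "to_fract b = (\<Prod>\<rho>\<in>ram. to_fract \<rho> ^ N \<rho>)"
    proof -
      have pw: "to_fract (x ^ k) = to_fract x ^ k" for x :: "'a poly" and k by (induction k) auto
      have "to_fract (prod g A) = (\<Prod>i\<in>A. to_fract (g i))" for g :: "'a poly \<Rightarrow> 'a poly" and A
        by (induction A rule: infinite_finite_induct) auto
      thus ?thesis by (simp add: b_def pw)
    qed
    thus ?thesis using nz by (simp add: val_prod[OF valuation_pval[OF that]] val_power[OF valuation_pval[OF that]])
  qed
  show "pval \<pi> (to_fract b) = int (N \<pi>)" if "\<pi> \<in> ram"
  proof -
    have "(\<Sum>\<rho>\<in>ram. int (N \<rho>) * pval \<pi> (to_fract \<rho>)) = (\<Sum>\<rho>\<in>ram. if \<rho> = \<pi> then int (N \<pi>) else 0)"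
      using ram_irr that by (intro sum.cong) (auto simp: pval_self pval_other)
    thus ?thesis using v[OF ram_irr[OF that]] that finite_ram by simp
  qed
  show "pval \<pi> (to_fract b) = 0" if "monic_irreducible \<pi>" "\<pi> \<notin> ram"
    unfolding v[OF that(1)]
  proof (intro sum.neutral ballI)
    fix \<rho> assume "\<rho> \<in> ram"
    hence "pval \<pi> (to_fract \<rho>) = 0" using pval_other[OF that(1) ram_irr] that by metis
    thus "int (N \<rho>) * pval \<pi> (to_fract \<rho>) = 0" by simp
  qed
qed

lemma B_nz: "B \<noteq> 0" unfolding B_def by (rule ram_prod)

lemma B_\<alpha>: "\<kappa> B * \<alpha> \<in> O\<^sub>K"
  unfolding J_def
proof (intro CollectI allI impI)
  fix \<pi> :: "'a poly" assume \<pi>: "monic_irreducible \<pi>"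
  have "0 + int 1 * ee \<pi> \<le> int p * pval \<pi> (to_fract B)"
  proof (cases "\<pi> \<in> ram")
    case True
    have "pval \<pi> (to_fract B) = ee \<pi>" using ram_prod(2)[OF True, of "\<lambda>\<pi>. nat (ee \<pi>)"] ram_ee[OF True] by (simp add: B_def)
    moreover have "1 * ee \<pi> \<le> int p * ee \<pi>" using ram_ee[OF True] p_pos by (intro mult_right_mono) auto
    ultimately show ?thesis by simp
  qed (use unram[OF \<pi>] B_nz \<pi> in \<open>auto simp: pval_to_fract\<close>)
  thus "\<kappa> B * \<alpha> \<in> F \<pi> 0" using fil_monomial[OF p_gt_1, of "to_fract B" "pval \<pi>" "ee \<pi>" 0] by simp
qed

lemma \<kappa>_mult: "\<kappa> (a * b) = \<kappa> a * \<kappa> b" by (simp add: hom_mult)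
lemma \<kappa>_0_iff [simp]: "\<kappa> a = 0 \<longleftrightarrow> a = 0" by simp
lemma \<kappa>_1 [simp]: "\<kappa> 1 = 1" by simp
lemma \<kappa>_power: "\<kappa> (a ^ n) = \<kappa> a ^ n" by (induction n) (simp_all add: hom_mult)

text \<open>The elements with a polynomial denominator form a ring containing k and \<alpha>, hence
  all of K.\<close>

lemma denominator: "\<exists>b. b \<noteq> 0 \<and> \<kappa> b * z \<in> O\<^sub>K"
proof -
  define Z where "Z = {z. \<exists>b. b \<noteq> 0 \<and> \<kappa> b * z \<in> O\<^sub>K}"
  have add: "x + y \<in> Z" if xy: "x \<in> Z" "y \<in> Z" for x y
  proof -
    obtain a b where ab: "a \<noteq> 0" "\<kappa> a * x \<in> O\<^sub>K" "b \<noteq> 0" "\<kappa> b * y \<in> O\<^sub>K" using xy by (auto simp: Z_def)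
    moreover have "\<kappa> b * (\<kappa> a * x) + \<kappa> a * (\<kappa> b * y) \<in> O\<^sub>K"
      by (rule J_add[OF J_O_mult[OF O_\<kappa> ab(2)] J_O_mult[OF O_\<kappa> ab(4)]])
    hence "\<kappa> (a * b) * (x + y) \<in> O\<^sub>K" unfolding \<kappa>_mult by (simp add: algebra_simps)
    ultimately show ?thesis unfolding Z_def by (intro CollectI exI[of _ "a * b"]) auto
  qed
  have mult: "x * y \<in> Z" if xy: "x \<in> Z" "y \<in> Z" for x y
  proof -
    obtain a b where ab: "a \<noteq> 0" "\<kappa> a * x \<in> O\<^sub>K" "b \<noteq> 0" "\<kappa> b * y \<in> O\<^sub>K" using xy by (auto simp: Z_def)
    moreover have "(\<kappa> a * x) * (\<kappa> b * y) \<in> O\<^sub>K" by (rule J_O_mult[OF ab(2) ab(4)])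
    hence "\<kappa> (a * b) * (x * y) \<in> O\<^sub>K" unfolding \<kappa>_mult by (simp add: algebra_simps)
    ultimately show ?thesis unfolding Z_def by (intro CollectI exI[of _ "a * b"]) auto
  qed
  have \<iota>: "\<iota> c \<in> Z" for c
  proof -
    obtain a b where ab: "b \<noteq> 0" "c = to_fract a / to_fract b" by (rule fract_cases)
    hence "to_fract b * c = to_fract a" by simp
    hence "\<kappa> b * \<iota> c = \<kappa> a" by (metis hom_mult)
    thus ?thesis unfolding Z_def using ab O_\<kappa> by (intro CollectI exI[of _ b]) auto
  qed
  have "\<alpha> \<in> Z" unfolding Z_def using B_nz B_\<alpha> by blast
  hence "\<iota> c * \<alpha> ^ i \<in> Z" for c i
  proof (induction i)
    case (Suc i)
    have "\<iota> c * \<alpha> ^ Suc i = \<alpha> * (\<iota> c * \<alpha> ^ i)" by (simp add: mult_ac)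
    thus ?case using mult Suc by metis
  qed (use \<iota> in simp)
  moreover have "0 \<in> Z" using \<iota>[of 0] by simp
  ultimately have "(\<Sum>i<n. \<iota> (coef z i) * \<alpha> ^ i) \<in> Z" for n by (induction n) (auto intro: add)
  hence "z \<in> Z" using coef_expand[of z] by metis
  thus ?thesis by (auto simp: Z_def)
qed

lemma ram_prod_J:
  assumes "\<And>\<pi>. monic_irreducible \<pi> \<Longrightarrow> \<pi> \<notin> ram \<Longrightarrow> n \<pi> = 0"
  shows "\<kappa> (\<Prod>\<pi>\<in>ram. \<pi> ^ nat \<bar>n \<pi>\<bar>) \<in> J n"
  unfolding J_def
proof (intro CollectI allI impI)
  fix \<pi> :: "'a poly" assume \<pi>: "monic_irreducible \<pi>"
  show "\<kappa> (\<Prod>\<pi>\<in>ram. \<pi> ^ nat \<bar>n \<pi>\<bar>) \<in> F \<pi> (n \<pi>)"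
  proof (cases "\<pi> \<in> ram")
    case True
    have "1 * \<bar>n \<pi>\<bar> \<le> int p * \<bar>n \<pi>\<bar>" using p_pos by (intro mult_right_mono) auto
    thus ?thesis using ram_prod(2)[OF True, of "\<lambda>\<pi>. nat \<bar>n \<pi>\<bar>"] abs_ge_self[of "n \<pi>"]
      unfolding fil_\<iota> by (simp del: abs_ge_self)
  next
    case False
    thus ?thesis using ram_prod(3)[OF \<pi> False] assms[OF \<pi> False] by (simp add: fil_\<iota>)
  qed
qed

lemma local_multiplier:
  assumes "\<And>\<pi>. monic_irreducible \<pi> \<Longrightarrow> \<pi> \<notin> ram \<Longrightarrow> n \<pi> = 0"
    and \<pi>: "monic_irreducible \<pi>" and z: "z \<in> F \<pi> (n \<pi>)"
  shows "\<exists>r. \<not> \<pi> dvd r \<and> \<kappa> r * z \<in> J n"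
proof -
  obtain b1 where b1: "b1 \<noteq> 0" "\<kappa> b1 * z \<in> O\<^sub>K" using denominator by blast
  define b2 where "b2 = (\<Prod>\<pi>\<in>ram. \<pi> ^ nat \<bar>n \<pi>\<bar>)"
  have b2: "b2 \<noteq> 0" "\<kappa> b2 \<in> J n" using ram_prod(1) ram_prod_J[OF assms(1)] by (auto simp: b2_def)
  define b where "b = b1 * b2"
  have "(\<kappa> b1 * z) * \<kappa> b2 \<in> J n" by (rule J_O_mult[OF b1(2) b2(2)])
  hence bz: "\<kappa> b * z \<in> J n" unfolding b_def \<kappa>_mult by (simp only: mult_ac)
  have b0: "b \<noteq> 0" using b1 b2 by (simp add: b_def)
  obtain r where r: "b = \<pi> ^ pmult \<pi> b * r" "\<not> \<pi> dvd r"
    using pmult_decompose[OF degree_monic_irreducible[OF \<pi>] b0] .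
  have r0: "r \<noteq> 0" using r by auto
  have "\<kappa> r * z \<in> F \<rho> (n \<rho>)" if \<rho>: "monic_irreducible \<rho>" for \<rho>
  proof (cases "\<rho> = \<pi>")
    case True
    have "\<kappa> r * z \<in> F \<pi> (n \<pi> + int p * pval \<pi> (to_fract r))" using fil_scale[OF adm[OF \<pi>] _ z] r0 by simp
    thus ?thesis using True pval_not_dvd[OF \<pi> r(2)] by simp
  next
    case False
    let ?q = "to_fract (\<pi> ^ pmult \<pi> b)"
    have "pval \<rho> (to_fract \<pi>) = 0" using False \<pi> \<rho> by (intro pval_other) auto
    hence v: "pval \<rho> ?q = 0"
    proof -
      have "to_fract (\<pi> ^ k) = to_fract \<pi> ^ k" for k by (induction k) auto
      thus ?thesis using \<open>pval \<rho> (to_fract \<pi>) = 0\<close> monic_irreducible_nz[OF \<pi>]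
        by (simp add: val_power[OF valuation_pval[OF \<rho>]])
    qed
    have "\<kappa> b * z = \<iota> ?q * (\<kappa> r * z)" using r(1) by (metis \<kappa>_mult mult.assoc)
    moreover have "\<kappa> b * z \<in> F \<rho> (n \<rho>)" using bz \<rho> by (simp add: J_def)
    ultimately have "\<iota> ?q * (\<kappa> r * z) \<in> F \<rho> (n \<rho> + int p * pval \<rho> ?q)"
      unfolding v by (simp only:) simp
    moreover have "?q \<noteq> 0" using monic_irreducible_nz[OF \<pi>] by simp
    ultimately show ?thesis using fil_scale_iff[OF adm[OF \<rho>]] by blast
  qed
  thus ?thesis using r(2) by (auto simp: J_def)
qed

text \<open>The polynomials that multiply \<open>x\<close> into \<open>I\<close> form an ideal. The
  local hypothesis supplies, for each \<pi>, a member not divisible by \<pi>, so the generator is a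
  nonzero constant. Only closure of \<open>I\<close> under addition and under
  \<open>O\<^sub>K\<close> enters, no invertibility.\<close>

lemma local_global:
  assumes add: "\<And>x y. x \<in> I \<Longrightarrow> y \<in> I \<Longrightarrow> x + y \<in> I"
    and smult: "\<And>r x. r \<in> O\<^sub>K \<Longrightarrow> x \<in> I \<Longrightarrow> r * x \<in> I"
    and loc: "\<And>\<pi>. monic_irreducible \<pi> \<Longrightarrow> \<exists>y\<in>I. y \<noteq> 0 \<and> x / y \<in> F \<pi> 0"
  shows "x \<in> I"
proof -
  define A where "A = {r. \<kappa> r * x \<in> I}"
  have mult: "\<exists>r\<in>A. \<not> \<pi> dvd r" if \<pi>: "monic_irreducible \<pi>" for \<pi>
  proof -
    obtain y where y: "y \<in> I" "y \<noteq> 0" "x / y \<in> F \<pi> 0" using loc[OF \<pi>] by blast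
    obtain r where r: "\<not> \<pi> dvd r" "\<kappa> r * (x / y) \<in> O\<^sub>K"
      using local_multiplier[of "\<lambda>_. 0" \<pi> "x / y"] \<pi> y by auto
    have "\<kappa> r * (x / y) * y \<in> I" using r(2) y(1) by (rule smult)
    hence "r \<in> A" using y by (simp add: A_def)
    thus ?thesis using r by blast
  qed
  have "\<exists>d\<in>A. \<forall>a\<in>A. d dvd a"
  proof (rule poly_ideal_principal)
    \<comment> \<open>The hypothesis \<open>loc\<close> speaks of primes, so some prime has to be
      exhibited to see that \<open>I\<close> is nonempty.\<close>
    have irr: "monic_irreducible [:0, 1 :: 'a:]"
      by (auto simp: monic_irreducible_def intro: irreducible_linear_field_poly)
    obtain y where "y \<in> I" using loc[OF irr] by blast
    hence "0 * y \<in> I" by (intro smult) auto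
    thus "0 \<in> A" by (simp add: A_def)
    show "a + b \<in> A" if "a \<in> A" "b \<in> A" for a b
      using add[of "\<kappa> a * x" "\<kappa> b * x"] that by (simp add: A_def hom_add distrib_right)
    show "a * b \<in> A" if "b \<in> A" for a b
      using smult[OF O_\<kappa>, of "\<kappa> b * x" a] that by (simp add: A_def hom_mult mult.assoc)
  qed
  then obtain d where d: "d \<in> A" "\<And>a. a \<in> A \<Longrightarrow> d dvd a" by blast
  have "degree d = 0"
  proof (rule ccontr)
    assume "degree d \<noteq> 0"
    then obtain \<pi> where \<pi>: "monic_irreducible \<pi>" "\<pi> dvd d" using monic_irreducible_factor[of d] by auto
    obtain r where "r \<in> A" "\<not> \<pi> dvd r" using mult[OF \<pi>(1)] by blast
    thus False using d(2)[of r] \<pi>(2) dvd_trans by blast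
  qed
  then obtain u where u: "d = [:u:]" using degree_eq_zeroE by blast
  have "u \<noteq> 0"
  proof
    assume "u = 0"
    have irr: "monic_irreducible [:0, 1 :: 'a:]"
      by (auto simp: monic_irreducible_def intro: irreducible_linear_field_poly)
    obtain r where "r \<in> A" "\<not> [:0, 1:] dvd r" using mult[OF irr] by blast
    thus False using d(2)[of r] u \<open>u = 0\<close> by auto
  qed
  hence "[:inverse u:] * d = 1" using u by simp
  hence e: "\<kappa> [:inverse u:] * (\<kappa> d * x) = x" by (metis \<kappa>_1 \<kappa>_mult mult.assoc mult_1)
  have "\<kappa> d * x \<in> I" using d(1) by (simp add: A_def)
  from smult[OF O_\<kappa> this, of "[:inverse u:]"] show ?thesis unfolding e .
qed

end

section \<open>The ring of integers and its ramified primes\<close>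

context artin_schreier_function_field
begin

text \<open>Integral elements have bounded powers at every place; the latter form a ring, so no closure
  property of integrality is needed.\<close>

definition power_bounded :: "'a poly \<Rightarrow> 'k set" where
  "power_bounded \<pi> = {y. \<exists>s. \<forall>n. y ^ n \<in> F \<pi> s}"

lemma F_of_nat: "monic_irreducible \<pi> \<Longrightarrow> of_nat n \<in> F \<pi> 0"
proof (induction n)
  case (Suc n)
  thus ?case using fil_add[OF adm fil_1[OF adm]] by simp
qed simp

lemma power_bounded_add:
  assumes \<pi>: "monic_irreducible \<pi>" and "x \<in> power_bounded \<pi>" "y \<in> power_bounded \<pi>"
  shows "x + y \<in> power_bounded \<pi>"
proof -
  obtain s t where st: "\<And>n. x ^ n \<in> F \<pi> s" "\<And>n. y ^ n \<in> F \<pi> t"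
    using assms(2,3) unfolding power_bounded_def by blast
  have "(x + y) ^ n \<in> F \<pi> (s + t)" for n
    unfolding binomial_ring
  proof (rule fil_sum[OF adm[OF \<pi>]])
    fix k
    have "of_nat (n choose k) * (x ^ k * y ^ (n - k)) \<in> F \<pi> (0 + (s + t))"
      by (intro fil_mult[OF adm[OF \<pi>]] F_of_nat[OF \<pi>] st)
    thus "of_nat (n choose k) * x ^ k * y ^ (n - k) \<in> F \<pi> (s + t)" by (simp add: mult.assoc)
  qed
  thus ?thesis by (auto simp: power_bounded_def)
qed

lemma power_bounded_uminus:
  assumes \<pi>: "monic_irreducible \<pi>" and "x \<in> power_bounded \<pi>"
  shows "- x \<in> power_bounded \<pi>"
proof -
  obtain s where s: "\<And>n. x ^ n \<in> F \<pi> s" using assms(2) unfolding power_bounded_def by blast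
  have "(- x) ^ n \<in> F \<pi> s" for n
    using s[of n] fil_uminus[OF adm[OF \<pi>] s[of n]] by (cases "even n") auto
  thus ?thesis by (auto simp: power_bounded_def)
qed

lemma power_bounded_diff:
  "monic_irreducible \<pi> \<Longrightarrow> x \<in> power_bounded \<pi> \<Longrightarrow> y \<in> power_bounded \<pi> \<Longrightarrow> x - y \<in> power_bounded \<pi>"
  using power_bounded_add[of \<pi> x "- y"] power_bounded_uminus[of \<pi> y] by simp

lemma power_bounded_\<sigma>:
  assumes \<pi>: "monic_irreducible \<pi>" and "x \<in> power_bounded \<pi>"
  shows "\<sigma> x \<in> power_bounded \<pi>"
proof -
  obtain s where s: "\<And>n. x ^ n \<in> F \<pi> s" using assms(2) unfolding power_bounded_def by blast
  hence "(\<sigma> x) ^ n \<in> F \<pi> s" for n using fil_\<sigma>[OF adm[OF \<pi>] s[of n]] by (simp add: \<sigma>.hom_power)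
  thus ?thesis by (auto simp: power_bounded_def)
qed

lemma F_power_bounded: "monic_irreducible \<pi> \<Longrightarrow> x \<in> F \<pi> 0 \<Longrightarrow> x \<in> power_bounded \<pi>"
  unfolding power_bounded_def using fil_power[OF adm] by fastforce

lemma bounded_multiples:
  fixes s w :: int
  assumes "\<And>n. s \<le> int n * w"
  shows "0 \<le> w"
proof (rule ccontr)
  assume "\<not> ?thesis"
  hence "int (nat \<bar>s\<bar> + 1) * w \<le> int (nat \<bar>s\<bar> + 1) * (- 1)" by (intro mult_left_mono) auto
  moreover have "int (nat \<bar>s\<bar> + 1) = \<bar>s\<bar> + 1" by simp
  ultimately have "s \<le> - (\<bar>s\<bar> + 1)" using assms[of "nat \<bar>s\<bar> + 1"] by simp
  thus False by linarith
qed

lemma nrm_power: "nrm (x ^ n) = nrm x ^ n"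
  by (induction n) (auto simp: nrm_1 nrm_mult)

text \<open>At a ramified prime the norm is a valuation, and bounded powers force it to be
  nonnegative. At an unramified prime, \<alpha> is integral, and by \<open>lead_coeff_mem\<close>
  the leading coordinate of \<open>x\<close> again has bounded powers; it can be split off and the
  degree drops.\<close>

lemma power_bounded_imp_F:
  assumes \<pi>: "monic_irreducible \<pi>" and x: "x \<in> power_bounded \<pi>"
  shows "x \<in> F \<pi> 0"
proof (cases "\<pi> \<in> ram")
  case True
  show ?thesis
  proof (cases "x = 0")
    case False
    obtain s where s: "\<And>n. x ^ n \<in> F \<pi> s" using x unfolding power_bounded_def by blast
    have "s \<le> int n * pval \<pi> (nrm x)" for n
      using fil_nrm[OF adm[OF \<pi>] s[of n]] False
      by (simp add: nrm_power val_power[OF valuation_pval[OF \<pi>]] nrm_eq_0_iff)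
    hence "0 \<le> pval \<pi> (nrm x)" by (rule bounded_multiples)
    thus ?thesis using single_place_fil_iff[OF single_ram[OF True] False] by simp
  qed simp
next
  case False
  have e: "ee \<pi> = 0" using unram[OF \<pi> False] by simp
  show ?thesis using x
  proof (induction "degree (rep x)" arbitrary: x rule: less_induct)
    case less
    let ?c = "lead_coeff (rep x)" and ?d = "degree (rep x)"
    have "\<iota> ?c \<in> power_bounded \<pi>"
      by (rule lead_coeff_mem[where x = x]) (use less.prems power_bounded_add[OF \<pi>] power_bounded_diff[OF \<pi>] power_bounded_\<sigma>[OF \<pi>] in auto)
    then obtain s where s: "\<And>n. \<iota> ?c ^ n \<in> F \<pi> s" unfolding power_bounded_def by blast
    have c: "?c = 0 \<or> 0 \<le> int p * pval \<pi> ?c"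
    proof (cases "?c = 0")
      case False
      have "s \<le> int n * (int p * pval \<pi> ?c)" for n
      proof -
        have "\<iota> (?c ^ n) \<in> F \<pi> s" using s[of n] by (simp add: hom_power)
        thus ?thesis unfolding fil_\<iota> using False by (simp add: val_power[OF valuation_pval[OF \<pi>]] mult_ac)
      qed
      thus ?thesis using bounded_multiples by blast
    qed simp
    have m: "\<iota> ?c * \<alpha> ^ ?d \<in> F \<pi> 0"
      unfolding fil_monomial[OF rep(1)] e using c by simp
    show ?case
    proof (cases "?d = 0")
      case True
      hence "rep x = [:?c:]" using degree_eq_zeroE by (metis lead_coeff_pCons(2) pCons_0_0 coeff_pCons_0 degree_pCons_0)
      hence "x = \<iota> ?c" using rep(2)[of x] by (metis poly_ev_simps(5,7) add.right_neutral mult_zero_right)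
      thus ?thesis using m True by simp
    next
      case False
      define y where "y = x - \<iota> ?c * \<alpha> ^ ?d"
      have y: "y \<in> power_bounded \<pi>"
        unfolding y_def using less.prems F_power_bounded[OF \<pi> m] power_bounded_diff[OF \<pi>] by blast
      have "coeff (rep y) i = 0" if "i \<ge> ?d" for i
      proof -
        have "coeff (rep y) i = coef y i" by (simp add: coef_def)
        also have "\<dots> = coef x i - (if i = ?d then ?c else 0)"
          unfolding y_def coef_simps(2) by (simp add: coef_monomial rep(1))
        also have "\<dots> = 0" using that by (auto simp: coef_def coeff_eq_0)
        finally show ?thesis .
      qed
      hence "degree (rep y) \<le> ?d - 1" by (intro degree_le) auto
      hence "degree (rep y) < ?d" using False by linarith
      hence "y \<in> F \<pi> 0" using less.hyps y by blast
      hence "y + \<iota> ?c * \<alpha> ^ ?d \<in> F \<pi> 0" using m fil_add[OF adm[OF \<pi>]] by blast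
      thus ?thesis by (simp add: y_def)
    qed
  qed
qed

text \<open>The monic equation expresses high powers through the powers below its degree with
  coefficients of nonnegative level, so a level common to those finitely many powers is never
  left.\<close>

lemma integral_power_bounded:
  assumes \<pi>: "monic_irreducible \<pi>" and g: "lead_coeff g = 1" "poly (map_poly \<kappa> g) x = 0"
  shows "x \<in> power_bounded \<pi>"
proof -
  let ?d = "degree g"
  have \<kappa>0: "\<kappa> 0 = 0" by simp
  have deg: "degree (map_poly \<kappa> g) = ?d" using g(1) by (intro degree_map_poly) auto
  have rel: "x ^ ?d = - (\<Sum>i<?d. \<kappa> (coeff g i) * x ^ i)"
  proof -
    have "0 = (\<Sum>i\<le>?d. \<kappa> (coeff g i) * x ^ i)"
      using g(2) unfolding poly_altdef deg by (simp add: coeff_map_poly)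
    also have "\<dots> = (\<Sum>i<?d. \<kappa> (coeff g i) * x ^ i) + x ^ ?d"
      using g(1) by (simp add: lessThan_Suc_atMost[symmetric])
    finally show ?thesis by (simp add: eq_neg_iff_add_eq_0 add.commute)
  qed
  have "\<exists>t. x ^ i \<in> F \<pi> t" for i
    by (metis fil_0 fil_exhaust)
  then obtain t where t: "\<And>i. x ^ i \<in> F \<pi> (t i)" by metis
  define s where "s = Min (insert 0 (t ` {..<?d}))"
  have low: "x ^ i \<in> F \<pi> s" if "i < ?d" for i
    by (rule fil_mono[OF t]) (use that in \<open>auto simp: s_def\<close>)
  have "x ^ n \<in> F \<pi> s" for n
  proof (induction n rule: less_induct)
    case (less n)
    show ?case
    proof (cases "n < ?d")
      case False
      have "x ^ n = x ^ (n - ?d) * x ^ ?d" using False by (simp flip: power_add)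
      also have "\<dots> = - (\<Sum>i<?d. \<kappa> (coeff g i) * x ^ (n - ?d + i))"
        unfolding rel by (simp add: sum_distrib_left power_add mult_ac)
      finally have eq: "x ^ n = - (\<Sum>i<?d. \<kappa> (coeff g i) * x ^ (n - ?d + i))" .
      show ?thesis unfolding eq
      proof (intro fil_uminus[OF adm[OF \<pi>]] fil_sum[OF adm[OF \<pi>]])
        fix i assume "i \<in> {..<?d}"
        hence "x ^ (n - ?d + i) \<in> F \<pi> s" using False by (intro less) auto
        from fil_mult[OF adm[OF \<pi>] F_\<kappa>[OF \<pi>] this] show "\<kappa> (coeff g i) * x ^ (n - ?d + i) \<in> F \<pi> s" by simp
      qed
    qed (use low in simp)
  qed
  thus ?thesis by (auto simp: power_bounded_def)
qed

text \<open>Integral elements have bounded powers at every prime. Conversely, the characteristic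
  polynomial of an element of \<open>O\<^sub>K\<close> has coefficients in both k and
  \<open>O\<^sub>K\<close>, hence polynomial ones.\<close>

lemma ring_of_integers_eq: "ring_of_integers \<iota> = O\<^sub>K"
proof (intro equalityI subsetI)
  fix x assume "x \<in> ring_of_integers \<iota>"
  then obtain g where "lead_coeff g = 1" "poly (map_poly \<kappa> g) x = 0"
    by (auto simp: ring_of_integers_def integral_closure_def)
  thus "x \<in> O\<^sub>K" using integral_power_bounded power_bounded_imp_F by (auto simp: J_def)
next
  fix x assume x: "x \<in> O\<^sub>K"
  obtain g where g: "conj_poly x = map_poly \<iota> g" "lead_coeff g = 1" using conj_poly_in_base by blast
  have "coeff g n \<in> range to_fract" for n
  proof (rule O_\<iota>)
    have "coeff (conj_poly x) n \<in> O\<^sub>K"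
      by (rule coeff_conj_poly_mem) (use x J_diff O_1 J_O_mult J_\<sigma>_pow in auto)
    thus "\<iota> (coeff g n) \<in> O\<^sub>K" by (simp add: g(1))
  qed
  hence i: "to_fract (inv_into UNIV to_fract (coeff g n)) = coeff g n" for n by (simp add: f_inv_into_f)
  define h where "h = map_poly (inv_into UNIV to_fract) g"
  have z: "inv_into UNIV to_fract (0 :: 'a poly fract) = 0"
    by (metis UNIV_I f_inv_into_f rangeI to_fract_0 to_fract_eq_0_iff)
  have ch: "to_fract (coeff h n) = coeff g n" for n by (simp add: h_def coeff_map_poly z i)
  have "inv_into UNIV to_fract (lead_coeff g) \<noteq> 0" by (metis g(2) i to_fract_0 one_neq_zero)
  moreover have "g \<noteq> 0" using g(2) by auto
  ultimately have dh: "degree h = degree g" unfolding h_def by (intro degree_map_poly) simp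
  have "to_fract (lead_coeff h) = 1" unfolding dh ch by (rule g(2))
  hence "lead_coeff h = 1" by (metis to_fract_1 to_fract_eq_iff)
  moreover have "map_poly \<kappa> h = conj_poly x"
    by (rule poly_eqI) (simp add: g(1) coeff_map_poly ch)
  ultimately show "x \<in> ring_of_integers \<iota>"
    unfolding ring_of_integers_def integral_closure_def using poly_conj_poly[of x] by auto
qed

lemma O_nrm: "x \<in> O\<^sub>K \<Longrightarrow> \<exists>a. nrm x = to_fract a"
  using O_\<iota>[of "nrm x"] O_prod[of "{..<p}" "\<lambda>j. (\<sigma> ^^ j) x"] J_\<sigma>_pow by (auto simp: \<iota>_nrm)

lemma nrm_split: "\<iota> (nrm x) = x * (\<Prod>j\<in>{1..<p}. (\<sigma> ^^ j) x)"
proof -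
  have "{..<p} = insert 0 {1..<p}" using p_pos by auto
  thus ?thesis unfolding \<iota>_nrm by simp
qed

lemma O_nrm_cofactor: "x \<in> O\<^sub>K \<Longrightarrow> (\<Prod>j\<in>{1..<p}. (\<sigma> ^^ j) x) \<in> O\<^sub>K"
  by (intro O_prod J_\<sigma>_pow)

text \<open>\<open>W \<pi>\<close> is the valuation of the prime above a ramified \<open>\<pi>\<close>.\<close>

definition W :: "'a poly \<Rightarrow> 'k \<Rightarrow> int" where "W \<pi> x = pval \<pi> (nrm x)"

lemma F_iff_W: "\<pi> \<in> ram \<Longrightarrow> x \<noteq> 0 \<Longrightarrow> x \<in> F \<pi> m \<longleftrightarrow> m \<le> W \<pi> x"
  unfolding W_def by (rule single_place_fil_iff[OF single_ram])

lemma W_mult: "\<pi> \<in> ram \<Longrightarrow> x \<noteq> 0 \<Longrightarrow> y \<noteq> 0 \<Longrightarrow> W \<pi> (x * y) = W \<pi> x + W \<pi> y"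
  unfolding W_def nrm_mult by (rule val_mult[OF valuation_pval[OF ram_irr]]) (auto simp: nrm_eq_0_iff)

lemma W_divide: "\<pi> \<in> ram \<Longrightarrow> x \<noteq> 0 \<Longrightarrow> y \<noteq> 0 \<Longrightarrow> W \<pi> (x / y) = W \<pi> x - W \<pi> y"
  using W_mult[of \<pi> "x / y" y] by simp

lemma W_\<iota>: "\<pi> \<in> ram \<Longrightarrow> c \<noteq> 0 \<Longrightarrow> W \<pi> (\<iota> c) = int p * pval \<pi> c"
  unfolding W_def nrm_\<iota> using val_power[OF valuation_pval[OF ram_irr]] by blast

lemma \<alpha>_nz: "\<alpha> \<noteq> 0"
  using root D_nz p_pos by (auto simp: power_0_left)

lemma W_power: "\<pi> \<in> ram \<Longrightarrow> x \<noteq> 0 \<Longrightarrow> W \<pi> (x ^ n) = int n * W \<pi> x"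
  unfolding W_def nrm_power using val_power[OF valuation_pval[OF ram_irr]] nrm_eq_0_iff by blast

lemma W_\<alpha>: "\<pi> \<in> ram \<Longrightarrow> W \<pi> \<alpha> = - ee \<pi>"
proof -
  assume \<pi>: "\<pi> \<in> ram"
  have "m \<le> W \<pi> \<alpha> \<longleftrightarrow> m \<le> - ee \<pi>" for m
  proof -
    have "m \<le> W \<pi> \<alpha> \<longleftrightarrow> \<iota> 1 * \<alpha> ^ 1 \<in> F \<pi> m" using F_iff_W[OF \<pi> \<alpha>_nz] by simp
    also have "\<dots> \<longleftrightarrow> m + ee \<pi> \<le> 0"
      unfolding fil_monomial[OF p_gt_1] using val_1[OF valuation_pval[OF ram_irr[OF \<pi>]]] by simp
    finally show ?thesis by linarith
  qed
  thus ?thesis by (meson order.eq_iff order.refl)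
qed

text \<open>The values \<open>- ee \<pi>\<close> of \<alpha> and \<open>p\<close> of \<pi> are
  coprime, so products of their powers realize every integer.\<close>

lemma W_surj:
  assumes \<pi>: "\<pi> \<in> ram"
  shows "\<exists>y. y \<noteq> 0 \<and> W \<pi> y = n"
proof -
  have "coprime (ee \<pi>) (int p)"
    using ram_ee[OF \<pi>] prime_p by (metis coprime_commute prime_imp_coprime prime_nat_int_transfer)
  then obtain k where "[ee \<pi> * k = - n] (mod int p)"
  proof -
    assume *: "\<And>k. [ee \<pi> * k = - n] (mod int p) \<Longrightarrow> thesis"
    obtain x where "[ee \<pi> * x = 1] (mod int p)" using \<open>coprime (ee \<pi>) (int p)\<close> cong_solve_coprime_int by blast
    hence "[ee \<pi> * x * (- n) = 1 * (- n)] (mod int p)" by (rule cong_scalar_right)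
    thus thesis using *[of "x * (- n)"] by (simp add: mult.assoc)
  qed
  hence k: "[ee \<pi> * (k mod int p) = - n] (mod int p)" by (simp add: cong_def mod_simps)
  define b where "b = nat (k mod int p)"
  have "int b = k mod int p" using p_pos by (simp add: b_def)
  with k have "int p dvd ee \<pi> * int b + n" by (simp add: cong_iff_dvd_diff)
  then obtain a where a: "ee \<pi> * int b + n = int p * a" by (elim dvdE)
  have nz: "to_fract \<pi> \<noteq> 0" using monic_irreducible_nz[OF ram_irr[OF \<pi>]] by simp
  let ?c = "to_fract \<pi> powi a"
  have c: "?c \<noteq> 0" using nz by simp
  have "pval \<pi> ?c = a"
    using val_powi[OF valuation_pval[OF ram_irr[OF \<pi>]] nz] pval_self[OF ram_irr[OF \<pi>]] by simp
  hence "W \<pi> (\<iota> ?c * \<alpha> ^ b) = int p * a - int b * ee \<pi>"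
    using W_mult[OF \<pi>, of "\<iota> ?c" "\<alpha> ^ b"] W_\<iota>[OF \<pi> c] W_power[OF \<pi> \<alpha>_nz] W_\<alpha>[OF \<pi>] c \<alpha>_nz by simp
  also have "\<dots> = n" using a by (simp add: algebra_simps)
  finally show ?thesis using c \<alpha>_nz by (intro exI[of _ "\<iota> ?c * \<alpha> ^ b"]) auto
qed

definition supported :: "('a poly \<Rightarrow> int) \<Rightarrow> bool" where
  "supported n \<longleftrightarrow> (\<forall>\<pi>. \<pi> \<notin> ram \<longrightarrow> n \<pi> = 0)"

text \<open>Together with \<open>J_unit_at\<close> this provides an element of \<open>J n\<close>
  generating it locally, one prime at a time, in the form consumed by
  \<open>local_global\<close>.\<close>

lemma J_attain:
  assumes "supported n" and \<pi>: "\<pi> \<in> ram"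
  shows "\<exists>x\<in>J n. x \<noteq> 0 \<and> W \<pi> x = n \<pi>"
proof -
  obtain y where y: "y \<noteq> 0" "W \<pi> y = n \<pi>" using W_surj[OF \<pi>] by blast
  hence "y \<in> F \<pi> (n \<pi>)" using F_iff_W[OF \<pi>] by simp
  then obtain r where r: "\<not> \<pi> dvd r" "\<kappa> r * y \<in> J n"
    using local_multiplier[of n, OF _ ram_irr[OF \<pi>]] assms(1) by (auto simp: supported_def)
  have "to_fract r \<noteq> 0" using r(1) by auto
  hence "W \<pi> (\<kappa> r * y) = n \<pi>"
    using W_mult[OF \<pi>, of "\<kappa> r" y] W_\<iota>[OF \<pi>, of "to_fract r"] y pval_not_dvd[OF ram_irr[OF \<pi>] r(1)] by simp
  thus ?thesis using r y \<open>to_fract r \<noteq> 0\<close> by (intro bexI[of _ "\<kappa> r * y"]) auto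
qed

lemma J_unit_at:
  assumes "supported n" and \<pi>: "monic_irreducible \<pi>" "\<pi> \<notin> ram"
  shows "\<exists>b. b \<noteq> 0 \<and> \<kappa> b \<in> J n \<and> pval \<pi> (to_fract b) = 0"
proof -
  let ?b = "\<Prod>\<rho>\<in>ram. \<rho> ^ nat \<bar>n \<rho>\<bar>"
  have "\<kappa> ?b \<in> J n" using assms(1) by (intro ram_prod_J) (auto simp: supported_def)
  thus ?thesis using ram_prod(1)[of "\<lambda>\<rho>. nat \<bar>n \<rho>\<bar>"] ram_prod(3)[OF \<pi>, of "\<lambda>\<rho>. nat \<bar>n \<rho>\<bar>"] by blast
qed

end

section \<open>Fractional ideals\<close>

abbreviation ideal_mult :: "'k::field set \<Rightarrow> 'k set \<Rightarrow> 'k set" where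
  "ideal_mult \<equiv> ideal_prod ring_of_type_algebra"

lemma ideal_mult_prod: "x \<in> I \<Longrightarrow> y \<in> J \<Longrightarrow> x * y \<in> ideal_mult I J"
  using ideal_prod.prod[of x I y J ring_of_type_algebra] by (simp add: ring_of_type_algebra_def)

lemma ideal_mult_add: "x \<in> ideal_mult I J \<Longrightarrow> y \<in> ideal_mult I J \<Longrightarrow> x + y \<in> ideal_mult I J"
  using ideal_prod.sum[of x ring_of_type_algebra I J y] by (simp add: ring_of_type_algebra_def)

lemma ideal_mult_induct [consumes 1, case_names prod sum]:
  assumes "x \<in> ideal_mult I J" "\<And>i j. i \<in> I \<Longrightarrow> j \<in> J \<Longrightarrow> P (i * j)"
    "\<And>x y. x \<in> ideal_mult I J \<Longrightarrow> P x \<Longrightarrow> y \<in> ideal_mult I J \<Longrightarrow> P y \<Longrightarrow> P (x + y)"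
  shows "P x"
  using assms(1)
  by (induction rule: ideal_prod.induct) (use assms(2,3) in \<open>auto simp: ring_of_type_algebra_def\<close>)

lemma ideal_mult_subset:
  assumes "\<And>i j. i \<in> I \<Longrightarrow> j \<in> J \<Longrightarrow> i * j \<in> K" "\<And>x y. x \<in> K \<Longrightarrow> y \<in> K \<Longrightarrow> x + y \<in> K"
  shows "ideal_mult I J \<subseteq> K"
proof
  fix x assume "x \<in> ideal_mult I J"
  thus "x \<in> K" by (induction rule: ideal_mult_induct) (use assms in auto)
qed

lemma ideal_mult_commute: "ideal_mult I J = ideal_mult J I"
proof -
  have "ideal_mult I J \<subseteq> ideal_mult J I" for I J :: "'k::field set"
    by (rule ideal_mult_subset) (metis ideal_mult_prod mult.commute, rule ideal_mult_add)
  thus ?thesis by blast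
qed

lemma ideal_mult_assoc_subset: "ideal_mult (ideal_mult I J) K \<subseteq> ideal_mult I (ideal_mult J K)"
proof (rule ideal_mult_subset)
  fix x k assume "x \<in> ideal_mult I J" "k \<in> K"
  thus "x * k \<in> ideal_mult I (ideal_mult J K)"
  proof (induction rule: ideal_mult_induct)
    case (prod i j)
    have "i * (j * k) \<in> ideal_mult I (ideal_mult J K)" using prod by (intro ideal_mult_prod)
    thus ?case by (simp add: mult.assoc)
  next
    case (sum x y)
    thus ?case by (simp add: distrib_right ideal_mult_add)
  qed
qed (rule ideal_mult_add)

lemma ideal_mult_assoc: "ideal_mult (ideal_mult I J) K = ideal_mult I (ideal_mult J K)"
proof (rule antisym[OF ideal_mult_assoc_subset])
  show "ideal_mult I (ideal_mult J K) \<subseteq> ideal_mult (ideal_mult I J) K"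
    using ideal_mult_assoc_subset[of K J I] by (simp add: ideal_mult_commute)
qed

lemma ideal_mult_scale: "ideal_mult ((*) a ` I) J = (*) a ` ideal_mult I J"
proof (intro equalityI subsetI)
  fix x assume "x \<in> ideal_mult ((*) a ` I) J"
  thus "x \<in> (*) a ` ideal_mult I J"
  proof (induction rule: ideal_mult_induct)
    case (prod i j)
    then obtain y where "y \<in> I" "i = a * y" by auto
    thus ?case using prod ideal_mult_prod[of y I j J] by (auto simp: mult.assoc)
  next
    case (sum x y)
    then obtain x' y' where "x' \<in> ideal_mult I J" "x = a * x'" "y' \<in> ideal_mult I J" "y = a * y'" by auto
    thus ?case using ideal_mult_add[of x' I J y'] by (auto simp: distrib_left[symmetric])
  qed
next
  fix x assume "x \<in> (*) a ` ideal_mult I J"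
  then obtain y where "y \<in> ideal_mult I J" "x = a * y" by auto
  moreover from this(1) have "a * y \<in> ideal_mult ((*) a ` I) J"
  proof (induction rule: ideal_mult_induct)
    case (prod i j)
    hence "(a * i) * j \<in> ideal_mult ((*) a ` I) J" by (intro ideal_mult_prod) auto
    thus ?case by (simp add: mult.assoc)
  next
    case (sum x y)
    thus ?case by (simp add: distrib_left ideal_mult_add)
  qed
  ultimately show "x \<in> ideal_mult ((*) a ` I) J" by simp
qed

lemma ideal_mult_image:
  assumes "\<And>x y. f (x + y) = f x + f y" "\<And>x y. f (x * y) = f x * f y"
  shows "f ` ideal_mult I J = ideal_mult (f ` I) (f ` J)"
proof (intro equalityI subsetI)
  fix x assume "x \<in> ideal_mult (f ` I) (f ` J)"
  thus "x \<in> f ` ideal_mult I J"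
  proof (induction rule: ideal_mult_induct)
    case (prod i j)
    then obtain i' j' where "i' \<in> I" "j' \<in> J" "i = f i'" "j = f j'" by auto
    thus ?case using ideal_mult_prod[of i' I j' J] assms(2) by (metis imageI)
  next
    case (sum x y)
    then obtain x' y' where "x' \<in> ideal_mult I J" "x = f x'" "y' \<in> ideal_mult I J" "y = f y'" by auto
    thus ?case using ideal_mult_add[of x' I J y'] assms(1) by (metis imageI)
  qed
next
  fix x assume "x \<in> f ` ideal_mult I J"
  then obtain y where "y \<in> ideal_mult I J" "x = f y" by auto
  moreover from this(1) have "f y \<in> ideal_mult (f ` I) (f ` J)"
    by (induction rule: ideal_mult_induct) (auto simp: assms intro: ideal_mult_add ideal_mult_prod)
  ultimately show "x \<in> ideal_mult (f ` I) (f ` J)" by simp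
qed

section \<open>Fractional ideals of the ring of integers\<close>

context artin_schreier_function_field
begin

abbreviation scale :: "'k \<Rightarrow> 'k set \<Rightarrow> 'k set" where "scale a I \<equiv> (\<lambda>x. a * x) ` I"

lemma scale_scale: "scale a (scale b I) = scale (a * b) I"
  by (auto simp: image_image mult.assoc)

lemma scale_1: "scale 1 I = I" by simp

lemma mem_scale_iff: "a \<noteq> 0 \<Longrightarrow> x \<in> scale a I \<longleftrightarrow> x / a \<in> I"
  by (auto simp: image_iff intro!: bexI[of _ "x / a"])

text \<open>Products of local generators of the two factors generate the right-hand side locally,
  and \<open>local_global\<close> assembles them.\<close>

lemma J_mult_eq:
  assumes n: "supported n" "supported n'"
  shows "ideal_mult (J n) (J n') = J (\<lambda>\<pi>. n \<pi> + n' \<pi>)"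
proof
  show "ideal_mult (J n) (J n') \<subseteq> J (\<lambda>\<pi>. n \<pi> + n' \<pi>)"
    by (rule ideal_mult_subset) (auto intro: J_mult J_add)
  show "J (\<lambda>\<pi>. n \<pi> + n' \<pi>) \<subseteq> ideal_mult (J n) (J n')"
  proof
    fix x assume x: "x \<in> J (\<lambda>\<pi>. n \<pi> + n' \<pi>)"
    show "x \<in> ideal_mult (J n) (J n')"
    proof (rule local_global)
      show "r * x \<in> ideal_mult (J n) (J n')" if "r \<in> O\<^sub>K" "x \<in> ideal_mult (J n) (J n')" for r x
        using that(2)
      proof (induction rule: ideal_mult_induct)
        case (prod i j)
        have "(r * i) * j \<in> ideal_mult (J n) (J n')" using J_O_mult that prod by (intro ideal_mult_prod) auto
        thus ?case by (simp add: mult.assoc)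
      qed (simp add: distrib_left ideal_mult_add)
      fix \<pi> :: "'a poly" assume \<pi>: "monic_irreducible \<pi>"
      hence xF: "x \<in> F \<pi> (n \<pi> + n' \<pi>)" using x by (simp add: J_def)
      show "\<exists>y\<in>ideal_mult (J n) (J n'). y \<noteq> 0 \<and> x / y \<in> F \<pi> 0"
      proof (cases "\<pi> \<in> ram")
        case True
        obtain y where y: "y \<in> J n" "y \<noteq> 0" "W \<pi> y = n \<pi>" using J_attain[OF n(1) True] by blast
        obtain y' where y': "y' \<in> J n'" "y' \<noteq> 0" "W \<pi> y' = n' \<pi>" using J_attain[OF n(2) True] by blast
        have "x / (y * y') \<in> F \<pi> 0"
        proof (cases "x = 0")
          case False
          hence "n \<pi> + n' \<pi> \<le> W \<pi> x" using xF F_iff_W[OF True] by simp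
          thus ?thesis using y y' False
            by (subst F_iff_W[OF True]) (auto simp: W_divide[OF True] W_mult[OF True])
        qed simp
        thus ?thesis using y y' by (intro bexI[of _ "y * y'"] ideal_mult_prod) auto
      next
        case False
        obtain b where b: "b \<noteq> 0" "\<kappa> b \<in> J n" "pval \<pi> (to_fract b) = 0" using J_unit_at[OF n(1) \<pi> False] by blast
        obtain b' where b': "b' \<noteq> 0" "\<kappa> b' \<in> J n'" "pval \<pi> (to_fract b') = 0" using J_unit_at[OF n(2) \<pi> False] by blast
        let ?c = "inverse (to_fract (b * b'))"
        have c: "?c \<noteq> 0" using b b' by simp
        have "pval \<pi> ?c = 0"
          using b b' val_inverse[OF valuation_pval[OF \<pi>], of "to_fract (b * b')"]
            val_mult[OF valuation_pval[OF \<pi>], of "to_fract b" "to_fract b'"] by simp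
        moreover have "n \<pi> + n' \<pi> = 0" using n False by (simp add: supported_def)
        ultimately have "\<iota> ?c * x \<in> F \<pi> 0" using fil_scale[OF adm[OF \<pi>] c xF] by simp
        moreover have "\<iota> ?c = inverse (\<kappa> b * \<kappa> b')" by (simp only: hom_inverse hom_mult to_fract_mult)
        hence "\<iota> ?c * x = x / (\<kappa> b * \<kappa> b')" by (simp add: divide_inverse mult.commute)
        ultimately show ?thesis using b b' by (intro bexI[of _ "\<kappa> b * \<kappa> b'"] ideal_mult_prod) auto
      qed
    qed (rule ideal_mult_add)
  qed
qed

lemma J_shift:
  assumes "g \<noteq> 0"
  shows "scale (\<iota> g) (J n) = J (\<lambda>\<pi>. n \<pi> + int p * pval \<pi> g)"
proof (intro equalityI subsetI)
  fix x assume "x \<in> J (\<lambda>\<pi>. n \<pi> + int p * pval \<pi> g)"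
  moreover have "x = \<iota> g * (x / \<iota> g)" using assms by simp
  ultimately have "x / \<iota> g \<in> J n" using J_scale[OF assms, of "x / \<iota> g" n] by simp
  thus "x \<in> scale (\<iota> g) (J n)" using assms by (auto simp: mem_scale_iff)
qed (use J_scale[OF assms] in auto)

abbreviation fracs :: "'k set set" where "fracs \<equiv> fractional_ideals O\<^sub>K"

lemma fracD:
  assumes "I \<in> fracs"
  shows "0 \<in> I" "I \<noteq> {0}" "\<And>x y. x \<in> I \<Longrightarrow> y \<in> I \<Longrightarrow> x + y \<in> I" "\<And>r x. r \<in> O\<^sub>K \<Longrightarrow> x \<in> I \<Longrightarrow> r * x \<in> I"
    "\<exists>d\<in>O\<^sub>K. d \<noteq> 0 \<and> (\<forall>x\<in>I. d * x \<in> O\<^sub>K)"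
  using assms by (auto simp: fractional_ideals_def)

lemma fracI:
  assumes "x \<in> I" "x \<noteq> 0" "\<And>x y. x \<in> I \<Longrightarrow> y \<in> I \<Longrightarrow> x + y \<in> I"
    "\<And>r x. r \<in> O\<^sub>K \<Longrightarrow> x \<in> I \<Longrightarrow> r * x \<in> I" "b \<noteq> 0" "\<And>x. x \<in> I \<Longrightarrow> \<kappa> b * x \<in> O\<^sub>K"
  shows "I \<in> fracs"
proof -
  have "0 * x \<in> I" using assms(1,4) J_0 by blast
  moreover have "I \<noteq> {0}" using assms(1,2) by blast
  moreover have "\<kappa> b \<noteq> 0" using assms(5) by simp
  ultimately show ?thesis unfolding fractional_ideals_def
    using assms(3,4,6) O_\<kappa>[of b] by (intro CollectI conjI ballI bexI[of _ "\<kappa> b"]) simp_all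
qed

lemma frac_diff:
  assumes "I \<in> fracs" "x \<in> I" "y \<in> I"
  shows "x - y \<in> I"
proof -
  have "- 1 \<in> O\<^sub>K" using J_diff[OF J_0 O_1] by simp
  hence "- 1 * y \<in> I" using fracD(4)[OF assms(1)] assms(3) by blast
  thus ?thesis using fracD(3)[OF assms(1,2), of "- 1 * y"] by simp
qed

lemma frac_nonzero: "I \<in> fracs \<Longrightarrow> \<exists>x\<in>I. x \<noteq> 0"
  using fracD(1,2)[of I] by blast

text \<open>The norm of a denominator in \<open>O\<^sub>K\<close> is a polynomial and an integral
  multiple of it.\<close>

lemma frac_denominator:
  assumes "I \<in> fracs"
  shows "\<exists>b. b \<noteq> 0 \<and> (\<forall>x\<in>I. \<kappa> b * x \<in> O\<^sub>K)"
proof -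
  obtain d where d: "d \<in> O\<^sub>K" "d \<noteq> 0" "\<And>x. x \<in> I \<Longrightarrow> d * x \<in> O\<^sub>K" using fracD(5)[OF assms] by blast
  obtain b where b: "nrm d = to_fract b" using O_nrm[OF d(1)] by blast
  have "b \<noteq> 0" using b d(2) nrm_eq_0_iff[of d] by auto
  moreover have "\<kappa> b * x \<in> O\<^sub>K" if "x \<in> I" for x
  proof -
    have e: "\<kappa> b * x = (\<Prod>j\<in>{1..<p}. (\<sigma> ^^ j) d) * (d * x)"
      unfolding b[symmetric] nrm_split by (simp add: mult_ac)
    show ?thesis unfolding e by (rule J_O_mult[OF O_nrm_cofactor[OF d(1)] d(3)[OF that]])
  qed
  ultimately show ?thesis by blast
qed

lemma J_frac:
  assumes "supported n"
  shows "J n \<in> fracs"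
proof -
  have s: "supported (\<lambda>\<pi>. - n \<pi>)" using assms by (simp add: supported_def)
  let ?d = "\<Prod>\<pi>\<in>ram. \<pi> ^ nat \<bar>n \<pi>\<bar>"
  have d0: "?d \<noteq> 0" by (rule ram_prod)
  have d: "\<kappa> ?d \<in> J n" by (rule ram_prod_J) (use assms in \<open>auto simp: supported_def\<close>)
  have d': "\<kappa> ?d \<in> J (\<lambda>\<pi>. - n \<pi>)"
    using ram_prod_J[of "\<lambda>\<pi>. - n \<pi>"] s by (auto simp: supported_def)
  have den: "\<kappa> ?d * x \<in> O\<^sub>K" if "x \<in> J n" for x using J_mult[OF d' that] by simp
  have "\<kappa> ?d \<noteq> 0" using d0 by (simp only: \<kappa>_0_iff) simp
  from fracI[OF d this J_add J_O_mult d0 den] show ?thesis .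
qed

lemma frac_scale:
  assumes "I \<in> fracs" "a \<noteq> 0"
  shows "scale a I \<in> fracs"
proof -
  obtain x where x: "x \<in> I" "x \<noteq> 0" using frac_nonzero[OF assms(1)] by blast
  obtain b where b: "b \<noteq> 0" "\<And>x. x \<in> I \<Longrightarrow> \<kappa> b * x \<in> O\<^sub>K" using frac_denominator[OF assms(1)] by blast
  obtain c where c: "c \<noteq> 0" "\<kappa> c * a \<in> O\<^sub>K" using denominator by blast
  have den: "\<kappa> (b * c) * (a * y) \<in> O\<^sub>K" if "y \<in> I" for y
    using J_O_mult[OF c(2) b(2)[OF that]] by (simp add: hom_mult mult_ac)
  show ?thesis
  proof (rule fracI)
    show "a * x \<in> scale a I" "a * x \<noteq> 0" using x assms(2) by auto
    show "\<kappa> (b * c) * y \<in> O\<^sub>K" if "y \<in> scale a I" for y using that den by blast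
    show "b * c \<noteq> 0" using b(1) c(1) by simp
    fix y z assume "y \<in> scale a I" "z \<in> scale a I"
    then obtain y' z' where "y' \<in> I" "y = a * y'" "z' \<in> I" "z = a * z'" by blast
    moreover from this have "a * (y' + z') \<in> scale a I" using fracD(3)[OF assms(1)] by blast
    ultimately show "y + z \<in> scale a I" by (simp add: distrib_left)
  next
    fix r y assume r: "r \<in> O\<^sub>K" and "y \<in> scale a I"
    then obtain y' where "y' \<in> I" "y = a * y'" by blast
    moreover from this r have "a * (r * y') \<in> scale a I" using fracD(4)[OF assms(1)] by blast
    ultimately show "r * y \<in> scale a I" by (simp add: mult.left_commute)
  qed
qed

lemma frac_mult:
  assumes "I \<in> fracs" "I' \<in> fracs"
  shows "ideal_mult I I' \<in> fracs"
proof -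
  obtain x where x: "x \<in> I" "x \<noteq> 0" using frac_nonzero[OF assms(1)] by blast
  obtain y where y: "y \<in> I'" "y \<noteq> 0" using frac_nonzero[OF assms(2)] by blast
  obtain b where b: "b \<noteq> 0" "\<And>x. x \<in> I \<Longrightarrow> \<kappa> b * x \<in> O\<^sub>K" using frac_denominator[OF assms(1)] by blast
  obtain c where c: "c \<noteq> 0" "\<And>x. x \<in> I' \<Longrightarrow> \<kappa> c * x \<in> O\<^sub>K" using frac_denominator[OF assms(2)] by blast
  have den: "\<kappa> (b * c) * z \<in> O\<^sub>K" if "z \<in> ideal_mult I I'" for z
    using that
  proof (induction rule: ideal_mult_induct)
    case (prod i j)
    from J_O_mult[OF b(2)[OF prod(1)] c(2)[OF prod(2)]] show ?case by (simp add: hom_mult mult_ac)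
  qed (simp add: distrib_left J_add)
  have sm: "r * z \<in> ideal_mult I I'" if "r \<in> O\<^sub>K" "z \<in> ideal_mult I I'" for r z
    using that(2)
  proof (induction rule: ideal_mult_induct)
    case (prod i j)
    have "(r * i) * j \<in> ideal_mult I I'" using fracD(4)[OF assms(1)] that prod by (intro ideal_mult_prod) auto
    thus ?case by (simp add: mult.assoc)
  qed (simp add: distrib_left ideal_mult_add)
  have xy: "x * y \<in> ideal_mult I I'" "x * y \<noteq> 0" using x y by (simp_all add: ideal_mult_prod)
  have "b * c \<noteq> 0" using b(1) c(1) by simp
  from fracI[OF xy ideal_mult_add sm this den] show ?thesis .
qed

lemma ideal_mult_one:
  assumes "I \<in> fracs"
  shows "ideal_mult O\<^sub>K I = I"
proof
  show "ideal_mult O\<^sub>K I \<subseteq> I" by (rule ideal_mult_subset) (use fracD[OF assms] in auto)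
  show "I \<subseteq> ideal_mult O\<^sub>K I" using ideal_mult_prod[OF O_1] by fastforce
qed

lemma frac_\<sigma>:
  assumes "I \<in> fracs"
  shows "\<sigma> ` I \<in> fracs"
proof -
  obtain x where x: "x \<in> I" "x \<noteq> 0" using frac_nonzero[OF assms(1)] by blast
  obtain b where b: "b \<noteq> 0" "\<And>x. x \<in> I \<Longrightarrow> \<kappa> b * x \<in> O\<^sub>K" using frac_denominator[OF assms(1)] by blast
  have den: "\<kappa> b * \<sigma> y \<in> O\<^sub>K" if "y \<in> I" for y
    using J_\<sigma>[OF b(2)[OF that]] by (simp add: \<sigma>.hom_mult)
  show ?thesis
  proof (rule fracI)
    show "\<sigma> x \<in> \<sigma> ` I" "\<sigma> x \<noteq> 0" using x by auto
    show "\<kappa> b * y \<in> O\<^sub>K" if "y \<in> \<sigma> ` I" for y using that den by blast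
    show "b \<noteq> 0" by (rule b(1))
    fix y z assume "y \<in> \<sigma> ` I" "z \<in> \<sigma> ` I"
    then obtain y' z' where "y' \<in> I" "y = \<sigma> y'" "z' \<in> I" "z = \<sigma> z'" by blast
    moreover from this have "\<sigma> (y' + z') \<in> \<sigma> ` I" using fracD(3)[OF assms(1)] by blast
    ultimately show "y + z \<in> \<sigma> ` I" by (simp add: \<sigma>.hom_add)
  next
    fix r y assume r: "r \<in> O\<^sub>K" and "y \<in> \<sigma> ` I"
    then obtain y' where y': "y' \<in> I" "y = \<sigma> y'" by blast
    have "(\<sigma> ^^ Suc (p - 1)) r = r" using p_pos \<sigma>_pow_p by simp
    hence "\<sigma> ((\<sigma> ^^ (p - 1)) r) = r" by simp
    moreover have "\<sigma> ((\<sigma> ^^ (p - 1)) r * y') \<in> \<sigma> ` I"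
      using fracD(4)[OF assms(1) J_\<sigma>_pow[OF r] y'(1)] by blast
    ultimately show "r * y \<in> \<sigma> ` I" by (simp add: \<sigma>.hom_mult y')
  qed
qed

text \<open>After scaling by the generator of \<open>I \<inter> k\<close>, a \<open>\<sigma>\<close>-stable ideal is trivial at every unramified
  prime, because there the coefficients of its elements lie in \<open>I \<inter> k\<close> locally.\<close>

lemma invariant_ideal_normalized:
  assumes I: "I \<in> fracs" "\<And>x. x \<in> I \<Longrightarrow> \<sigma> x \<in> I" and base: "\<And>c. \<iota> c \<in> I \<longleftrightarrow> c \<in> range to_fract"
  shows "\<exists>n. supported n \<and> I = J n"
proof -
  obtain d where d: "d \<noteq> 0" "\<And>x. x \<in> I \<Longrightarrow> \<kappa> d * x \<in> O\<^sub>K" using frac_denominator[OF I(1)] by blast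
  have one: "1 \<in> I" using base[of 1] by (metis hom_one rangeI to_fract_1)
  have "\<exists>y\<in>I. y \<noteq> 0 \<and> (\<forall>z\<in>I. z \<noteq> 0 \<longrightarrow> W \<pi> y \<le> W \<pi> z)" if \<pi>: "\<pi> \<in> ram" for \<pi>
  proof -
    \<comment> \<open>The denominator \<open>d\<close> bounds the valuation on \<open>I\<close> from
      below; after this shift a least value exists by well-ordering of the natural numbers.\<close>
    let ?m = "\<lambda>y. nat (W \<pi> y + W \<pi> (\<kappa> d))"
    have nonneg: "0 \<le> W \<pi> y + W \<pi> (\<kappa> d)" if "y \<in> I" "y \<noteq> 0" for y
    proof -
      have "\<kappa> d * y \<in> F \<pi> 0" using d(2)[OF that(1)] ram_irr[OF \<pi>] by (simp add: J_def)
      hence "0 \<le> W \<pi> (\<kappa> d * y)" using F_iff_W[OF \<pi>] d(1) that by simp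
      thus ?thesis using W_mult[OF \<pi>] d(1) that by simp
    qed
    obtain y where "(y \<in> I \<and> y \<noteq> 0) \<and> (\<forall>z. z \<in> I \<and> z \<noteq> 0 \<longrightarrow> ?m y \<le> ?m z)"
      using ex_has_least_nat[of "\<lambda>y. y \<in> I \<and> y \<noteq> 0" 1 ?m] one by auto
    thus ?thesis using nonneg by (force simp: nat_le_eq_zle)
  qed
  then obtain y where y: "\<And>\<pi>. \<pi> \<in> ram \<Longrightarrow> y \<pi> \<in> I \<and> y \<pi> \<noteq> 0 \<and> (\<forall>z\<in>I. z \<noteq> 0 \<longrightarrow> W \<pi> (y \<pi>) \<le> W \<pi> z)"
    by metis
  define n where "n \<pi> = (if \<pi> \<in> ram then W \<pi> (y \<pi>) else 0)" for \<pi>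
  have sub: "x \<in> F \<pi> (n \<pi>)" if "x \<in> I" "monic_irreducible \<pi>" for x \<pi>
  proof (cases "\<pi> \<in> ram")
    case True
    thus ?thesis using y[OF True] that F_iff_W[OF True, of x] by (cases "x = 0") (auto simp: n_def)
  next
    case False
    \<comment> \<open>Induction on the number of coordinates that may be nonzero. The leading one
      lies in the intersection of \<open>I\<close> with k, so by \<open>base\<close> it is a
      polynomial.\<close>
    have "\<forall>x\<in>I. (\<forall>i\<ge>k. coef x i = 0) \<longrightarrow> x \<in> F \<pi> 0" for k
    proof (induction k)
      case 0
      have "x = 0" if "\<forall>i\<ge>0. coef x i = 0" for x using coef_eqI[of x 0] that by (simp add: coef_simps)
      thus ?case by (metis fil_0)
    next
      case (Suc k)
      show ?case
      proof (intro ballI impI)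
        fix x assume x: "x \<in> I" "\<forall>i\<ge>Suc k. coef x i = 0"
        show "x \<in> F \<pi> 0"
        proof (cases "coef x k = 0")
          case True
          hence "\<forall>i\<ge>k. coef x i = 0" using x(2) by (metis Suc_leI le_neq_implies_less)
          thus ?thesis using Suc x(1) by blast
        next
          case c: False
          have kp: "k < p" using c coef_ge[of k x] by force
          have "degree (rep x) = k"
          proof (rule antisym)
            show "degree (rep x) \<le> k" using x(2) by (intro degree_le) (auto simp: coef_def)
            show "k \<le> degree (rep x)" using c by (intro le_degree) (simp add: coef_def)
          qed
          moreover have "\<iota> (lead_coeff (rep x)) \<in> I"
            by (rule lead_coeff_mem[where x = x]) (use I(2) x fracD(3)[OF I(1)] frac_diff[OF I(1)] in auto)
          ultimately have "\<iota> (coef x k) \<in> I" by (simp add: coef_def)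
          then obtain a where a: "coef x k = to_fract a" using base by auto
          have Bk: "to_fract B ^ k \<noteq> 0" "pval \<pi> (to_fract B ^ k) = 0"
            using B_nz ram_prod(3)[OF that(2) False, of "\<lambda>\<pi>. nat (ee \<pi>)"]
            by (simp_all add: val_power[OF valuation_pval[OF that(2)]] B_def)
          \<comment> \<open>The leading term of \<open>x\<close>, multiplied by a power of
            \<open>B\<close> to become integral; it lies in \<open>I\<close> because 1 does.
            \<open>B\<close> is a unit at the unramified \<pi>, so the multiplication can be undone
            there.\<close>
          define t where "t = \<kappa> a * (\<kappa> B * \<alpha>) ^ k"
          have tO: "t \<in> O\<^sub>K" unfolding t_def using O_\<kappa> O_power[OF B_\<alpha>] by (intro J_O_mult)
          have tI: "t \<in> I" using fracD(4)[OF I(1) tO one] by simp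
          have t_alt: "t = \<iota> (coef x k * to_fract B ^ k) * \<alpha> ^ k"
            unfolding t_def a by (simp add: hom_mult hom_power power_mult_distrib)
          define x1 where "x1 = \<iota> (to_fract B ^ k) * x - t"
          have "\<iota> (to_fract B ^ k) * x \<in> I"
            using fracD(4)[OF I(1) O_\<kappa>[of "B ^ k"] x(1)] by (simp add: \<kappa>_power hom_power)
          hence x1: "x1 \<in> I" unfolding x1_def using frac_diff[OF I(1)] tI by blast
          have "\<forall>i\<ge>k. coef x1 i = 0"
          proof (intro allI impI)
            fix i assume i: "k \<le> i"
            have "coef x1 i = to_fract B ^ k * coef x i - (if i = k then coef x k * to_fract B ^ k else 0)"
              unfolding x1_def t_alt coef_simps(2) by (simp only: coef_simps(4)[of _ x] coef_monomial[OF kp])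
            thus "coef x1 i = 0" using i x(2) by (cases "i = k") auto
          qed
          hence "x1 \<in> F \<pi> 0" using Suc x1 by blast
          moreover have "t \<in> F \<pi> 0" using tO that(2) by (simp add: J_def)
          ultimately have "x1 + t \<in> F \<pi> 0" using fil_add[OF adm[OF that(2)]] by blast
          hence "\<iota> (to_fract B ^ k) * x \<in> F \<pi> (0 + int p * pval \<pi> (to_fract B ^ k))"
            using Bk by (simp add: x1_def)
          thus ?thesis using fil_scale_iff[OF adm[OF that(2)] Bk(1)] by blast
        qed
      qed
    qed
    from this[of p] have "x \<in> F \<pi> 0" using that(1) coef_ge by blast
    thus ?thesis using False by (simp add: n_def)
  qed
  have "J n \<subseteq> I"
  proof
    fix x assume x: "x \<in> J n"
    show "x \<in> I"
    proof (rule local_global)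
      fix \<pi> :: "'a poly" assume \<pi>: "monic_irreducible \<pi>"
      show "\<exists>y\<in>I. y \<noteq> 0 \<and> x / y \<in> F \<pi> 0"
      proof (cases "\<pi> \<in> ram")
        case True
        have "x / y \<pi> \<in> F \<pi> 0"
        proof (cases "x = 0")
          case False
          have "x \<in> F \<pi> (n \<pi>)" using x \<pi> by (simp add: J_def)
          hence "W \<pi> (y \<pi>) \<le> W \<pi> x" using F_iff_W[OF True False] True by (simp add: n_def)
          thus ?thesis using y[OF True] False W_divide[OF True False, of "y \<pi>"] F_iff_W[OF True, of "x / y \<pi>"] by simp
        qed simp
        thus ?thesis using y[OF True] by blast
      next
        case False
        have "x \<in> F \<pi> (n \<pi>)" using x \<pi> by (simp add: J_def)
        thus ?thesis using one False by (intro bexI[of _ 1]) (auto simp: n_def)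
      qed
    qed (use fracD[OF I(1)] in auto)
  qed
  moreover have "I \<subseteq> J n" using sub by (auto simp: J_def)
  ultimately show ?thesis by (intro exI[of _ n]) (auto simp: supported_def n_def)
qed

text \<open>The intersection of \<open>I\<close> with k is a fractional ideal of the polynomial
  ring, hence generated by some \<open>g\<close>. It is nonzero because a \<sigma>-stable ideal
  contains the leading coordinates of its elements. Division by \<open>g\<close> reduces to the
  normalized case.\<close>

lemma invariant_ideal:
  assumes I: "I \<in> fracs" "\<sigma> ` I = I"
  shows "\<exists>g n. g \<noteq> 0 \<and> supported n \<and> I = scale (\<iota> g) (J n)"
proof -
  obtain b where b: "b \<noteq> 0" "\<And>x. x \<in> I \<Longrightarrow> \<kappa> b * x \<in> O\<^sub>K" using frac_denominator[OF I(1)] by blast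
  define A where "A = {a. \<iota> (to_fract a / to_fract b) \<in> I}"
  have "\<exists>d\<in>A. \<forall>a\<in>A. d dvd a"
  proof (rule poly_ideal_principal)
    show "0 \<in> A" using fracD(1)[OF I(1)] by (simp add: A_def)
    show "x + y \<in> A" if "x \<in> A" "y \<in> A" for x y
    proof -
      have "\<iota> (to_fract x / to_fract b) + \<iota> (to_fract y / to_fract b) \<in> I"
        using that fracD(3)[OF I(1)] by (simp add: A_def)
      thus ?thesis by (simp add: A_def hom_add[symmetric] add_divide_distrib)
    qed
    show "x * y \<in> A" if "y \<in> A" for x y
    proof -
      have "\<kappa> x * \<iota> (to_fract y / to_fract b) \<in> I" using that fracD(4)[OF I(1) O_\<kappa>] by (simp add: A_def)
      thus ?thesis by (simp add: A_def hom_mult[symmetric])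
    qed
  qed
  then obtain a0 where a0: "a0 \<in> A" "\<And>a. a \<in> A \<Longrightarrow> a0 dvd a" by blast
  have inA: "\<exists>a\<in>A. c = to_fract a / to_fract b" if "\<iota> c \<in> I" for c
  proof -
    have "\<iota> (to_fract b * c) \<in> O\<^sub>K" using b(2)[OF that] by (simp add: hom_mult)
    then obtain a where "to_fract b * c = to_fract a" using O_\<iota> by blast
    hence "c = to_fract a / to_fract b" using b(1) by (simp add: field_simps)
    thus ?thesis using that by (auto simp: A_def)
  qed
  have "a0 \<noteq> 0"
  proof
    assume a: "a0 = 0"
    obtain x where x: "x \<in> I" "x \<noteq> 0" using frac_nonzero[OF I(1)] by blast
    have "\<iota> (lead_coeff (rep x)) \<in> I"
      by (rule lead_coeff_mem[where x = x]) (use I(2) x fracD(3)[OF I(1)] frac_diff[OF I(1)] in auto)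
    then obtain a' where "a' \<in> A" "lead_coeff (rep x) = to_fract a' / to_fract b" using inA by blast
    moreover have "lead_coeff (rep x) \<noteq> 0" using x rep_eq_0_iff by simp
    ultimately show False using a a0(2)[of a'] by auto
  qed
  define g where "g = to_fract a0 / to_fract b"
  have g0: "g \<noteq> 0" using \<open>a0 \<noteq> 0\<close> b by (simp add: g_def)
  have base: "\<iota> (g * c) \<in> I \<longleftrightarrow> c \<in> range to_fract" for c
  proof
    assume "\<iota> (g * c) \<in> I"
    then obtain a where a: "a \<in> A" "g * c = to_fract a / to_fract b" using inA by blast
    from a(1) have "a0 dvd a" by (rule a0(2))
    then obtain k where "a = a0 * k" by (elim dvdE)
    hence "g * c = g * to_fract k" using a by (simp add: g_def)
    thus "c \<in> range to_fract" using g0 by auto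
  next
    assume "c \<in> range to_fract"
    then obtain k where "c = to_fract k" by blast
    moreover have "\<kappa> k * \<iota> g \<in> I" using a0(1) fracD(4)[OF I(1) O_\<kappa>] by (simp add: A_def g_def)
    ultimately show "\<iota> (g * c) \<in> I" by (simp add: hom_mult mult.commute)
  qed
  let ?I' = "scale (inverse (\<iota> g)) I"
  have mem: "x \<in> ?I' \<longleftrightarrow> \<iota> g * x \<in> I" for x
    using g0 mem_scale_iff[of "inverse (\<iota> g)" x I] by (simp add: field_simps)
  have "\<exists>n. supported n \<and> ?I' = J n"
  proof (rule invariant_ideal_normalized)
    show "?I' \<in> fracs" using frac_scale[OF I(1)] g0 by simp
    show "\<sigma> x \<in> ?I'" if "x \<in> ?I'" for x
    proof -
      have "\<sigma> (\<iota> g * x) \<in> I" using that I(2) mem by blast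
      thus ?thesis unfolding mem by (simp add: \<sigma>.hom_mult)
    qed
    show "\<iota> c \<in> ?I' \<longleftrightarrow> c \<in> range to_fract" for c
      unfolding mem using base[of c] by (simp add: hom_mult)
  qed
  then obtain n where n: "supported n" "?I' = J n" by blast
  have "I = scale (\<iota> g) ?I'" using g0 unfolding scale_scale by simp
  thus ?thesis using n g0 by metis
qed

end

section \<open>The class group and its invariant classes\<close>

context artin_schreier_function_field
begin

abbreviation frac_group :: "'k set monoid" where "frac_group \<equiv> fractional_ideal_group O\<^sub>K"
abbreviation Cl :: "'k set set monoid" where "Cl \<equiv> class_group O\<^sub>K"
abbreviation principal :: "'k set set" where "principal \<equiv> principal_fractional_ideals O\<^sub>K"

lemma frac_group_simps [simp]:
  "carrier frac_group = fracs" "monoid.mult frac_group = ideal_mult" "one frac_group = O\<^sub>K"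
  by (simp_all add: fractional_ideal_group_def)

lemma supported_0: "supported (\<lambda>_. 0)" by (simp add: supported_def)

lemma O_frac: "O\<^sub>K \<in> fracs" by (rule J_frac[OF supported_0])

lemma comm_monoid_frac_group: "comm_monoid frac_group"
proof (rule comm_monoidI)
  fix I I' I'' assume I: "I \<in> carrier frac_group" "I' \<in> carrier frac_group"
  thus "I \<otimes>\<^bsub>frac_group\<^esub> I' \<in> carrier frac_group" by (simp add: frac_mult)
  show "\<one>\<^bsub>frac_group\<^esub> \<otimes>\<^bsub>frac_group\<^esub> I = I" using I by (simp add: ideal_mult_one)
  show "I \<otimes>\<^bsub>frac_group\<^esub> I' = I' \<otimes>\<^bsub>frac_group\<^esub> I" by (simp add: ideal_mult_commute)
  show "I \<otimes>\<^bsub>frac_group\<^esub> I' \<otimes>\<^bsub>frac_group\<^esub> I'' = I \<otimes>\<^bsub>frac_group\<^esub> (I' \<otimes>\<^bsub>frac_group\<^esub> I'')"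
    by (simp add: ideal_mult_assoc)
qed (simp add: O_frac)

lemma \<sigma>_image_mult: "\<sigma> ` ideal_mult I I' = ideal_mult (\<sigma> ` I) (\<sigma> ` I')"
  by (rule ideal_mult_image) (auto simp: \<sigma>.hom_add \<sigma>.hom_mult)

lemma \<sigma>_image_O: "\<sigma> ` J n = J n"
proof
  show "J n \<subseteq> \<sigma> ` J n"
  proof
    fix x assume x: "x \<in> J n"
    have "(\<sigma> ^^ Suc (p - 1)) x = x" using p_pos \<sigma>_pow_p by simp
    hence "x = \<sigma> ((\<sigma> ^^ (p - 1)) x)" by simp
    thus "x \<in> \<sigma> ` J n" using J_\<sigma>_pow[OF x] by blast
  qed
qed (use J_\<sigma> in auto)

lemma scale_mult_scale: "ideal_mult (scale a I) (scale b I') = scale (a * b) (ideal_mult I I')"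
proof -
  have "ideal_mult (scale a I) (scale b I') = scale a (scale b (ideal_mult I' I))"
    unfolding ideal_mult_scale by (subst ideal_mult_commute) (simp only: ideal_mult_scale)
  thus ?thesis by (simp add: scale_scale ideal_mult_commute)
qed

text \<open>The product of the conjugates of \<open>I\<close> is an invariant ideal, and the invariant ideals are
  visibly invertible.\<close>

lemma frac_inverse:
  assumes I: "I \<in> fracs"
  shows "\<exists>I'\<in>fracs. ideal_mult I' I = O\<^sub>K"
proof -
  interpret M: comm_monoid frac_group by (rule comm_monoid_frac_group)
  define f where "f j = (\<sigma> ^^ j) ` I" for j
  have fS: "f (Suc j) = \<sigma> ` f j" for j by (simp add: f_def image_comp comp_def)
  have f: "f j \<in> fracs" for j
  proof (induction j)
    case 0
    thus ?case using I by (simp add: f_def)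
  qed (simp add: fS frac_\<sigma>)
  have img: "\<sigma> ` finprod frac_group f {..n} = finprod frac_group (\<lambda>j. f (Suc j)) {..n}" for n
  proof (induction n)
    case 0
    have "finprod frac_group f {..0} = f 0" "finprod frac_group (\<lambda>j. f (Suc j)) {..0} = f (Suc 0)"
      by (rule M.finprod_0; use f in simp)+
    thus ?case by (simp only: fS)
  next
    case (Suc n)
    have 1: "finprod frac_group f {..Suc n} = ideal_mult (f (Suc n)) (finprod frac_group f {..n})"
      using M.finprod_Suc[of f n] f by simp
    have 2: "finprod frac_group (\<lambda>j. f (Suc j)) {..Suc n} =
        ideal_mult (f (Suc (Suc n))) (finprod frac_group (\<lambda>j. f (Suc j)) {..n})"
      using M.finprod_Suc[of "\<lambda>j. f (Suc j)" n] f by simp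
    show ?case unfolding 1 2 \<sigma>_image_mult Suc fS[symmetric] ..
  qed
  \<comment> \<open>With \<open>p\<close> at least 2, the product \<open>?R\<close> of the
    conjugates other than \<open>I\<close> itself is nonempty and can be indexed by
    \<open>{..k}\<close>.\<close>
  have "p = Suc (Suc (p - 2))" using p_gt_1 by simp
  then obtain k where k: "p = Suc (Suc k)" by blast
  let ?R = "finprod frac_group (\<lambda>j. f (Suc j)) {..k}"
  let ?P = "finprod frac_group f {..Suc k}"
  have R: "?R \<in> fracs" using M.finprod_closed[of "\<lambda>j. f (Suc j)" "{..k}"] f by auto
  have P: "?P = ideal_mult ?R I"
    using f by (subst M.finprod_Suc2) (auto simp: f_def)
  \<comment> \<open>The last conjugate is \<open>I\<close> again, so \<sigma> only permutes the
    factors of \<open>?P\<close>.\<close>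
  have "f (Suc (Suc k)) = I" unfolding k[symmetric] f_def \<sigma>_pow_p by simp
  hence "\<sigma> ` ?P = ideal_mult I ?R"
    unfolding img using f by (subst M.finprod_Suc) auto
  hence inv: "\<sigma> ` ?P = ?P" unfolding P by (simp add: ideal_mult_commute)
  have PF: "?P \<in> fracs" unfolding P by (rule frac_mult[OF R I])
  obtain g n where g: "g \<noteq> 0" "supported n" "?P = scale (\<iota> g) (J n)" using invariant_ideal[OF PF inv] by blast
  have s: "supported (\<lambda>\<pi>. - n \<pi>)" using g(2) by (simp add: supported_def)
  let ?Q = "scale (inverse (\<iota> g)) (J (\<lambda>\<pi>. - n \<pi>))"
  have Q: "?Q \<in> fracs" using frac_scale[OF J_frac[OF s]] g(1) by simp
  have "ideal_mult ?Q ?P = scale (inverse (\<iota> g) * \<iota> g) (ideal_mult (J (\<lambda>\<pi>. - n \<pi>)) (J n))"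
    unfolding g(3) by (rule scale_mult_scale)
  also have "\<dots> = O\<^sub>K" using g(1) by (simp add: J_mult_eq[OF s g(2)])
  finally have "ideal_mult (ideal_mult ?Q ?R) I = O\<^sub>K" unfolding P by (simp add: ideal_mult_assoc)
  thus ?thesis using frac_mult[OF Q R] by blast
qed

lemma comm_group_frac_group: "comm_group frac_group"
proof -
  interpret M: comm_monoid frac_group by (rule comm_monoid_frac_group)
  show ?thesis
  proof (rule comm_groupI)
    show "\<exists>y\<in>carrier frac_group. y \<otimes>\<^bsub>frac_group\<^esub> x = \<one>\<^bsub>frac_group\<^esub>" if "x \<in> carrier frac_group" for x
      using frac_inverse that by simp
  qed (rule M.m_closed M.one_closed M.m_assoc M.m_comm M.l_one; assumption)+
qed

lemma principal_altdef: "principal = {scale a O\<^sub>K | a. a \<noteq> 0}"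
  by (simp add: principal_fractional_ideals_def)

lemma principalI: "a \<noteq> 0 \<Longrightarrow> scale a O\<^sub>K \<in> principal"
  unfolding principal_altdef by blast

lemma principal_ne: "principal \<noteq> {}"
  using principalI[OF one_neq_zero] by (metis empty_iff)

lemma principal_sub: "principal \<subseteq> fracs"
proof
  fix I assume "I \<in> principal"
  then obtain a where "a \<noteq> 0" "I = scale a O\<^sub>K" unfolding principal_altdef by blast
  thus "I \<in> fracs" using frac_scale[OF O_frac] by blast
qed

lemma principal_mult:
  assumes "I \<in> principal" "I' \<in> principal"
  shows "ideal_mult I I' \<in> principal"
proof -
  obtain a where a: "a \<noteq> 0" "I = scale a O\<^sub>K" using assms(1) unfolding principal_altdef by blast
  obtain b where b: "b \<noteq> 0" "I' = scale b O\<^sub>K" using assms(2) unfolding principal_altdef by blast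
  have "ideal_mult I I' = scale (a * b) O\<^sub>K"
    unfolding a(2) b(2) scale_mult_scale ideal_mult_one[OF O_frac] ..
  thus ?thesis using principalI[of "a * b"] a b by simp
qed

lemma principal_inverse:
  assumes "I \<in> principal"
  shows "\<exists>I'\<in>principal. ideal_mult I' I = O\<^sub>K"
proof -
  obtain a where a: "a \<noteq> 0" "I = scale a O\<^sub>K" using assms(1) unfolding principal_altdef by blast
  have "ideal_mult (scale (inverse a) O\<^sub>K) I = scale (inverse a * a) O\<^sub>K"
    unfolding a(2) scale_mult_scale ideal_mult_one[OF O_frac] ..
  also have "\<dots> = O\<^sub>K" using a(1) by simp
  finally show ?thesis using principalI[of "inverse a"] a(1) by (intro bexI) auto
qed

lemma normal_principal: "principal \<lhd> frac_group"
proof -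
  have "subgroup principal frac_group"
  proof (rule group.subgroupI)
    show "group frac_group" using comm_group_frac_group comm_group.axioms(2) by blast
    show "inv\<^bsub>frac_group\<^esub> I \<in> principal" if I: "I \<in> principal" for I
    proof -
      obtain I' where I': "I' \<in> principal" "ideal_mult I' I = O\<^sub>K" using principal_inverse[OF I] by blast
      have "inv\<^bsub>frac_group\<^esub> I = I'"
        by (rule group.inv_equality[OF \<open>group frac_group\<close>]) (use I I' principal_sub in auto)
      thus ?thesis using I' by simp
    qed
  qed (use principal_sub principal_ne principal_mult in simp_all)
  thus ?thesis by (rule comm_group.subgroup_imp_normal[OF comm_group_frac_group])
qed

lemma ideal_class_altdef:
  assumes "I \<in> fracs"
  shows "ideal_class O\<^sub>K I = {scale a I | a. a \<noteq> 0}"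
proof -
  have "ideal_mult (scale a O\<^sub>K) I = scale a I" for a
    by (simp add: ideal_mult_scale ideal_mult_one[OF assms])
  thus ?thesis unfolding ideal_class_def r_coset_def principal_altdef by auto
qed

lemma mem_ideal_class:
  assumes "I \<in> fracs"
  shows "I \<in> ideal_class O\<^sub>K I"
proof -
  have "scale 1 I \<in> {scale a I | a. a \<noteq> 0}" using one_neq_zero by blast
  thus ?thesis unfolding ideal_class_altdef[OF assms] scale_1 .
qed

lemma ideal_class_eq_iff:
  assumes "I \<in> fracs" "I' \<in> fracs"
  shows "ideal_class O\<^sub>K I = ideal_class O\<^sub>K I' \<longleftrightarrow> (\<exists>a. a \<noteq> 0 \<and> I = scale a I')"
proof
  assume "ideal_class O\<^sub>K I = ideal_class O\<^sub>K I'"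
  moreover have "I \<in> ideal_class O\<^sub>K I" by (rule mem_ideal_class[OF assms(1)])
  ultimately show "\<exists>a. a \<noteq> 0 \<and> I = scale a I'" by (auto simp: ideal_class_altdef[OF assms(2)])
next
  assume "\<exists>a. a \<noteq> 0 \<and> I = scale a I'"
  then obtain a where a: "a \<noteq> 0" "I = scale a I'" by blast
  have sub: "ideal_class O\<^sub>K U \<subseteq> ideal_class O\<^sub>K Y"
    if UY: "U \<in> fracs" "Y \<in> fracs" "c \<noteq> 0" "U = scale c Y" for U Y c
  proof
    fix Z assume "Z \<in> ideal_class O\<^sub>K U"
    then obtain b where b: "b \<noteq> 0" "Z = scale b U" unfolding ideal_class_altdef[OF UY(1)] by blast
    have Z: "Z = scale (b * c) Y" unfolding b(2) UY(4) scale_scale ..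
    have "b * c \<noteq> 0" using b(1) UY(3) by simp
    thus "Z \<in> ideal_class O\<^sub>K Y" unfolding Z ideal_class_altdef[OF UY(2)] by blast
  qed
  have "I' = scale (inverse a) I" unfolding a(2) scale_scale using a(1) by simp
  thus "ideal_class O\<^sub>K I = ideal_class O\<^sub>K I'"
    using sub[OF assms a] sub[OF assms(2,1), of "inverse a"] a(1) by simp
qed

lemma comm_group_Cl: "comm_group Cl"
  unfolding class_group_def
  by (rule comm_group.abelian_FactGroup[OF comm_group_frac_group normal_imp_subgroup[OF normal_principal]])

lemma carrier_Cl: "carrier Cl = ideal_class O\<^sub>K ` fracs"
  unfolding class_group_def carrier_FactGroup ideal_class_def by simp

lemma Cl_mult:
  assumes "I \<in> fracs" "I' \<in> fracs"
  shows "ideal_class O\<^sub>K I \<otimes>\<^bsub>Cl\<^esub> ideal_class O\<^sub>K I' = ideal_class O\<^sub>K (ideal_mult I I')"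
  using normal.rcos_sum[OF normal_principal, of I I'] assms unfolding class_group_def ideal_class_def by simp

lemma Cl_one: "\<one>\<^bsub>Cl\<^esub> = ideal_class O\<^sub>K O\<^sub>K"
  unfolding ideal_class_altdef[OF O_frac] class_group_def by (simp add: principal_altdef)

definition cls :: "('a poly \<Rightarrow> int) \<Rightarrow> 'k set set" where "cls n = ideal_class O\<^sub>K (J n)"

lemma supported_add: "supported n \<Longrightarrow> supported n' \<Longrightarrow> supported (\<lambda>\<pi>. n \<pi> + n' \<pi>)"
  by (simp add: supported_def)

lemma cls_mult:
  assumes "supported n" "supported n'"
  shows "cls n \<otimes>\<^bsub>Cl\<^esub> cls n' = cls (\<lambda>\<pi>. n \<pi> + n' \<pi>)"
  unfolding cls_def using Cl_mult[OF J_frac J_frac] J_mult_eq assms by simp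

lemma cls_0: "cls (\<lambda>_. 0) = \<one>\<^bsub>Cl\<^esub>" by (simp add: cls_def Cl_one)

lemma cls_eq_one_iff:
  assumes "supported n"
  shows "cls n = \<one>\<^bsub>Cl\<^esub> \<longleftrightarrow> (\<exists>a. a \<noteq> 0 \<and> J n = scale a O\<^sub>K)"
  unfolding cls_def Cl_one by (rule ideal_class_eq_iff[OF J_frac[OF assms] O_frac])

lemma J_W: "x \<in> J n \<Longrightarrow> \<pi> \<in> ram \<Longrightarrow> x \<noteq> 0 \<Longrightarrow> n \<pi> \<le> W \<pi> x"
  using F_iff_W[of \<pi> x "n \<pi>"] ram_irr[of \<pi>] unfolding J_def by blast

text \<open>An element attaining the exponent on either side, transported to the other side by the
  scaling, gives one inequality each.\<close>

lemma J_scaled_supported: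
  assumes "supported n" "g \<noteq> 0" "scale (\<iota> g) (J n) = J n'" "supported n'" "\<pi> \<in> ram"
  shows "n' \<pi> = n \<pi> + int p * pval \<pi> g"
proof -
  obtain x where x: "x \<in> J n" "x \<noteq> 0" "W \<pi> x = n \<pi>" using J_attain[OF assms(1,5)] by blast
  obtain y where y: "y \<in> J n'" "y \<noteq> 0" "W \<pi> y = n' \<pi>" using J_attain[OF assms(4,5)] by blast
  have "\<iota> g * x \<in> J n'" using assms(3) x(1) by blast
  hence "n' \<pi> \<le> W \<pi> (\<iota> g * x)" using J_W[OF _ assms(5)] x(2) assms(2) by simp
  hence 1: "n' \<pi> \<le> n \<pi> + int p * pval \<pi> g"
    using W_mult[OF assms(5), of "\<iota> g" x] W_\<iota>[OF assms(5,2)] x assms(2) by simp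
  obtain z where z: "z \<in> J n" "y = \<iota> g * z" using y(1) assms(3) by blast
  have z0: "z \<noteq> 0" using y z by auto
  have "n \<pi> \<le> W \<pi> z" by (rule J_W[OF z(1) assms(5) z0])
  hence "n \<pi> + int p * pval \<pi> g \<le> n' \<pi>"
    using W_mult[OF assms(5), of "\<iota> g" z] W_\<iota>[OF assms(5,2)] z0 assms(2) y(3) z(2) by simp
  with 1 show ?thesis by simp
qed

section \<open>Invariant classes are the classes of invariant ideals\<close>

lemma char_a: "CHAR('a) = p"
  using char_field_hom[OF field_hom_const[where ?'a = 'a]] char_f by simp

text \<open>A finite field is perfect. As the norm of a constant is its p-th power, every constant
  is therefore the norm of a constant.\<close>

lemma frobenius_surj: "\<exists>d. d ^ p = (c :: 'a)"
proof -
  have ch: "prime CHAR('a)" "p = CHAR('a)" using prime_p char_a by simp_all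
  have "inj (\<lambda>d :: 'a. d ^ p)"
  proof (rule injI)
    fix x y :: 'a assume "x ^ p = y ^ p"
    hence "(x - y) ^ p = 0" using freshmans_dream_minus[OF ch, of x y] by simp
    thus "x = y" by simp
  qed
  hence "surj (\<lambda>d :: 'a. d ^ p)" by (rule finite_UNIV_inj_surj[rotated]) simp
  thus ?thesis by (metis surjD)
qed

abbreviation const :: "'a \<Rightarrow> 'k" where "const c \<equiv> \<kappa> [:c:]"

lemma O_unit_base:
  assumes "\<iota> c \<in> O\<^sub>K" "\<iota> (inverse c) \<in> O\<^sub>K" "c \<noteq> 0"
  shows "\<exists>c0. c0 \<noteq> 0 \<and> c = to_fract [:c0:]"
proof -
  obtain a b where ab: "c = to_fract a" "inverse c = to_fract b" using O_\<iota> assms by blast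
  hence "to_fract (a * b) = to_fract 1" using assms(3) by (metis right_inverse to_fract_1 to_fract_mult)
  hence "a * b = 1" by (simp only: to_fract_eq_iff)
  hence "degree a = 0" by (metis dvd_triv_left poly_dvd_1)
  then obtain c0 where "a = [:c0:]" using degree_eq_zeroE by blast
  thus ?thesis using ab assms(3) by (intro exI[of _ c0]) auto
qed

lemma const_power: "const (c ^ n) = const c ^ n"
proof -
  have "[:c ^ n:] = [:c:] ^ n"
  proof (induction n)
    case (Suc n)
    have "[:c ^ Suc n:] = [:c:] * [:c ^ n:]" by simp
    thus ?case unfolding Suc by simp
  qed (simp add: one_pCons)
  thus ?thesis by (simp only: \<kappa>_power)
qed

lemma scale_fixed_imp_O:
  assumes "I \<in> fracs" "scale c I = I"
  shows "c \<in> O\<^sub>K"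
proof -
  obtain I' where I': "ideal_mult I' I = O\<^sub>K" using frac_inverse[OF assms(1)] by blast
  have "scale c (ideal_mult I I') = ideal_mult I I'" by (metis assms(2) ideal_mult_scale)
  hence "scale c O\<^sub>K = O\<^sub>K" using I' by (simp add: ideal_mult_commute)
  moreover have "c * 1 \<in> scale c O\<^sub>K" using O_1 by blast
  ultimately show ?thesis by simp
qed

lemma unit_of_norm:
  assumes I: "I \<in> fracs" and a: "a \<noteq> 0" "scale (\<iota> (nrm a)) I = I"
  shows "\<exists>d b. d \<noteq> 0 \<and> b \<noteq> 0 \<and> a = const d * (\<sigma> b / b)"
proof -
  have n0: "nrm a \<noteq> 0" using a nrm_eq_0_iff by simp
  \<comment> \<open>The inverse also stabilizes \<open>I\<close>, so after cancelling
    \<open>I\<close> the norm is a unit of the polynomial ring.\<close>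
  have "scale (\<iota> (inverse (nrm a))) I = scale (\<iota> (inverse (nrm a))) (scale (\<iota> (nrm a)) I)" using a(2) by simp
  also have "\<dots> = scale (\<iota> (inverse (nrm a)) * \<iota> (nrm a)) I" by (rule scale_scale)
  also have "\<dots> = I" using n0 by (simp add: hom_mult[symmetric])
  finally obtain c0 where c0: "c0 \<noteq> 0" "nrm a = to_fract [:c0:]"
    using O_unit_base scale_fixed_imp_O[OF I] a(2) n0 by blast
  obtain d where d: "d ^ p = c0" using frobenius_surj by blast
  hence d0: "d \<noteq> 0" using c0 p_pos by (auto simp: power_0_left)
  let ?d = "to_fract [:d:]"
  have "\<iota> (?d ^ p) = \<iota> (nrm a)" using const_power[of d p] d c0 by (simp add: hom_power)
  hence "?d ^ p = nrm a" by simp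
  moreover have "nrm (\<iota> (inverse ?d) * a) = inverse (?d ^ p) * nrm a"
    by (simp add: nrm_mult nrm_\<iota> power_inverse)
  ultimately have "nrm (\<iota> (inverse ?d) * a) = 1" using n0 by simp
  then obtain b where b: "b \<noteq> 0" "\<iota> (inverse ?d) * a = \<sigma> b / b" using hilbert_90 by blast
  have "const d * (\<iota> (inverse ?d) * a) = a" using d0 by (simp add: mult.assoc[symmetric] hom_mult[symmetric])
  thus ?thesis using b d0 by metis
qed

lemma scale_const: "c \<noteq> 0 \<Longrightarrow> I \<in> fracs \<Longrightarrow> scale (const c) I = I"
proof -
  assume c: "c \<noteq> 0" and I: "I \<in> fracs"
  have s: "scale (const c) I \<subseteq> I" for c using fracD(4)[OF I O_\<kappa>] by auto
  have "const c * const (inverse c) = 1" using c by (simp add: \<kappa>_mult[symmetric] one_pCons[symmetric] del: to_fract_mult)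
  hence "I = scale (const c) (scale (const (inverse c)) I)" by (simp add: scale_scale)
  thus ?thesis using s[of c] s[of "inverse c"] by blast
qed

lemma \<sigma>_scale: "\<sigma> ` scale a I = scale (\<sigma> a) (\<sigma> ` I)"
  by (simp add: image_image \<sigma>.hom_mult)

text \<open>If \<open>\<sigma> I = a I\<close>, then the norm of \<open>a\<close> is a constant, hence the norm of a constant, and Hilbert 90
  turns \<open>I\<close> into an invariant ideal in its class.\<close>

lemma invariant_class:
  assumes I: "I \<in> fracs" and a: "a \<noteq> 0" "\<sigma> ` I = scale a I"
  shows "\<exists>n. supported n \<and> ideal_class O\<^sub>K I = cls n"
proof -
  \<comment> \<open>The factors picked up by iteration are the partial norms of \<open>a\<close>. At
    \<open>j = p\<close> the ideal returns to itself and the full norm must stabilize it.\<close>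
  have "(\<sigma> ^^ j) ` I = scale (\<Prod>i<j. (\<sigma> ^^ i) a) I" for j
  proof (induction j)
    case (Suc j)
    have "(\<sigma> ^^ Suc j) ` I = \<sigma> ` ((\<sigma> ^^ j) ` I)" by (simp add: image_comp comp_def)
    also have "\<dots> = scale (\<sigma> (\<Prod>i<j. (\<sigma> ^^ i) a) * a) I"
      unfolding Suc \<sigma>_scale a(2) scale_scale ..
    also have "\<sigma> (\<Prod>i<j. (\<sigma> ^^ i) a) * a = (\<Prod>i<Suc j. (\<sigma> ^^ i) a)"
      unfolding prod.lessThan_Suc_shift by (simp add: \<sigma>.hom_prod mult.commute)
    finally show ?case .
  qed simp
  from this[of p] have "scale (\<iota> (nrm a)) I = I" by (simp add: \<sigma>_pow_p \<iota>_nrm)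
  then obtain d b where db: "d \<noteq> 0" "b \<noteq> 0" "a = const d * (\<sigma> b / b)"
    using unit_of_norm[OF I a(1)] by blast
  have "scale a I = scale (\<sigma> b / b) (scale (const d) I)" unfolding db(3) scale_scale by (simp only: mult.commute[of "const d"])
  hence aI: "\<sigma> ` I = scale (\<sigma> b / b) I" unfolding a(2) using scale_const[OF db(1) I] by simp
  let ?I = "scale (inverse b) I"
  have F: "?I \<in> fracs" using frac_scale[OF I] db(2) by simp
  have "\<sigma> ` ?I = scale (\<sigma> (inverse b) * (\<sigma> b / b)) I" unfolding \<sigma>_scale aI scale_scale ..
  also have "\<sigma> (inverse b) * (\<sigma> b / b) = inverse b" using db(2) unfolding \<sigma>.hom_inverse by (simp add: divide_inverse)
  finally obtain g n where gn: "g \<noteq> 0" "supported n" "?I = scale (\<iota> g) (J n)" using invariant_ideal[OF F] by blast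
  have "I = scale b ?I" using db(2) by (simp only: scale_scale) simp
  hence "I = scale (b * \<iota> g) (J n)" unfolding gn(3) scale_scale .
  hence "ideal_class O\<^sub>K I = cls n"
    unfolding cls_def ideal_class_eq_iff[OF I J_frac[OF gn(2)]] using db gn by (intro exI[of _ "b * \<iota> g"]) simp
  thus ?thesis using gn by blast
qed

lemma invariant_classes_eq:
  "invariant_classes (galois_group \<iota>) O\<^sub>K = {cls n | n. supported n}"
proof (intro equalityI subsetI)
  fix C assume C: "C \<in> invariant_classes (galois_group \<iota>) O\<^sub>K"
  then obtain I where I: "I \<in> fracs" "C = ideal_class O\<^sub>K I" by (auto simp: invariant_classes_def carrier_Cl)
  have "\<sigma> ^^ 1 \<in> galois_group \<iota>" unfolding galois_group using p_gt_1 by blast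
  hence "(\<lambda>I. \<sigma> ` I) ` C = C" using C by (simp add: invariant_classes_def)
  moreover have "I \<in> C" unfolding I(2) by (rule mem_ideal_class[OF I(1)])
  ultimately have "\<sigma> ` I \<in> C" by blast
  then obtain a where "a \<noteq> 0" "\<sigma> ` I = scale a I" unfolding I(2) ideal_class_altdef[OF I(1)] by blast
  thus "C \<in> {cls n | n. supported n}" using invariant_class[OF I(1)] I(2) by blast
next
  fix C assume "C \<in> {cls n | n. supported n}"
  then obtain n where n: "supported n" "C = cls n" by blast
  note F = J_frac[OF n(1)]
  have C: "C = {scale a (J n) | a. a \<noteq> 0}" unfolding n(2) cls_def by (rule ideal_class_altdef[OF F])
  have sub: "(\<lambda>I. \<sigma> ` I) ` C \<subseteq> C"
  proof
    fix Y assume "Y \<in> (\<lambda>I. \<sigma> ` I) ` C"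
    then obtain a where "a \<noteq> 0" "Y = \<sigma> ` scale a (J n)" unfolding C by blast
    hence "\<sigma> a \<noteq> 0" "Y = scale (\<sigma> a) (J n)" unfolding \<sigma>_scale \<sigma>_image_O by auto
    thus "Y \<in> C" unfolding C by blast
  qed
  have "C \<subseteq> (\<lambda>I. \<sigma> ` I) ` C"
  proof
    fix Y assume "Y \<in> C"
    then obtain a where a: "a \<noteq> 0" "Y = scale a (J n)" unfolding C by blast
    have "bij \<sigma>" using bij_\<sigma>_pow[of 1] by simp
    then obtain b where b: "\<sigma> b = a" by (metis bij_pointE)
    hence Y: "Y = \<sigma> ` scale b (J n)" using a by (simp only: \<sigma>_scale \<sigma>_image_O)
    have "b \<noteq> 0" using a b by auto
    hence "scale b (J n) \<in> C" unfolding C by blast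
    thus "Y \<in> (\<lambda>I. \<sigma> ` I) ` C" unfolding Y by (rule imageI)
  qed
  with sub have img: "(\<lambda>I. \<sigma> ` I) ` C = C" by (rule antisym)
  have pow: "(\<lambda>I. (\<sigma> ^^ j) ` I) ` C = C" for j
  proof (induction j)
    case (Suc j)
    have "(\<lambda>I. (\<sigma> ^^ Suc j) ` I) ` C = (\<lambda>I. \<sigma> ` I) ` ((\<lambda>I. (\<sigma> ^^ j) ` I) ` C)" by (simp add: image_image)
    thus ?case by (simp only: Suc img)
  qed simp
  have "C \<in> carrier Cl" unfolding n(2) cls_def carrier_Cl using F by blast
  moreover have "(\<lambda>I. \<tau> ` I) ` C = C" if \<tau>: "\<tau> \<in> galois_group \<iota>" for \<tau>
  proof -
    obtain j where j: "\<tau> = \<sigma> ^^ j" using \<tau> unfolding galois_group by blast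
    show ?thesis unfolding j by (rule pow)
  qed
  ultimately show "C \<in> invariant_classes (galois_group \<iota>) O\<^sub>K"
    unfolding invariant_classes_def by blast
qed

lemma J_cong: "(\<And>\<pi>. monic_irreducible \<pi> \<Longrightarrow> n \<pi> = n' \<pi>) \<Longrightarrow> J n = J n'"
  by (auto simp: J_def)

lemma J_power: "x \<in> J n \<Longrightarrow> x ^ k \<in> J (\<lambda>\<pi>. int k * n \<pi>)"
proof (induction k)
  case (Suc k)
  from J_mult[OF Suc.prems Suc.IH[OF Suc.prems]] show ?case by (simp add: algebra_simps)
qed (simp add: O_1)

text \<open>If \<open>x\<close> lies in the prime, so does its norm, which is then divisible by
  \<pi>; hence W is at least 1. Conversely, an integral \<open>x\<close> with W at least 1 at \<pi>
  has its p-th power in the ideal generated by \<pi>, and the prime contains a root of each of its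
  powers. In particular the prime above \<pi> is unique.\<close>

lemma prime_above_eq:
  assumes \<pi>: "\<pi> \<in> ram" and above: "prime_above \<iota> \<pi> \<PP>"
  shows "\<PP> = J (\<lambda>\<rho>. if \<rho> = \<pi> then 1 else 0)"
proof -
  let ?R = "ring_of_type_algebra\<lparr>carrier := O\<^sub>K\<rparr> :: 'k ring"
  have pr: "primeideal \<PP> ?R" and mem: "\<And>g. \<kappa> g \<in> \<PP> \<longleftrightarrow> \<pi> dvd g"
    using above unfolding prime_above_def ring_of_integers_eq by auto
  interpret P: primeideal \<PP> ?R by (rule pr)
  have R: "carrier ?R = O\<^sub>K" "monoid.mult ?R = (*)" by (simp_all add: ring_of_type_algebra_def)
  have sub: "\<PP> \<subseteq> O\<^sub>K" using P.a_subset R by simp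
  have l: "y * x \<in> \<PP>" if "x \<in> \<PP>" "y \<in> O\<^sub>K" for x y using P.I_l_closed that R by simp
  have prime: "x \<in> \<PP> \<or> y \<in> \<PP>" if "x \<in> O\<^sub>K" "y \<in> O\<^sub>K" "x * y \<in> \<PP>" for x y
    using P.I_prime that R by simp
  have one: "1 \<notin> \<PP>" using mem[of 1] degree_monic_irreducible[OF ram_irr[OF \<pi>]] by (auto simp: poly_dvd_1)
  note irr = ram_irr[OF \<pi>]
  show ?thesis
  proof (intro equalityI subsetI)
    fix x assume x: "x \<in> \<PP>"
    hence xO: "x \<in> O\<^sub>K" using sub by blast
    obtain a where a: "nrm x = to_fract a" using O_nrm[OF xO] by blast
    have "(\<Prod>j\<in>{1..<p}. (\<sigma> ^^ j) x) * x \<in> \<PP>" by (rule l[OF x O_nrm_cofactor[OF xO]])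
    hence "\<iota> (nrm x) \<in> \<PP>" by (simp add: nrm_split mult.commute)
    hence d: "\<pi> dvd a" using mem a by simp
    have "x \<in> F \<pi> 1"
    proof (cases "x = 0")
      case False
      hence "a \<noteq> 0" using a nrm_eq_0_iff[of x] by auto
      hence "0 < pmult \<pi> a" using d pmult_pos_iff[OF degree_monic_irreducible[OF irr]] by simp
      hence "1 \<le> W \<pi> x" unfolding W_def a pval_to_fract[OF irr \<open>a \<noteq> 0\<close>] by linarith
      thus ?thesis using F_iff_W[OF \<pi> False] by simp
    qed simp
    thus "x \<in> J (\<lambda>\<rho>. if \<rho> = \<pi> then 1 else 0)" using xO by (auto simp: J_def)
  next
    fix x assume x: "x \<in> J (\<lambda>\<rho>. if \<rho> = \<pi> then 1 else 0)"
    have xO: "x \<in> O\<^sub>K"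
      unfolding J_def
    proof (intro CollectI allI impI)
      fix \<rho> :: "'a poly" assume "monic_irreducible \<rho>"
      hence "x \<in> F \<rho> (if \<rho> = \<pi> then 1 else 0)" using x by (simp add: J_def)
      thus "x \<in> F \<rho> 0" by (rule fil_mono) auto
    qed
    have "J (\<lambda>\<rho>. int p * (if \<rho> = \<pi> then 1 else 0)) = J (\<lambda>\<rho>. 0 + int p * pval \<rho> (to_fract \<pi>))"
      by (rule J_cong) (auto simp: pval_self[OF irr] pval_other irr)
    also have "\<dots> = scale (\<kappa> \<pi>) O\<^sub>K" using J_shift[of "to_fract \<pi>" "\<lambda>_. 0"] monic_irreducible_nz[OF irr] by simp
    finally obtain y where y: "y \<in> O\<^sub>K" "x ^ p = \<kappa> \<pi> * y" using J_power[OF x, of p] by blast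
    hence "x ^ p \<in> \<PP>" using l[of "\<kappa> \<pi>" y] mem[of \<pi>] by (simp add: mult.commute)
    moreover have "x ^ k \<in> \<PP> \<Longrightarrow> x \<in> \<PP>" for k
    proof (induction k)
      case (Suc k)
      thus ?case using prime[OF xO O_power[OF xO], of k] by auto
    qed (use one in simp)
    ultimately show "x \<in> \<PP>" by blast
  qed
qed

end

section \<open>Lattices with a cyclic action of trace zero\<close>

text \<open>Periodic sequences model the group ring of the cyclic group of order p over the
  integers. Indexing by all integers lets shifts and reflections be written without reduction modulo
  p.\<close>

definition periodic :: "nat \<Rightarrow> (int \<Rightarrow> int) \<Rightarrow> bool" where
  "periodic p f \<longleftrightarrow> (\<forall>i. f (i + int p) = f i)"

definition period_sum :: "nat \<Rightarrow> (int \<Rightarrow> int) \<Rightarrow> int" where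
  "period_sum p f = (\<Sum>n<p. f (int n))"

definition difference :: "(int \<Rightarrow> int) \<Rightarrow> int \<Rightarrow> int" where
  "difference f = (\<lambda>i. f (i + 1) - f i)"

text \<open>Multiplication in the group ring; \<open>period_sum\<close> is the augmentation, and
  \<open>difference\<close> is multiplication by S - 1 for the shift S.\<close>

definition convolution :: "nat \<Rightarrow> (int \<Rightarrow> int) \<Rightarrow> (int \<Rightarrow> int) \<Rightarrow> int \<Rightarrow> int" where
  "convolution p f g i = period_sum p (\<lambda>j. f j * g (i - j))"

lemma periodicD: "periodic p f \<Longrightarrow> f (i + int p) = f i"
  by (simp add: periodic_def)

lemma periodic_mod:
  assumes "periodic p f"
  shows "f (i mod int p) = f i"
proof -
  have 1: "f (i + int p * int k) = f i" for i k
  proof (induction k)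
    case (Suc k)
    have "i + int p * int (Suc k) = (i + int p * int k) + int p" by (simp add: algebra_simps)
    thus ?case using periodicD[OF assms] Suc by metis
  qed simp
  show ?thesis
  proof (cases "i div int p \<ge> 0")
    case True
    thus ?thesis using 1[of "i mod int p" "nat (i div int p)"] by (simp add: mod_mult_div_eq)
  next
    case False
    have "i + int p * (- (i div int p)) = i mod int p" by (simp add: minus_mult_div_eq_mod)
    thus ?thesis using 1[of i "nat (- (i div int p))"] False by simp
  qed
qed

lemma periodic_difference: "periodic p f \<Longrightarrow> periodic p (difference f)"
  by (simp add: periodic_def difference_def) (metis add.assoc add.commute)

lemma periodic_shift: "periodic p f \<Longrightarrow> periodic p (\<lambda>i. f (i + c))"
  by (simp add: periodic_def) (metis add.assoc add.commute)

lemma period_sum_shift1: "periodic p f \<Longrightarrow> period_sum p (\<lambda>i. f (i + 1)) = period_sum p f"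
proof -
  assume f: "periodic p f"
  have "(\<Sum>n<p. f (int (Suc n)) - f (int n)) = f (int p) - f (int 0)"
    by (rule sum_lessThan_telescope)
  also have "f (int p) = f (int 0)" using periodicD[OF f, of 0] by simp
  finally show ?thesis by (simp add: period_sum_def sum_subtractf add.commute)
qed

lemma period_sum_shift:
  assumes "periodic p f"
  shows "period_sum p (\<lambda>i. f (i + c)) = period_sum p f"
proof (induction c rule: int_induct[where k = 0])
  case (step1 c)
  thus ?case using period_sum_shift1[OF periodic_shift[OF assms, of c]] by (simp add: add.assoc add.commute[of 1])
next
  case (step2 c)
  thus ?case using period_sum_shift1[OF periodic_shift[OF assms, of "c - 1"]] by (simp add: algebra_simps)
qed simp

lemma period_sum_difference: "periodic p f \<Longrightarrow> period_sum p (difference f) = 0"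
  using period_sum_shift1[of p f] by (simp add: difference_def period_sum_def sum_subtractf)

lemma periodic_uminus: "periodic p f \<Longrightarrow> periodic p (\<lambda>j. f (- j))"
  by (simp add: periodic_def) (metis add.commute diff_add_cancel uminus_add_conv_diff)

lemma period_sum_uminus:
  assumes "periodic p f"
  shows "period_sum p (\<lambda>j. f (- j)) = period_sum p f"
proof -
  have "period_sum p (\<lambda>j. f (- j)) = (\<Sum>n<p. f (- int (p - Suc n)))"
    unfolding period_sum_def by (rule sum.nat_diff_reindex[symmetric])
  also have "\<dots> = (\<Sum>n<p. f (int n + (1 - int p)))"
    by (rule sum.cong) (auto simp: of_nat_diff algebra_simps)
  also have "\<dots> = period_sum p f" using period_sum_shift[OF assms] by (simp add: period_sum_def)
  finally show ?thesis .
qed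

lemma convolution_commute:
  assumes "periodic p f" "periodic p g"
  shows "convolution p f g = convolution p g f"
proof
  fix i
  let ?h = "\<lambda>j. f j * g (i - j)"
  have g': "periodic p (\<lambda>j. g (i - j))"
    using periodic_shift[OF periodic_uminus[OF assms(2)], of "- i"] by simp
  have h: "periodic p ?h" using assms(1) g' by (simp add: periodic_def)
  have "period_sum p (\<lambda>j. ?h (- (j + (- i)))) = period_sum p ?h"
    using period_sum_shift[OF periodic_uminus[OF h], of "- i"] period_sum_uminus[OF h] by simp
  thus "convolution p f g i = convolution p g f i" by (simp add: convolution_def mult.commute)
qed

lemma convolution_difference: "convolution p f (difference g) = difference (convolution p f g)"
  by (rule ext) (simp add: convolution_def difference_def period_sum_def sum_subtractf[symmetric] algebra_simps)

lemma convolution_difference_left: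
  assumes "periodic p f" "periodic p g"
  shows "convolution p (difference f) g = difference (convolution p f g)"
  using convolution_commute[OF periodic_difference[OF assms(1)] assms(2)]
    convolution_commute[OF assms] convolution_difference[of p g f] by simp

lemma periodic_funpow_difference: "periodic p f \<Longrightarrow> periodic p ((difference ^^ n) f)"
  by (induction n) (auto intro: periodic_difference)

lemma convolution_funpow_difference:
  assumes "periodic p f" "periodic p g"
  shows "convolution p ((difference ^^ n) f) g = (difference ^^ n) (convolution p f g)"
  by (induction n) (simp_all add: convolution_difference_left periodic_funpow_difference assms)

lemma periodic_convolution: "periodic p g \<Longrightarrow> periodic p (convolution p f g)"
  unfolding periodic_def convolution_def by (simp add: diff_add_eq[symmetric])

text \<open>The augmentation is a ring homomorphism.\<close>

lemma period_sum_convolution: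
  assumes "periodic p g"
  shows "period_sum p (convolution p f g) = period_sum p f * period_sum p g"
proof -
  have "period_sum p (convolution p f g) = (\<Sum>n<p. f (int n) * (\<Sum>k<p. g (int k - int n)))"
    unfolding convolution_def period_sum_def by (subst sum.swap) (simp add: sum_distrib_left)
  also have "\<dots> = (\<Sum>n<p. f (int n) * period_sum p g)"
    using period_sum_shift[OF assms] by (intro sum.cong) (auto simp: period_sum_def diff_conv_add_uminus simp del: add_uminus_conv_diff)
  finally show ?thesis by (simp add: period_sum_def sum_distrib_right)
qed

lemma periodic_eqI:
  assumes "p > 0" "periodic p f" "periodic p g" "\<And>n. n < p \<Longrightarrow> f (int n) = g (int n)"
  shows "f = g"
proof
  fix i
  have "f (int (nat (i mod int p))) = g (int (nat (i mod int p)))"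
    using assms(1) by (intro assms(4)) (simp add: nat_less_iff)
  thus "f i = g i" using periodic_mod[OF assms(2), of i] periodic_mod[OF assms(3), of i] assms(1) by simp
qed

text \<open>The two sequences differ by a constant, and p times this constant is the difference of
  the sums.\<close>

lemma difference_inj:
  assumes "p > 0" "periodic p f" "periodic p g" "period_sum p f = period_sum p g" "difference f = difference g"
  shows "f = g"
proof -
  define h where "h i = f i - g i" for i
  have step: "h (i + 1) = h i" for i
    using fun_cong[OF assms(5), of i] by (simp add: h_def difference_def)
  have h: "h (int n) = h 0" for n
  proof (induction n)
    case (Suc n)
    have "h (int (Suc n)) = h (int n + 1)" by (simp add: add.commute)
    thus ?case using step Suc by simp
  qed simp
  have "period_sum p h = 0" using assms(4) by (simp add: h_def period_sum_def sum_subtractf)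
  hence "int p * h 0 = 0" by (simp add: period_sum_def h)
  hence "h 0 = 0" using assms(1) by simp
  hence "f (int n) = g (int n)" for n using h[of n] by (simp add: h_def)
  thus ?thesis by (intro periodic_eqI[OF assms(1-3)])
qed

text \<open>Every difference again has sum zero, so injectivity can be applied repeatedly.\<close>

lemma funpow_difference_inj:
  assumes "p > 0" "periodic p f" "periodic p g" "period_sum p f = 0" "period_sum p g = 0"
    "(difference ^^ n) f = (difference ^^ n) g"
  shows "f = g"
  using assms(6)
proof (induction n)
  case (Suc n)
  have s: "period_sum p ((difference ^^ n) h) = 0" if "periodic p h" "period_sum p h = 0" for h
  proof (cases n)
    case (Suc k)
    show ?thesis unfolding Suc funpow.simps comp_apply
      by (rule period_sum_difference[OF periodic_funpow_difference[OF that(1)]])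
  qed (simp add: that)
  have "period_sum p ((difference ^^ n) f) = period_sum p ((difference ^^ n) g)"
    by (simp only: s[OF assms(2,4)] s[OF assms(3,5)])
  moreover have "difference ((difference ^^ n) f) = difference ((difference ^^ n) g)"
    using Suc.prems by simp
  ultimately show ?case
    using Suc.IH difference_inj[OF assms(1) periodic_funpow_difference[OF assms(2)] periodic_funpow_difference[OF assms(3)]]
    by blast
qed simp

text \<open>Partial sums give a primitive, and it closes up at the end of the period exactly because
  the sum is zero.\<close>

lemma difference_surj:
  assumes "p > 0" "periodic p f" "period_sum p f = 0"
  shows "\<exists>g. periodic p g \<and> difference g = f"
proof -
  define g where "g i = (\<Sum>n<nat (i mod int p). f (int n))" for i
  have g: "periodic p g" by (simp add: periodic_def g_def)
  have "difference g = f"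
  proof (rule periodic_eqI[OF assms(1) periodic_difference[OF g] assms(2)])
    fix n assume n: "n < p"
    have gn: "g (int n) = (\<Sum>k<n. f (int k))" using n by (simp add: g_def zmod_int[symmetric])
    show "difference g (int n) = f (int n)"
    proof (cases "Suc n < p")
      case True
      have "nat ((int n + 1) mod int p) = Suc n" using True by (simp add: mod_pos_pos_trivial)
      hence "g (int n + 1) = (\<Sum>k<n. f (int k)) + f (int n)" by (simp add: g_def)
      thus ?thesis using gn by (simp add: difference_def)
    next
      case False
      hence p: "p = Suc n" using n by simp
      hence "g (int n + 1) = 0" by (simp add: g_def add.commute)
      moreover have "(\<Sum>k<n. f (int k)) + f (int n) = 0" using assms(3) by (simp add: period_sum_def p)
      ultimately show ?thesis using gn by (simp add: difference_def)
    qed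
  qed
  with g show ?thesis by blast
qed

lemma funpow_difference_binomial:
  "(difference ^^ n) f i = (\<Sum>k\<le>n. (- 1) ^ (n + k) * int (n choose k) * f (i + int k))"
proof (induction n arbitrary: i)
  case (Suc n)
  define c where "c n k = (- 1) ^ (n + k) * int (n choose k)" for n k :: nat
  have c0: "c (Suc n) 0 = - c n 0" and cS: "c (Suc n) (Suc k) = c n k - c n (Suc k)" for k
    by (simp_all add: c_def algebra_simps)
  have "(\<Sum>k\<le>Suc n. c (Suc n) k * f (i + int k)) =
      c (Suc n) 0 * f i + (\<Sum>k\<le>n. c (Suc n) (Suc k) * f (i + int (Suc k)))"
    by (subst sum.atMost_Suc_shift) simp
  also have "\<dots> = (\<Sum>k\<le>n. c n k * f (i + int (Suc k))) - (c n 0 * f i + (\<Sum>k\<le>n. c n (Suc k) * f (i + int (Suc k))))"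
    unfolding c0 cS by (simp add: sum_subtractf algebra_simps)
  also have "c n 0 * f i + (\<Sum>k\<le>n. c n (Suc k) * f (i + int (Suc k))) = (\<Sum>k\<le>Suc n. c n k * f (i + int k))"
    by (subst sum.atMost_Suc_shift) simp
  also have "\<dots> = (\<Sum>k\<le>n. c n k * f (i + int k))" by (simp add: c_def)
  also have "(\<Sum>k\<le>n. c n k * f (i + int (Suc k))) = (difference ^^ n) f (i + 1)"
    unfolding Suc c_def by (simp add: algebra_simps)
  also have "(\<Sum>k\<le>n. c n k * f (i + int k)) = (difference ^^ n) f i"
    unfolding Suc c_def by simp
  finally have e: "(\<Sum>k\<le>Suc n. c (Suc n) k * f (i + int k)) = (difference ^^ n) f (i + 1) - (difference ^^ n) f i" .
  have "(difference ^^ Suc n) f i = (difference ^^ n) f (i + 1) - (difference ^^ n) f i"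
    by (simp add: difference_def[of "(difference ^^ n) f"])
  thus ?case using e by (simp only: c_def)
qed simp

text \<open>\<open>(S - 1)\<^sup>p \<equiv> S\<^sup>p - 1 = 0\<close> modulo \<open>p\<close> for the shift \<open>S\<close>.\<close>

lemma funpow_difference_dvd:
  assumes "prime p" "periodic p f"
  shows "int p dvd (difference ^^ p) f i"
proof -
  let ?c = "\<lambda>k. (- 1) ^ (p + k) * int (p choose k) * f (i + int k)"
  have p0: "p > 0" using assms(1) prime_gt_0_nat by blast
  have mid: "int p dvd (\<Sum>k\<in>{0<..<p}. ?c k)"
    by (intro dvd_sum dvd_mult2 dvd_mult) (use assms(1) in \<open>auto intro: dvd_choose_prime\<close>)
  have split: "{..p} = insert 0 (insert p {0<..<p})" using p0 by auto
  have "(difference ^^ p) f i = ?c 0 + (?c p + (\<Sum>k\<in>{0<..<p}. ?c k))"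
    unfolding funpow_difference_binomial split using p0 by simp
  also have "?c p = f i" using periodicD[OF assms(2)] by (simp add: power_add[symmetric] mult_2[symmetric])
  also have "?c 0 = (- 1) ^ p * f i" by simp
  finally have eq: "(difference ^^ p) f i = ((- 1) ^ p + 1) * f i + (\<Sum>k\<in>{0<..<p}. ?c k)" by (simp add: algebra_simps)
  have "int p dvd (- 1) ^ p + 1"
  proof (cases "p = 2")
    case False
    hence "2 < p" using prime_gt_1_nat[OF assms(1)] by linarith
    hence "odd p" using prime_odd_nat[OF assms(1)] by blast
    thus ?thesis by simp
  qed simp
  thus ?thesis unfolding eq using mid by (metis dvd_add dvd_mult2)
qed

lemma funpow_difference_smult:
  "(difference ^^ n) (\<lambda>i. c * f i) = (\<lambda>i. c * (difference ^^ n) f i)"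
  by (induction n) (auto simp: difference_def algebra_simps)

text \<open>After \<open>p ^ m\<close> is divided out the sequence is still periodic, so
  \<open>funpow_difference_dvd\<close> applies once more.\<close>

lemma funpow_difference_power_dvd:
  assumes "prime p" "periodic p f"
  shows "int p ^ m dvd (difference ^^ (p * m)) f i"
proof (induction m arbitrary: i)
  case (Suc m)
  have p0: "int p ^ m \<noteq> 0" using assms(1) prime_gt_0_nat by simp
  define g where "g i = (difference ^^ (p * m)) f i div int p ^ m" for i
  have g: "(difference ^^ (p * m)) f = (\<lambda>i. int p ^ m * g i)" using Suc by (auto simp: g_def)
  have "periodic p g" using periodic_funpow_difference[OF assms(2), of "p * m"] by (simp add: periodic_def g_def)
  hence "int p dvd (difference ^^ p) g i" by (rule funpow_difference_dvd[OF assms(1)])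
  hence "int p ^ m * int p dvd int p ^ m * (difference ^^ p) g i" by (intro mult_dvd_mono) auto
  moreover have "(difference ^^ (p * Suc m)) f i = int p ^ m * (difference ^^ p) g i"
    by (simp add: funpow_add g funpow_difference_smult)
  ultimately show ?case by (simp add: mult.commute)
qed simp

text \<open>A lattice \<open>L\<close> of sequences of sum zero is a torsion-free module of rank one over \<open>\<int>[\<zeta>\<^sub>p]\<close>, so \<open>L / (S - 1) L\<close> has order
  \<open>p\<close>.  The class of an element least divisible by \<open>S - 1\<close> (in all periodic sequences) generates it,
  because two elements of \<open>L\<close> can be compared through their convolution.\<close>

lemma cyclic_lattice:
  fixes L :: "(int \<Rightarrow> int) set"
  assumes p: "prime p" and per: "\<And>f. f \<in> L \<Longrightarrow> periodic p f" and sum0: "\<And>f. f \<in> L \<Longrightarrow> period_sum p f = 0"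
    and diff: "\<And>f g. f \<in> L \<Longrightarrow> g \<in> L \<Longrightarrow> (\<lambda>i. f i - g i) \<in> L"
    and shift: "\<And>f. f \<in> L \<Longrightarrow> (\<lambda>i. f (i + 1)) \<in> L"
    and nontrivial: "\<exists>f\<in>L. f \<noteq> (\<lambda>_. 0)"
  shows "\<exists>w\<in>L. (\<forall>z\<in>L. w \<noteq> difference z) \<and> (\<forall>y\<in>L. \<exists>a. \<exists>z\<in>L. y = (\<lambda>i. a * w i + difference z i))"
proof -
  have p0: "p > 0" using p prime_gt_0_nat by blast
  obtain f0 where f0: "f0 \<in> L" "f0 \<noteq> (\<lambda>_. 0)" using nontrivial by blast
  have zero: "(\<lambda>_. 0) \<in> L" using diff[OF f0(1) f0(1)] by simp
  have neg: "(\<lambda>i. - f i) \<in> L" if "f \<in> L" for f using diff[OF zero that] by simp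
  have add: "(\<lambda>i. f i + g i) \<in> L" if "f \<in> L" "g \<in> L" for f g using diff[OF that(1) neg[OF that(2)]] by simp
  have nmult: "(\<lambda>i. int n * f i) \<in> L" if "f \<in> L" for f n
    by (induction n) (use zero add[OF that] in \<open>auto simp: distrib_right\<close>)
  have mult: "(\<lambda>i. c * f i) \<in> L" if "f \<in> L" for f c
    using nmult[OF that, of "nat c"] neg[OF nmult[OF that, of "nat (- c)"]] by (cases "c \<ge> 0") auto
  have sums: "(\<lambda>i. \<Sum>n\<in>A. f n i) \<in> L" if "finite A" "\<And>n. n \<in> A \<Longrightarrow> f n \<in> L" for f and A :: "nat set"
    using that by (induction A rule: finite_induct) (use zero add in auto)
  have shiftn: "(\<lambda>i. f (i + int n)) \<in> L" if "f \<in> L" for f n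
  proof (induction n)
    case (Suc n)
    from shift[OF this] show ?case by (simp add: algebra_simps)
  qed (use that in simp)
  have shifts: "(\<lambda>i. f (i + c)) \<in> L" if f: "f \<in> L" for f c
  proof -
    have "f (i + int (nat (c mod int p))) = f (i + c)" for i
    proof -
      have "(i + c mod int p) mod int p = (i + c) mod int p" by (simp add: mod_simps)
      thus ?thesis using periodic_mod[OF per[OF f], of "i + c mod int p"] periodic_mod[OF per[OF f], of "i + c"] p0 by simp
    qed
    thus ?thesis using shiftn[OF f, of "nat (c mod int p)"] by simp
  qed
  define D where "D = {difference z | z. z \<in> L}"
  have D_diff: "(\<lambda>i. f i - g i) \<in> D" if fg: "f \<in> D" "g \<in> D" for f g
  proof -
    obtain y z where "y \<in> L" "f = difference y" "z \<in> L" "g = difference z"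
      using fg unfolding D_def by blast
    moreover from this have "(\<lambda>i. f i - g i) = difference (\<lambda>i. y i - z i)" by (auto simp: difference_def)
    ultimately show ?thesis unfolding D_def using diff by blast
  qed
  have D_0: "(\<lambda>_. 0) \<in> D" unfolding D_def using zero by (auto simp: difference_def intro!: exI[of _ "\<lambda>_. 0"])
  have D_add: "(\<lambda>i. f i + g i) \<in> D" if "f \<in> D" "g \<in> D" for f g
    using D_diff[OF that(1) D_diff[OF D_0 that(2)]] by simp
  have D_mult: "(\<lambda>i. c * f i) \<in> D" if f: "f \<in> D" for f c
  proof -
    obtain y where "y \<in> L" "f = difference y" using f unfolding D_def by blast
    moreover from this have "(\<lambda>i. c * f i) = difference (\<lambda>i. c * y i)" by (auto simp: difference_def algebra_simps)
    ultimately show ?thesis unfolding D_def using mult by blast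
  qed
  have D_sums: "(\<lambda>i. \<Sum>n\<in>A. f n i) \<in> D" if "finite A" "\<And>n. n \<in> A \<Longrightarrow> f n \<in> D" for f and A :: "nat set"
    using that by (induction A rule: finite_induct) (use D_0 D_add in auto)
  have D_shiftn: "(\<lambda>i. f (i + int n) - f i) \<in> D" if f: "f \<in> L" for f n
  proof (induction n)
    case (Suc n)
    have "difference (\<lambda>i. f (i + int n)) \<in> D" unfolding D_def using shiftn[OF f] by blast
    from D_add[OF this Suc] show ?case by (simp add: difference_def algebra_simps)
  qed (simp add: D_0)
  have D_shift: "(\<lambda>i. f (i + c) - f i) \<in> D" if f: "f \<in> L" for f c
  proof -
    have "f (i + int (nat (c mod int p))) = f (i + c)" for i
    proof -
      have "(i + c mod int p) mod int p = (i + c) mod int p" by (simp add: mod_simps)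
      thus ?thesis using periodic_mod[OF per[OF f], of "i + c mod int p"] periodic_mod[OF per[OF f], of "i + c"] p0 by simp
    qed
    thus ?thesis using D_shiftn[OF f, of "nat (c mod int p)"] by simp
  qed
  have conv_L: "convolution p y x \<in> L" if x: "x \<in> L" for x y
  proof -
    have "convolution p y x = (\<lambda>i. \<Sum>n<p. y (int n) * x (i + (- int n)))"
      by (rule ext) (simp add: convolution_def period_sum_def)
    also have "\<dots> \<in> L" by (rule sums, rule finite_lessThan, rule mult[OF shifts[OF x]])
    finally show ?thesis .
  qed
  \<comment> \<open>Modulo \<open>D\<close> the shift acts trivially on \<open>L\<close>, so
    convolution with \<open>y\<close> acts as multiplication by the augmentation of
    \<open>y\<close>.\<close>
  have conv_D: "(\<lambda>i. convolution p y x i - period_sum p y * x i) \<in> D" if x: "x \<in> L" for x y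
  proof -
    have "(\<lambda>i. convolution p y x i - period_sum p y * x i) = (\<lambda>i. \<Sum>n<p. y (int n) * (x (i + (- int n)) - x i))"
      by (rule ext) (simp add: convolution_def period_sum_def sum_distrib_right sum_subtractf right_diff_distrib)
    also have "\<dots> \<in> D" by (rule D_sums, rule finite_lessThan, rule D_mult[OF D_shift[OF x]])
    finally show ?thesis .
  qed
  \<comment> \<open>Convolution with the constant sequence 1 sums over a period and so kills
    \<open>L\<close>; its augmentation is p. Hence p annihilates the quotient of \<open>L\<close> by
    \<open>D\<close>.\<close>
  have p_D: "(\<lambda>i. int p * x i) \<in> D" if x: "x \<in> L" for x
  proof -
    have "convolution p (\<lambda>_. 1) x i = 0" for i
    proof -
      have "convolution p (\<lambda>_. 1) x i = period_sum p (\<lambda>j. x (- (j + (- i))))"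
        by (simp add: convolution_def)
      also have "\<dots> = 0"
        using period_sum_shift[OF periodic_uminus[OF per[OF x]], of "- i"] period_sum_uminus[OF per[OF x]] sum0[OF x] by simp
      finally show ?thesis .
    qed
    hence "(\<lambda>i. - (int p * x i)) \<in> D" using conv_D[OF x, of "\<lambda>_. 1"] by (simp add: period_sum_def)
    from D_mult[OF this, of "- 1"] show ?thesis by simp
  qed
  \<comment> \<open>Divisibility by the s-th power of S - 1 is tested among all periodic sequences
    and not within \<open>L\<close>; this makes elements of \<open>L\<close> comparable.\<close>
  define dep where "dep s y \<longleftrightarrow> (\<exists>g. periodic p g \<and> y = (difference ^^ s) g)" for s y
  \<comment> \<open>Depth \<open>p * m\<close> forces divisibility by \<open>p ^ m\<close>, which
    exceeds any nonzero entry once m is its absolute value.\<close>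
  have bounded: "\<exists>s. dep s y \<and> (\<forall>t. dep t y \<longrightarrow> t \<le> s)" if y: "y \<in> L" "y \<noteq> (\<lambda>_. 0)" for y
  proof -
    obtain i where i: "y i \<noteq> 0" using y(2) by auto
    define m where "m = nat \<bar>y i\<bar>"
    have "t < p * m" if t: "dep t y" for t
    proof (rule ccontr)
      assume "\<not> ?thesis"
      then obtain k where k: "t = p * m + k" by (metis le_Suc_ex not_le)
      obtain g where g: "periodic p g" "y = (difference ^^ t) g" using t by (auto simp: dep_def)
      have "int p ^ m dvd (difference ^^ (p * m)) ((difference ^^ k) g) i"
        by (rule funpow_difference_power_dvd[OF p periodic_funpow_difference[OF g(1)]])
      hence "int p ^ m dvd y i" unfolding g(2) k by (simp add: funpow_add)
      hence "int p ^ m \<le> \<bar>y i\<bar>" using dvd_imp_le_int[OF i] by force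
      moreover have "m < 2 ^ m" by (rule less_exp)
      hence "m < p ^ m" using power_mono[of 2 p m] prime_ge_2_nat[OF p] by linarith
      hence "int m < int p ^ m" by (metis of_nat_less_iff of_nat_power)
      ultimately show False by (simp add: m_def)
    qed
    moreover have "dep 0 y" using per[OF y(1)] by (auto simp: dep_def)
    ultimately show ?thesis using Nat.ex_has_greatest_nat[of "\<lambda>t. dep t y" 0 "p * m"] by (metis less_imp_le)
  qed
  define s where "s y = (GREATEST t. dep t y)" for y
  have s: "dep (s y) y" "\<And>t. dep t y \<Longrightarrow> t \<le> s y" if y: "y \<in> L" "y \<noteq> (\<lambda>_. 0)" for y
  proof -
    obtain k where k: "dep k y" "\<forall>t. dep t y \<longrightarrow> t \<le> k" using bounded[OF y] by blast
    hence "s y = k" unfolding s_def by (intro Greatest_equality) auto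
    thus "dep (s y) y" "\<And>t. dep t y \<Longrightarrow> t \<le> s y" using k by auto
  qed
  define w where "w = (ARG_MIN s f. f \<in> L \<and> f \<noteq> (\<lambda>_. 0))"
  have w: "w \<in> L \<and> w \<noteq> (\<lambda>_. 0)" unfolding w_def by (rule arg_min_natI[of _ f0]) (use f0 in auto)
  have w_min: "s w \<le> s y" if "y \<in> L" "y \<noteq> (\<lambda>_. 0)" for y
    unfolding w_def using arg_min_nat_le[of "\<lambda>f. f \<in> L \<and> f \<noteq> (\<lambda>_. 0)" y s] that by auto
  obtain w' where w': "periodic p w'" "w = (difference ^^ s w) w'" using s(1)[of w] w by (auto simp: dep_def)
  \<comment> \<open>If the augmentation of \<open>w'\<close> were \<open>p * k\<close>, subtracting
    the constant \<open>k\<close> would make it zero and one more factor S - 1 could be extracted,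
    against the choice of the depth.\<close>
  have not_dvd: "\<not> int p dvd period_sum p w'"
  proof
    assume "int p dvd period_sum p w'"
    then obtain k where k: "period_sum p w' = int p * k" by (elim dvdE)
    define g where "g i = w' i - k" for i
    have g: "periodic p g" "period_sum p g = 0"
      using w'(1) k by (simp_all add: g_def periodic_def period_sum_def sum_subtractf)
    have "difference w' = difference g" by (simp add: g_def difference_def)
    obtain h where h: "periodic p h" "difference h = g" using difference_surj[OF p0 g] by blast
    have "dep (Suc (s w)) w"
    proof (cases "s w")
      \<comment> \<open>No difference is applied here that would kill the constant \<open>k\<close>;
        but \<open>w' = w\<close> has sum zero, so \<open>k\<close> is zero.\<close>
      case 0
      hence "w = w'" using w' by simp
      hence "k = 0" using k sum0 w p0 by simp
      hence "g = w" using \<open>w = w'\<close> by (simp add: g_def[abs_def])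
      thus ?thesis unfolding dep_def 0 using h by (intro exI[of _ h]) auto
    next
      case (Suc n)
      have "w = (difference ^^ n) (difference w')" by (metis w'(2) Suc funpow_Suc_right comp_apply)
      also have "\<dots> = (difference ^^ n) (difference (difference h))"
        unfolding \<open>difference w' = difference g\<close> h(2) ..
      also have "\<dots> = (difference ^^ Suc (s w)) h" unfolding Suc by (simp add: funpow_swap1)
      finally show ?thesis using h(1) by (auto simp: dep_def)
    qed
    thus False using s(2)[of w "Suc (s w)"] w by simp
  qed
  have "coprime (period_sum p w') (int p)"
    using not_dvd p by (metis coprime_commute prime_imp_coprime prime_nat_int_transfer)
  then obtain a b where ab: "a * period_sum p w' + b * int p = 1"
    by (metis bezout_int coprime_imp_gcd_eq_1)
  have main: "\<exists>a. \<exists>z\<in>L. y = (\<lambda>i. a * w i + difference z i)" if y: "y \<in> L" for y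
  proof (cases "y = (\<lambda>_. 0)")
    case True
    have "y = (\<lambda>i. 0 * w i + difference (\<lambda>_. 0) i)" unfolding True by (simp add: difference_def)
    thus ?thesis using zero by blast
  next
    case False
    obtain y' where y': "periodic p y'" "y = (difference ^^ s y) y'" using s(1)[OF y False] by (auto simp: dep_def)
    obtain d where d: "s y = s w + d" using w_min[OF y False] le_Suc_ex by blast
    define y2 where "y2 = (difference ^^ d) y'"
    have y2: "periodic p y2" "y = (difference ^^ s w) y2"
      using y' d by (simp_all add: y2_def periodic_funpow_difference funpow_add)
    have perw: "periodic p w" and pery: "periodic p y" using per w y by auto
    \<comment> \<open>Dividing the commutative product of \<open>w\<close> and \<open>y\<close> by
      the same power of S - 1 in either factor gives the same result, because both quotients have
      sum zero and S - 1 is injective there.\<close>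
    have "(difference ^^ s w) (convolution p w' y) = convolution p w y"
      using convolution_funpow_difference[OF w'(1) pery, of "s w"] w'(2) by simp
    also have "\<dots> = convolution p y w" by (rule convolution_commute[OF perw pery])
    also have "\<dots> = (difference ^^ s w) (convolution p y2 w)"
      using convolution_funpow_difference[OF y2(1) perw, of "s w"] y2(2) by simp
    finally have eq: "convolution p w' y = convolution p y2 w"
      by (rule funpow_difference_inj[OF p0 periodic_convolution[OF pery] periodic_convolution[OF perw], rotated 2])
        (use period_sum_convolution[OF pery] period_sum_convolution[OF perw] sum0 w y in auto)
    have "(\<lambda>i. (convolution p y2 w i - period_sum p y2 * w i) - (convolution p w' y i - period_sum p w' * y i)) \<in> D"
      by (rule D_diff[OF conv_D conv_D]) (use w y in auto)
    hence 1: "(\<lambda>i. period_sum p w' * y i - period_sum p y2 * w i) \<in> D" unfolding eq by (simp add: algebra_simps)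
    have "(\<lambda>i. a * (period_sum p w' * y i - period_sum p y2 * w i) + b * (int p * y i)) \<in> D"
      using D_add[OF D_mult[OF 1] D_mult[OF p_D[OF y]]] .
    then obtain z where z: "z \<in> L" "\<And>i. a * (period_sum p w' * y i - period_sum p y2 * w i) + b * (int p * y i) = difference z i"
      by (auto simp: D_def fun_eq_iff)
    have "y i = (a * period_sum p y2) * w i + difference z i" for i
    proof -
      have "y i = (a * period_sum p w' + b * int p) * y i" using ab by simp
      thus ?thesis using z(2)[of i] by (simp add: algebra_simps)
    qed
    thus ?thesis using z(1) by blast
  qed
  \<comment> \<open>Such a \<open>z\<close> would have smaller depth than \<open>w\<close>, against
    minimality.\<close>
  have "w \<noteq> difference z" if z: "z \<in> L" for z
  proof
    assume wz: "w = difference z"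
    have z0: "z \<noteq> (\<lambda>_. 0)" using w wz by (auto simp: difference_def)
    obtain g where g: "periodic p g" "z = (difference ^^ s z) g" using s(1)[OF z z0] by (auto simp: dep_def)
    have "w = (difference ^^ Suc (s z)) g" using wz g(2) by simp
    hence "dep (Suc (s z)) w" using g(1) by (auto simp: dep_def)
    hence "Suc (s z) \<le> s w" using s(2) w by blast
    thus False using w_min[OF z z0] by simp
  qed
  with main w show ?thesis by blast
qed

section \<open>Completion at infinity\<close>

lemma val_ge_add_fls:
  "val_ge fls_subdegree n (f :: 'a::field fls) \<Longrightarrow> val_ge fls_subdegree n g \<Longrightarrow> val_ge fls_subdegree n (f + g)"
  by (auto simp: val_ge_def intro!: fls_subdegree_geI)

lemma valuation_fls: "valuation (fls_subdegree :: 'a::field fls \<Rightarrow> int)"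
  unfolding valuation_def
proof (intro conjI allI impI)
  fix f g :: "'a fls" assume "f \<noteq> 0" "g \<noteq> 0" "f + g \<noteq> 0"
  thus "min (fls_subdegree f) (fls_subdegree g) \<le> fls_subdegree (f + g)"
    using val_ge_add_fls[of "min (fls_subdegree f) (fls_subdegree g)" f g] by (simp add: val_ge_def)
qed simp

lemma field_hom_fls_const: "field_hom (fls_const :: 'a::field \<Rightarrow> 'a fls)"
  by (rule field_homI) (simp_all add: fls_plus_const)

text \<open>Expansion at infinity: the series variable stands for 1/t, so t is sent to
  \<open>fls_X_inv\<close>.\<close>

definition poly_to_fls :: "'a::field poly \<Rightarrow> 'a fls" where
  "poly_to_fls = poly_ev fls_const fls_X_inv"

lemma poly_to_fls_simps:
  "poly_to_fls (g + h) = poly_to_fls g + poly_to_fls h"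
  "poly_to_fls (g * h) = poly_to_fls g * poly_to_fls h"
  "poly_to_fls 1 = 1" "poly_to_fls 0 = 0"
  unfolding poly_to_fls_def using field_hom.poly_ev_simps[OF field_hom_fls_const] by auto

lemma subdegree_poly_to_fls:
  assumes "g \<noteq> 0"
  shows "poly_to_fls g \<noteq> 0" "fls_subdegree (poly_to_fls g) = - int (degree g)"
proof -
  have c: "fls_nth (poly_to_fls g) n = (\<Sum>i\<le>degree g. coeff g i * (if n = - int i then 1 else 0))" for n
    unfolding poly_to_fls_def field_hom.poly_ev_altdef[OF field_hom_fls_const]
    by (simp add: fls_nth_sum fls_mult_const_nth)
  have lc: "fls_nth (poly_to_fls g) (- int (degree g)) = lead_coeff g"
  proof -
    have "(\<Sum>i\<le>degree g. coeff g i * (if - int (degree g) = - int i then 1 else 0)) =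
        (\<Sum>i\<le>degree g. if i = degree g then lead_coeff g else 0)" by (rule sum.cong) auto
    thus ?thesis unfolding c by simp
  qed
  hence nz: "fls_nth (poly_to_fls g) (- int (degree g)) \<noteq> 0" using assms by simp
  thus "poly_to_fls g \<noteq> 0" by auto
  show "fls_subdegree (poly_to_fls g) = - int (degree g)"
  proof (rule fls_subdegree_eqI[OF nz])
    fix k assume "k < - int (degree g)"
    thus "fls_nth (poly_to_fls g) k = 0" unfolding c by (intro sum.neutral) auto
  qed
qed

definition fract_to_fls :: "'a::field poly fract \<Rightarrow> 'a fls" where
  "fract_to_fls x = (let (a, b) = (SOME (a, b). b \<noteq> 0 \<and> x = to_fract a / to_fract b) in poly_to_fls a / poly_to_fls b)"

lemma fract_to_fls_eq:
  assumes "b \<noteq> 0"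
  shows "fract_to_fls (to_fract a / to_fract b) = poly_to_fls a / poly_to_fls b"
proof -
  define ab where "ab = (SOME (c, d). d \<noteq> 0 \<and> to_fract a / to_fract b = to_fract c / to_fract d)"
  have "case ab of (c, d) \<Rightarrow> d \<noteq> 0 \<and> to_fract a / to_fract b = to_fract c / to_fract d"
    unfolding ab_def by (rule someI[of _ "(a, b)"]) (use assms in auto)
  then obtain c d where cd: "ab = (c, d)" "d \<noteq> 0" "to_fract a / to_fract b = to_fract c / to_fract d"
    by (cases ab) auto
  hence "to_fract (a * d) = to_fract (c * b)" using assms by (simp add: field_simps)
  hence "a * d = c * b" by (simp only: to_fract_eq_iff)
  hence "poly_to_fls a * poly_to_fls d = poly_to_fls c * poly_to_fls b" by (metis poly_to_fls_simps(2))
  moreover have "poly_to_fls b \<noteq> 0" "poly_to_fls d \<noteq> 0" using subdegree_poly_to_fls(1) assms cd by blast+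
  ultimately have "poly_to_fls a / poly_to_fls b = poly_to_fls c / poly_to_fls d" by (simp add: frac_eq_eq)
  moreover have "fract_to_fls (to_fract a / to_fract b) = (case ab of (c, d) \<Rightarrow> poly_to_fls c / poly_to_fls d)"
    by (simp only: fract_to_fls_def ab_def Let_def)
  ultimately show ?thesis by (simp add: cd(1))
qed

lemma field_hom_fract_to_fls: "field_hom (fract_to_fls :: 'a::field poly fract \<Rightarrow> 'a fls)"
proof (rule field_homI)
  fix x y :: "'a poly fract"
  obtain a b where ab: "b \<noteq> 0" "x = to_fract a / to_fract b" by (rule fract_cases)
  obtain c d where cd: "d \<noteq> 0" "y = to_fract c / to_fract d" by (rule fract_cases)
  have nz: "b * d \<noteq> 0" "poly_to_fls b \<noteq> 0" "poly_to_fls d \<noteq> 0"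
    using ab cd subdegree_poly_to_fls(1) by auto
  have "x + y = to_fract (a * d + c * b) / to_fract (b * d)" "x * y = to_fract (a * c) / to_fract (b * d)"
    using ab cd by (simp_all add: field_simps)
  hence "fract_to_fls (x + y) = poly_to_fls (a * d + c * b) / poly_to_fls (b * d)"
    "fract_to_fls (x * y) = poly_to_fls (a * c) / poly_to_fls (b * d)"
    by (simp_all only: fract_to_fls_eq[OF nz(1)])
  thus "fract_to_fls (x + y) = fract_to_fls x + fract_to_fls y" "fract_to_fls (x * y) = fract_to_fls x * fract_to_fls y"
    unfolding ab(2) cd(2) fract_to_fls_eq[OF ab(1)] fract_to_fls_eq[OF cd(1)]
    using nz by (simp_all add: poly_to_fls_simps field_simps)
next
  have "fract_to_fls (to_fract 1 / to_fract 1) = (1 :: 'a fls)"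
    by (subst fract_to_fls_eq) (simp_all add: poly_to_fls_simps)
  thus "fract_to_fls 1 = (1 :: 'a fls)" by simp
qed

lemma subdegree_fract_to_fls:
  assumes "x \<noteq> 0"
  shows "fls_subdegree (fract_to_fls x) = infval x"
proof -
  obtain a b where ab: "b \<noteq> 0" "x = to_fract a / to_fract b" by (rule fract_cases)
  hence a: "a \<noteq> 0" using assms by auto
  note sa = subdegree_poly_to_fls[OF a] and sb = subdegree_poly_to_fls[OF ab(1)]
  show ?thesis unfolding ab(2) fract_to_fls_eq[OF ab(1)] infval_fract[OF a ab(1)]
    using val_divide[OF valuation_fls sa(1) sb(1)] sa(2) sb(2) by simp
qed

text \<open>Up to the coefficient in question a series is a finite sum of monomials, on which the
  p-th power is additive; the p-th power of the remainder starts beyond \<open>n\<close>.\<close>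

lemma fps_frobenius:
  fixes f :: "'a::comm_ring_1 fps"
  assumes "prime p" "CHAR('a) = p"
  shows "(f ^ p) $ n = (if p dvd n then (f $ (n div p)) ^ p else 0)"
proof -
  have p0: "p > 0" using assms(1) prime_gt_0_nat by blast
  have ch: "prime CHAR('a fps)" "p = CHAR('a fps)" using assms by simp_all
  define g where "g = (\<Sum>i\<le>n. fps_const (f $ i) * fps_X ^ i)"
  define h where "h = fps_shift (Suc n) f"
  have f: "f = g + h * fps_X ^ Suc n"
  proof (rule fps_ext)
    fix k
    have "g $ k = (if k \<le> n then f $ k else 0)"
      unfolding g_def by (simp add: fps_sum_nth if_distrib[of "\<lambda>x. _ * x"] cong: if_cong)
    thus "f $ k = (g + h * fps_X ^ Suc n) $ k"
      by (simp add: h_def fps_X_power_mult_right_nth del: power_Suc)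
  qed
  have "f ^ p = g ^ p + (h * fps_X ^ Suc n) ^ p"
    by (subst f) (rule freshmans_dream[OF ch])
  also have "g ^ p = (\<Sum>i\<le>n. (fps_const (f $ i) * fps_X ^ i) ^ p)"
    unfolding g_def by (rule freshmans_dream_sum[OF ch])
  also have "(h * fps_X ^ Suc n) ^ p = h ^ p * fps_X ^ (Suc n * p)"
    unfolding power_mult_distrib power_mult ..
  finally have "(f ^ p) $ n = (\<Sum>i\<le>n. ((fps_const (f $ i) * fps_X ^ i) ^ p) $ n) + (h ^ p * fps_X ^ (Suc n * p)) $ n"
    by (simp only: fps_add_nth fps_sum_nth)
  also have "(h ^ p * fps_X ^ (Suc n * p)) $ n = 0"
  proof -
    have "n < Suc n * p" using p0 by (metis Suc_le_eq lessI less_le_trans mult.right_neutral mult_le_mono2 One_nat_def)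
    thus ?thesis by (simp add: fps_X_power_mult_right_nth del: mult_Suc)
  qed
  also have "(\<Sum>i\<le>n. ((fps_const (f $ i) * fps_X ^ i) ^ p) $ n) = (\<Sum>i\<le>n. if n = i * p then (f $ i) ^ p else 0)"
    by (rule sum.cong) (auto simp: power_mult_distrib power_mult[symmetric] fps_const_power)
  also have "\<dots> = (if p dvd n then (f $ (n div p)) ^ p else 0)"
  proof (cases "p dvd n")
    case True
    have "(\<Sum>i\<le>n. if n = i * p then (f $ i) ^ p else 0) = (\<Sum>i\<le>n. if i = n div p then (f $ (n div p)) ^ p else 0)"
      using True p0 by (intro sum.cong) auto
    thus ?thesis using True by simp
  next
    case False
    thus ?thesis by (auto intro!: sum.neutral)
  qed
  finally show ?thesis by simp
qed

text \<open>By the Frobenius formula the equation determines the n-th coefficient from the one at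
  \<open>n div p\<close>. Index 0 would refer to itself and is excluded from the recursion; there
  the value 0 solves the equation because \<open>d $ 0 = 0\<close>.\<close>

lemma fps_artin_schreier_root:
  fixes d :: "'a::comm_ring_1 fps"
  assumes "prime p" "CHAR('a) = p" "d $ 0 = 0"
  shows "\<exists>a. a ^ p - a = d"
proof -
  have p1: "p > 1" using assms(1) prime_gt_1_nat by blast
  define r where "r = wfrec less_than (\<lambda>F n. (if p dvd n \<and> n > 0 then F (n div p) ^ p else 0) - d $ n)"
  have r: "r n = (if p dvd n \<and> n > 0 then r (n div p) ^ p else 0) - d $ n" for n
  proof -
    have "r n = (if p dvd n \<and> n > 0 then cut r less_than n (n div p) ^ p else 0) - d $ n"
      unfolding r_def by (subst wfrec) auto
    also have "\<dots> = (if p dvd n \<and> n > 0 then r (n div p) ^ p else 0) - d $ n"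
      using p1 by (auto simp: cut_def)
    finally show ?thesis .
  qed
  have "Abs_fps r ^ p - Abs_fps r = d"
  proof (rule fps_ext)
    fix n
    have "r 0 = 0" using r[of 0] assms(3) by simp
    thus "(Abs_fps r ^ p - Abs_fps r) $ n = d $ n"
      using r[of n] p1 by (cases "n = 0") (auto simp: fps_frobenius[OF assms(1,2)] power_0_left)
  qed
  thus ?thesis by blast
qed

section \<open>Units and principal invariant ideals\<close>

context artin_schreier_function_field
begin

lemma algebraic_const:
  assumes "g \<noteq> 0" "poly (map_poly const g) x = 0"
  shows "x \<in> range const"
  using const_closed assms unfolding algebraically_closed_in_def by blast

lemma const_inj [simp]: "const a = const b \<longleftrightarrow> a = b" by simp

text \<open>The coefficients of the characteristic polynomial are polynomials without a pole at
  infinity, hence constants. So \<open>x\<close> is algebraic over the constants, and these are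
  algebraically closed in K.\<close>

lemma const_criterion:
  assumes x: "x \<in> O\<^sub>K" and inf: "\<And>n c. coeff (conj_poly x) n = \<iota> c \<Longrightarrow> val_ge infval 0 c"
  shows "x \<in> range const"
proof -
  obtain g where g: "conj_poly x = map_poly \<iota> g" "lead_coeff g = 1" using conj_poly_in_base by blast
  have "\<exists>c. coeff g n = to_fract [:c:]" for n
  proof -
    have c: "coeff (conj_poly x) n = \<iota> (coeff g n)" by (simp add: g(1))
    have "coeff (conj_poly x) n \<in> O\<^sub>K"
      by (rule coeff_conj_poly_mem) (use x J_diff O_1 J_O_mult J_\<sigma>_pow in auto)
    then obtain a where a: "coeff g n = to_fract a" using O_\<iota> c by auto
    have "val_ge infval 0 (to_fract a)" using inf c a by metis
    hence "degree a = 0" by (cases "a = 0") (auto simp: val_ge_def infval_to_fract)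
    thus ?thesis using a degree_eq_zeroE by metis
  qed
  then obtain c where c: "\<And>n. coeff g n = to_fract [:c n:]" by metis
  have 0: "c n = 0" if "n > degree g" for n
    using c[of n] coeff_eq_0[OF that] by (metis to_fract_eq_0_iff pCons_eq_0_iff)
  define h where "h = (\<Sum>i\<le>degree g. Polynomial.monom (c i) i)"
  have ch: "coeff h n = c n" for n
    unfolding h_def coeff_sum using 0[of n] by (cases "n \<le> degree g") (auto simp: if_distrib[where f = "\<lambda>x. coeff x n"])
  have "map_poly const h = conj_poly x"
    by (rule poly_eqI) (simp add: g(1) coeff_map_poly ch c)
  moreover have "h \<noteq> 0"
  proof
    assume "h = 0"
    hence "c (degree g) = 0" using ch[of "degree g"] by simp
    hence "lead_coeff g = 0" using c[of "degree g"] by simp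
    thus False using g(2) by simp
  qed
  ultimately show ?thesis using algebraic_const poly_conj_poly by metis
qed

lemma nrm_1_inverse:
  assumes "u \<in> O\<^sub>K" "nrm u = 1"
  shows "inverse u \<in> O\<^sub>K"
proof -
  have "u * (\<Prod>j\<in>{1..<p}. (\<sigma> ^^ j) u) = 1" using nrm_split[of u] assms(2) by simp
  hence "inverse u = (\<Prod>j\<in>{1..<p}. (\<sigma> ^^ j) u)" by (rule inverse_unique)
  thus ?thesis using O_nrm_cofactor[OF assms(1)] by simp
qed

lemma const_nrm_1:
  assumes "const c = u" "nrm u = 1"
  shows "u = 1"
proof -
  have "\<iota> (to_fract [:c:] ^ p) = \<iota> 1" using assms nrm_\<iota>[of "to_fract [:c:]"] by metis
  hence "const (c ^ p) = const 1" by (simp add: const_power hom_power one_pCons[symmetric])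
  hence "c ^ p = 1 ^ p" unfolding const_inj by simp
  hence "(c - 1) ^ p = 0" using freshmans_dream_minus[of p c 1] prime_p char_a by (metis diff_self)
  hence "c = 1" by simp
  thus ?thesis using assms(1) by (simp add: one_pCons[symmetric])
qed

lemma principal_imp_unit:
  assumes n: "supported n" and a: "a \<noteq> 0" "J n = scale a O\<^sub>K"
  shows "\<sigma> a / a \<in> O\<^sub>K" "nrm (\<sigma> a / a) = 1"
proof -
  have "scale (\<sigma> a) O\<^sub>K = scale a O\<^sub>K"
    using \<sigma>_image_O[of n] unfolding a(2) \<sigma>_scale \<sigma>_image_O .
  moreover have "\<sigma> a * 1 \<in> scale (\<sigma> a) O\<^sub>K" using O_1 by blast
  ultimately have "\<sigma> a \<in> scale a O\<^sub>K" by simp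
  thus "\<sigma> a / a \<in> O\<^sub>K" using mem_scale_iff[OF a(1)] by simp
  have "nrm (\<sigma> a / a) * nrm a = nrm (\<sigma> a)" using a(1) by (simp add: nrm_mult[symmetric])
  thus "nrm (\<sigma> a / a) = 1" using a(1) by (simp add: nrm_\<sigma> nrm_eq_0_iff)
qed

lemma scale_base_principal:
  assumes "supported n" "g \<noteq> 0" "J n = scale (\<iota> g) O\<^sub>K" "\<pi> \<in> ram"
  shows "n \<pi> = int p * pval \<pi> g"
  using J_scaled_supported[OF supported_0 assms(2) assms(3)[symmetric] assms(1,4)] by simp

text \<open>The p-th power of the prime above a ramified \<pi> is generated by \<pi>. Positive and
  negative exponents are collected in a numerator and a denominator.\<close>

lemma J_multiple_principal:
  assumes n: "supported n" and dvd: "\<And>\<pi>. \<pi> \<in> ram \<Longrightarrow> int p dvd n \<pi>"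
  shows "\<exists>g. g \<noteq> 0 \<and> J n = scale (\<iota> g) O\<^sub>K"
proof -
  define N where "N \<pi> = n \<pi> div int p" for \<pi>
  let ?a = "\<Prod>\<pi>\<in>ram. \<pi> ^ nat (N \<pi>)" and ?b = "\<Prod>\<pi>\<in>ram. \<pi> ^ nat (- N \<pi>)"
  have nz: "?a \<noteq> 0" "?b \<noteq> 0" by (rule ram_prod)+
  define g where "g = to_fract ?a / to_fract ?b"
  have g0: "g \<noteq> 0" using nz unfolding g_def divide_eq_0_iff to_fract_eq_0_iff by blast
  have v: "pval \<pi> g = pval \<pi> (to_fract ?a) - pval \<pi> (to_fract ?b)" if "monic_irreducible \<pi>" for \<pi>
    unfolding g_def using nz by (intro val_divide[OF valuation_pval[OF that]]) (simp_all only: to_fract_eq_0_iff not_False_eq_True)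
  have "scale (\<iota> g) O\<^sub>K = J (\<lambda>\<pi>. 0 + int p * pval \<pi> g)" by (rule J_shift[OF g0])
  also have "\<dots> = J n"
  proof (rule J_cong)
    fix \<pi> :: "'a poly" assume \<pi>: "monic_irreducible \<pi>"
    show "0 + int p * pval \<pi> g = n \<pi>"
    proof (cases "\<pi> \<in> ram")
      case True
      have "pval \<pi> g = N \<pi>"
        unfolding v[OF \<pi>] ram_prod(2)[OF True] by simp
      thus ?thesis using dvd[OF True] by (simp add: N_def)
    next
      case False
      thus ?thesis using n unfolding v[OF \<pi>] ram_prod(3)[OF \<pi> False] by (simp add: supported_def)
    qed
  qed
  finally show ?thesis using g0 by metis
qed

text \<open>With a single place at infinity, norm one already means value 0 there, so the unit
  attached to a generator has no pole and \<open>const_criterion\<close> applies. It turns out to be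
  1, and then the generator lies in k.\<close>

lemma imaginary_principal_iff:
  assumes inf: "single_place infval e" and n: "supported n"
  shows "(\<exists>a. a \<noteq> 0 \<and> J n = scale a O\<^sub>K) \<longleftrightarrow> (\<forall>\<pi>\<in>ram. int p dvd n \<pi>)"
proof
  have adm_inf: "admissible infval e" using inf by (simp add: single_place_def)
  assume "\<exists>a. a \<noteq> 0 \<and> J n = scale a O\<^sub>K"
  then obtain a where a: "a \<noteq> 0" "J n = scale a O\<^sub>K" by blast
  let ?u = "\<sigma> a / a"
  note u = principal_imp_unit[OF n a]
  have "?u \<noteq> 0" using a(1) by simp
  hence uF: "?u \<in> fil infval e 0"
    using single_place_fil_iff[OF inf, of ?u 0] u(2) val_1[OF valuation_infval[where ?'a = 'a]] by simp
  have "?u \<in> range const"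
  proof (rule const_criterion[OF u(1)])
    fix n c assume c: "coeff (conj_poly ?u) n = \<iota> c"
    have "coeff (conj_poly ?u) n \<in> fil infval e 0"
    proof (rule coeff_conj_poly_mem)
      show "x - y \<in> fil infval e 0" if "x \<in> fil infval e 0" "y \<in> fil infval e 0" for x y
        by (rule fil_diff[OF adm_inf that])
      show "x * y \<in> fil infval e 0" if "x \<in> fil infval e 0" "y \<in> fil infval e 0" for x y
        using fil_mult[OF adm_inf that] by simp
      show "1 \<in> fil infval e 0" by (rule fil_1[OF adm_inf])
      show "(\<sigma> ^^ j) ?u \<in> fil infval e 0" for j by (rule fil_\<sigma>_pow[OF adm_inf uF])
    qed
    thus "val_ge infval 0 c" unfolding c fil_\<iota> using p_pos by (auto simp: val_ge_def zero_le_mult_iff)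
  qed
  then obtain c where c: "?u = const c" by (rule rangeE)
  have "?u = 1" by (rule const_nrm_1[OF c[symmetric] u(2)])
  hence "\<sigma> a = a" using a(1) by (simp add: field_simps)
  then obtain g where g: "a = \<iota> g" using fixed_field by blast
  hence "g \<noteq> 0" using a(1) by auto
  thus "\<forall>\<pi>\<in>ram. int p dvd n \<pi>" using scale_base_principal[OF n _ a(2)[unfolded g]] by simp
next
  assume "\<forall>\<pi>\<in>ram. int p dvd n \<pi>"
  then obtain g where "g \<noteq> 0" "J n = scale (\<iota> g) O\<^sub>K" using J_multiple_principal[OF n] by blast
  thus "\<exists>a. a \<noteq> 0 \<and> J n = scale a O\<^sub>K" by (intro exI[of _ "\<iota> g"]) auto
qed

end

lemma finite_degree_le: "finite {g :: 'a::finite_field poly. degree g \<le> N}"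
proof -
  have "g = (\<Sum>i\<le>N. Polynomial.monom (restrict (coeff g) {..N} i) i)" if "degree g \<le> N" for g :: "'a poly"
  proof -
    have "(\<Sum>i\<le>N. Polynomial.monom (restrict (coeff g) {..N} i) i) = (\<Sum>i\<le>N. Polynomial.monom (coeff g i) i)"
      by (rule sum.cong) auto
    thus ?thesis using poly_as_sum_of_monoms'[OF that] by simp
  qed
  moreover have "restrict (coeff g) {..N} \<in> {..N} \<rightarrow>\<^sub>E UNIV" for g :: "'a poly" by simp
  ultimately have "{g :: 'a poly. degree g \<le> N} \<subseteq> (\<lambda>f. \<Sum>i\<le>N. Polynomial.monom (f i) i) ` ({..N} \<rightarrow>\<^sub>E UNIV)"
    by (intro subsetI, elim CollectE, intro image_eqI)
  thus ?thesis by (rule finite_subset) (intro finite_imageI finite_PiE; simp)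
qed

section \<open>Units of norm one and the real case\<close>

context artin_schreier_function_field
begin

lemma \<sigma>_divide: "\<sigma> (x / y) = \<sigma> x / \<sigma> y"
  by (simp add: divide_inverse \<sigma>.hom_mult \<sigma>.hom_inverse)

lemma valuation_W:
  assumes \<pi>: "\<pi> \<in> ram"
  shows "valuation (W \<pi>)"
  unfolding valuation_def
proof (intro conjI allI impI)
  fix x y :: 'k assume nz: "x \<noteq> 0" "y \<noteq> 0"
  show "W \<pi> (x * y) = W \<pi> x + W \<pi> y" by (rule W_mult[OF \<pi> nz])
  assume xy: "x + y \<noteq> 0"
  have "x \<in> F \<pi> (min (W \<pi> x) (W \<pi> y))" "y \<in> F \<pi> (min (W \<pi> x) (W \<pi> y))"
    using F_iff_W[OF \<pi> nz(1)] F_iff_W[OF \<pi> nz(2)] by auto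
  thus "min (W \<pi> x) (W \<pi> y) \<le> W \<pi> (x + y)"
    using fil_add[OF adm[OF ram_irr[OF \<pi>]]] F_iff_W[OF \<pi> xy] by blast
qed

lemma W_generator:
  assumes n: "supported n" and a: "a \<noteq> 0" "J n = scale a O\<^sub>K" and \<pi>: "\<pi> \<in> ram"
  shows "n \<pi> = W \<pi> a"
proof -
  have "a * 1 \<in> J n" unfolding a(2) using O_1 by blast
  hence 1: "n \<pi> \<le> W \<pi> a" using J_W[OF _ \<pi> a(1)] by simp
  obtain x where x: "x \<in> J n" "x \<noteq> 0" "W \<pi> x = n \<pi>" using J_attain[OF n \<pi>] by blast
  then obtain y where y: "y \<in> O\<^sub>K" "x = a * y" using a(2) by blast
  hence y0: "y \<noteq> 0" using x by auto
  have "0 \<le> W \<pi> y" using J_W[OF y(1) \<pi> y0] by simp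
  thus ?thesis using 1 W_mult[OF \<pi> a(1) y0] x(3) y(2) by simp
qed

text \<open>Restricting to norm one removes the constants other than 1, so that the logarithmic
  vectors below determine their units.\<close>

definition norm_one_units :: "'k set" where "norm_one_units = {u \<in> O\<^sub>K. nrm u = 1}"

lemma norm_one_unitsD:
  assumes "u \<in> norm_one_units"
  shows "u \<in> O\<^sub>K" "nrm u = 1" "inverse u \<in> O\<^sub>K" "u \<noteq> 0"
  using assms nrm_1_inverse[of u] nrm_eq_0_iff[of u] by (auto simp: norm_one_units_def)

lemma nrm_inverse: "nrm (inverse u) = inverse (nrm u)"
proof (cases "u = 0")
  case False
  hence "nrm (inverse u) * nrm u = 1" by (simp add: nrm_mult[symmetric] nrm_1)
  thus ?thesis by (metis inverse_unique mult.commute)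
next
  case True
  have "nrm (0 :: 'k) = 0" using nrm_eq_0_iff by blast
  thus ?thesis using True by simp
qed

lemma norm_one_units_mult: "u \<in> norm_one_units \<Longrightarrow> v \<in> norm_one_units \<Longrightarrow> u * v \<in> norm_one_units"
proof -
  assume uv: "u \<in> norm_one_units" "v \<in> norm_one_units"
  have "nrm (u * v) = 1" unfolding nrm_mult norm_one_unitsD(2)[OF uv(1)] norm_one_unitsD(2)[OF uv(2)] by simp
  thus ?thesis unfolding norm_one_units_def
    using J_O_mult[OF norm_one_unitsD(1)[OF uv(1)] norm_one_unitsD(1)[OF uv(2)]] by blast
qed

lemma norm_one_units_inverse: "u \<in> norm_one_units \<Longrightarrow> inverse u \<in> norm_one_units"
proof -
  assume u: "u \<in> norm_one_units"
  have "nrm (inverse u) = 1" unfolding nrm_inverse norm_one_unitsD(2)[OF u] by simp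
  thus ?thesis unfolding norm_one_units_def using norm_one_unitsD(3)[OF u] by blast
qed

lemma norm_one_units_divide: "u \<in> norm_one_units \<Longrightarrow> v \<in> norm_one_units \<Longrightarrow> u / v \<in> norm_one_units"
  unfolding divide_inverse by (intro norm_one_units_mult norm_one_units_inverse)

lemma norm_one_units_\<sigma>: "u \<in> norm_one_units \<Longrightarrow> \<sigma> u \<in> norm_one_units"
  unfolding norm_one_units_def using J_\<sigma> by (auto simp only: nrm_\<sigma>)

lemma norm_one_units_power: "u \<in> norm_one_units \<Longrightarrow> u ^ n \<in> norm_one_units"
proof (induction n)
  case 0
  show ?case using O_1 nrm_1 unfolding norm_one_units_def by simp
qed (simp add: norm_one_units_mult)

lemma norm_one_units_powi: "u \<in> norm_one_units \<Longrightarrow> u powi n \<in> norm_one_units"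
  by (auto simp: power_int_def norm_one_units_power norm_one_units_inverse)

lemma scale_norm_one_unit:
  assumes "z \<in> norm_one_units"
  shows "scale z O\<^sub>K = O\<^sub>K"
proof -
  note z = norm_one_unitsD[OF assms]
  have "scale c O\<^sub>K \<subseteq> O\<^sub>K" if "c \<in> O\<^sub>K" for c using J_O_mult[OF that] by blast
  from this[OF z(1)] this[OF z(3)] have "scale z (scale (inverse z) O\<^sub>K) \<subseteq> scale z O\<^sub>K" "scale z O\<^sub>K \<subseteq> O\<^sub>K" by blast+
  moreover have "scale z (scale (inverse z) O\<^sub>K) = O\<^sub>K" unfolding scale_scale using z(4) by simp
  ultimately show ?thesis by simp
qed

text \<open>The norm of a unit is a nonzero constant, hence the norm of a constant, which can be
  divided out.\<close>

lemma normalize_unit: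
  assumes "e \<in> O\<^sub>K" "inverse e \<in> O\<^sub>K" "e \<noteq> 0"
  shows "\<exists>d. d \<noteq> 0 \<and> e / const d \<in> norm_one_units"
proof -
  have i: "\<iota> (nrm y) \<in> O\<^sub>K" if "y \<in> O\<^sub>K" for y
    unfolding nrm_split using J_O_mult[OF that O_nrm_cofactor[OF that]] .
  have n0: "nrm e \<noteq> 0" using assms(3) nrm_eq_0_iff by simp
  have "\<iota> (inverse (nrm e)) \<in> O\<^sub>K" using i[OF assms(2)] by (simp only: nrm_inverse)
  then obtain c0 where c0: "c0 \<noteq> 0" "nrm e = to_fract [:c0:]" using O_unit_base[OF i[OF assms(1)] _ n0] by blast
  obtain d where d: "d ^ p = c0" using frobenius_surj by blast
  hence d0: "d \<noteq> 0" using c0 p_pos by (auto simp: power_0_left)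
  have "\<iota> (to_fract [:d:] ^ p) = \<iota> (nrm e)" using const_power[of d p] d c0 by (simp add: hom_power)
  hence dp: "to_fract [:d:] ^ p = nrm e" by simp
  have cd: "inverse (const d) = const (inverse d)"
  proof -
    have "const d * const (inverse d) = 1"
      using d0 by (simp add: \<kappa>_mult[symmetric] one_pCons[symmetric] del: to_fract_mult)
    thus ?thesis by (rule inverse_unique)
  qed
  have "nrm (e / const d) = nrm e * nrm (inverse (const d))" by (simp add: divide_inverse nrm_mult)
  also have "\<dots> = nrm e * inverse (to_fract [:d:] ^ p)" by (simp only: nrm_inverse nrm_\<iota>)
  also have "\<dots> = 1" using dp n0 by simp
  finally have "nrm (e / const d) = 1" .
  moreover have "e / const d \<in> O\<^sub>K" unfolding divide_inverse cd by (rule J_O_mult[OF assms(1) O_\<kappa>])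
  ultimately show ?thesis using d0 by (auto simp: norm_one_units_def)
qed

context
  assumes real: "val_ge infval 1 D"
begin

text \<open>The expansion of D at infinity has no constant term, so the equation of \<alpha> is
  solvable in power series in 1/t.\<close>

lemma embedding_exists:
  "\<exists>\<psi> :: 'k \<Rightarrow> 'a fls. field_hom \<psi> \<and> (\<forall>c. \<psi> (\<iota> c) = fract_to_fls c)"
proof -
  interpret f: field_hom "fract_to_fls :: 'a poly fract \<Rightarrow> 'a fls" by (rule field_hom_fract_to_fls)
  let ?d = "fract_to_fls D"
  have sd: "1 \<le> fls_subdegree ?d"
    using real D_nz subdegree_fract_to_fls[OF D_nz] by (simp add: val_ge_def)
  hence d0: "fls_regpart ?d $ 0 = 0" by simp
  have d: "fps_to_fls (fls_regpart ?d) = ?d" using sd by (intro fls_regpart_to_fls_trivial) simp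
  obtain a where "a ^ p - a = fls_regpart ?d" using fps_artin_schreier_root[OF prime_p char_a d0] by blast
  hence "fps_to_fls (a ^ p - a) = ?d" using d by simp
  hence "fps_to_fls a ^ p - fps_to_fls a = ?d" by (simp add: fps_to_fls_power)
  from extend_hom(1,3)[OF field_hom_fract_to_fls this] show ?thesis by blast
qed

context
  fixes \<psi> :: "'k \<Rightarrow> 'a fls"
  assumes \<psi>: "field_hom \<psi>" and \<psi>_\<iota>: "\<And>c. \<psi> (\<iota> c) = fract_to_fls c"
begin

text \<open>The valuation of one place above infinity. The others arise by composition with powers
  of \<sigma>, so one embedding suffices.\<close>

definition w :: "'k \<Rightarrow> int" where "w x = fls_subdegree (\<psi> x)"

lemma valuation_w: "valuation w"
proof -
  interpret s: field_hom \<psi> by (rule \<psi>)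
  show ?thesis using valuation_fls[where ?'a = 'a]
    unfolding valuation_def w_def s.hom_mult s.hom_add
    by (metis s.hom_0_iff s.hom_add)
qed

lemma w_\<iota>: "c \<noteq> 0 \<Longrightarrow> w (\<iota> c) = infval c"
  by (simp add: w_def \<psi>_\<iota> subdegree_fract_to_fls)

lemma real_const:
  assumes u: "u \<in> O\<^sub>K" "\<And>j. val_ge w 0 ((\<sigma> ^^ j) u)"
  shows "u \<in> range const"
proof (rule const_criterion[OF u(1)])
  fix n c assume c: "coeff (conj_poly u) n = \<iota> c"
  have "coeff (conj_poly u) n \<in> {x. val_ge w 0 x}"
  proof (rule coeff_conj_poly_mem)
    show "x - y \<in> {x. val_ge w 0 x}" if "x \<in> {x. val_ge w 0 x}" "y \<in> {x. val_ge w 0 x}" for x y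
      using that val_ge_diff[OF valuation_w] by simp
    show "x * y \<in> {x. val_ge w 0 x}" if "x \<in> {x. val_ge w 0 x}" "y \<in> {x. val_ge w 0 x}" for x y
      using that val_ge_mult[OF valuation_w, of 0 x 0 y] by simp
    show "1 \<in> {x. val_ge w 0 x}" using val_1[OF valuation_w] by (simp add: val_ge_def)
  qed (use u(2) in simp)
  thus "val_ge infval 0 c" unfolding c by (cases "c = 0") (auto simp: val_ge_def w_\<iota>)
qed

text \<open>The logarithmic embedding at infinity, extended periodically so that \<sigma> becomes
  the shift by one.\<close>

definition logvec :: "'k \<Rightarrow> int \<Rightarrow> int" where
  "logvec u i = w ((\<sigma> ^^ nat (i mod int p)) u)"

lemma \<sigma>_pow_nz: "u \<noteq> 0 \<Longrightarrow> (\<sigma> ^^ j) u \<noteq> 0"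
  by (induction j) auto

lemma logvec_mult: "u \<noteq> 0 \<Longrightarrow> v \<noteq> 0 \<Longrightarrow> logvec (u * v) i = logvec u i + logvec v i"
proof -
  assume nz: "u \<noteq> 0" "v \<noteq> 0"
  have "(\<sigma> ^^ n) (u * v) = (\<sigma> ^^ n) u * (\<sigma> ^^ n) v" for n
    by (induction n) (simp_all add: \<sigma>.hom_mult)
  thus ?thesis unfolding logvec_def using val_mult[OF valuation_w \<sigma>_pow_nz[OF nz(1)] \<sigma>_pow_nz[OF nz(2)]] by simp
qed

lemma logvec_1: "logvec 1 i = 0"
  using logvec_mult[of 1 1 i] by simp

lemma logvec_inverse: "u \<noteq> 0 \<Longrightarrow> logvec (inverse u) i = - logvec u i"
  using logvec_mult[of u "inverse u" i] logvec_1 by simp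

lemma logvec_divide: "u \<noteq> 0 \<Longrightarrow> v \<noteq> 0 \<Longrightarrow> logvec (u / v) i = logvec u i - logvec v i"
  unfolding divide_inverse using logvec_mult[of u "inverse v" i] logvec_inverse[of v i] by simp

lemma logvec_power: "u \<noteq> 0 \<Longrightarrow> logvec (u ^ n) i = int n * logvec u i"
  by (induction n) (auto simp: logvec_1 logvec_mult algebra_simps)

lemma logvec_powi: "u \<noteq> 0 \<Longrightarrow> logvec (u powi n) i = n * logvec u i"
  by (auto simp: power_int_def logvec_power logvec_inverse)

lemma logvec_\<sigma>: "logvec (\<sigma> u) i = logvec u (i + 1)"
proof -
  have "int ((nat (i mod int p) + 1) mod p) = int (nat ((i + 1) mod int p))"
    using p_pos by (simp add: zmod_int mod_simps add.commute)
  hence "(nat (i mod int p) + 1) mod p = nat ((i + 1) mod int p)" by (simp only: of_nat_eq_iff)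
  hence "(\<sigma> ^^ nat (i mod int p)) (\<sigma> u) = (\<sigma> ^^ nat ((i + 1) mod int p)) u"
    using \<sigma>_pow_mod[of "nat (i mod int p) + 1" u] by (simp add: funpow_swap1)
  thus ?thesis by (simp add: logvec_def)
qed

lemma periodic_logvec: "periodic p (logvec u)"
  by (simp add: periodic_def logvec_def)

lemma period_sum_logvec:
  assumes "u \<in> norm_one_units"
  shows "period_sum p (logvec u) = 0"
proof -
  note u = norm_one_unitsD[OF assms]
  have "period_sum p (logvec u) = (\<Sum>n<p. w ((\<sigma> ^^ n) u))"
    unfolding period_sum_def logvec_def by (rule sum.cong) (auto simp: zmod_int[symmetric])
  also have "\<dots> = w (\<iota> (nrm u))"
    unfolding \<iota>_nrm by (rule val_prod[OF valuation_w, symmetric]) (rule \<sigma>_pow_nz[OF u(4)])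
  also have "\<dots> = 0" using u(2) val_1[OF valuation_w] by simp
  finally show ?thesis .
qed

text \<open>Such a unit has no pole at any place above infinity, so it is a constant of norm
  one.\<close>

lemma logvec_eq_0:
  assumes u: "u \<in> norm_one_units" and z: "logvec u = (\<lambda>_. 0)"
  shows "u = 1"
proof -
  have "w ((\<sigma> ^^ j) u) = 0" for j
  proof -
    have "w ((\<sigma> ^^ (j mod p)) u) = 0"
      using fun_cong[OF z, of "int j"] by (simp add: logvec_def zmod_int[symmetric])
    thus ?thesis using \<sigma>_pow_mod[of j u] by simp
  qed
  hence "u \<in> range const" by (intro real_const norm_one_unitsD[OF u]) (simp add: val_ge_def)
  then obtain c where "u = const c" by (rule rangeE)
  thus ?thesis using const_nrm_1[of c u] norm_one_unitsD(2)[OF u] by simp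
qed

lemma logvec_inj:
  assumes "u \<in> norm_one_units" "v \<in> norm_one_units" "logvec u = logvec v"
  shows "u = v"
proof -
  note nz = norm_one_unitsD(4)[OF assms(1)] norm_one_unitsD(4)[OF assms(2)]
  have "logvec (u / v) = (\<lambda>_. 0)" using logvec_divide[OF nz] assms(3) by auto
  hence "u / v = 1" using logvec_eq_0 norm_one_units_divide assms by blast
  thus ?thesis using nz by simp
qed

section \<open>A nontrivial unit by Dirichlet's argument\<close>

abbreviation \<beta> :: 'k where "\<beta> \<equiv> \<kappa> B * \<alpha>"

text \<open>Elements of the order generated by the integral element \<beta>. It may be smaller than
  \<open>O\<^sub>K\<close>, but a lattice of full rank with polynomial coordinates is all that the
  counting requires.\<close>

definition comb :: "(nat \<Rightarrow> 'a poly) \<Rightarrow> 'k" where "comb c = (\<Sum>i<p. \<kappa> (c i) * \<beta> ^ i)"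

lemma comb_O: "comb c \<in> O\<^sub>K"
proof -
  have "(\<Sum>i<n. \<kappa> (c i) * \<beta> ^ i) \<in> O\<^sub>K" for n
    by (induction n) (simp_all add: J_add J_O_mult O_\<kappa> O_power B_\<alpha>)
  thus ?thesis by (simp add: comb_def)
qed

lemma comb_diff: "comb (\<lambda>i. c i - d i) = comb c - comb d"
  by (simp add: comb_def hom_minus left_diff_distrib sum_subtractf)

lemma comb_cong: "(\<And>i. i < p \<Longrightarrow> c i = d i) \<Longrightarrow> comb c = comb d"
  by (simp add: comb_def)

lemma comb_scale: "comb (\<lambda>i. a * c i) = \<kappa> a * comb c"
  by (simp add: comb_def hom_mult sum_distrib_left mult.assoc)

lemma comb_nz:
  assumes "i < p" "c i \<noteq> 0"
  shows "comb c \<noteq> 0"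
proof
  assume "comb c = 0"
  have "comb c = (\<Sum>j<p. \<iota> (to_fract (c j) * to_fract B ^ j) * \<alpha> ^ j)"
    by (simp add: comb_def hom_mult hom_power power_mult_distrib mult.assoc)
  hence "coef (comb c) i = (\<Sum>j<p. if i = j then to_fract (c j) * to_fract B ^ j else 0)"
    by (simp add: coef_sum coef_monomial)
  hence "coef (comb c) i = to_fract (c i) * to_fract B ^ i" using assms(1) by simp
  thus False using \<open>comb c = 0\<close> assms(2) B_nz by (simp add: coef_simps)
qed

text \<open>The constant \<open>b\<close> absorbs the values of all conjugates of the powers of
  \<beta> and is independent of the degree bound \<open>M\<close>.\<close>

lemma w_comb_bound: "\<exists>b :: nat. \<forall>M c j. (\<forall>i<p. degree (c i) \<le> M) \<longrightarrow> j < p \<longrightarrow> val_ge w (- int (M + b)) ((\<sigma> ^^ j) (comb c))"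
proof -
  define A where "A = (\<Sum>i<p. \<Sum>j<p. \<bar>w ((\<sigma> ^^ j) (\<beta> ^ i))\<bar>)"
  have le: "\<bar>w ((\<sigma> ^^ j) (\<beta> ^ i))\<bar> \<le> A" if "i < p" "j < p" for i j
  proof -
    have "\<bar>w ((\<sigma> ^^ j) (\<beta> ^ i))\<bar> \<le> (\<Sum>j<p. \<bar>w ((\<sigma> ^^ j) (\<beta> ^ i))\<bar>)"
      by (rule member_le_sum) (use that in auto)
    also have "\<dots> \<le> A" unfolding A_def
      by (rule member_le_sum[where f = "\<lambda>i. \<Sum>j<p. \<bar>w ((\<sigma> ^^ j) (\<beta> ^ i))\<bar>"]) (use that in \<open>auto intro: sum_nonneg\<close>)
    finally show ?thesis .
  qed
  have "val_ge w (- int (M + nat A)) ((\<sigma> ^^ j) (comb c))" if c: "\<forall>i<p. degree (c i) \<le> M" and j: "j < p" for M c j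
  proof -
    interpret s: field_hom "\<sigma> ^^ j" by (rule \<sigma>_pow_hom)
    have "(\<sigma> ^^ j) (comb c) = (\<Sum>i<p. \<kappa> (c i) * (\<sigma> ^^ j) (\<beta> ^ i))"
      by (simp only: comb_def s.hom_sum s.hom_mult[of "\<kappa> _"] \<sigma>_pow_\<iota>)
    moreover have "val_ge w (- int (M + nat A)) (\<kappa> (c i) * (\<sigma> ^^ j) (\<beta> ^ i))" if i: "i < p" for i
    proof -
      have "val_ge w (- int M) (\<kappa> (c i))"
      proof (cases "c i = 0")
        case False
        have "int (degree (c i)) \<le> int M" using c i by simp
        thus ?thesis using False by (simp add: val_ge_def w_\<iota> infval_to_fract)
      qed simp
      moreover have "val_ge w (- int (nat A)) ((\<sigma> ^^ j) (\<beta> ^ i))"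
        using le[OF i j] by (auto simp: val_ge_def)
      ultimately have "val_ge w (- int M + - int (nat A)) (\<kappa> (c i) * (\<sigma> ^^ j) (\<beta> ^ i))"
        by (rule val_ge_mult[OF valuation_w])
      thus ?thesis by simp
    qed
    ultimately show ?thesis using val_ge_sum[OF valuation_w, of "{..<p}"] by simp
  qed
  thus ?thesis by blast
qed

text \<open>Dirichlet's pigeonhole argument: \<open>p (M + 1)\<close> free coefficients against \<open>p (M + 1) - 1\<close> conditions.\<close>

lemma small_at_one_place:
  assumes b: "\<And>M c j. (\<forall>i<p. degree (c i) \<le> M) \<Longrightarrow> j < p \<Longrightarrow> val_ge w (- int (M + b)) ((\<sigma> ^^ j) (comb c))"
  shows "\<exists>c. (\<forall>i<p. degree (c i) \<le> M) \<and> (\<exists>i<p. c i \<noteq> 0) \<and> (int p - 1) * int M - int b \<le> w (comb c)"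
proof -
  interpret s: field_hom \<psi> by (rule \<psi>)
  \<comment> \<open>The number of Laurent coefficients, counted from \<open>- (M + b)\<close>
    upwards, that can be made to vanish: one fewer than the \<open>p * (M + 1)\<close> free
    coefficients in the finite field. \<open>G\<close> records these coefficients.\<close>
  define N where "N = p * Suc M - 1"
  define cf :: "(nat \<times> nat \<Rightarrow> 'a) \<Rightarrow> nat \<Rightarrow> 'a poly" where
    "cf f i = (\<Sum>k\<le>M. Polynomial.monom (f (i, k)) k)" for f i
  define G where "G f = restrict (\<lambda>n. fls_nth (\<psi> (comb (cf f))) (int n - int (M + b))) {..<N}" for f
  let ?A = "({..<p} \<times> {..M}) \<rightarrow>\<^sub>E (UNIV :: 'a set)" and ?B = "{..<N} \<rightarrow>\<^sub>E (UNIV :: 'a set)"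
  have N: "p * Suc M = Suc N" using p_pos by (simp add: N_def)
  have q: "card (UNIV :: 'a set) \<ge> 2"
  proof -
    have "card {0, 1 :: 'a} \<le> card (UNIV :: 'a set)" by (rule card_mono) auto
    thus ?thesis by simp
  qed
  have cA: "card ?A = card (UNIV :: 'a set) ^ Suc N" unfolding N[symmetric] by (simp add: card_PiE)
  have cB: "card ?B = card (UNIV :: 'a set) ^ N" by (simp add: card_PiE)
  have lt: "card ?B < card ?A" unfolding cA cB using q by simp
  have "G ` ?A \<subseteq> ?B" unfolding G_def by auto
  moreover have "finite ?B" by (intro finite_PiE) auto
  ultimately have "card (G ` ?A) \<le> card ?B" by (rule card_mono[rotated])
  hence "card (G ` ?A) < card ?A" using lt by (rule le_less_trans)
  hence "\<not> inj_on G ?A" by (rule pigeonhole)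
  then obtain f g where fg: "f \<in> ?A" "g \<in> ?A" "G f = G g" "f \<noteq> g" by (auto simp: inj_on_def)
  define c where "c i = cf f i - cf g i" for i
  have coeff_cf: "coeff (cf f i) k = (if k \<le> M then f (i, k) else 0)" for f i k
    by (simp add: cf_def coeff_sum)
  have deg_cf: "degree (cf f i) \<le> M" for f i by (rule degree_le) (simp add: coeff_cf)
  have deg: "\<forall>i<p. degree (c i) \<le> M" unfolding c_def using deg_cf by (auto intro: degree_diff_le)
  obtain i k where ik: "i < p" "k \<le> M" "f (i, k) \<noteq> g (i, k)"
    using fg(4) PiE_ext[OF fg(1,2)] by auto
  have "coeff (c i) k \<noteq> 0" using ik by (simp add: c_def coeff_cf)
  hence ci: "c i \<noteq> 0" by auto
  have nz: "comb c \<noteq> 0" using comb_nz[of i c] ik(1) ci by blast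
  have "- int (M + b) + int N \<le> w (comb c)"
    unfolding w_def
  proof (rule fls_subdegree_geI)
    show "\<psi> (comb c) \<noteq> 0" using nz by simp
    fix k assume k: "k < - int (M + b) + int N"
    show "fls_nth (\<psi> (comb c)) k = 0"
    proof (cases "k < - int (M + b)")
      case True
      have "- int (M + b) \<le> w (comb c)" using b[OF deg p_pos] nz by (simp add: val_ge_def)
      thus ?thesis using True by (intro fls_eq0_below_subdegree) (simp add: w_def)
    next
      case False
      define n where "n = nat (k + int (M + b))"
      have n: "n < N" "k = int n - int (M + b)" using False k by (auto simp: n_def)
      have "\<psi> (comb c) = \<psi> (comb (cf f)) - \<psi> (comb (cf g))"
        unfolding c_def comb_diff by (rule s.hom_minus)
      moreover have "G f n = G g n" using fg(3) by simp
      hence "fls_nth (\<psi> (comb (cf f))) k = fls_nth (\<psi> (comb (cf g))) k" using n by (simp add: G_def)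
      ultimately show ?thesis by simp
    qed
  qed
  moreover have "(int p - 1) * int M - int b \<le> - int (M + b) + int N"
  proof -
    have "int N = int p * (int M + 1) - 1" using arg_cong[OF N, of int] by (simp add: algebra_simps)
    thus ?thesis using p_pos by (simp add: algebra_simps)
  qed
  ultimately show ?thesis using deg ik(1) ci by (intro exI[of _ c]) auto
qed

text \<open>A value of about \<open>(p - 1) * M\<close> at one place compensates the poles of order
  at most \<open>M + b\<close> at the other \<open>p - 1\<close> places, so the norms have degree at
  most \<open>p * b\<close> whatever \<open>M\<close> is. Finitely many norms and residues occur,
  and two elements agreeing in both have a unit as quotient.\<close>

lemma nontrivial_unit: "\<exists>u\<in>norm_one_units. w u \<noteq> 0"
proof -
  obtain b :: nat where b: "\<And>M c j. (\<forall>i<p. degree (c i) \<le> M) \<Longrightarrow> j < p \<Longrightarrow> val_ge w (- int (M + b)) ((\<sigma> ^^ j) (comb c))"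
    using w_comb_bound by metis
  obtain c where c: "\<And>M i. i < p \<Longrightarrow> degree (c M i) \<le> M" "\<And>M. \<exists>i<p. c M i \<noteq> 0"
    "\<And>M. (int p - 1) * int M - int b \<le> w (comb (c M))"
    using small_at_one_place[OF b] by metis
  have nz: "comb (c M) \<noteq> 0" for M using c(2)[of M] comb_nz by blast
  have "\<forall>M. \<exists>a. nrm (comb (c M)) = to_fract a" using O_nrm[OF comb_O] by blast
  then obtain a where a: "\<And>M. nrm (comb (c M)) = to_fract (a M)" by metis
  have a0: "a M \<noteq> 0" for M using a[of M] nz[of M] nrm_eq_0_iff[of "comb (c M)"] by auto
  have dega: "degree (a M) \<le> p * b" for M
  proof -
    let ?x = "comb (c M)"
    have "- int (degree (a M)) = w (\<iota> (nrm ?x))" unfolding a using w_\<iota> a0 by (simp add: infval_to_fract)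
    also have "\<dots> = w ?x + w (\<Prod>j\<in>{1..<p}. (\<sigma> ^^ j) ?x)"
      unfolding nrm_split by (rule val_mult[OF valuation_w nz]) (simp add: \<sigma>_pow_nz[OF nz])
    also have "w (\<Prod>j\<in>{1..<p}. (\<sigma> ^^ j) ?x) = (\<Sum>j\<in>{1..<p}. w ((\<sigma> ^^ j) ?x))"
      by (rule val_prod[OF valuation_w]) (rule \<sigma>_pow_nz[OF nz])
    finally have e: "- int (degree (a M)) = w ?x + (\<Sum>j\<in>{1..<p}. w ((\<sigma> ^^ j) ?x))" .
    have "(\<Sum>j\<in>{1..<p}. - int (M + b)) \<le> (\<Sum>j\<in>{1..<p}. w ((\<sigma> ^^ j) ?x))"
    proof (rule sum_mono)
      fix j assume "j \<in> {1..<p}"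
      hence "val_ge w (- int (M + b)) ((\<sigma> ^^ j) ?x)" using c(1) by (intro b) auto
      thus "- int (M + b) \<le> w ((\<sigma> ^^ j) ?x)" using \<sigma>_pow_nz[OF nz] by (simp add: val_ge_def)
    qed
    moreover have "(\<Sum>j\<in>{1..<p}. - int (M + b)) = - ((int p - 1) * int (M + b))"
      using p_pos by (simp add: of_nat_diff algebra_simps)
    ultimately have "(int p - 1) * int M - int b - (int p - 1) * int (M + b) \<le> - int (degree (a M))"
      using e c(3)[of M] by linarith
    hence "int (degree (a M)) \<le> int p * int b" by (simp add: algebra_simps)
    thus ?thesis by (metis of_nat_le_iff of_nat_mult)
  qed
  define S where "S = {g :: 'a poly. degree g \<le> p * b}"
  \<comment> \<open>The norm together with the residues of the coordinates modulo the norm; all of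
    these have degree at most \<open>p * b\<close>.\<close>
  define key where "key M = (a M, restrict (\<lambda>i. c M i mod a M) {..<p})" for M
  have "c M i mod a M \<in> S" for M i
    using degree_mod_less[OF a0, of "c M i" M] dega[of M] by (auto simp: S_def)
  moreover have "a M \<in> S" for M using dega by (simp add: S_def)
  ultimately have "key M \<in> S \<times> ({..<p} \<rightarrow>\<^sub>E S)" for M unfolding key_def by (simp add: restrict_PiE_iff)
  hence "range key \<subseteq> S \<times> ({..<p} \<rightarrow>\<^sub>E S)" by blast
  moreover have "finite (S \<times> ({..<p} \<rightarrow>\<^sub>E S))" unfolding S_def by (intro finite_cartesian_product finite_PiE finite_degree_le) auto
  ultimately have fin: "finite (range key)" by (rule finite_subset)
  obtain M1 where M1: "infinite {M. key M = key M1}"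
    using pigeonhole_infinite[OF infinite_UNIV_nat fin] by auto
  \<comment> \<open>The second index is so large that its element has strictly greater value at the
    distinguished place; hence the quotient is not a unit of value 0.\<close>
  obtain M2 where M2: "key M2 = key M1" "nat (w (comb (c M1)) + int b) < M2"
    using M1 unfolding infinite_nat_iff_unbounded by blast
  let ?x = "comb (c M1)" and ?y = "comb (c M2)"
  have "1 * int M2 \<le> (int p - 1) * int M2" using p_gt_1 by (intro mult_right_mono) auto
  hence wxy: "w ?x < w ?y" using c(3)[of M2] M2(2) by linarith
  have aa: "a M2 = a M1" using M2(1) by (simp add: key_def)
  have "\<exists>h. i < p \<longrightarrow> c M1 i - c M2 i = a M1 * h" for i
  proof (cases "i < p")
    case True
    have "c M2 i mod a M2 = c M1 i mod a M1"
      using M2(1) True by (auto simp: key_def fun_eq_iff restrict_def split: if_splits)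
    hence "a M1 dvd c M1 i - c M2 i" unfolding aa by (metis mod_eq_dvd_iff)
    thus ?thesis by (auto elim: dvdE)
  qed simp
  then obtain h where h: "\<And>i. i < p \<Longrightarrow> c M1 i - c M2 i = a M1 * h i" by metis
  have "?x - ?y = comb (\<lambda>i. a M1 * h i)"
    unfolding comb_diff[symmetric] by (rule comb_cong[OF h])
  hence diff: "?x - ?y = \<kappa> (a M1) * comb h" by (simp only: comb_scale)
  have quot: "\<kappa> (a M) / comb (c M) \<in> O\<^sub>K" for M
  proof -
    have "\<kappa> (a M) = comb (c M) * (\<Prod>j\<in>{1..<p}. (\<sigma> ^^ j) (comb (c M)))" unfolding a[symmetric] by (rule nrm_split)
    hence "\<kappa> (a M) / comb (c M) = (\<Prod>j\<in>{1..<p}. (\<sigma> ^^ j) (comb (c M)))" using nz[of M] by simp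
    thus ?thesis using O_nrm_cofactor[OF comb_O] by simp
  qed
  \<comment> \<open>The difference of the two elements is a multiple of their common norm, and the
    norm divided by \<open>?y\<close> is integral, being the product of the other
    conjugates.\<close>
  have "?x / ?y = 1 + comb h * (\<kappa> (a M2) / ?y)"
  proof -
    have "?x = ?y + \<kappa> (a M2) * comb h" using diff unfolding aa by (metis add.commute diff_add_cancel)
    hence "?x / ?y = (?y + \<kappa> (a M2) * comb h) / ?y" by metis
    thus ?thesis using nz[of M2] by (simp add: add_divide_distrib mult.commute)
  qed
  hence "?x / ?y \<in> O\<^sub>K" using J_add[OF O_1 J_O_mult[OF comb_O quot]] by metis
  moreover have "nrm (?x / ?y) = 1"
    using a0[of M1] by (simp add: divide_inverse nrm_mult nrm_inverse a aa)
  ultimately have "?x / ?y \<in> norm_one_units" by (simp add: norm_one_units_def)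
  moreover have "w (?x / ?y) \<noteq> 0" using val_divide[OF valuation_w nz nz, of M1 M2] wxy by simp
  ultimately show ?thesis by blast
qed

text \<open>The map \<open>logvec\<close> is injective on the units of norm one and carries \<sigma>
  z / z to a difference, so this is \<open>cyclic_lattice\<close> in multiplicative
  notation.\<close>

lemma unit_lattice:
  "\<exists>u\<in>norm_one_units. (\<forall>z\<in>norm_one_units. u \<noteq> \<sigma> z / z) \<and>
     (\<forall>v\<in>norm_one_units. \<exists>k. \<exists>z\<in>norm_one_units. v = u powi k * (\<sigma> z / z))"
proof -
  have dlog: "logvec (\<sigma> z / z) = difference (logvec z)" if "z \<in> norm_one_units" for z
  proof
    fix i
    have "z \<noteq> 0" "\<sigma> z \<noteq> 0" using norm_one_unitsD(4)[OF that] by auto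
    thus "logvec (\<sigma> z / z) i = difference (logvec z) i"
      by (simp add: logvec_divide logvec_\<sigma> difference_def)
  qed
  have "\<exists>f\<in>logvec ` norm_one_units. (\<forall>z\<in>logvec ` norm_one_units. f \<noteq> difference z) \<and>
      (\<forall>y\<in>logvec ` norm_one_units. \<exists>a. \<exists>z\<in>logvec ` norm_one_units. y = (\<lambda>i. a * f i + difference z i))"
  proof (rule cyclic_lattice[OF prime_p])
    fix f assume "f \<in> logvec ` norm_one_units"
    then obtain u where u: "u \<in> norm_one_units" "f = logvec u" by blast
    show "periodic p f" unfolding u(2) by (rule periodic_logvec)
    show "period_sum p f = 0" unfolding u(2) by (rule period_sum_logvec[OF u(1)])
    have "(\<lambda>i. f (i + 1)) = logvec (\<sigma> u)" unfolding u(2) by (simp add: logvec_\<sigma> fun_eq_iff)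
    thus "(\<lambda>i. f (i + 1)) \<in> logvec ` norm_one_units" using norm_one_units_\<sigma>[OF u(1)] by blast
  next
    fix f g assume "f \<in> logvec ` norm_one_units" "g \<in> logvec ` norm_one_units"
    then obtain u v where uv: "u \<in> norm_one_units" "f = logvec u" "v \<in> norm_one_units" "g = logvec v" by blast
    have "(\<lambda>i. f i - g i) = logvec (u / v)"
      unfolding uv using norm_one_unitsD(4) uv by (simp add: logvec_divide fun_eq_iff)
    thus "(\<lambda>i. f i - g i) \<in> logvec ` norm_one_units" using norm_one_units_divide[OF uv(1,3)] by blast
  next
    obtain u where u: "u \<in> norm_one_units" "w u \<noteq> 0" using nontrivial_unit by blast
    have "logvec u 0 \<noteq> 0" using u(2) by (simp add: logvec_def)
    hence "logvec u \<noteq> (\<lambda>_. 0)" by auto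
    thus "\<exists>f\<in>logvec ` norm_one_units. f \<noteq> (\<lambda>_. 0)" using u(1) by blast
  qed
  then obtain u where u: "u \<in> norm_one_units" "\<forall>z\<in>norm_one_units. logvec u \<noteq> difference (logvec z)"
    "\<forall>v\<in>norm_one_units. \<exists>a. \<exists>z\<in>norm_one_units. logvec v = (\<lambda>i. a * logvec u i + difference (logvec z) i)"
    by auto
  have "u \<noteq> \<sigma> z / z" if "z \<in> norm_one_units" for z using u(2) that dlog[OF that] by metis
  moreover have "\<exists>k. \<exists>z\<in>norm_one_units. v = u powi k * (\<sigma> z / z)" if v: "v \<in> norm_one_units" for v
  proof -
    obtain k z where kz: "z \<in> norm_one_units" "logvec v = (\<lambda>i. k * logvec u i + difference (logvec z) i)"
      using u(3) v by blast
    have s: "\<sigma> z / z \<in> norm_one_units" using norm_one_units_divide[OF norm_one_units_\<sigma>[OF kz(1)] kz(1)] .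
    have pk: "u powi k \<in> norm_one_units" by (rule norm_one_units_powi[OF u(1)])
    have "logvec v = logvec (u powi k * (\<sigma> z / z))"
    proof
      fix i
      have "logvec (u powi k * (\<sigma> z / z)) i = logvec (u powi k) i + logvec (\<sigma> z / z) i"
        by (rule logvec_mult) (use norm_one_unitsD(4) pk s in blast)+
      thus "logvec v i = logvec (u powi k * (\<sigma> z / z)) i"
        using kz(2) dlog[OF kz(1)] logvec_powi[OF norm_one_unitsD(4)[OF u(1)]] by simp
    qed
    hence "v = u powi k * (\<sigma> z / z)" by (rule logvec_inj[OF v norm_one_units_mult[OF pk s]])
    thus ?thesis using kz(1) by blast
  qed
  ultimately show ?thesis using u(1) by blast
qed

end

text \<open>The vector \<open>n0\<close> is the ideal whose generator \<open>a0\<close> realizes the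
  distinguished unit as \<open>\<sigma> a0 / a0\<close>. Modulo p its multiples are all the
  relations, because every unit of norm one is a power of the distinguished one up to some \<sigma>
  z / z.\<close>

lemma real_principal:
  "\<exists>n0. supported n0 \<and> (\<exists>\<pi>\<in>ram. \<not> int p dvd n0 \<pi>) \<and>
     (\<forall>n. supported n \<longrightarrow> (\<exists>a. a \<noteq> 0 \<and> J n = scale a O\<^sub>K) \<longleftrightarrow> (\<exists>k :: int. \<forall>\<pi>\<in>ram. int p dvd n \<pi> - k * n0 \<pi>))"
proof -
  obtain \<psi> :: "'k \<Rightarrow> 'a fls" where \<psi>: "field_hom \<psi>" "\<And>c. \<psi> (\<iota> c) = fract_to_fls c"
    using embedding_exists by blast
  obtain u where u: "u \<in> norm_one_units" "\<And>z. z \<in> norm_one_units \<Longrightarrow> u \<noteq> \<sigma> z / z"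
    "\<And>v. v \<in> norm_one_units \<Longrightarrow> \<exists>k. \<exists>z\<in>norm_one_units. v = u powi k * (\<sigma> z / z)"
    using unit_lattice[OF \<psi>] by blast
  obtain b where b: "b \<noteq> 0" "u = \<sigma> b / b" using hilbert_90[OF norm_one_unitsD(2)[OF u(1)]] by blast
  have F: "scale b O\<^sub>K \<in> fracs" by (rule frac_scale[OF O_frac b(1)])
  have "\<sigma> ` scale b O\<^sub>K = scale (b * u) O\<^sub>K" unfolding \<sigma>_scale \<sigma>_image_O b(2) using b(1) by simp
  also have "\<dots> = scale b O\<^sub>K" unfolding scale_scale[symmetric] scale_norm_one_unit[OF u(1)] ..
  finally obtain g n0 where g: "g \<noteq> 0" "supported n0" "scale b O\<^sub>K = scale (\<iota> g) (J n0)"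
    using invariant_ideal[OF F] by blast
  \<comment> \<open>The element from Hilbert 90 generates an invariant ideal only up to a factor
    from k; removing that factor leaves \<sigma> a0 / a0 unchanged.\<close>
  define a0 where "a0 = inverse (\<iota> g) * b"
  have a0: "a0 \<noteq> 0" using b(1) g(1) by (simp add: a0_def)
  have "scale a0 O\<^sub>K = scale (inverse (\<iota> g)) (scale b O\<^sub>K)" unfolding a0_def scale_scale ..
  also have "\<dots> = J n0" unfolding g(3) scale_scale using g(1) by simp
  finally have Jn0: "J n0 = scale a0 O\<^sub>K" ..
  have "\<sigma> a0 / a0 = u"
    unfolding a0_def b(2) \<sigma>.hom_mult \<sigma>.hom_inverse \<sigma>_\<iota> using g(1) by simp
  hence \<sigma>a0: "\<sigma> a0 = u * a0" using a0 by (simp add: field_simps)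
  \<comment> \<open>Otherwise the ideal would have a generator in k as well. The quotient of the two
    generators is a unit, which after division by a constant has norm one and exhibits
    \<open>u\<close> as some \<sigma> z / z.\<close>
  have not0: "\<exists>\<pi>\<in>ram. \<not> int p dvd n0 \<pi>"
  proof (rule ccontr)
    assume "\<not> ?thesis"
    then obtain h where h: "h \<noteq> 0" "J n0 = scale (\<iota> h) O\<^sub>K" using J_multiple_principal[OF g(2)] by blast
    define e where "e = a0 / \<iota> h"
    have h0: "\<iota> h \<noteq> 0" using h(1) by simp
    have e0: "e \<noteq> 0" using a0 h0 by (simp add: e_def)
    have "a0 * 1 \<in> scale (\<iota> h) O\<^sub>K" unfolding h(2)[symmetric] Jn0 using O_1 by blast
    hence e1: "e \<in> O\<^sub>K" unfolding mem_scale_iff[OF h0] by (simp add: e_def)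
    have "\<iota> h * 1 \<in> scale a0 O\<^sub>K" unfolding Jn0[symmetric] h(2) using O_1 by blast
    hence e2: "inverse e \<in> O\<^sub>K" unfolding mem_scale_iff[OF a0] by (simp add: e_def)
    obtain d where d: "d \<noteq> 0" "e / const d \<in> norm_one_units" using normalize_unit[OF e1 e2 e0] by blast
    have "\<sigma> (e / const d) / (e / const d) = u"
      unfolding e_def \<sigma>_divide \<sigma>_\<iota> \<sigma>a0 using h0 a0 d(1) by simp
    thus False using u(2)[OF d(2)] by simp
  qed
  have iff: "(\<exists>a. a \<noteq> 0 \<and> J n = scale a O\<^sub>K) \<longleftrightarrow> (\<exists>k :: int. \<forall>\<pi>\<in>ram. int p dvd n \<pi> - k * n0 \<pi>)" if n: "supported n" for n
  proof
    assume "\<exists>a. a \<noteq> 0 \<and> J n = scale a O\<^sub>K"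
    then obtain a where a: "a \<noteq> 0" "J n = scale a O\<^sub>K" by blast
    have "\<sigma> a / a \<in> norm_one_units" using principal_imp_unit[OF n a] by (simp add: norm_one_units_def)
    then obtain k z where kz: "z \<in> norm_one_units" "\<sigma> a / a = u powi k * (\<sigma> z / z)" using u(3) by blast
    have z0: "z \<noteq> 0" by (rule norm_one_unitsD(4)[OF kz(1)])
    have u0: "u \<noteq> 0" by (rule norm_one_unitsD(4)[OF u(1)])
    \<comment> \<open>This product satisfies \<open>\<sigma> t / t = \<sigma> a / a\<close>, so
      \<open>a / t\<close> lies in k and contributes only multiples of p to the exponents.\<close>
    define t where "t = a0 powi k * z"
    have t0: "t \<noteq> 0" using a0 z0 by (simp add: t_def)
    have "\<sigma> t = (\<sigma> a0) powi k * \<sigma> z"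
      unfolding t_def \<sigma>.hom_mult by (auto simp: power_int_def \<sigma>.hom_power \<sigma>.hom_inverse)
    also have "\<dots> = u powi k * a0 powi k * \<sigma> z" unfolding \<sigma>a0 power_int_mult_distrib ..
    finally have \<sigma>t: "\<sigma> t = u powi k * (\<sigma> z / z) * t" using z0 by (simp add: t_def mult_ac)
    have "\<sigma> a = u powi k * (\<sigma> z / z) * a" using kz(2) a(1) by (metis nonzero_eq_divide_eq)
    hence "\<sigma> (a / t) = a / t" unfolding \<sigma>_divide \<sigma>t using t0 z0 u0 by simp
    then obtain h where h: "a / t = \<iota> h" using fixed_field by blast
    hence at: "a = \<iota> h * t" using t0 by (simp add: field_simps)
    hence h0: "h \<noteq> 0" using a(1) by auto
    have "int p dvd n \<pi> - k * n0 \<pi>" if \<pi>: "\<pi> \<in> ram" for \<pi>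
    proof -
      note vW = valuation_W[OF \<pi>]
      have "W \<pi> z = 0"
      proof -
        have "0 \<le> W \<pi> z" using J_W[OF norm_one_unitsD(1)[OF kz(1)] \<pi> z0] by simp
        moreover have "0 \<le> W \<pi> (inverse z)" using J_W[OF norm_one_unitsD(3)[OF kz(1)] \<pi>] z0 by simp
        ultimately show ?thesis using val_inverse[OF vW z0] by simp
      qed
      moreover have "W \<pi> a = W \<pi> (\<iota> h) + W \<pi> t" unfolding at using h0 t0 by (intro val_mult[OF vW]) auto
      moreover have "W \<pi> t = k * W \<pi> a0 + W \<pi> z"
        unfolding t_def using val_mult[OF vW, of "a0 powi k" z] val_powi[OF vW a0] a0 z0 by simp
      ultimately have "n \<pi> = int p * pval \<pi> h + k * n0 \<pi>"
        using W_generator[OF n a \<pi>] W_generator[OF g(2) a0 Jn0 \<pi>] W_\<iota>[OF \<pi> h0] by simp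
      thus ?thesis by simp
    qed
    thus "\<exists>k :: int. \<forall>\<pi>\<in>ram. int p dvd n \<pi> - k * n0 \<pi>" by blast
  next
    assume "\<exists>k :: int. \<forall>\<pi>\<in>ram. int p dvd n \<pi> - k * n0 \<pi>"
    then obtain k :: int where k: "\<And>\<pi>. \<pi> \<in> ram \<Longrightarrow> int p dvd n \<pi> - k * n0 \<pi>" by blast
    \<comment> \<open>Replacing \<open>k\<close> by its residue modulo p does not affect the
      divisibility and leaves only natural powers of \<open>a0\<close>.\<close>
    define l where "l = nat (k mod int p)"
    have l: "int l = k mod int p" using p_pos by (simp add: l_def)
    have supp: "supported (\<lambda>\<pi>. int i * n0 \<pi>)" for i using g(2) by (simp add: supported_def)
    have pw: "J (\<lambda>\<pi>. int i * n0 \<pi>) = scale (a0 ^ i) O\<^sub>K" for i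
    proof (induction i)
      case (Suc i)
      have "J (\<lambda>\<pi>. int (Suc i) * n0 \<pi>) = ideal_mult (J n0) (J (\<lambda>\<pi>. int i * n0 \<pi>))"
        unfolding J_mult_eq[OF g(2) supp] by (simp add: algebra_simps)
      also have "\<dots> = scale (a0 * a0 ^ i) O\<^sub>K"
        unfolding Suc Jn0 scale_mult_scale ideal_mult_one[OF O_frac] ..
      finally show ?case by simp
    qed simp
    define r where "r \<pi> = n \<pi> - int l * n0 \<pi>" for \<pi>
    have r: "supported r" using n g(2) by (simp add: r_def supported_def)
    have "int p dvd r \<pi>" if "\<pi> \<in> ram" for \<pi>
    proof -
      have "r \<pi> = (n \<pi> - k * n0 \<pi>) + int p * ((k div int p) * n0 \<pi>)"
        unfolding r_def l by (simp add: minus_mult_div_eq_mod[symmetric] algebra_simps)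
      thus ?thesis using k[OF that] by simp
    qed
    then obtain h where h: "h \<noteq> 0" "J r = scale (\<iota> h) O\<^sub>K" using J_multiple_principal[OF r] by blast
    have "J n = ideal_mult (J r) (J (\<lambda>\<pi>. int l * n0 \<pi>))"
      unfolding J_mult_eq[OF r supp] by (simp add: r_def)
    also have "\<dots> = scale (\<iota> h * a0 ^ l) O\<^sub>K"
      unfolding h(2) pw scale_mult_scale ideal_mult_one[OF O_frac] ..
    finally have "J n = scale (\<iota> h * a0 ^ l) O\<^sub>K" .
    moreover have "\<iota> h * a0 ^ l \<noteq> 0" using h(1) a0 by simp
    ultimately show "\<exists>a. a \<noteq> 0 \<and> J n = scale a O\<^sub>K" by blast
  qed
  show ?thesis using g(2) not0 iff by blast
qed

end

end

section \<open>The vector space of invariant classes\<close>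

text \<open>The scalars are representatives added and multiplied modulo p, so the module laws need
  exponents to be reducible modulo p; this is where the torsion hypothesis is used.\<close>

lemma vectorspace_power_module:
  fixes p :: nat
  assumes M: "comm_group M" and H: "subgroup H M" and p: "prime p"
    and torsion: "\<And>x. x \<in> H \<Longrightarrow> x [^]\<^bsub>M\<^esub> (int p) = \<one>\<^bsub>M\<^esub>"
  shows "vectorspace (residue_ring (int p)) (power_module M H)"
proof -
  interpret M: comm_group M by (rule M)
  interpret H: subgroup H M by (rule H)
  interpret R: residues_prime p "residue_ring (int p)" by (unfold_locales) (use p in auto)
  have Hc: "x \<in> carrier M" if "x \<in> H" for x using that H.subset by auto
  have inv: "inv\<^bsub>M\<^esub> x \<in> H" if "x \<in> H" for x using that by simp
  have zpow: "x [^]\<^bsub>M\<^esub> n \<in> H" if "x \<in> H" for x and n :: int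
    using that by (rule M.subgroup_int_pow_closed[OF H])
  have red: "x [^]\<^bsub>M\<^esub> (n mod int p) = x [^]\<^bsub>M\<^esub> n" if x: "x \<in> H" for x and n :: int
  proof -
    have "x [^]\<^bsub>M\<^esub> n = x [^]\<^bsub>M\<^esub> (int p * (n div int p) + n mod int p)" by simp
    also have "\<dots> = (x [^]\<^bsub>M\<^esub> int p) [^]\<^bsub>M\<^esub> (n div int p) \<otimes>\<^bsub>M\<^esub> x [^]\<^bsub>M\<^esub> (n mod int p)"
      using Hc[OF x] by (simp only: M.int_pow_mult M.int_pow_pow)
    also have "\<dots> = x [^]\<^bsub>M\<^esub> (n mod int p)" using torsion[OF x] Hc[OF x] by simp
    finally show ?thesis by simp
  qed
  have ring_simps: "a \<oplus>\<^bsub>residue_ring (int p)\<^esub> b = (a + b) mod int p"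
    "a \<otimes>\<^bsub>residue_ring (int p)\<^esub> b = (a * b) mod int p" "\<one>\<^bsub>residue_ring (int p)\<^esub> = 1" for a b
    by (simp_all add: residue_ring_def)
  have mod_simps: "carrier (power_module M H) = H" "x \<oplus>\<^bsub>power_module M H\<^esub> y = x \<otimes>\<^bsub>M\<^esub> y"
    "\<zero>\<^bsub>power_module M H\<^esub> = \<one>\<^bsub>M\<^esub>" "n \<odot>\<^bsub>power_module M H\<^esub> x = x [^]\<^bsub>M\<^esub> n" for x y n
    by (simp_all add: power_module_def)
  have "module (residue_ring (int p)) (power_module M H)"
  proof (rule moduleI)
    show "cring (residue_ring (int p))" by (rule R.cring)
    show "abelian_group (power_module M H)"
    proof (rule abelian_groupI, unfold mod_simps)
      fix x assume x: "x \<in> H"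
      show "\<exists>y\<in>H. y \<otimes>\<^bsub>M\<^esub> x = \<one>\<^bsub>M\<^esub>" by (rule bexI[OF _ inv[OF x]]) (simp add: Hc x)
    qed (simp_all add: Hc M.m_ac)
    fix a b x y
    assume "x \<in> carrier (power_module M H)" "y \<in> carrier (power_module M H)"
    hence x: "x \<in> H" "y \<in> H" by (simp_all add: mod_simps)
    show "a \<odot>\<^bsub>power_module M H\<^esub> (x \<oplus>\<^bsub>power_module M H\<^esub> y) =
      a \<odot>\<^bsub>power_module M H\<^esub> x \<oplus>\<^bsub>power_module M H\<^esub> a \<odot>\<^bsub>power_module M H\<^esub> y"
      unfolding mod_simps using x by (simp add: Hc M.int_pow_distrib)
  next
    fix a b x
    assume "x \<in> carrier (power_module M H)"
    hence x: "x \<in> H" by (simp_all add: mod_simps)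
    show "a \<odot>\<^bsub>power_module M H\<^esub> x \<in> carrier (power_module M H)"
      unfolding mod_simps by (rule zpow[OF x])
    show "(a \<oplus>\<^bsub>residue_ring (int p)\<^esub> b) \<odot>\<^bsub>power_module M H\<^esub> x =
      a \<odot>\<^bsub>power_module M H\<^esub> x \<oplus>\<^bsub>power_module M H\<^esub> b \<odot>\<^bsub>power_module M H\<^esub> x"
      unfolding mod_simps ring_simps red[OF x] by (rule M.int_pow_mult[OF Hc[OF x]])
    show "(a \<otimes>\<^bsub>residue_ring (int p)\<^esub> b) \<odot>\<^bsub>power_module M H\<^esub> x =
      a \<odot>\<^bsub>power_module M H\<^esub> (b \<odot>\<^bsub>power_module M H\<^esub> x)"
      unfolding mod_simps ring_simps red[OF x] by (simp add: M.int_pow_pow Hc[OF x] mult.commute)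
    show "\<one>\<^bsub>residue_ring (int p)\<^esub> \<odot>\<^bsub>power_module M H\<^esub> x = x"
      unfolding mod_simps ring_simps by (rule M.int_pow_1[OF Hc[OF x]])
  qed
  thus ?thesis unfolding vectorspace_def using R.is_field by simp
qed

context artin_schreier_function_field
begin

interpretation Cl: comm_group Cl by (rule comm_group_Cl)

abbreviation inv_classes :: "'k set set set" where
  "inv_classes \<equiv> invariant_classes (galois_group \<iota>) O\<^sub>K"
abbreviation V :: "(int, 'k set set) module" where "V \<equiv> power_module Cl inv_classes"
abbreviation prime_class :: "'a poly \<Rightarrow> 'k set set" where
  "prime_class \<pi> \<equiv> cls (\<lambda>\<rho>. if \<rho> = \<pi> then 1 else 0)"

lemma cls_carrier: "supported n \<Longrightarrow> cls n \<in> carrier Cl"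
  unfolding cls_def carrier_Cl by (rule imageI[OF J_frac])

lemma cls_inv_classes: "supported n \<Longrightarrow> cls n \<in> inv_classes"
  unfolding invariant_classes_eq by blast

lemma supported_uminus: "supported n \<Longrightarrow> supported (\<lambda>\<pi>. - n \<pi>)" by (simp add: supported_def)
lemma supported_scale: "supported n \<Longrightarrow> supported (\<lambda>\<pi>. k * n \<pi>)" by (simp add: supported_def)
lemma supported_single: "\<rho> \<in> ram \<Longrightarrow> supported (\<lambda>\<pi>. if \<pi> = \<rho> then 1 else 0)" by (auto simp: supported_def)

lemma cls_uminus:
  assumes "supported n"
  shows "inv\<^bsub>Cl\<^esub> cls n = cls (\<lambda>\<pi>. - n \<pi>)"
proof (rule Cl.inv_equality)
  show "cls (\<lambda>\<pi>. - n \<pi>) \<otimes>\<^bsub>Cl\<^esub> cls n = \<one>\<^bsub>Cl\<^esub>"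
    using cls_mult[OF supported_uminus[OF assms] assms] cls_0 by simp
qed (rule cls_carrier assms supported_uminus)+

lemma cls_nat_pow:
  assumes "supported n"
  shows "cls n [^]\<^bsub>Cl\<^esub> (k :: nat) = cls (\<lambda>\<pi>. int k * n \<pi>)"
proof (induction k)
  case (Suc k)
  have "cls n [^]\<^bsub>Cl\<^esub> Suc k = cls (\<lambda>\<pi>. int k * n \<pi>) \<otimes>\<^bsub>Cl\<^esub> cls n" using Suc by simp
  also have "\<dots> = cls (\<lambda>\<pi>. int k * n \<pi> + n \<pi>)" by (rule cls_mult[OF supported_scale[OF assms] assms])
  finally show ?case by (simp add: algebra_simps)
qed (simp add: cls_0)

lemma cls_int_pow:
  assumes "supported n"
  shows "cls n [^]\<^bsub>Cl\<^esub> (k :: int) = cls (\<lambda>\<pi>. k * n \<pi>)"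
proof (cases k)
  case (nonneg j)
  thus ?thesis using cls_nat_pow[OF assms] by (simp add: int_pow_int)
next
  case (neg j)
  have "cls n [^]\<^bsub>Cl\<^esub> k = inv\<^bsub>Cl\<^esub> (cls n [^]\<^bsub>Cl\<^esub> Suc j)"
    unfolding neg Cl.int_pow_neg_int[OF cls_carrier[OF assms]] by simp
  also have "\<dots> = cls (\<lambda>\<pi>. - (int (Suc j) * n \<pi>))"
    unfolding cls_nat_pow[OF assms] by (rule cls_uminus[OF supported_scale[OF assms]])
  also have "(\<lambda>\<pi>. - (int (Suc j) * n \<pi>)) = (\<lambda>\<pi>. k * n \<pi>)" by (simp add: neg algebra_simps)
  finally show ?thesis .
qed

lemma subgroup_inv_classes: "subgroup inv_classes Cl"
proof
  show "inv_classes \<subseteq> carrier Cl" by (auto simp: invariant_classes_def)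
  show "\<one>\<^bsub>Cl\<^esub> \<in> inv_classes" using cls_inv_classes[OF supported_0] by (simp add: cls_0)
  fix x assume "x \<in> inv_classes"
  then obtain n where n: "x = cls n" "supported n" unfolding invariant_classes_eq by blast
  show "inv\<^bsub>Cl\<^esub> x \<in> inv_classes"
    unfolding n(1) cls_uminus[OF n(2)] by (rule cls_inv_classes[OF supported_uminus[OF n(2)]])
  fix y assume "y \<in> inv_classes"
  then obtain n' where n': "y = cls n'" "supported n'" unfolding invariant_classes_eq by blast
  show "x \<otimes>\<^bsub>Cl\<^esub> y \<in> inv_classes"
    unfolding n(1) n'(1) cls_mult[OF n(2) n'(2)] by (rule cls_inv_classes[OF supported_add[OF n(2) n'(2)]])
qed

lemma vectorspace_V: "vectorspace (residue_ring (int p)) V"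
proof (rule vectorspace_power_module[OF comm_group_Cl subgroup_inv_classes prime_p])
  fix x assume "x \<in> inv_classes"
  then obtain n where n: "x = cls n" "supported n" unfolding invariant_classes_eq by blast
  have "\<exists>g. g \<noteq> 0 \<and> J (\<lambda>\<pi>. int p * n \<pi>) = scale (\<iota> g) O\<^sub>K"
    by (rule J_multiple_principal[OF supported_scale[OF n(2)]]) simp
  then obtain g where "g \<noteq> 0" "J (\<lambda>\<pi>. int p * n \<pi>) = scale (\<iota> g) O\<^sub>K" by (elim exE conjE)
  hence "\<exists>a. a \<noteq> 0 \<and> J (\<lambda>\<pi>. int p * n \<pi>) = scale a O\<^sub>K" by (intro exI[of _ "\<iota> g"]) simp
  hence "cls (\<lambda>\<pi>. int p * n \<pi>) = \<one>\<^bsub>Cl\<^esub>" using cls_eq_one_iff[OF supported_scale[OF n(2)]] by simp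
  thus "x [^]\<^bsub>Cl\<^esub> int p = \<one>\<^bsub>Cl\<^esub>" unfolding n(1) cls_int_pow[OF n(2)] .
qed

interpretation V: vectorspace "residue_ring (int p)" V by (rule vectorspace_V)

lemma carrier_V: "carrier V = {cls n |n. supported n}"
  by (simp add: power_module_def invariant_classes_eq)

lemma V_simps: "x \<oplus>\<^bsub>V\<^esub> y = x \<otimes>\<^bsub>Cl\<^esub> y" "\<zero>\<^bsub>V\<^esub> = \<one>\<^bsub>Cl\<^esub>" "k \<odot>\<^bsub>V\<^esub> x = x [^]\<^bsub>Cl\<^esub> k"
  by (simp_all add: power_module_def)

lemma residue_carrier: "carrier (residue_ring (int p)) = {0..int p - 1}" "\<zero>\<^bsub>residue_ring (int p)\<^esub> = 0"
  by (simp_all add: residue_ring_def)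

lemma prime_class_carrier: "T \<subseteq> ram \<Longrightarrow> prime_class ` T \<subseteq> carrier V"
  unfolding carrier_V using supported_single by blast

lemma lincomb_prime_classes:
  assumes T: "T \<subseteq> ram" and inj: "inj_on prime_class T"
    and a: "a \<in> prime_class ` T \<rightarrow> carrier (residue_ring (int p))"
  shows "V.lincomb a (prime_class ` T) = cls (\<lambda>\<pi>. if \<pi> \<in> T then a (prime_class \<pi>) else 0)"
proof -
  have "finite T" using T finite_ram by (rule finite_subset)
  thus ?thesis using T inj a
  proof (induction T rule: finite_induct)
    case empty
    show ?case by (simp add: V.lincomb_def V_simps cls_0)
  next
    case (insert \<rho> T)
    have \<rho>: "\<rho> \<in> ram" using insert.prems by simp
    let ?n = "\<lambda>\<pi>. if \<pi> \<in> T then a (prime_class \<pi>) else 0" and ?d = "\<lambda>\<pi>. if \<pi> = \<rho> then 1 else 0 :: int"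
    have n: "supported ?n" using insert.prems(1) by (auto simp: supported_def)
    have "V.lincomb a (prime_class ` insert \<rho> T) = V.lincomb a (insert (prime_class \<rho>) (prime_class ` T))" by simp
    also have "\<dots> = a (prime_class \<rho>) \<odot>\<^bsub>V\<^esub> prime_class \<rho> \<oplus>\<^bsub>V\<^esub> V.lincomb a (prime_class ` T)"
      unfolding V.lincomb_def
    proof (rule V.M.finsum_insert)
      have "\<rho> \<notin> T" "inj_on prime_class (insert \<rho> T)" using insert by auto
      thus "prime_class \<rho> \<notin> prime_class ` T" by (auto simp del: image_insert simp: inj_on_def)
      show "(\<lambda>v. a v \<odot>\<^bsub>V\<^esub> v) \<in> prime_class ` T \<rightarrow> carrier V"
      proof
        fix v assume v: "v \<in> prime_class ` T"
        show "a v \<odot>\<^bsub>V\<^esub> v \<in> carrier V"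
          using insert.prems prime_class_carrier[of T] v by (intro V.smult_closed) auto
      qed
      show "a (prime_class \<rho>) \<odot>\<^bsub>V\<^esub> prime_class \<rho> \<in> carrier V"
        using insert.prems prime_class_carrier[of "{\<rho>}"] by (intro V.smult_closed) auto
    qed (use insert in simp)
    also have "V.lincomb a (prime_class ` T) = cls ?n" using insert by (intro insert.IH) (auto simp: inj_on_def)
    also have "a (prime_class \<rho>) \<odot>\<^bsub>V\<^esub> prime_class \<rho> = cls (\<lambda>\<pi>. a (prime_class \<rho>) * ?d \<pi>)"
      unfolding V_simps by (rule cls_int_pow[OF supported_single[OF \<rho>]])
    also have "\<dots> \<oplus>\<^bsub>V\<^esub> cls ?n = cls (\<lambda>\<pi>. a (prime_class \<rho>) * ?d \<pi> + ?n \<pi>)"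
      unfolding V_simps by (rule cls_mult[OF supported_scale[OF supported_single[OF \<rho>]] n])
    also have "(\<lambda>\<pi>. a (prime_class \<rho>) * ?d \<pi> + ?n \<pi>) = (\<lambda>\<pi>. if \<pi> \<in> insert \<rho> T then a (prime_class \<pi>) else 0)"
      using insert.hyps by auto
    finally show ?case .
  qed
qed

lemma cls_in_span:
  assumes T: "T \<subseteq> ram" and n: "\<And>\<pi>. \<pi> \<notin> T \<Longrightarrow> n \<pi> = 0"
  shows "cls n \<in> V.span (prime_class ` T)"
proof -
  have "finite T" using T finite_ram by (rule finite_subset)
  thus ?thesis using T n
  proof (induction T arbitrary: n rule: finite_induct)
    case empty
    hence "n = (\<lambda>_. 0)" by auto
    moreover have "\<zero>\<^bsub>V\<^esub> \<in> V.span {}" using V.span_is_submodule[of "{}"] by (simp add: submodule_def)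
    ultimately show ?case by (simp add: cls_0 V_simps)
  next
    case (insert \<rho> T)
    have \<rho>: "\<rho> \<in> ram" using insert.prems by simp
    let ?n = "n(\<rho> := 0)" and ?d = "\<lambda>\<pi>. if \<pi> = \<rho> then 1 else 0 :: int"
    have n: "supported ?n" using insert.prems by (auto simp: supported_def)
    have sub: "submodule (residue_ring (int p)) (V.span (prime_class ` insert \<rho> T)) V"
      by (rule V.span_is_submodule[OF prime_class_carrier[OF insert.prems(1)]])
    have "cls ?n \<in> V.span (prime_class ` T)" using insert.prems by (intro insert.IH) auto
    hence 1: "cls ?n \<in> V.span (prime_class ` insert \<rho> T)"
      using V.span_is_monotone[of "prime_class ` T" "prime_class ` insert \<rho> T"] by auto
    have "prime_class \<rho> \<in> V.span (prime_class ` insert \<rho> T)"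
      using V.in_own_span[OF prime_class_carrier[OF insert.prems(1)]] by auto
    \<comment> \<open>Scalars range over the residues only. The remaining multiple of p in the
      exponent belongs to a principal ideal and leaves the class unchanged.\<close>
    hence "(n \<rho> mod int p) \<odot>\<^bsub>V\<^esub> prime_class \<rho> \<in> V.span (prime_class ` insert \<rho> T)"
      using sub prime_p prime_gt_0_nat[of p] by (intro submodule.smult_closed[OF sub]) (auto simp: residue_carrier)
    hence 2: "cls (\<lambda>\<pi>. (n \<rho> mod int p) * ?d \<pi>) \<in> V.span (prime_class ` insert \<rho> T)"
      unfolding V_simps cls_int_pow[OF supported_single[OF \<rho>]] .
    have m: "cls (\<lambda>\<pi>. int p * (n \<rho> div int p * ?d \<pi>)) = \<one>\<^bsub>Cl\<^esub>"
    proof -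
      let ?m = "\<lambda>\<pi>. int p * (n \<rho> div int p * ?d \<pi>)"
      have s: "supported ?m" by (intro supported_scale supported_single \<rho>)
      obtain g where "g \<noteq> 0" "J ?m = scale (\<iota> g) O\<^sub>K"
        using J_multiple_principal[OF s] by (metis dvd_triv_left)
      hence "\<exists>a. a \<noteq> 0 \<and> J ?m = scale a O\<^sub>K" by (intro exI[of _ "\<iota> g"]) simp
      thus ?thesis using cls_eq_one_iff[OF s] by simp
    qed
    have s: "supported (\<lambda>\<pi>. (n \<rho> mod int p) * ?d \<pi>)" "supported (\<lambda>\<pi>. int p * (n \<rho> div int p * ?d \<pi>))"
      by (intro supported_scale supported_single \<rho>)+
    have "cls (\<lambda>\<pi>. (n \<rho> mod int p) * ?d \<pi>) = cls (\<lambda>\<pi>. (n \<rho> mod int p) * ?d \<pi>) \<otimes>\<^bsub>Cl\<^esub> cls (\<lambda>\<pi>. int p * (n \<rho> div int p * ?d \<pi>))"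
      unfolding m by (rule Cl.r_one[symmetric, OF cls_carrier[OF s(1)]])
    also have "\<dots> = cls (\<lambda>\<pi>. (n \<rho> mod int p) * ?d \<pi> + int p * (n \<rho> div int p * ?d \<pi>))" by (rule cls_mult[OF s])
    also have "(\<lambda>\<pi>. (n \<rho> mod int p) * ?d \<pi> + int p * (n \<rho> div int p * ?d \<pi>)) = (\<lambda>\<pi>. n \<rho> * ?d \<pi>)" by auto
    finally have 3: "cls (\<lambda>\<pi>. n \<rho> * ?d \<pi>) \<in> V.span (prime_class ` insert \<rho> T)" using 2 by simp
    have "cls (\<lambda>\<pi>. n \<rho> * ?d \<pi>) \<oplus>\<^bsub>V\<^esub> cls ?n \<in> V.span (prime_class ` insert \<rho> T)"
      by (rule submodule.m_closed[OF sub 3 1])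
    also have "cls (\<lambda>\<pi>. n \<rho> * ?d \<pi>) \<oplus>\<^bsub>V\<^esub> cls ?n = cls (\<lambda>\<pi>. n \<rho> * ?d \<pi> + ?n \<pi>)"
      unfolding V_simps by (rule cls_mult[OF supported_scale[OF supported_single[OF \<rho>]] n])
    also have "(\<lambda>\<pi>. n \<rho> * ?d \<pi> + ?n \<pi>) = n" by auto
    finally show ?case .
  qed
qed

lemma span_prime_classes: "V.span (prime_class ` ram) = carrier V"
proof
  show "V.span (prime_class ` ram) \<subseteq> carrier V"
    by (rule V.span_is_subset2[OF prime_class_carrier[OF order_refl]])
  show "carrier V \<subseteq> V.span (prime_class ` ram)"
    unfolding carrier_V using cls_in_span[OF order_refl] by (auto simp: supported_def)
qed

text \<open>The dimension is read off from exponent vectors: no relation modulo p may be supported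
  on \<open>T\<close>, and every class must have a representative supported on \<open>T\<close>. It
  is applied to all ramified primes in the imaginary case, and to all but one in the real
  case.\<close>

lemma dim_V:
  assumes T: "T \<subseteq> ram"
    and indep: "\<And>n. (\<And>\<pi>. \<pi> \<notin> T \<Longrightarrow> n \<pi> = 0) \<Longrightarrow> cls n = \<one>\<^bsub>Cl\<^esub> \<Longrightarrow> \<forall>\<pi>\<in>T. int p dvd n \<pi>"
    and gen: "\<And>n. supported n \<Longrightarrow> \<exists>n'. (\<forall>\<pi>. \<pi> \<notin> T \<longrightarrow> n' \<pi> = 0) \<and> cls n = cls n'"
  shows "V.dim = card T"
proof -
  have p1: "\<not> int p dvd 1" using prime_p by (auto dest: prime_gt_1_nat)
  have fin: "finite T" using T finite_ram by (rule finite_subset)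
  \<comment> \<open>The basis consists of classes, so distinct primes must have distinct classes;
    otherwise their quotient would be a relation with exponents 1 and -1.\<close>
  have inj: "inj_on prime_class T"
  proof (rule inj_onI, rule ccontr)
    fix \<pi> \<rho> assume T': "\<pi> \<in> T" "\<rho> \<in> T" and eq: "prime_class \<pi> = prime_class \<rho>" and ne: "\<pi> \<noteq> \<rho>"
    let ?d = "\<lambda>\<rho> \<pi>. if \<pi> = \<rho> then 1 else 0 :: int"
    have s: "supported (?d \<pi>)" "supported (?d \<rho>)" using T T' by (auto intro!: supported_single)
    have "cls (\<lambda>\<tau>. ?d \<pi> \<tau> + - ?d \<rho> \<tau>) = cls (?d \<pi>) \<otimes>\<^bsub>Cl\<^esub> inv\<^bsub>Cl\<^esub> (cls (?d \<rho>))"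
      unfolding cls_uminus[OF s(2)] by (rule cls_mult[OF s(1) supported_uminus[OF s(2)], symmetric])
    also have "\<dots> = \<one>\<^bsub>Cl\<^esub>" unfolding eq by (rule Cl.r_inv[OF cls_carrier[OF s(2)]])
    finally have "\<forall>\<tau>\<in>T. int p dvd ?d \<pi> \<tau> + - ?d \<rho> \<tau>" using T' by (intro indep) auto
    thus False using T'(1) ne p1 by auto
  qed
  have ind: "V.lin_indpt (prime_class ` T)"
  proof (rule V.finite_lin_indpt2)
    show "finite (prime_class ` T)" using fin by simp
    show "prime_class ` T \<subseteq> carrier V" by (rule prime_class_carrier[OF T])
    fix a assume a: "a \<in> prime_class ` T \<rightarrow> carrier (residue_ring (int p))"
      and z: "V.lincomb a (prime_class ` T) = \<zero>\<^bsub>V\<^esub>"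
    have "cls (\<lambda>\<pi>. if \<pi> \<in> T then a (prime_class \<pi>) else 0) = \<one>\<^bsub>Cl\<^esub>"
      using z unfolding lincomb_prime_classes[OF T inj a] V_simps .
    hence "\<forall>\<pi>\<in>T. int p dvd (if \<pi> \<in> T then a (prime_class \<pi>) else 0)" by (rule indep[rotated]) simp
    hence d: "int p dvd a (prime_class \<pi>)" if "\<pi> \<in> T" for \<pi> using that by auto
    show "\<forall>v\<in>prime_class ` T. a v = \<zero>\<^bsub>residue_ring (int p)\<^esub>"
    proof
      fix v assume v: "v \<in> prime_class ` T"
      have "a v \<in> {0..int p - 1}" using a v residue_carrier by auto
      moreover have "int p dvd a v" using v d by auto
      ultimately show "a v = \<zero>\<^bsub>residue_ring (int p)\<^esub>" unfolding residue_carrier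
        using zdvd_not_zless[of "a v" "int p"] by force
    qed
  qed
  have "V.span (prime_class ` T) = carrier V"
  proof
    show "V.span (prime_class ` T) \<subseteq> carrier V"
      by (rule V.span_is_subset2[OF prime_class_carrier[OF T]])
    show "carrier V \<subseteq> V.span (prime_class ` T)"
    proof
      fix x assume "x \<in> carrier V"
      then obtain n where "x = cls n" "supported n" unfolding carrier_V by blast
      then obtain n' where n': "\<And>\<pi>. \<pi> \<notin> T \<Longrightarrow> n' \<pi> = 0" "x = cls n'" using gen by blast
      show "x \<in> V.span (prime_class ` T)" unfolding n'(2) using cls_in_span[OF T, of n', OF n'(1)] .
    qed
  qed
  hence "V.basis (prime_class ` T)" unfolding V.basis_def using ind prime_class_carrier[OF T] by simp
  hence "V.dim = card (prime_class ` T)" using fin by (intro V.dim_basis) auto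
  thus ?thesis using card_image[OF inj] by simp
qed

lemma dim_imaginary:
  assumes "single_place infval e"
  shows "V.dim = card ram"
proof (rule dim_V)
  fix n :: "'a poly \<Rightarrow> int"
  assume "\<And>\<pi>. \<pi> \<notin> ram \<Longrightarrow> n \<pi> = 0" and one: "cls n = \<one>\<^bsub>Cl\<^esub>"
  hence n: "supported n" by (simp add: supported_def)
  show "\<forall>\<pi>\<in>ram. int p dvd n \<pi>"
    using one cls_eq_one_iff[OF n] imaginary_principal_iff[OF assms n] by simp
next
  fix n assume "supported n"
  thus "\<exists>n'. (\<forall>\<pi>. \<pi> \<notin> ram \<longrightarrow> n' \<pi> = 0) \<and> cls n = cls n'"
    by (intro exI[of _ n]) (simp add: supported_def)
qed simp

text \<open>The relation \<open>n0\<close> has an entry prime to p at \<pi>0. It eliminates the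
  class at \<pi>0, and it is used up by that: a relation vanishing at \<pi>0 is a multiple of
  \<open>n0\<close> by a number divisible by p.\<close>

lemma dim_real:
  assumes "val_ge infval 1 D"
  shows "int V.dim = int (card ram) - 1"
proof -
  obtain n0 \<pi>0 where n0: "supported n0" "\<pi>0 \<in> ram" "\<not> int p dvd n0 \<pi>0"
    and iff: "\<And>n. supported n \<Longrightarrow> (\<exists>a. a \<noteq> 0 \<and> J n = scale a O\<^sub>K) \<longleftrightarrow> (\<exists>k :: int. \<forall>\<pi>\<in>ram. int p dvd n \<pi> - k * n0 \<pi>)"
    using real_principal[OF assms] by (elim exE conjE bexE) blast
  have cls_iff: "cls n = \<one>\<^bsub>Cl\<^esub> \<longleftrightarrow> (\<exists>k :: int. \<forall>\<pi>\<in>ram. int p dvd n \<pi> - k * n0 \<pi>)" if "supported n" for n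
    by (rule trans[OF cls_eq_one_iff[OF that] iff[OF that]])
  have pp: "prime (int p)" using prime_p by simp
  have "coprime (n0 \<pi>0) (int p)" using prime_imp_coprime[OF pp n0(3)] by (simp add: coprime_commute)
  then obtain s where "[n0 \<pi>0 * s = 1] (mod int p)" using cong_solve_coprime_int by blast
  hence s: "int p dvd n0 \<pi>0 * s - 1" by (simp add: cong_iff_dvd_diff)
  have "V.dim = card (ram - {\<pi>0})"
  proof (rule dim_V)
    fix n :: "'a poly \<Rightarrow> int"
    assume z: "\<And>\<pi>. \<pi> \<notin> ram - {\<pi>0} \<Longrightarrow> n \<pi> = 0" and one: "cls n = \<one>\<^bsub>Cl\<^esub>"
    hence n: "supported n" by (simp add: supported_def)
    obtain k where k: "\<forall>\<pi>\<in>ram. int p dvd n \<pi> - k * n0 \<pi>" using one cls_iff[OF n] by blast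
    have "int p dvd k * n0 \<pi>0" using k n0(2) z[of \<pi>0] by force
    hence "int p dvd k" using prime_dvd_mult_iff[OF pp] n0(3) by blast
    show "\<forall>\<pi>\<in>ram - {\<pi>0}. int p dvd n \<pi>"
    proof
      fix \<pi> assume "\<pi> \<in> ram - {\<pi>0}"
      hence "int p dvd (n \<pi> - k * n0 \<pi>) + k * n0 \<pi>" using k \<open>int p dvd k\<close> by (intro dvd_add) auto
      thus "int p dvd n \<pi>" by simp
    qed
  next
    fix n assume n: "supported n"
    let ?k = "- (n \<pi>0 * s)"
    \<comment> \<open>The multiple of \<open>n0\<close>, with \<open>s\<close> inverse to its entry
      at \<pi>0 modulo p, clears that entry of \<open>n\<close> only modulo p; replacing it by 0
      changes the exponent by a multiple of p.\<close>
    define n' where "n' \<pi> = (if \<pi> = \<pi>0 then 0 else n \<pi> + ?k * n0 \<pi>)" for \<pi>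
    have n': "supported n'" using n n0(1,2) by (auto simp: n'_def supported_def)
    have d: "supported (\<lambda>\<pi>. n' \<pi> + - n \<pi>)" by (intro supported_add n' supported_uminus n)
    have "\<forall>\<pi>\<in>ram. int p dvd n' \<pi> + - n \<pi> - ?k * n0 \<pi>"
    proof
      fix \<pi>
      have "n' \<pi>0 + - n \<pi>0 - ?k * n0 \<pi>0 = n \<pi>0 * (n0 \<pi>0 * s - 1)" by (simp add: n'_def algebra_simps)
      thus "int p dvd n' \<pi> + - n \<pi> - ?k * n0 \<pi>" using s by (cases "\<pi> = \<pi>0") (simp_all add: n'_def)
    qed
    hence "cls (\<lambda>\<pi>. n' \<pi> + - n \<pi>) = \<one>\<^bsub>Cl\<^esub>" using cls_iff[OF d] by blast
    hence "cls n' \<otimes>\<^bsub>Cl\<^esub> inv\<^bsub>Cl\<^esub> cls n = \<one>\<^bsub>Cl\<^esub>"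
      unfolding cls_uminus[OF n] cls_mult[OF n' supported_uminus[OF n]] .
    hence "inv\<^bsub>Cl\<^esub> (inv\<^bsub>Cl\<^esub> cls n) = cls n'"
      by (rule Cl.inv_equality) (use cls_carrier[OF n] cls_carrier[OF n'] in simp_all)
    hence "cls n' = cls n" using cls_carrier[OF n] by simp
    moreover have "\<forall>\<pi>. \<pi> \<notin> ram - {\<pi>0} \<longrightarrow> n' \<pi> = 0" using n' by (auto simp: n'_def supported_def)
    ultimately show "\<exists>n'. (\<forall>\<pi>. \<pi> \<notin> ram - {\<pi>0} \<longrightarrow> n' \<pi> = 0) \<and> cls n = cls n'" by metis
  qed auto
  moreover have "card ram > 0" using n0(2) finite_ram by (auto simp: card_gt_0_iff)
  ultimately show ?thesis using n0(2) finite_ram by (simp add: card_Diff_singleton)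
qed

end

section \<open>The normalized form of \<open>D\<close>\<close>

lemma char_prime_power:
  assumes "prime p" "card (UNIV :: 'a::finite_field set) = p ^ r"
  shows "CHAR('a) = p"
proof -
  have "CHAR('a) dvd p ^ r" using CHAR_dvd_CARD[where ?'a = 'a] assms(2) by simp
  thus ?thesis using assms(1) CHAR_prime[where ?'a = 'a] by (meson prime_dvd_power primes_dvd_imp_eq)
qed

lemma pval_partial_fraction:
  assumes \<pi>: "monic_irreducible \<pi>" and "coprime \<pi> a"
  shows "to_fract a / to_fract \<pi> ^ n \<noteq> 0" "pval \<pi> (to_fract a / to_fract \<pi> ^ n) = - int n"
proof -
  note v = valuation_pval[OF \<pi>]
  have nd: "\<not> \<pi> dvd a"
  proof
    assume "\<pi> dvd a"
    hence "is_unit \<pi>" using assms(2) coprime_common_divisor[of \<pi> a \<pi>] by simp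
    thus False using \<pi> by (auto simp: monic_irreducible_def Factorial_Ring.irreducible_def)
  qed
  hence a: "to_fract a \<noteq> 0" by auto
  have \<pi>0: "to_fract \<pi> \<noteq> 0" using monic_irreducible_nz[OF \<pi>] by simp
  show "to_fract a / to_fract \<pi> ^ n \<noteq> 0" using a \<pi>0 by simp
  have "pval \<pi> (to_fract a / to_fract \<pi> ^ n) = pval \<pi> (to_fract a) - pval \<pi> (to_fract \<pi> ^ n)"
    by (rule val_divide[OF v a]) (use \<pi>0 in simp)
  thus "pval \<pi> (to_fract a / to_fract \<pi> ^ n) = - int n"
    by (simp add: val_power[OF v \<pi>0] pval_self[OF \<pi>] pval_not_dvd[OF \<pi> nd])
qed

lemma val_ge_pval_partial_fraction:
  assumes \<pi>: "monic_irreducible \<pi>" and \<rho>: "monic_irreducible \<rho>" and "\<pi> \<noteq> \<rho>"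
  shows "val_ge (pval \<pi>) 0 (to_fract a / to_fract \<rho> ^ n)"
proof (cases "a = 0")
  case False
  note v = valuation_pval[OF \<pi>]
  have \<rho>0: "to_fract \<rho> \<noteq> 0" using monic_irreducible_nz[OF \<rho>] by simp
  have "pval \<pi> (to_fract a / to_fract \<rho> ^ n) = pval \<pi> (to_fract a) - pval \<pi> (to_fract \<rho> ^ n)"
    by (rule val_divide[OF v]) (use False \<rho>0 in simp_all)
  also have "\<dots> = int (pmult \<pi> a)"
    by (simp add: val_power[OF v \<rho>0] pval_other[OF \<pi> \<rho> assms(3)] pval_to_fract[OF \<pi> False])
  finally show ?thesis by (simp add: val_ge_def)
qed simp

lemma val_ge_infval_proper:
  assumes "degree a < degree b"
  shows "val_ge infval 1 (to_fract a / to_fract b)"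
proof (rule val_geI)
  assume "to_fract a / to_fract b \<noteq> 0"
  hence "a \<noteq> 0" "b \<noteq> 0" by auto
  thus "1 \<le> infval (to_fract a / to_fract b)" using infval_fract[of a b] assms by simp
qed

text \<open>The residue field at infinity is the field of constants.\<close>

lemma infval_residue:
  fixes x :: "'a::field poly fract"
  assumes "val_ge infval 0 x"
  shows "\<exists>c. val_ge infval 1 (x - to_fract [:c:])"
proof -
  obtain a b where ab: "b \<noteq> 0" "x = to_fract a / to_fract b" by (rule fract_cases)
  have deg: "degree a \<le> degree b"
  proof (cases "a = 0")
    case False
    hence "x \<noteq> 0" using ab by simp
    thus ?thesis using assms infval_fract[OF False ab(1)] ab(2) by (simp add: val_ge_def)
  qed simp
  \<comment> \<open>The coefficient of \<open>a\<close> is taken at the degree of \<open>b\<close>,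
    so that \<open>c\<close> is 0 when the fraction already vanishes at infinity.\<close>
  define c where "c = coeff a (degree b) / lead_coeff b"
  let ?g = "a - Polynomial.smult c b"
  have "[:c:] * b = Polynomial.smult c b" by simp
  hence "x - to_fract [:c:] = to_fract ?g / to_fract b"
    using ab by (simp add: divide_diff_eq_iff flip: to_fract_mult)
  moreover have "val_ge infval 1 (to_fract ?g / to_fract b)"
  proof (cases "?g = 0")
    case False
    have "degree ?g \<le> degree b" using deg by (intro degree_diff_le) auto
    moreover have "coeff ?g (degree b) = 0" using ab(1) by (simp add: c_def)
    ultimately have "degree ?g < degree b" using False by (metis le_neq_implies_less leading_coeff_0_iff)
    thus ?thesis by (rule val_ge_infval_proper)
  qed simp
  ultimately show ?thesis by metis
qed

text \<open>The case f = 0 is the real one: D then has positive value at infinity. There m is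
  positive because the relation among the classes involves a ramified prime, so the integer
  subtraction never gives a negative dimension.\<close>

theorem theorem3p3:
  fixes p q r m :: nat
    and P Q :: "nat \<Rightarrow> 'a :: finite_field poly"
    and e :: "nat \<Rightarrow> nat"
    and f :: "'a poly"
    and D :: "'a poly fract"
    and \<iota> :: "'a poly fract \<Rightarrow> 'k :: field"
    and \<alpha> :: 'k
    and \<PP> :: "nat \<Rightarrow> 'k set"
  assumes "prime p" and "r > 0" and "q = p ^ r" and "card (UNIV :: 'a set) = q"
    and "inj_on P {1..m}"
    and "\<And>i. i \<in> {1..m} \<Longrightarrow> lead_coeff (P i) = 1 \<and> irreducible (P i)"
    and "\<And>i. i \<in> {1..m} \<Longrightarrow> coprime (P i) (Q i)"
    and "\<And>i. i \<in> {1..m} \<Longrightarrow> degree (Q i) < degree (P i ^ e i)"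
    and "\<And>i. i \<in> {1..m} \<Longrightarrow> \<not> p dvd e i"
    and "f = 0 \<or> (\<exists>c. f = [:c:] \<and> (\<nexists>x. x ^ p - x = c)) \<or> (degree f > 0 \<and> \<not> p dvd degree f)"
    and "D = (\<Sum>i\<in>{1..m}. to_fract (Q i) / to_fract (P i) ^ e i) + to_fract f"
    and "\<nexists>x. D = x ^ p - x"
    and "field_hom \<iota>"
    and "\<alpha> ^ p - \<alpha> = \<iota> D"
    and "simple_extension \<iota> \<alpha>"
    and "algebraically_closed_in (\<lambda>c. \<iota> (to_fract [:c:]))"
    and "\<And>i. i \<in> {1..m} \<Longrightarrow> prime_above \<iota> (P i) (\<PP> i)"
  defines "O\<^sub>K \<equiv> ring_of_integers \<iota>"
  defines "V \<equiv> power_module (class_group O\<^sub>K) (invariant_classes (galois_group \<iota>) O\<^sub>K)"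
  shows "vectorspace (residue_ring (int p)) V \<and>
    (\<lambda>i. ideal_class O\<^sub>K (\<PP> i)) ` {1..m} \<subseteq> carrier V \<and>
    LinearCombinations.module.span (residue_ring (int p)) V
      ((\<lambda>i. ideal_class O\<^sub>K (\<PP> i)) ` {1..m}) = carrier V \<and>
    int (vectorspace.dim (residue_ring (int p)) V) = (if f = 0 then int m - 1 else int m)"
proof -
  note inj = assms(5) and Q = assms(7,8) and f = assms(10) and D_eq = assms(11)
  have P: "monic_irreducible (P i)" if "i \<in> {1..m}" for i
    using assms(6)[OF that] by (simp add: monic_irreducible_def)
  define s where "s i = to_fract (Q i) / to_fract (P i) ^ e i" for i
  have D: "D = sum s {1..m} + to_fract f" unfolding D_eq s_def ..
  define ram where "ram = P ` {1..m}"
  \<comment> \<open>Defined through D because \<open>P\<close> lists the primes by index;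
    \<open>vD\<close> identifies it with \<open>e i\<close>.\<close>
  define ee where "ee \<pi> = (if \<pi> \<in> ram then - pval \<pi> D else 0)" for \<pi>
  have vD: "pval (P i) D = - int (e i)" if i: "i \<in> {1..m}" for i
  proof -
    have eq: "D = s i + (sum s ({1..m} - {i}) + to_fract f)"
      unfolding D using i by (simp add: sum.remove[of _ i s] add.assoc)
    have s: "s i \<noteq> 0" "pval (P i) (s i) = - int (e i)"
      unfolding s_def using pval_partial_fraction[OF P[OF i] Q(1)[OF i]] by blast+
    \<comment> \<open>A vanishing exponent would be divisible by p.\<close>
    have "e i > 0" using assms(9)[OF i] by (intro Nat.gr0I) auto
    moreover have "val_ge (pval (P i)) 0 (sum s ({1..m} - {i}) + to_fract f)"
      unfolding s_def using i inj
      by (intro val_ge_add val_ge_sum valuation_pval P val_ge_pval_to_fract val_ge_pval_partial_fraction)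
        (auto dest: inj_onD)
    ultimately have "val_ge (pval (P i)) (pval (P i) (s i) + 1) (sum s ({1..m} - {i}) + to_fract f)"
      unfolding s(2) by (elim val_ge_mono) simp
    from val_add_eq[OF valuation_pval[OF P[OF i]] s(1) this] show ?thesis unfolding eq s(2) by simp
  qed
  have inf_s: "val_ge infval 1 (sum s {1..m})"
  proof (rule val_ge_sum[OF valuation_infval])
    fix i assume "i \<in> {1..m}"
    moreover have "to_fract (g ^ n) = to_fract g ^ n" for g :: "'a poly" and n by (induction n) simp_all
    ultimately show "val_ge infval 1 (s i)" using val_ge_infval_proper[OF Q(2)[of i]] by (simp add: s_def)
  qed
  interpret artin_schreier_function_field \<iota> p D \<alpha> ram ee
  proof (unfold artin_schreier_function_field_def artin_schreier_def artin_schreier_function_field_axioms_def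
      artin_schreier_axioms_def, intro conjI allI impI)
    show "CHAR('a poly fract) = p"
      using char_field_hom[OF field_hom_const[where ?'a = 'a]] char_prime_power[where ?'a = 'a, OF assms(1), of r] assms(3,4) by simp
    show "finite ram" by (simp add: ram_def)
  next
    fix \<pi> assume "\<pi> \<in> ram"
    then obtain i where i: "i \<in> {1..m}" "\<pi> = P i" by (auto simp: ram_def)
    show "monic_irreducible \<pi>" using P i by simp
    show "pval \<pi> D = - ee \<pi>" "0 < ee \<pi>" "\<not> int p dvd ee \<pi>"
      using i vD[OF i(1)] assms(9)[OF i(1)] by (auto simp: ee_def ram_def intro: Nat.gr0I)
  next
    fix \<pi> :: "'a poly" assume \<pi>: "monic_irreducible \<pi>" "\<pi> \<notin> ram"
    thus "ee \<pi> = 0" by (simp add: ee_def)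
    show "val_ge (pval \<pi>) 0 D"
      unfolding D s_def using \<pi>
      by (intro val_ge_add val_ge_sum valuation_pval P val_ge_pval_to_fract val_ge_pval_partial_fraction)
        (auto simp: ram_def)
  qed (use assms in auto)
  have V: "V = power_module (class_group (J (\<lambda>_. 0))) (invariant_classes (galois_group \<iota>) (J (\<lambda>_. 0)))"
    unfolding V_def O\<^sub>K_def ring_of_integers_eq ..
  have "ideal_class O\<^sub>K (\<PP> i) = cls (\<lambda>\<rho>. if \<rho> = P i then 1 else 0)" if "i \<in> {1..m}" for i
    using prime_above_eq[OF _ assms(17)[OF that]] that
    unfolding O\<^sub>K_def ring_of_integers_eq cls_def by (simp add: ram_def)
  hence img: "(\<lambda>i. ideal_class O\<^sub>K (\<PP> i)) ` {1..m} = (\<lambda>\<pi>. cls (\<lambda>\<rho>. if \<rho> = \<pi> then 1 else 0)) ` ram"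
    unfolding ram_def image_image by (intro image_cong) auto
  have card: "card ram = m" unfolding ram_def card_image[OF inj] by simp
  have "int (vectorspace.dim (residue_ring (int p)) V) = (if f = 0 then int m - 1 else int m)"
  proof (cases "f = 0")
    case True
    hence "val_ge infval 1 D" using inf_s by (simp add: D)
    from dim_real[OF this] show ?thesis using True card by (simp add: V)
  next
    case False
    \<comment> \<open>At infinity the partial fractions have positive value, so \<open>f\<close>
      alone decides: if nonconstant it gives a pole of order prime to p, and if constant it is the
      residue of D, for which the Artin-Schreier equation has no solution.\<close>
    have "\<exists>e. single_place infval e"
    proof (cases "degree f > 0")
      case True
      have nz: "to_fract f \<noteq> 0" using False by simp
      have v: "infval (to_fract f) = - int (degree f)" by (rule infval_to_fract[OF False])
      have "val_ge infval (infval (to_fract f) + 1) (sum s {1..m})"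
        unfolding v using inf_s by (elim val_ge_mono) simp
      from val_add_eq(2)[OF valuation_infval nz this] have "infval D = - int (degree f)"
        unfolding D v add.commute[of "to_fract f"] .
      moreover have "\<not> p dvd degree f" using f True by auto
      ultimately have "single_place infval (int (degree f))"
        using True D_nz by (intro single_place_ramified valuation_infval) auto
      thus ?thesis ..
    next
      case deg: False
      then obtain c where c: "f = [:c:]" "\<nexists>x. c = x ^ p - x" using f False by metis
      \<comment> \<open>The uniformizer 1/t at infinity.\<close>
      let ?T = "inverse (to_fract [:0, 1 :: 'a:])"
      have T: "to_fract [:0, 1 :: 'a:] \<noteq> 0" by simp
      have "single_place infval 0"
      proof (rule single_place_inert[OF valuation_infval field_hom_const])
        show "infval (to_fract [:c:]) = 0" if "c \<noteq> 0" for c :: 'a using that by (simp add: infval_to_fract)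
        show "\<exists>c. val_ge infval 1 (x - to_fract [:c:])" if "val_ge infval 0 x" for x :: "'a poly fract"
          by (rule infval_residue[OF that])
        show "?T \<noteq> 0" using T by simp
        show "infval ?T = 1" using val_inverse[OF valuation_infval T] by (simp add: infval_to_fract)
        show "val_ge infval 1 (D - to_fract [:c:])" using inf_s by (simp add: D c(1))
      qed (rule c(2))
      thus ?thesis ..
    qed
    then obtain e where "single_place infval e" ..
    from dim_imaginary[OF this] show ?thesis using False card by (simp add: V)
  qed
  thus ?thesis
    using vectorspace_V prime_class_carrier[OF order_refl] span_prime_classes unfolding img V by blast
qed

end
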